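(* Let $(\mathfrak{X},\mathcal{O})$ be a monoided topos. Then there is an equivalence of categories between the category of quasi-integral Kato log structures on $(\mathfrak{X},\mathcal{O})$ and the category of Deligne--Faltings (DF) log structures on $(\mathfrak{X},\mathcal{O})$.
   Context: All monoids are commutative. A topos means a Grothendieck topos (the category of sheaves of sets on a Grothendieck site). A monoided topos is a pair $(\mathfrak{X},\mathcal{O})$ of a topos $\mathfrak{X}$ and a monoid object $\mathcal{O}$ in $\mathfrak{X}$; $\mathcal{O}^\times\subseteq\mathcal{O}$ is the subobject of invertible sections. For a monoid $A$ in $\mathfrak{X}$ and an object $U$, $A(U)$ is the monoid of arrows $U\to A$. A Kato log structure on $(\mathfrak{X},\mathcal{O})$ is a pair $(M,\alpha)$ of a monoid $M$ in $\mathfrak{X}$ and a homomorphism $\alpha\colon M\to\mathcal{O}$ such that the restriction $\alpha^{-1}\mathcal{O}^\times\to\mathcal{O}^\times$ is an isomorphism. Through this isomorphism $\mathcal{O}^\times$ acts on $M$; $(M,\alpha)$ is quasi-integral if this action is free (no non-trivial stabilizers). A morphism $(M,\alpha)\to(N,\beta)$ is a homomorphism of monoids $\phi\colon M\to N$ with $\beta\circ\phi=\alpha$. $\mathrm{Div}_{\mathfrak{X}}=[\mathcal{O}/\mathcal{O}^\times]$ is the quotient stack over $\mathfrak{X}$ for the action of $\mathcal{O}^\times$ on $\mathcal{O}$ by multiplication: a section over $U$ is an $\mathcal{O}^\times$-torsor on $U$ with an $\mathcal{O}^\times$-equivariant map to $\mathcal{O}$, and arrows are isomorphisms of such. It is a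 symmetric monoidal stack, with monoidal structure induced by the multiplication of $\mathcal{O}$. A monoid $A$ in $\mathfrak{X}$ is sharp if for each object $U$ the only invertible element of $A(U)$ is $0$. A DF log structure on $(\mathfrak{X},\mathcal{O})$ is a pair $(A,L)$ where $A$ is a sharp monoid in $\mathfrak{X}$ and $L\colon A\to\mathrm{Div}_{\mathfrak{X}}$ is a (strong) symmetric monoidal functor of stacks ($A$ being viewed as a stack with only identity arrows) with trivial kernel: if $a\in A(U)$ is such that $L(a)$ is invertible in $\mathrm{Div}_{\mathfrak{X}}$ in the monoidal sense, then $a=0$. A morphism $(A,L)\to(B,K)$ of DF log structures is a homomorphism of monoids $\phi\colon A\to B$ together with a monoidal natural isomorphism $\Phi\colon K\circ\phi\cong L$. *)

theory Defs
  imports "HOL-Algebra.Group" "HOL-Library.FuncSet"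
begin

record ('o, 'a) cat =
  Obj :: "'o set"
  Arr :: "'a set"
  Dom :: "'a \<Rightarrow> 'o"
  Cod :: "'a \<Rightarrow> 'o"
  Idt :: "'o \<Rightarrow> 'a"
  Cmp :: "'a \<Rightarrow> 'a \<Rightarrow> 'a"  \<comment> \<open>\<open>Cmp C g f\<close> is \<open>g\<close> after \<open>f\<close>\<close>

locale category =
  fixes C :: "('o, 'a) cat"
  assumes Dom_Obj: "f \<in> Arr C \<Longrightarrow> Dom C f \<in> Obj C"
    and Cod_Obj: "f \<in> Arr C \<Longrightarrow> Cod C f \<in> Obj C"
    and Idt_Arr: "X \<in> Obj C \<Longrightarrow> Idt C X \<in> Arr C"
    and Dom_Idt: "X \<in> Obj C \<Longrightarrow> Dom C (Idt C X) = X"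
    and Cod_Idt: "X \<in> Obj C \<Longrightarrow> Cod C (Idt C X) = X"
    and Cmp_Arr: "\<lbrakk>f \<in> Arr C; g \<in> Arr C; Dom C g = Cod C f\<rbrakk> \<Longrightarrow> Cmp C g f \<in> Arr C"
    and Dom_Cmp: "\<lbrakk>f \<in> Arr C; g \<in> Arr C; Dom C g = Cod C f\<rbrakk> \<Longrightarrow> Dom C (Cmp C g f) = Dom C f"
    and Cod_Cmp: "\<lbrakk>f \<in> Arr C; g \<in> Arr C; Dom C g = Cod C f\<rbrakk> \<Longrightarrow> Cod C (Cmp C g f) = Cod C g"
    and Cmp_Idt_left: "f \<in> Arr C \<Longrightarrow> Cmp C (Idt C (Cod C f)) f = f"
    and Cmp_Idt_right: "f \<in> Arr C \<Longrightarrow> Cmp C f (Idt C (Dom C f)) = f"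
    and Cmp_assoc: "\<lbrakk>f \<in> Arr C; g \<in> Arr C; h \<in> Arr C; Dom C g = Cod C f; Dom C h = Cod C g\<rbrakk>
      \<Longrightarrow> Cmp C h (Cmp C g f) = Cmp C (Cmp C h g) f"

definition is_functor ::
  "('o, 'a) cat \<Rightarrow> ('p, 'b) cat \<Rightarrow> ('o \<Rightarrow> 'p) \<Rightarrow> ('a \<Rightarrow> 'b) \<Rightarrow> bool" where
  "is_functor C D Fo Fa \<longleftrightarrow>
     (\<forall>X\<in>Obj C. Fo X \<in> Obj D \<and> Fa (Idt C X) = Idt D (Fo X)) \<and>
     (\<forall>f\<in>Arr C. Fa f \<in> Arr D \<and> Dom D (Fa f) = Fo (Dom C f) \<and> Cod D (Fa f) = Fo (Cod C f)) \<and>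
     (\<forall>f\<in>Arr C. \<forall>g\<in>Arr C. Dom C g = Cod C f \<longrightarrow> Fa (Cmp C g f) = Cmp D (Fa g) (Fa f))"

definition is_iso :: "('o, 'a) cat \<Rightarrow> 'a \<Rightarrow> bool" where
  "is_iso C f \<longleftrightarrow> f \<in> Arr C \<and>
     (\<exists>g\<in>Arr C. Dom C g = Cod C f \<and> Cod C g = Dom C f \<and>
        Cmp C g f = Idt C (Dom C f) \<and> Cmp C f g = Idt C (Cod C f))"

definition natural_iso ::
  "('o, 'a) cat \<Rightarrow> ('p, 'b) cat \<Rightarrow> ('o \<Rightarrow> 'p) \<Rightarrow> ('a \<Rightarrow> 'b) \<Rightarrow> ('o \<Rightarrow> 'p) \<Rightarrow> ('a \<Rightarrow> 'b) \<Rightarrow> ('o \<Rightarrow> 'b) \<Rightarrow> bool" where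
  "natural_iso C D Fo Fa Go Ga \<eta> \<longleftrightarrow>
     (\<forall>X\<in>Obj C. is_iso D (\<eta> X) \<and> Dom D (\<eta> X) = Fo X \<and> Cod D (\<eta> X) = Go X) \<and>
     (\<forall>f\<in>Arr C. Cmp D (Ga f) (\<eta> (Dom C f)) = Cmp D (\<eta> (Cod C f)) (Fa f))"

definition equivalent_categories :: "('o, 'a) cat \<Rightarrow> ('p, 'b) cat \<Rightarrow> bool" where
  "equivalent_categories C D \<longleftrightarrow> category C \<and> category D \<and>
     (\<exists>Fo Fa Go Ga \<eta> \<epsilon>. is_functor C D Fo Fa \<and> is_functor D C Go Ga \<and>
        natural_iso C C (\<lambda>X. X) (\<lambda>f. f) (Go \<circ> Fo) (Ga \<circ> Fa) \<eta> \<and>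
        natural_iso D D (Fo \<circ> Go) (Fa \<circ> Ga) (\<lambda>X. X) (\<lambda>f. f) \<epsilon>)"


locale site = category C for C :: "('o, 'a) cat" +
  fixes J :: "'o \<Rightarrow> 'a set set"
begin

definition sieve :: "'o \<Rightarrow> 'a set \<Rightarrow> bool" where
  "sieve X S \<longleftrightarrow> S \<subseteq> {f \<in> Arr C. Cod C f = X} \<and>
     (\<forall>f\<in>S. \<forall>g\<in>Arr C. Cod C g = Dom C f \<longrightarrow> Cmp C f g \<in> S)"

definition pull_sieve :: "'a \<Rightarrow> 'a set \<Rightarrow> 'a set" where
  "pull_sieve f S = {g \<in> Arr C. Cod C g = Dom C f \<and> Cmp C f g \<in> S}"

definition grothendieck_topology :: bool where
  "grothendieck_topology \<longleftrightarrow>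
     (\<forall>X\<in>Obj C. \<forall>S\<in>J X. sieve X S) \<and>
     (\<forall>X\<in>Obj C. {f \<in> Arr C. Cod C f = X} \<in> J X) \<and>
     (\<forall>f\<in>Arr C. \<forall>S\<in>J (Cod C f). pull_sieve f S \<in> J (Dom C f)) \<and>
     (\<forall>X\<in>Obj C. \<forall>S\<in>J X. \<forall>R. sieve X R \<longrightarrow> (\<forall>f\<in>S. pull_sieve f R \<in> J (Dom C f)) \<longrightarrow> R \<in> J X)"

end

record ('o, 'a, 'u) presheaf =
  sec :: "'o \<Rightarrow> 'u set"
  res :: "'a \<Rightarrow> 'u \<Rightarrow> 'u"

text \<open>A family of maps between sets of sections, indexed by the objects of the site.\<close>
type_synonym ('o, 'u) family = "'o \<Rightarrow> 'u \<Rightarrow> 'u"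

record ('o, 'a, 'u) monoid_presheaf =
  mon :: "'o \<Rightarrow> 'u monoid"
  mres :: "'a \<Rightarrow> 'u \<Rightarrow> 'u"

definition und :: "('o, 'a, 'u) monoid_presheaf \<Rightarrow> ('o, 'a, 'u) presheaf" where
  "und A = \<lparr>sec = (\<lambda>X. carrier (mon A X)), res = mres A\<rparr>"

text \<open>
  The collection \<open>\<V>\<close> of small sets plays the role of a Grothendieck universe (inside the arbitrary
  type \<open>'u\<close>) relative to which the site is small; ``the category of sets'' has the members of
  \<open>\<V>\<close> as its objects. The only closure properties required are: closure under passing to sets of
  smaller cardinality, existence of a two-element set, closure under binary products, and
  under products indexed by the arrows of the site. As \<open>\<V>\<close> consists of subsets of \<open>'u\<close>, a
  product belongs to \<open>\<V>\<close> through an injective coding of its elements by elements of \<open>'u\<close>.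
  These properties hold for the sets of cardinality less than \<open>\<kappa>\<close> if \<open>'u\<close> has strongly
  inaccessible cardinality \<open>\<kappa>\<close> greater than the number of arrows, and for all subsets of \<open>'u\<close> if
  \<open>'u\<close> is infinite and \<open>'a \<Rightarrow> 'u\<close> embeds into \<open>'u\<close>.
\<close>

locale topos = site C J for C :: "('o, 'a) cat" and J :: "'o \<Rightarrow> 'a set set" +
  fixes \<V> :: "'u set set"
  assumes topology: "grothendieck_topology"
    and small_le: "\<And>A B (i :: 'u \<Rightarrow> 'u). \<lbrakk>A \<in> \<V>; inj_on i B; i ` B \<subseteq> A\<rbrakk> \<Longrightarrow> B \<in> \<V>"
    and small_two: "\<exists>a b. a \<noteq> b \<and> {a, b} \<in> \<V>"
    and small_Times: "\<And>A B. \<lbrakk>A \<in> \<V>; B \<in> \<V>\<rbrakk> \<Longrightarrow> \<exists>e :: 'u \<times> 'u \<Rightarrow> 'u. inj_on e (A \<times> B) \<and> e ` (A \<times> B) \<in> \<V>"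
    and small_PiE: "\<And>B :: 'a \<Rightarrow> 'u set. (\<And>f. f \<in> Arr C \<Longrightarrow> B f \<in> \<V>)
      \<Longrightarrow> \<exists>e :: ('a \<Rightarrow> 'u) \<Rightarrow> 'u. inj_on e (PiE (Arr C) B) \<and> e ` PiE (Arr C) B \<in> \<V>"
begin

definition presheaf :: "('o, 'a, 'u) presheaf \<Rightarrow> bool" where
  "presheaf F \<longleftrightarrow>
     (\<forall>f\<in>Arr C. res F f \<in> sec F (Cod C f) \<rightarrow> sec F (Dom C f)) \<and>
     (\<forall>X\<in>Obj C. \<forall>x\<in>sec F X. res F (Idt C X) x = x) \<and>
     (\<forall>f\<in>Arr C. \<forall>g\<in>Arr C. Cod C g = Dom C f \<longrightarrow>
        (\<forall>x\<in>sec F (Cod C f). res F (Cmp C f g) x = res F g (res F f x)))"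

text \<open>The objects of the topos.\<close>
definition sheaf :: "('o, 'a, 'u) presheaf \<Rightarrow> bool" where
  "sheaf F \<longleftrightarrow> presheaf F \<and> (\<forall>X\<in>Obj C. sec F X \<in> \<V>) \<and>
     (\<forall>X\<in>Obj C. \<forall>S\<in>J X. \<forall>x.
        (\<forall>f\<in>S. x f \<in> sec F (Dom C f)) \<and>
        (\<forall>f\<in>S. \<forall>g\<in>Arr C. Cod C g = Dom C f \<longrightarrow> x (Cmp C f g) = res F g (x f))
        \<longrightarrow> (\<exists>!s. s \<in> sec F X \<and> (\<forall>f\<in>S. res F f s = x f)))"

text \<open>
  Arrows \<open>F \<rightarrow> G\<close> of the topos. They are extensional (\<open>undefined\<close> outside the sections of \<open>F\<close>),
  so that equality of arrows is equality of terms.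
\<close>
definition Hom :: "('o, 'a, 'u) presheaf \<Rightarrow> ('o, 'a, 'u) presheaf \<Rightarrow> ('o, 'u) family set" where
  "Hom F G = {\<phi> \<in> (\<Pi>\<^sub>E X\<in>Obj C. sec F X \<rightarrow>\<^sub>E sec G X).
     \<forall>f\<in>Arr C. \<forall>x\<in>sec F (Cod C f). \<phi> (Dom C f) (res F f x) = res G f (\<phi> (Cod C f) x)}"

definition idm :: "('o, 'a, 'u) presheaf \<Rightarrow> ('o, 'u) family" where
  "idm F = (\<lambda>X\<in>Obj C. \<lambda>x\<in>sec F X. x)"

text \<open>\<open>cmp F \<psi> \<phi>\<close> is \<open>\<psi> \<circ> \<phi>\<close>, where \<open>F\<close> is the source of \<open>\<phi>\<close>.\<close>
definition cmp :: "('o, 'a, 'u) presheaf \<Rightarrow> ('o, 'u) family \<Rightarrow> ('o, 'u) family \<Rightarrow> ('o, 'u) family" where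
  "cmp F \<psi> \<phi> = (\<lambda>X\<in>Obj C. compose (sec F X) (\<psi> X) (\<phi> X))"

text \<open>
  Products in the topos are computed sectionwise, so a (commutative) monoid object is a sheaf
  of commutative monoids.
\<close>
definition monoid_sheaf :: "('o, 'a, 'u) monoid_presheaf \<Rightarrow> bool" where
  "monoid_sheaf A \<longleftrightarrow> sheaf (und A) \<and> (\<forall>X\<in>Obj C. comm_monoid (mon A X)) \<and>
     (\<forall>f\<in>Arr C. mres A f \<in> hom (mon A (Cod C f)) (mon A (Dom C f)) \<and>
        mres A f \<one>\<^bsub>mon A (Cod C f)\<^esub> = \<one>\<^bsub>mon A (Dom C f)\<^esub>)"

definition monoid_hom ::
  "('o, 'a, 'u) monoid_presheaf \<Rightarrow> ('o, 'a, 'u) monoid_presheaf \<Rightarrow> ('o, 'u) family \<Rightarrow> bool" where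
  "monoid_hom A B \<phi> \<longleftrightarrow> \<phi> \<in> Hom (und A) (und B) \<and>
     (\<forall>X\<in>Obj C. \<phi> X \<in> hom (mon A X) (mon B X) \<and> \<phi> X \<one>\<^bsub>mon A X\<^esub> = \<one>\<^bsub>mon B X\<^esub>)"

text \<open>The monoid \<open>A(U)\<close> of arrows \<open>U \<rightarrow> A\<close>, for an object \<open>U\<close> of the topos.\<close>
definition arrows :: "('o, 'a, 'u) presheaf \<Rightarrow> ('o, 'a, 'u) monoid_presheaf \<Rightarrow> ('o, 'u) family monoid" where
  "arrows U A = \<lparr>carrier = Hom U (und A),
     monoid.mult = (\<lambda>a b. \<lambda>X\<in>Obj C. \<lambda>x\<in>sec U X. a X x \<otimes>\<^bsub>mon A X\<^esub> b X x),
     one = (\<lambda>X\<in>Obj C. \<lambda>x\<in>sec U X. \<one>\<^bsub>mon A X\<^esub>)\<rparr>"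

definition sharp :: "('o, 'a, 'u) monoid_presheaf \<Rightarrow> bool" where
  "sharp A \<longleftrightarrow> (\<forall>U. sheaf U \<longrightarrow> Units (arrows U A) = {\<one>\<^bsub>arrows U A\<^esub>})"

end

type_synonym ('o, 'a, 'u) kato = "('o, 'a, 'u) monoid_presheaf \<times> ('o, 'u) family"
type_synonym ('o, 'a, 'u) kato_arrow = "('o, 'a, 'u) kato \<times> ('o, 'u) family \<times> ('o, 'a, 'u) kato"

text \<open>
  An object of the quotient stack over an object \<open>base\<close> of the topos: a torsor
  \<open>proj : tot \<rightarrow> base\<close> with action \<open>act\<close>, and an equivariant map \<open>val\<close> to the monoid.
\<close>
record ('o, 'a, 'u) torsor_map =
  base :: "('o, 'a, 'u) presheaf"
  tot :: "('o, 'a, 'u) presheaf"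
  proj :: "('o, 'u) family"
  act :: "'o \<Rightarrow> 'u \<Rightarrow> 'u \<Rightarrow> 'u"
  val :: "('o, 'u) family"

text \<open>
  The data of \<open>(A, L)\<close>. The functor \<open>L : A \<rightarrow> Div\<close> is encoded as a functor between the categories fibred
  over the topos: an object of \<open>A\<close> over \<open>U\<close> is an arrow \<open>a : U \<rightarrow> A\<close>, sent to \<open>Lobj U a\<close>; the arrow
  \<open>a \<circ> f \<rightarrow> a\<close> over \<open>f : V \<rightarrow> U\<close> is sent to \<open>Larr V f U a : Lobj V (a \<circ> f) \<rightarrow> Lobj U a\<close>, which amounts to an
  isomorphism of \<open>Lobj V (a \<circ> f)\<close> with the pullback of \<open>Lobj U a\<close>.
  The monoidal structure consists of \<open>Lmul U a b : L(a) \<otimes> L(b) \<rightarrow> L(a + b)\<close> and \<open>Lone U : 1 \<rightarrow> L(0)\<close>.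
\<close>
record ('o, 'a, 'u) df_data =
  Lmon :: "('o, 'a, 'u) monoid_presheaf"
  Lobj :: "('o, 'a, 'u) presheaf \<Rightarrow> ('o, 'u) family \<Rightarrow> ('o, 'a, 'u) torsor_map"
  Larr :: "('o, 'a, 'u) presheaf \<Rightarrow> ('o, 'u) family \<Rightarrow> ('o, 'a, 'u) presheaf \<Rightarrow> ('o, 'u) family \<Rightarrow> ('o, 'u) family"
  Lmul :: "('o, 'a, 'u) presheaf \<Rightarrow> ('o, 'u) family \<Rightarrow> ('o, 'u) family \<Rightarrow> ('o, 'u) family"
  Lone :: "('o, 'a, 'u) presheaf \<Rightarrow> ('o, 'u) family"

type_synonym ('o, 'a, 'u) df_arrow =
  "('o, 'a, 'u) df_data \<times>
   (('o, 'u) family \<times> (('o, 'a, 'u) presheaf \<Rightarrow> ('o, 'u) family \<Rightarrow> ('o, 'u) family)) \<times>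
   ('o, 'a, 'u) df_data"

locale monoided_topos = topos C J \<V>
  for C :: "('o, 'a) cat" and J :: "'o \<Rightarrow> 'a set set" and \<V> :: "'u set set" +
  fixes \<O> :: "('o, 'a, 'u) monoid_presheaf"
  assumes monoid_O: "monoid_sheaf \<O>"
begin

abbreviation O_units :: "'o \<Rightarrow> 'u set" where
  "O_units X \<equiv> Units (mon \<O> X)"

definition inv_image_units :: "('o, 'a, 'u) kato \<Rightarrow> 'o \<Rightarrow> 'u set" where
  "inv_image_units K X = (case K of (M, \<alpha>) \<Rightarrow> {m \<in> carrier (mon M X). \<alpha> X m \<in> O_units X})"

definition kato :: "('o, 'a, 'u) kato \<Rightarrow> bool" where
  "kato K = (case K of (M, \<alpha>) \<Rightarrow> monoid_sheaf M \<and> monoid_hom M \<O> \<alpha> \<and>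
     (\<forall>X\<in>Obj C. \<alpha> X \<in> Group.iso ((mon M X)\<lparr>carrier := inv_image_units K X\<rparr>) (units_of (mon \<O> X))))"

definition kato_act :: "('o, 'a, 'u) kato \<Rightarrow> 'o \<Rightarrow> 'u \<Rightarrow> 'u \<Rightarrow> 'u" where
  "kato_act K X u m = (case K of (M, \<alpha>) \<Rightarrow> inv_into (inv_image_units K X) (\<alpha> X) u \<otimes>\<^bsub>mon M X\<^esub> m)"

definition quasi_integral :: "('o, 'a, 'u) kato \<Rightarrow> bool" where
  "quasi_integral K \<longleftrightarrow> (\<forall>X\<in>Obj C. \<forall>u\<in>O_units X. \<forall>m\<in>carrier (mon (fst K) X).
     kato_act K X u m = m \<longrightarrow> u = \<one>\<^bsub>mon \<O> X\<^esub>)"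

definition kato_hom :: "('o, 'a, 'u) kato \<Rightarrow> ('o, 'a, 'u) kato \<Rightarrow> ('o, 'u) family \<Rightarrow> bool" where
  "kato_hom K K' \<phi> = (case (K, K') of ((M, \<alpha>), (N, \<beta>)) \<Rightarrow>
     monoid_hom M N \<phi> \<and> cmp (und M) \<beta> \<phi> = \<alpha>)"

definition quasi_integral_kato_cat :: "(('o, 'a, 'u) kato, ('o, 'a, 'u) kato_arrow) cat" where
  "quasi_integral_kato_cat = \<lparr>
     Obj = {K. kato K \<and> quasi_integral K},
     Arr = {(K, \<phi>, K'). kato K \<and> quasi_integral K \<and> kato K' \<and> quasi_integral K' \<and> kato_hom K K' \<phi>},
     Dom = (\<lambda>(K, \<phi>, K'). K),
     Cod = (\<lambda>(K, \<phi>, K'). K'),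
     Idt = (\<lambda>K. (K, idm (und (fst K)), K)),
     Cmp = (\<lambda>(K', \<psi>, K'') (K, \<phi>, _). (K, cmp (und (fst K)) \<psi> \<phi>, K''))\<rparr>"


definition torsor :: "('o, 'a, 'u) torsor_map \<Rightarrow> bool" where
  "torsor P \<longleftrightarrow> sheaf (base P) \<and> sheaf (tot P) \<and> proj P \<in> Hom (tot P) (base P) \<and>
     (\<forall>X\<in>Obj C. \<forall>u\<in>O_units X. \<forall>p\<in>sec (tot P) X.
        act P X u p \<in> sec (tot P) X \<and> proj P X (act P X u p) = proj P X p) \<and>
     (\<forall>X\<in>Obj C. \<forall>p\<in>sec (tot P) X. act P X \<one>\<^bsub>mon \<O> X\<^esub> p = p) \<and>
     (\<forall>X\<in>Obj C. \<forall>u\<in>O_units X. \<forall>v\<in>O_units X. \<forall>p\<in>sec (tot P) X.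
        act P X (u \<otimes>\<^bsub>mon \<O> X\<^esub> v) p = act P X u (act P X v p)) \<and>
     (\<forall>f\<in>Arr C. \<forall>u\<in>O_units (Cod C f). \<forall>p\<in>sec (tot P) (Cod C f).
        res (tot P) f (act P (Cod C f) u p) = act P (Dom C f) (mres \<O> f u) (res (tot P) f p)) \<and>
     (\<forall>X\<in>Obj C. \<forall>p\<in>sec (tot P) X. \<forall>q\<in>sec (tot P) X. proj P X p = proj P X q \<longrightarrow>
        (\<exists>!u. u \<in> O_units X \<and> act P X u p = q)) \<and>
     (\<forall>X\<in>Obj C. \<forall>x\<in>sec (base P) X. \<exists>S\<in>J X. \<forall>f\<in>S. \<exists>p\<in>sec (tot P) (Dom C f).
        proj P (Dom C f) p = res (base P) f x)"

definition div_obj :: "('o, 'a, 'u) torsor_map \<Rightarrow> bool" where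
  "div_obj P \<longleftrightarrow> torsor P \<and> val P \<in> Hom (tot P) (und \<O>) \<and>
     (\<forall>X\<in>Obj C. \<forall>u\<in>O_units X. \<forall>p\<in>sec (tot P) X. val P X (act P X u p) = u \<otimes>\<^bsub>mon \<O> X\<^esub> val P X p)"

text \<open>
  Arrows \<open>P \<rightarrow> Q\<close> of the fibred category \<open>Div\<close> over an arrow \<open>f\<close> of the topos. An equivariant map of
  torsors over \<open>f\<close> automatically identifies \<open>P\<close> with the pullback of \<open>Q\<close> along \<open>f\<close>; in particular
  the arrows over an identity are isomorphisms.
\<close>
definition div_arr ::
  "('o, 'a, 'u) torsor_map \<Rightarrow> ('o, 'u) family \<Rightarrow> ('o, 'a, 'u) torsor_map \<Rightarrow> ('o, 'u) family set" where
  "div_arr P f Q = {g \<in> Hom (tot P) (tot Q). \<forall>X\<in>Obj C. \<forall>p\<in>sec (tot P) X.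
     proj Q X (g X p) = f X (proj P X p) \<and>
     (\<forall>u\<in>O_units X. g X (act P X u p) = act Q X u (g X p)) \<and>
     val Q X (g X p) = val P X p}"

text \<open>
  The tensor product over \<open>U\<close> is the contracted product of torsors: the quotient sheaf \<open>T\<close> of the fibre
  product \<open>P \<times>\<^sub>U Q\<close> by the action \<open>u (p, q) = (u p, u\<^sup>-\<^sup>1 q)\<close> of the units, with quotient map \<open>\<tau>\<close>,
  and with action and map to \<open>\<O>\<close> induced by the action on one factor and by multiplication.
  The quotient sheaf is characterised by \<open>\<tau>\<close> being locally surjective with the orbits as fibres.
\<close>
definition contracted_product ::
  "('o, 'a, 'u) torsor_map \<Rightarrow> ('o, 'a, 'u) torsor_map \<Rightarrow>
   ('o, 'a, 'u) torsor_map \<Rightarrow> ('o \<Rightarrow> 'u \<Rightarrow> 'u \<Rightarrow> 'u) \<Rightarrow> bool" where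
  "contracted_product P Q T \<tau> \<longleftrightarrow> div_obj T \<and> base T = base P \<and>
     (\<forall>X\<in>Obj C. \<forall>p\<in>sec (tot P) X. \<forall>q\<in>sec (tot Q) X. proj P X p = proj Q X q \<longrightarrow>
        \<tau> X p q \<in> sec (tot T) X \<and> proj T X (\<tau> X p q) = proj P X p \<and>
        (\<forall>f\<in>Arr C. Cod C f = X \<longrightarrow>
           res (tot T) f (\<tau> X p q) = \<tau> (Dom C f) (res (tot P) f p) (res (tot Q) f q)) \<and>
        (\<forall>u\<in>O_units X. \<tau> X (act P X u p) q = act T X u (\<tau> X p q) \<and>
           \<tau> X p (act Q X u q) = act T X u (\<tau> X p q)) \<and>
        val T X (\<tau> X p q) = val P X p \<otimes>\<^bsub>mon \<O> X\<^esub> val Q X q \<and>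
        (\<forall>p'\<in>sec (tot P) X. \<forall>q'\<in>sec (tot Q) X. proj P X p' = proj Q X q' \<longrightarrow> \<tau> X p q = \<tau> X p' q' \<longrightarrow>
           (\<exists>u\<in>O_units X. p' = act P X u p \<and> q' = act Q X (inv\<^bsub>mon \<O> X\<^esub> u) q))) \<and>
     (\<forall>X\<in>Obj C. \<forall>t\<in>sec (tot T) X. \<exists>S\<in>J X. \<forall>f\<in>S.
        \<exists>p\<in>sec (tot P) (Dom C f). \<exists>q\<in>sec (tot Q) (Dom C f).
          proj P (Dom C f) p = proj Q (Dom C f) q \<and> \<tau> (Dom C f) p q = res (tot T) f t)"

text \<open>The contracted product exists and is unique up to unique isomorphism; one is chosen.\<close>
definition tensor_choice ::
  "('o, 'a, 'u) torsor_map \<Rightarrow> ('o, 'a, 'u) torsor_map \<Rightarrow>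
   ('o, 'a, 'u) torsor_map \<times> ('o \<Rightarrow> 'u \<Rightarrow> 'u \<Rightarrow> 'u)" where
  "tensor_choice P Q = (SOME (T, \<tau>). contracted_product P Q T \<tau>)"

definition tensor ::
  "('o, 'a, 'u) torsor_map \<Rightarrow> ('o, 'a, 'u) torsor_map \<Rightarrow> ('o, 'a, 'u) torsor_map" where
  "tensor P Q = fst (tensor_choice P Q)"

definition tens ::
  "('o, 'a, 'u) torsor_map \<Rightarrow> ('o, 'a, 'u) torsor_map \<Rightarrow> 'o \<Rightarrow> 'u \<Rightarrow> 'u \<Rightarrow> 'u" where
  "tens P Q = snd (tensor_choice P Q)"

text \<open>
  The unit object over \<open>U\<close>, the image of \<open>1 : U \<rightarrow> \<O>\<close> in the quotient stack: the trivial torsor, i.e. a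
  torsor with a global section \<open>e\<close>, with the equivariant map to \<open>\<O>\<close> sending \<open>e\<close> to \<open>1\<close>. Again it is
  unique up to unique isomorphism, and one is chosen.
\<close>
definition trivial_torsor ::
  "('o, 'a, 'u) presheaf \<Rightarrow> ('o, 'a, 'u) torsor_map \<Rightarrow> ('o, 'u) family \<Rightarrow> bool" where
  "trivial_torsor U T e \<longleftrightarrow> div_obj T \<and> base T = U \<and> e \<in> Hom U (tot T) \<and>
     (\<forall>X\<in>Obj C. \<forall>x\<in>sec U X. proj T X (e X x) = x \<and> val T X (e X x) = \<one>\<^bsub>mon \<O> X\<^esub>)"

definition unit_choice :: "('o, 'a, 'u) presheaf \<Rightarrow> ('o, 'a, 'u) torsor_map \<times> ('o, 'u) family" where
  "unit_choice U = (SOME (T, e). trivial_torsor U T e)"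

definition unit_obj :: "('o, 'a, 'u) presheaf \<Rightarrow> ('o, 'a, 'u) torsor_map" where
  "unit_obj U = fst (unit_choice U)"

definition unit_sec :: "('o, 'a, 'u) presheaf \<Rightarrow> ('o, 'u) family" where
  "unit_sec U = snd (unit_choice U)"

text \<open>The structural arrows of the symmetric monoidal fibred category \<open>Div\<close>.\<close>

definition tensor_map ::
  "('o, 'a, 'u) torsor_map \<Rightarrow> ('o, 'a, 'u) torsor_map \<Rightarrow> ('o, 'u) family \<Rightarrow>
   ('o, 'a, 'u) torsor_map \<Rightarrow> ('o, 'a, 'u) torsor_map \<Rightarrow>
   ('o, 'u) family \<Rightarrow> ('o, 'u) family \<Rightarrow> ('o, 'u) family" where
  "tensor_map P Q f P' Q' g h = (THE k. k \<in> div_arr (tensor P Q) f (tensor P' Q') \<and>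
     (\<forall>X\<in>Obj C. \<forall>p\<in>sec (tot P) X. \<forall>q\<in>sec (tot Q) X. proj P X p = proj Q X q \<longrightarrow>
        k X (tens P Q X p q) = tens P' Q' X (g X p) (h X q)))"

definition unit_map ::
  "('o, 'a, 'u) presheaf \<Rightarrow> ('o, 'u) family \<Rightarrow> ('o, 'a, 'u) presheaf \<Rightarrow> ('o, 'u) family" where
  "unit_map V f U = (THE k. k \<in> div_arr (unit_obj V) f (unit_obj U) \<and>
     (\<forall>X\<in>Obj C. \<forall>x\<in>sec V X. k X (unit_sec V X x) = unit_sec U X (f X x)))"

definition associator ::
  "('o, 'a, 'u) torsor_map \<Rightarrow> ('o, 'a, 'u) torsor_map \<Rightarrow> ('o, 'a, 'u) torsor_map \<Rightarrow> ('o, 'u) family" where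
  "associator P Q R = (THE k.
     k \<in> div_arr (tensor (tensor P Q) R) (idm (base P)) (tensor P (tensor Q R)) \<and>
     (\<forall>X\<in>Obj C. \<forall>p\<in>sec (tot P) X. \<forall>q\<in>sec (tot Q) X. \<forall>r\<in>sec (tot R) X.
        proj P X p = proj Q X q \<and> proj Q X q = proj R X r \<longrightarrow>
        k X (tens (tensor P Q) R X (tens P Q X p q) r) = tens P (tensor Q R) X p (tens Q R X q r)))"

definition braiding ::
  "('o, 'a, 'u) torsor_map \<Rightarrow> ('o, 'a, 'u) torsor_map \<Rightarrow> ('o, 'u) family" where
  "braiding P Q = (THE k. k \<in> div_arr (tensor P Q) (idm (base P)) (tensor Q P) \<and>
     (\<forall>X\<in>Obj C. \<forall>p\<in>sec (tot P) X. \<forall>q\<in>sec (tot Q) X. proj P X p = proj Q X q \<longrightarrow>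
        k X (tens P Q X p q) = tens Q P X q p))"

definition left_unitor :: "('o, 'a, 'u) torsor_map \<Rightarrow> ('o, 'u) family" where
  "left_unitor P = (THE k. k \<in> div_arr (tensor (unit_obj (base P)) P) (idm (base P)) P \<and>
     (\<forall>X\<in>Obj C. \<forall>p\<in>sec (tot P) X.
        k X (tens (unit_obj (base P)) P X (unit_sec (base P) X (proj P X p)) p) = p))"

definition right_unitor :: "('o, 'a, 'u) torsor_map \<Rightarrow> ('o, 'u) family" where
  "right_unitor P = (THE k. k \<in> div_arr (tensor P (unit_obj (base P))) (idm (base P)) P \<and>
     (\<forall>X\<in>Obj C. \<forall>p\<in>sec (tot P) X.
        k X (tens P (unit_obj (base P)) X p (unit_sec (base P) X (proj P X p))) = p))"

definition div_invertible :: "('o, 'a, 'u) torsor_map \<Rightarrow> bool" where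
  "div_invertible P \<longleftrightarrow> (\<exists>Q. div_obj Q \<and> base Q = base P \<and>
     div_arr (tensor P Q) (idm (base P)) (unit_obj (base P)) \<noteq> {})"


text \<open>\<open>L\<close> is a functor from \<open>A\<close> to \<open>Div\<close> over the topos.\<close>
definition stack_functor :: "('o, 'a, 'u) df_data \<Rightarrow> bool" where
  "stack_functor L \<longleftrightarrow>
     (\<forall>U a. sheaf U \<longrightarrow> a \<in> Hom U (und (Lmon L)) \<longrightarrow>
        div_obj (Lobj L U a) \<and> base (Lobj L U a) = U) \<and>
     (\<forall>V U f a. sheaf V \<longrightarrow> sheaf U \<longrightarrow> f \<in> Hom V U \<longrightarrow> a \<in> Hom U (und (Lmon L)) \<longrightarrow>
        Larr L V f U a \<in> div_arr (Lobj L V (cmp V a f)) f (Lobj L U a)) \<and>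
     (\<forall>U a. sheaf U \<longrightarrow> a \<in> Hom U (und (Lmon L)) \<longrightarrow>
        Larr L U (idm U) U a = idm (tot (Lobj L U a))) \<and>
     (\<forall>W V U g f a. sheaf W \<longrightarrow> sheaf V \<longrightarrow> sheaf U \<longrightarrow> g \<in> Hom W V \<longrightarrow> f \<in> Hom V U \<longrightarrow>
        a \<in> Hom U (und (Lmon L)) \<longrightarrow>
        Larr L W (cmp W f g) U a =
          cmp (tot (Lobj L W (cmp W a (cmp W f g)))) (Larr L V f U a) (Larr L W g V (cmp V a f)))"

definition symmetric_monoidal :: "('o, 'a, 'u) df_data \<Rightarrow> bool" where
  "symmetric_monoidal L \<longleftrightarrow>
     \<comment> \<open>the structure arrows, natural with respect to arrows \<open>f : V \<rightarrow> U\<close>\<close>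
     (\<forall>U. sheaf U \<longrightarrow> Lone L U \<in> div_arr (unit_obj U) (idm U) (Lobj L U \<one>\<^bsub>arrows U (Lmon L)\<^esub>)) \<and>
     (\<forall>U a b. sheaf U \<longrightarrow> a \<in> Hom U (und (Lmon L)) \<longrightarrow> b \<in> Hom U (und (Lmon L)) \<longrightarrow>
        Lmul L U a b \<in> div_arr (tensor (Lobj L U a) (Lobj L U b)) (idm U)
                          (Lobj L U (a \<otimes>\<^bsub>arrows U (Lmon L)\<^esub> b))) \<and>
     (\<forall>V U f. sheaf V \<longrightarrow> sheaf U \<longrightarrow> f \<in> Hom V U \<longrightarrow>
        cmp (tot (unit_obj V)) (Larr L V f U \<one>\<^bsub>arrows U (Lmon L)\<^esub>) (Lone L V) =
        cmp (tot (unit_obj V)) (Lone L U) (unit_map V f U)) \<and>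
     (\<forall>V U f a b. sheaf V \<longrightarrow> sheaf U \<longrightarrow> f \<in> Hom V U \<longrightarrow>
        a \<in> Hom U (und (Lmon L)) \<longrightarrow> b \<in> Hom U (und (Lmon L)) \<longrightarrow>
        (let P = Lobj L V (cmp V a f); Q = Lobj L V (cmp V b f) in
         cmp (tot (tensor P Q)) (Larr L V f U (a \<otimes>\<^bsub>arrows U (Lmon L)\<^esub> b))
           (Lmul L V (cmp V a f) (cmp V b f)) =
         cmp (tot (tensor P Q)) (Lmul L U a b)
           (tensor_map P Q f (Lobj L U a) (Lobj L U b) (Larr L V f U a) (Larr L V f U b)))) \<and>
     \<comment> \<open>compatibility with associators, unitors and braidings\<close>
     (\<forall>U a b c. sheaf U \<longrightarrow> a \<in> Hom U (und (Lmon L)) \<longrightarrow> b \<in> Hom U (und (Lmon L)) \<longrightarrow>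
        c \<in> Hom U (und (Lmon L)) \<longrightarrow>
        (let P = Lobj L U a; Q = Lobj L U b; R = Lobj L U c;
             ab = a \<otimes>\<^bsub>arrows U (Lmon L)\<^esub> b; bc = b \<otimes>\<^bsub>arrows U (Lmon L)\<^esub> c;
             T = tot (tensor (tensor P Q) R) in
         cmp T (Lmul L U a bc)
           (cmp T (tensor_map P (tensor Q R) (idm U) P (Lobj L U bc) (idm (tot P)) (Lmul L U b c))
              (associator P Q R)) =
         cmp T (Lmul L U ab c)
           (tensor_map (tensor P Q) R (idm U) (Lobj L U ab) R (Lmul L U a b) (idm (tot R))))) \<and>
     (\<forall>U a. sheaf U \<longrightarrow> a \<in> Hom U (und (Lmon L)) \<longrightarrow>
        (let P = Lobj L U a; I = unit_obj U; z = \<one>\<^bsub>arrows U (Lmon L)\<^esub> in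
         cmp (tot (tensor I P)) (Lmul L U z a)
           (tensor_map I P (idm U) (Lobj L U z) P (Lone L U) (idm (tot P))) = left_unitor P \<and>
         cmp (tot (tensor P I)) (Lmul L U a z)
           (tensor_map P I (idm U) P (Lobj L U z) (idm (tot P)) (Lone L U)) = right_unitor P)) \<and>
     (\<forall>U a b. sheaf U \<longrightarrow> a \<in> Hom U (und (Lmon L)) \<longrightarrow> b \<in> Hom U (und (Lmon L)) \<longrightarrow>
        cmp (tot (tensor (Lobj L U a) (Lobj L U b))) (Lmul L U b a)
          (braiding (Lobj L U a) (Lobj L U b)) = Lmul L U a b)"

definition trivial_kernel :: "('o, 'a, 'u) df_data \<Rightarrow> bool" where
  "trivial_kernel L \<longleftrightarrow> (\<forall>U a. sheaf U \<longrightarrow> a \<in> Hom U (und (Lmon L)) \<longrightarrow>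
     div_invertible (Lobj L U a) \<longrightarrow> a = \<one>\<^bsub>arrows U (Lmon L)\<^esub>)"

definition df :: "('o, 'a, 'u) df_data \<Rightarrow> bool" where
  "df L \<longleftrightarrow> monoid_sheaf (Lmon L) \<and> sharp (Lmon L) \<and> stack_functor L \<and>
     symmetric_monoidal L \<and> trivial_kernel L"

text \<open>
  Morphisms \<open>(A, L) \<rightarrow> (B, K)\<close>: the component of \<open>\<Phi>\<close> at \<open>a : U \<rightarrow> A\<close> is \<open>\<Phi> U a : K(\<phi> \<circ> a) \<rightarrow> L(a)\<close>, and the
  last three conjuncts say that \<open>\<Phi>\<close> is natural and monoidal. Outside the objects of \<open>A\<close>, \<open>\<Phi>\<close> is
  \<open>undefined\<close>.
\<close>
definition df_hom ::
  "('o, 'a, 'u) df_data \<Rightarrow> ('o, 'a, 'u) df_data \<Rightarrow> ('o, 'u) family \<Rightarrow>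
   (('o, 'a, 'u) presheaf \<Rightarrow> ('o, 'u) family \<Rightarrow> ('o, 'u) family) \<Rightarrow> bool" where
  "df_hom L K \<phi> \<Phi> \<longleftrightarrow> monoid_hom (Lmon L) (Lmon K) \<phi> \<and>
     \<Phi> \<in> (\<Pi>\<^sub>E U\<in>{U. sheaf U}. \<Pi>\<^sub>E a\<in>Hom U (und (Lmon L)).
            div_arr (Lobj K U (cmp U \<phi> a)) (idm U) (Lobj L U a)) \<and>
     (\<forall>V U f a. sheaf V \<longrightarrow> sheaf U \<longrightarrow> f \<in> Hom V U \<longrightarrow> a \<in> Hom U (und (Lmon L)) \<longrightarrow>
        (let T = tot (Lobj K V (cmp V \<phi> (cmp V a f))) in
         cmp T (Larr L V f U a) (\<Phi> V (cmp V a f)) =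
         cmp T (\<Phi> U a) (Larr K V f U (cmp U \<phi> a)))) \<and>
     (\<forall>U a b. sheaf U \<longrightarrow> a \<in> Hom U (und (Lmon L)) \<longrightarrow> b \<in> Hom U (und (Lmon L)) \<longrightarrow>
        (let P = Lobj K U (cmp U \<phi> a); Q = Lobj K U (cmp U \<phi> b) in
         cmp (tot (tensor P Q)) (\<Phi> U (a \<otimes>\<^bsub>arrows U (Lmon L)\<^esub> b))
           (Lmul K U (cmp U \<phi> a) (cmp U \<phi> b)) =
         cmp (tot (tensor P Q)) (Lmul L U a b)
           (tensor_map P Q (idm U) (Lobj L U a) (Lobj L U b) (\<Phi> U a) (\<Phi> U b)))) \<and>
     (\<forall>U. sheaf U \<longrightarrow>
        cmp (tot (unit_obj U)) (\<Phi> U \<one>\<^bsub>arrows U (Lmon L)\<^esub>) (Lone K U) = Lone L U)"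

definition df_cat :: "(('o, 'a, 'u) df_data, ('o, 'a, 'u) df_arrow) cat" where
  "df_cat = \<lparr>
     Obj = {L. df L},
     Arr = {(L, (\<phi>, \<Phi>), K). df L \<and> df K \<and> df_hom L K \<phi> \<Phi>},
     Dom = (\<lambda>(L, _, K). L),
     Cod = (\<lambda>(L, _, K). K),
     Idt = (\<lambda>L. (L, (idm (und (Lmon L)),
        \<lambda>U\<in>{U. sheaf U}. \<lambda>a\<in>Hom U (und (Lmon L)). idm (tot (Lobj L U a))), L)),
     Cmp = (\<lambda>(K, (\<psi>, \<Psi>), N) (L, (\<phi>, \<Phi>), _). (L, (cmp (und (Lmon L)) \<psi> \<phi>,
        \<lambda>U\<in>{U. sheaf U}. \<lambda>a\<in>Hom U (und (Lmon L)).
          cmp (tot (Lobj N U (cmp U (cmp (und (Lmon L)) \<psi> \<phi>) a))) (\<Phi> U a) (\<Psi> U (cmp U \<phi> a))), N))\<rparr>"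

end

end

theory Submission
  imports Defs
begin

text \<open>
  Given a DF log structure \<open>(A, L)\<close>, let \<open>P = L(id\<^sub>A)\<close> be the torsor over \<open>A\<close> classified by \<open>L\<close>, with its
  equivariant map \<open>\<alpha> : M \<rightarrow> \<O>\<close> on the total space \<open>M\<close>. The monoidal structure of \<open>L\<close>, evaluated at the two
  projections \<open>A \<times> A \<rightarrow> A\<close>, makes \<open>M\<close> a monoid, and triviality of the kernel says precisely that sections of
  \<open>M\<close> with invertible image are the translates of the unit section, so \<open>(M, \<alpha>)\<close> is a Kato log structure. It is
  quasi-integral because \<open>M\<close> is a torsor. Since every \<open>L(a)\<close> is the pullback of \<open>P\<close> along \<open>a\<close>, the functor
  \<open>(A, L) \<mapsto> (M, \<alpha>)\<close> is fully faithful: a homomorphism \<open>M \<rightarrow> N\<close> compatible with the maps to \<open>\<O>\<close> is equivariant,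
  and so descends to the quotients by the units. Conversely, if \<open>(M, \<alpha>)\<close> is quasi-integral, then \<open>M\<close> is a torsor over the
  quotient sheaf \<open>A = M / \<O>\<^sup>\<times>\<close>, and \<open>L(a) = U \<times>\<^sub>A M\<close> for \<open>a : U \<rightarrow> A\<close> is a DF log structure which
  gives back \<open>(M, \<alpha>)\<close>.
\<close>

text \<open>The functor runs from DF to Kato structures because in that direction it is evaluation
  at the one arrow \<open>idm (und (Lmon L))\<close>. A quasi-inverse would have to choose
  quotients, fibre products and maps out of tensor products coherently; instead full faithfulness
  and essential surjectivity are proved, and the quasi-inverse comes from category theory alone. A
  torsor has sections only locally. Most arrows are therefore given by a relation that prescribes a
  value where a section of a suitable form exists, and are then glued. Gluing needs the prescribed
  value to be unique, and this is where freeness of the actions enters again and again. The axioms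
  of a monoidal functor mention chosen tensor products, associators and unitors. As pure tensors
  generate locally, these axioms are turned into equations between sections, and later arguments use
  only those. Trivial kernel speaks of arrows out of sheaves, a Kato structure of sections over
  objects of the site. The gap is closed by a universal test sheaf: the sheaf of all sections of M
  with invertible value.\<close>

lemma equivalent_categoriesI:
  assumes C: "category C" and D: "category D" and G: "is_functor D C Go Ga"
    and ess: "\<And>X. X \<in> Obj C \<Longrightarrow> \<exists>Y\<in>Obj D. \<exists>f. is_iso C f \<and> Dom C f = X \<and> Cod C f = Go Y"
    and ff: "\<And>Y Y' f. \<lbrakk>Y \<in> Obj D; Y' \<in> Obj D; f \<in> Arr C; Dom C f = Go Y; Cod C f = Go Y'\<rbrakk>
      \<Longrightarrow> \<exists>!g. g \<in> Arr D \<and> Dom D g = Y \<and> Cod D g = Y' \<and> Ga g = f"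
  shows "equivalent_categories C D"
proof -
  interpret C: category C by fact
  interpret D: category D by fact
  have Go: "Go Y \<in> Obj C" "Ga (Idt D Y) = Idt C (Go Y)" if "Y \<in> Obj D" for Y
    using G that by (auto simp: is_functor_def)
  have Ga: "Ga g \<in> Arr C" "Dom C (Ga g) = Go (Dom D g)" "Cod C (Ga g) = Go (Cod D g)" if "g \<in> Arr D" for g
    using G that by (auto simp: is_functor_def)
  have GC: "Ga (Cmp D g f) = Cmp C (Ga g) (Ga f)" if "f \<in> Arr D" "g \<in> Arr D" "Dom D g = Cod D f" for f g
    using G that by (auto simp: is_functor_def)
  \<comment> \<open>This is the uniqueness in \<open>ff\<close>. Every equation between arrows of D
    below is proved through it: compare the endpoints, then the images under
    \<open>Ga\<close>.\<close>
  have faithful: "g = g'" if "g \<in> Arr D" "g' \<in> Arr D" "Dom D g = Dom D g'" "Cod D g = Cod D g'" "Ga g = Ga g'" for g g'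
    using ff[of "Dom D g" "Cod D g" "Ga g"] that Ga[of g] by (metis D.Cod_Obj D.Dom_Obj)
  have "\<exists>Fo \<eta> \<theta>. \<forall>X\<in>Obj C. Fo X \<in> Obj D \<and> \<eta> X \<in> Arr C \<and> Dom C (\<eta> X) = X \<and> Cod C (\<eta> X) = Go (Fo X) \<and>
     \<theta> X \<in> Arr C \<and> Dom C (\<theta> X) = Go (Fo X) \<and> Cod C (\<theta> X) = X \<and> Cmp C (\<theta> X) (\<eta> X) = Idt C X \<and>
     Cmp C (\<eta> X) (\<theta> X) = Idt C (Go (Fo X))"
  proof -
    have "\<forall>X\<in>Obj C. \<exists>Y f g. Y \<in> Obj D \<and> f \<in> Arr C \<and> Dom C f = X \<and> Cod C f = Go Y \<and>
     g \<in> Arr C \<and> Dom C g = Go Y \<and> Cod C g = X \<and> Cmp C g f = Idt C X \<and>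
     Cmp C f g = Idt C (Go Y)"
      using ess unfolding is_iso_def by metis
    then show ?thesis by metis
  qed
  then obtain Fo \<eta> \<theta> where F: "\<And>X. X \<in> Obj C \<Longrightarrow> Fo X \<in> Obj D \<and> \<eta> X \<in> Arr C \<and> Dom C (\<eta> X) = X \<and> Cod C (\<eta> X) = Go (Fo X) \<and>
     \<theta> X \<in> Arr C \<and> Dom C (\<theta> X) = Go (Fo X) \<and> Cod C (\<theta> X) = X \<and> Cmp C (\<theta> X) (\<eta> X) = Idt C X \<and>
     Cmp C (\<eta> X) (\<theta> X) = Idt C (Go (Fo X))" by metis
  define lift where "lift Y Y' f = (THE g. g \<in> Arr D \<and> Dom D g = Y \<and> Cod D g = Y' \<and> Ga g = f)" for Y Y' f
  have lift: "lift Y Y' f \<in> Arr D \<and> Dom D (lift Y Y' f) = Y \<and> Cod D (lift Y Y' f) = Y' \<and> Ga (lift Y Y' f) = f"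
    if "Y \<in> Obj D" "Y' \<in> Obj D" "f \<in> Arr C" "Dom C f = Go Y" "Cod C f = Go Y'" for Y Y' f
    unfolding lift_def by (rule theI') (rule ff[OF that])
  \<comment> \<open>Conjugation by the chosen isomorphisms turns f into an arrow between objects in
    the image of \<open>Go\<close>, to which fullness applies.\<close>
  define conj where "conj f = Cmp C (\<eta> (Cod C f)) (Cmp C f (\<theta> (Dom C f)))" for f
  define Fa where "Fa f = lift (Fo (Dom C f)) (Fo (Cod C f)) (conj f)" for f
  have conj: "conj f \<in> Arr C" "Dom C (conj f) = Go (Fo (Dom C f))" "Cod C (conj f) = Go (Fo (Cod C f))"
    if f: "f \<in> Arr C" for f
    using f F[OF C.Dom_Obj[OF f]] F[OF C.Cod_Obj[OF f]]
    by (auto simp: conj_def C.Cmp_Arr C.Dom_Cmp C.Cod_Cmp)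
  have Fa: "Fa f \<in> Arr D" "Dom D (Fa f) = Fo (Dom C f)" "Cod D (Fa f) = Fo (Cod C f)" "Ga (Fa f) = conj f"
    if f: "f \<in> Arr C" for f
    using lift[OF _ _ conj[OF f]] F[OF C.Dom_Obj[OF f]] F[OF C.Cod_Obj[OF f]] by (auto simp: Fa_def)
  \<comment> \<open>The counit at Y is the lift of the inverse of \<eta> at \<open>Go Y\<close>; the
    lift of \<eta> itself will be its inverse, by faithfulness.\<close>
  define \<epsilon> where "\<epsilon> Y = lift (Fo (Go Y)) Y (\<theta> (Go Y))" for Y
  define \<epsilon>' where "\<epsilon>' Y = lift Y (Fo (Go Y)) (\<eta> (Go Y))" for Y
  have \<epsilon>: "\<epsilon> Y \<in> Arr D" "Dom D (\<epsilon> Y) = Fo (Go Y)" "Cod D (\<epsilon> Y) = Y" "Ga (\<epsilon> Y) = \<theta> (Go Y)" if Y: "Y \<in> Obj D" for Y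
    using lift[of "Fo (Go Y)" Y "\<theta> (Go Y)"] Y F[OF Go(1)[OF Y]] by (auto simp: \<epsilon>_def)
  have \<epsilon>': "\<epsilon>' Y \<in> Arr D" "Dom D (\<epsilon>' Y) = Y" "Cod D (\<epsilon>' Y) = Fo (Go Y)" "Ga (\<epsilon>' Y) = \<eta> (Go Y)" if Y: "Y \<in> Obj D" for Y
    using lift[of Y "Fo (Go Y)" "\<eta> (Go Y)"] Y F[OF Go(1)[OF Y]] by (auto simp: \<epsilon>'_def)
  have conj_\<eta>: "Cmp C (conj f) (\<eta> (Dom C f)) = Cmp C (\<eta> (Cod C f)) f" if f: "f \<in> Arr C" for f
  proof -
    note X = F[OF C.Dom_Obj[OF f]] and Y = F[OF C.Cod_Obj[OF f]]
    have "Cmp C (conj f) (\<eta> (Dom C f)) = Cmp C (\<eta> (Cod C f)) (Cmp C (Cmp C f (\<theta> (Dom C f))) (\<eta> (Dom C f)))"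
      unfolding conj_def using f X Y by (intro C.Cmp_assoc[symmetric]) (auto simp: C.Cmp_Arr C.Dom_Cmp C.Cod_Cmp)
    also have "Cmp C (Cmp C f (\<theta> (Dom C f))) (\<eta> (Dom C f)) = Cmp C f (Cmp C (\<theta> (Dom C f)) (\<eta> (Dom C f)))"
      using f X by (intro C.Cmp_assoc[symmetric]) auto
    finally show ?thesis using X f by (simp add: C.Cmp_Idt_right)
  qed
  have \<theta>_conj: "Cmp C (\<theta> (Cod C f)) (conj f) = Cmp C f (\<theta> (Dom C f))" if f: "f \<in> Arr C" for f
  proof -
    note X = F[OF C.Dom_Obj[OF f]] and Y = F[OF C.Cod_Obj[OF f]]
    have "Cmp C (\<theta> (Cod C f)) (conj f) = Cmp C (Cmp C (\<theta> (Cod C f)) (\<eta> (Cod C f))) (Cmp C f (\<theta> (Dom C f)))"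
      unfolding conj_def using f X Y by (intro C.Cmp_assoc) (auto simp: C.Cmp_Arr C.Dom_Cmp C.Cod_Cmp)
    also have "\<dots> = Cmp C (Idt C (Cod C (Cmp C f (\<theta> (Dom C f))))) (Cmp C f (\<theta> (Dom C f)))"
      using f X Y by (simp add: C.Cod_Cmp)
    finally show ?thesis using X f by (simp add: C.Cmp_Idt_left C.Cmp_Arr)
  qed
  have Fun: "is_functor C D Fo Fa"
    unfolding is_functor_def
  proof (intro conjI ballI impI)
    fix X assume X: "X \<in> Obj C"
    show "Fo X \<in> Obj D" using F[OF X] by simp
    have "Ga (Fa (Idt C X)) = Ga (Idt D (Fo X))"
      using Fa(4)[OF C.Idt_Arr[OF X]] F[OF X] X Go[of "Fo X"]
        C.Cmp_Idt_left[of "\<theta> X"] by (simp add: conj_def C.Dom_Idt C.Cod_Idt)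
    then show "Fa (Idt C X) = Idt D (Fo X)"
      using Fa[OF C.Idt_Arr[OF X]] F[OF X] X
      by (intro faithful) (auto simp: C.Dom_Idt C.Cod_Idt D.Dom_Idt D.Cod_Idt D.Idt_Arr)
  next
    fix f g assume f: "f \<in> Arr C" and g: "g \<in> Arr C" and fg: "Dom C g = Cod C f"
    note X = F[OF C.Dom_Obj[OF f]] and Y = F[OF C.Cod_Obj[OF f]] and Z = F[OF C.Cod_Obj[OF g]]
    note gf = C.Cmp_Arr[OF f g fg]
    have "Cmp C (conj g) (conj f) = Cmp C (Cmp C (conj g) (\<eta> (Cod C f))) (Cmp C f (\<theta> (Dom C f)))"
      unfolding conj_def[of f] using conj[OF f] conj[OF g] f g fg X Y
      by (intro C.Cmp_assoc) (auto simp: C.Cmp_Arr C.Dom_Cmp C.Cod_Cmp)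
    also have "\<dots> = Cmp C (Cmp C (\<eta> (Cod C g)) g) (Cmp C f (\<theta> (Dom C f)))"
      using conj_\<eta>[OF g] fg by simp
    also have "\<dots> = Cmp C (\<eta> (Cod C g)) (Cmp C g (Cmp C f (\<theta> (Dom C f))))"
      using f g fg X Y Z
      by (intro C.Cmp_assoc[symmetric]) (auto simp: C.Cmp_Arr C.Dom_Cmp C.Cod_Cmp)
    also have "Cmp C g (Cmp C f (\<theta> (Dom C f))) = Cmp C (Cmp C g f) (\<theta> (Dom C f))"
      using f g fg X Y by (intro C.Cmp_assoc) auto
    also have "Cmp C (\<eta> (Cod C g)) \<dots> = conj (Cmp C g f)"
      using f g fg by (simp add: conj_def C.Dom_Cmp C.Cod_Cmp)
    finally have "Ga (Fa (Cmp C g f)) = Ga (Cmp D (Fa g) (Fa f))"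
      using Fa[OF f] Fa[OF g] Fa[OF gf] fg by (simp add: GC)
    then show "Fa (Cmp C g f) = Cmp D (Fa g) (Fa f)"
      using Fa[OF f] Fa[OF g] Fa[OF gf] fg f g
      by (intro faithful) (auto simp: D.Cmp_Arr D.Dom_Cmp D.Cod_Cmp C.Dom_Cmp C.Cod_Cmp)
  qed (use Fa in auto)
  have \<eta>_nat: "natural_iso C C (\<lambda>X. X) (\<lambda>f. f) (Go \<circ> Fo) (Ga \<circ> Fa) \<eta>"
    unfolding natural_iso_def is_iso_def
    using F conj_\<eta> Fa by simp metis
  have \<epsilon>_nat: "natural_iso D D (Fo \<circ> Go) (Fa \<circ> Ga) (\<lambda>X. X) (\<lambda>f. f) \<epsilon>"
    unfolding natural_iso_def
  proof (intro conjI ballI)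
    fix Y assume Y: "Y \<in> Obj D"
    note e = \<epsilon>[OF Y] \<epsilon>'[OF Y] F[OF Go(1)[OF Y]]
    have "Cmp D (\<epsilon>' Y) (\<epsilon> Y) = Idt D (Fo (Go Y))" "Cmp D (\<epsilon> Y) (\<epsilon>' Y) = Idt D Y"
      using e Y
      by (auto intro!: faithful simp: GC Go D.Cmp_Arr D.Idt_Arr D.Dom_Cmp D.Cod_Cmp D.Dom_Idt D.Cod_Idt)
    then show "is_iso D (\<epsilon> Y)" unfolding is_iso_def using e by metis
    show "Dom D (\<epsilon> Y) = (Fo \<circ> Go) Y" "Cod D (\<epsilon> Y) = Y" using e by auto
  next
    fix f assume f: "f \<in> Arr D"
    note X = \<epsilon>[OF D.Dom_Obj[OF f]] and Y = \<epsilon>[OF D.Cod_Obj[OF f]]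
    note e = Ga[OF f] Fa[OF Ga(1)[OF f]]
    have "Ga (Cmp D f (\<epsilon> (Dom D f))) = Ga (Cmp D (\<epsilon> (Cod D f)) (Fa (Ga f)))"
      using f X Y e \<theta>_conj[OF Ga(1)[OF f]] by (simp add: GC)
    then show "Cmp D f (\<epsilon> (Dom D f)) = Cmp D (\<epsilon> (Cod D f)) ((Fa \<circ> Ga) f)"
      using f X Y e by (intro faithful) (auto simp: D.Cmp_Arr D.Dom_Cmp D.Cod_Cmp)
  qed
  show ?thesis
    unfolding equivalent_categories_def using C D Fun G \<eta>_nat \<epsilon>_nat by blast
qed

lemma sec_und [simp]: "sec (und A) X = carrier (mon A X)"
  by (simp add: und_def)

lemma res_und [simp]: "res (und A) = mres A"
  by (simp add: und_def)

abbreviation "tsec P \<equiv> sec (tot P)"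
abbreviation "Lsec L U a \<equiv> sec (tot (Lobj L U a))"
abbreviation "Lproj L U a \<equiv> proj (Lobj L U a)"

section \<open>Sheaves and descent\<close>

context topos
begin

abbreviation "Lpts L U \<equiv> Hom U (und (Lmon L))"

section \<open>Covering sieves and local properties\<close>

lemma cover_sieve: "X \<in> Obj C \<Longrightarrow> S \<in> J X \<Longrightarrow> sieve X S"
  using topology by (auto simp: grothendieck_topology_def)

lemma cover_max: "X \<in> Obj C \<Longrightarrow> {f \<in> Arr C. Cod C f = X} \<in> J X"
  using topology by (auto simp: grothendieck_topology_def)

lemma cover_pull: "f \<in> Arr C \<Longrightarrow> S \<in> J (Cod C f) \<Longrightarrow> pull_sieve f S \<in> J (Dom C f)"
  using topology by (auto simp: grothendieck_topology_def)

lemma cover_trans: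
  "\<lbrakk>X \<in> Obj C; S \<in> J X; sieve X R; (\<And>f. f \<in> S \<Longrightarrow> pull_sieve f R \<in> J (Dom C f))\<rbrakk> \<Longrightarrow>
      R \<in> J X"
  using topology unfolding grothendieck_topology_def by blast

lemma cover_arr: "\<lbrakk>X \<in> Obj C; S \<in> J X; f \<in> S\<rbrakk> \<Longrightarrow> f \<in> Arr C \<and> Cod C f = X"
  using cover_sieve[of X S] by (auto simp: sieve_def)

lemma cover_comp:
  "\<lbrakk>X \<in> Obj C; S \<in> J X; f \<in> S; g \<in> Arr C; Cod C g = Dom C f\<rbrakk> \<Longrightarrow> Cmp C f g \<in> S"
  using cover_sieve[of X S] by (auto simp: sieve_def)

text \<open>Pulled back along an arrow of S, the larger sieve becomes maximal, so transitivity
  applies.\<close>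

lemma cover_superset:
  assumes X: "X \<in> Obj C" and S: "S \<in> J X" and R: "sieve X R" "S \<subseteq> R"
  shows "R \<in> J X"
proof (rule cover_trans[OF X S R(1)])
  fix f assume f: "f \<in> S"
  then have "pull_sieve f R = {g \<in> Arr C. Cod C g = Dom C f}"
    using cover_comp[OF X S f] R by (auto simp: pull_sieve_def)
  then show "pull_sieve f R \<in> J (Dom C f)"
    using cover_max cover_arr[OF X S f] Dom_Obj by simp
qed

lemma sieve_pull:
  assumes "sieve X R" "f \<in> Arr C" "Cod C f = X"
  shows "sieve (Dom C f) (pull_sieve f R)"
  unfolding sieve_def
proof (intro conjI ballI impI)
  fix g h assume g: "g \<in> pull_sieve f R" and h: "h \<in> Arr C" "Cod C h = Dom C g"
  then have g': "g \<in> Arr C" "Cod C g = Dom C f" "Cmp C f g \<in> R" by (auto simp: pull_sieve_def)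
  have "Cmp C (Cmp C f g) h \<in> R"
    using assms g' h by (auto simp: sieve_def Dom_Cmp)
  then show "Cmp C g h \<in> pull_sieve f R"
    using assms g' h Cmp_assoc[of h g f] by (simp add: pull_sieve_def Cmp_Arr Cod_Cmp)
qed (auto simp: pull_sieve_def)

text \<open>The arrows satisfying \<open>Q\<close> need not form a sieve; they only have to contain
  a covering one. This lets \<open>Q f\<close> be any statement about restrictions along f.\<close>

definition locally :: "'o \<Rightarrow> ('a \<Rightarrow> bool) \<Rightarrow> bool" where
  "locally X Q \<longleftrightarrow> (\<exists>S\<in>J X. \<forall>f\<in>S. Q f)"

lemma locally_all: "X \<in> Obj C \<Longrightarrow> (\<And>f. f \<in> Arr C \<Longrightarrow> Cod C f = X \<Longrightarrow> Q f) \<Longrightarrow> locally X Q"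
  unfolding locally_def by (rule bexI[OF _ cover_max]) auto

lemma locally_mono:
  "\<lbrakk>locally X P; X \<in> Obj C; (\<And>f. f \<in> Arr C \<Longrightarrow> Cod C f = X \<Longrightarrow> P f \<Longrightarrow> Q f)\<rbrakk> \<Longrightarrow>
      locally X Q"
  unfolding locally_def by (metis cover_arr)

lemma locally_pull:
  assumes "locally X Q" "f \<in> Arr C" "Cod C f = X"
  shows "locally (Dom C f) (\<lambda>g. Q (Cmp C f g))"
proof -
  obtain S where "S \<in> J X" "\<forall>f\<in>S. Q f" using assms(1) by (auto simp: locally_def)
  then have "pull_sieve f S \<in> J (Dom C f)" "\<forall>g\<in>pull_sieve f S. Q (Cmp C f g)"
    using cover_pull[of f S] assms(2,3) by (auto simp: pull_sieve_def)
  then show ?thesis unfolding locally_def by blast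
qed

text \<open>Transitivity in the form needed when one local choice is made after another: the
  composites \<open>Cmp C f g\<close>, with g in the cover found over the domain of f, form a sieve
  whose pullback along f contains that cover.\<close>

lemma locally_bind:
  assumes P: "locally X P" and X: "X \<in> Obj C"
    and Q: "\<And>f. \<lbrakk>f \<in> Arr C; Cod C f = X; P f\<rbrakk> \<Longrightarrow> locally (Dom C f) (\<lambda>g. Q (Cmp C f g))"
  shows "locally X Q"
proof -
  obtain S where S: "S \<in> J X" "\<forall>f\<in>S. P f" using P by (auto simp: locally_def)
  have "\<exists>R\<in>J (Dom C f). \<forall>g\<in>R. Q (Cmp C f g)" if "f \<in> S" for f
    using Q cover_arr[OF X S(1) that] S that by (auto simp: locally_def)
  then obtain R where R: "\<And>f. f \<in> S \<Longrightarrow> R f \<in> J (Dom C f)" "\<And>f g. f \<in> S \<Longrightarrow> g \<in> R f \<Longrightarrow> Q (Cmp C f g)"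
    by metis
  define U where "U = {Cmp C f g | f g. f \<in> S \<and> g \<in> R f}"
  have fg: "f \<in> Arr C \<and> Cod C f = X \<and> g \<in> Arr C \<and> Cod C g = Dom C f" if "f \<in> S" "g \<in> R f" for f g
    using cover_arr[OF X S(1) that(1)] cover_arr[OF _ R(1)[OF that(1)] that(2)] Dom_Obj by blast
  have U: "sieve X U"
    unfolding sieve_def
  proof (intro conjI ballI impI subsetI)
    fix h assume "h \<in> U"
    then show "h \<in> {f \<in> Arr C. Cod C f = X}" using fg unfolding U_def by (auto intro: Cmp_Arr simp: Cod_Cmp)
  next
    fix h k assume "h \<in> U" and k: "k \<in> Arr C" "Cod C k = Dom C h"
    then obtain f g where h: "h = Cmp C f g" "f \<in> S" "g \<in> R f" by (auto simp: U_def)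
    note a = fg[OF h(2,3)]
    have "Cmp C g k \<in> R f"
      using cover_comp[OF _ R(1)[OF h(2)] h(3)] a k h(1) by (simp add: Dom_Cmp Dom_Obj)
    moreover have "Cmp C h k = Cmp C f (Cmp C g k)"
      using a k h(1) by (simp add: Cmp_assoc Dom_Cmp)
    ultimately show "Cmp C h k \<in> U" unfolding U_def using h(2) by blast
  qed
  have "U \<in> J X"
  proof (rule cover_trans[OF X S(1) U])
    fix f assume f: "f \<in> S"
    note a = cover_arr[OF X S(1) f]
    show "pull_sieve f U \<in> J (Dom C f)"
    proof (rule cover_superset[OF _ R(1)[OF f]])
      show "Dom C f \<in> Obj C" using a Dom_Obj by simp
      show "sieve (Dom C f) (pull_sieve f U)" using sieve_pull[OF U] a by simp
      show "R f \<subseteq> pull_sieve f U" using f fg[OF f] unfolding pull_sieve_def U_def by blast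
    qed
  qed
  moreover have "\<forall>h\<in>U. Q h" using R(2) by (auto simp: U_def)
  ultimately show ?thesis by (auto simp: locally_def)
qed

text \<open>Along an arrow of S, the pullbacks of R and of the intersection coincide, so the
  intersection covers by transitivity.\<close>

lemma locally_conj:
  assumes P: "locally X P" and Q: "locally X Q" and X: "X \<in> Obj C"
  shows "locally X (\<lambda>f. P f \<and> Q f)"
proof -
  obtain S R where S: "S \<in> J X" "\<forall>f\<in>S. P f" and R: "R \<in> J X" "\<forall>f\<in>R. Q f"
    using P Q by (auto simp: locally_def)
  have "S \<inter> R \<in> J X"
  proof (rule cover_trans[OF X S(1)])
    show "sieve X (S \<inter> R)" using cover_sieve[OF X S(1)] cover_sieve[OF X R(1)] unfolding sieve_def by blast
    fix f assume f: "f \<in> S"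
    have "Cmp C f g \<in> S" if "g \<in> Arr C" "Cod C g = Dom C f" for g
      using cover_comp[OF X S(1) f that] .
    then have "pull_sieve f (S \<inter> R) = pull_sieve f R"
      unfolding pull_sieve_def by blast
    then show "pull_sieve f (S \<inter> R) \<in> J (Dom C f)"
      using cover_pull[of f R] cover_arr[OF X S(1) f] R by simp
  qed
  then show ?thesis unfolding locally_def by (rule bexI[rotated]) (use S R in simp)
qed

section \<open>Gluing of sections\<close>

lemma sheaf_presheaf: "sheaf F \<Longrightarrow> presheaf F"
  by (simp add: sheaf_def)

lemma res_in: "\<lbrakk>sheaf F; f \<in> Arr C; x \<in> sec F (Cod C f)\<rbrakk> \<Longrightarrow> res F f x \<in> sec F (Dom C f)"
  using sheaf_presheaf[of F] by (auto simp: presheaf_def)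

lemma res_Idt: "\<lbrakk>sheaf F; X \<in> Obj C; x \<in> sec F X\<rbrakk> \<Longrightarrow> res F (Idt C X) x = x"
  using sheaf_presheaf[of F] by (auto simp: presheaf_def)

lemma res_Cmp:
  "\<lbrakk>sheaf F; f \<in> Arr C; g \<in> Arr C; Cod C g = Dom C f; x \<in> sec F (Cod C f)\<rbrakk> \<Longrightarrow>
      res F (Cmp C f g) x = res F g (res F f x)"
  using sheaf_presheaf[of F] by (auto simp: presheaf_def)

lemma sheaf_small: "sheaf F \<Longrightarrow> X \<in> Obj C \<Longrightarrow> sec F X \<in> \<V>"
  by (simp add: sheaf_def)

lemma sheaf_ex1:
  assumes "sheaf F" "X \<in> Obj C" "S \<in> J X" "\<And>f. f \<in> S \<Longrightarrow> x f \<in> sec F (Dom C f)"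
    "\<And>f g. \<lbrakk>f \<in> S; g \<in> Arr C; Cod C g = Dom C f\<rbrakk> \<Longrightarrow> x (Cmp C f g) = res F g (x f)"
  shows "\<exists>!s. s \<in> sec F X \<and> (\<forall>f\<in>S. res F f s = x f)"
proof -
  have "\<forall>X\<in>Obj C. \<forall>S\<in>J X. \<forall>x.
        (\<forall>f\<in>S. x f \<in> sec F (Dom C f)) \<and>
        (\<forall>f\<in>S. \<forall>g\<in>Arr C. Cod C g = Dom C f \<longrightarrow> x (Cmp C f g) = res F g (x f))
        \<longrightarrow> (\<exists>!s. s \<in> sec F X \<and> (\<forall>f\<in>S. res F f s = x f))"
    using assms(1) unfolding sheaf_def by simp
  from bspec[OF bspec[OF this assms(2)] assms(3), THEN spec, of x] show ?thesis
    using assms(4,5) by simp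
qed

text \<open>The restrictions of s form a matching family on the cover, and both s and t amalgamate
  it.\<close>

lemma sheaf_sep:
  assumes F: "sheaf F" and X: "X \<in> Obj C" and s: "s \<in> sec F X" and t: "t \<in> sec F X"
    and l: "locally X (\<lambda>f. res F f s = res F f t)"
  shows "s = t"
proof -
  obtain S where S: "S \<in> J X" "\<forall>f\<in>S. res F f s = res F f t" using l by (auto simp: locally_def)
  have "\<exists>!r. r \<in> sec F X \<and> (\<forall>f\<in>S. res F f r = res F f s)"
  proof (rule sheaf_ex1[OF F X S(1)])
    fix f assume f: "f \<in> S"
    note a = cover_arr[OF X S(1) f]
    show "res F f s \<in> sec F (Dom C f)" using res_in[OF F] a s by auto
    show "res F (Cmp C f g) s = res F g (res F f s)" if "g \<in> Arr C" "Cod C g = Dom C f" for g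
      using res_Cmp[OF F] a s that by auto
  qed
  then show ?thesis using s t S(2) by metis
qed

text \<open>\<open>D f y\<close> reads: y is a candidate for the restriction along f. Uniqueness and
  stability of candidates replace the compatibility of a matching family on a chosen sieve, so that
  D can be an equation or an existence statement; the conclusion reaches every f that has a
  candidate.\<close>

lemma sheaf_glue:
  assumes F: "sheaf F" and X: "X \<in> Obj C"
    and D: "\<And>f y. \<lbrakk>f \<in> Arr C; Cod C f = X; D f y\<rbrakk> \<Longrightarrow> y \<in> sec F (Dom C f)"
    and un: "\<And>f y y'. \<lbrakk>f \<in> Arr C; Cod C f = X; D f y; D f y'\<rbrakk> \<Longrightarrow> y = y'"
    and rs: "\<And>f g y. \<lbrakk>f \<in> Arr C; Cod C f = X; g \<in> Arr C; Cod C g = Dom C f; D f y\<rbrakk> \<Longrightarrow>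
      D (Cmp C f g) (res F g y)"
    and loc: "locally X (\<lambda>f. \<exists>y. D f y)"
  shows "\<exists>s\<in>sec F X. \<forall>f y. f \<in> Arr C \<longrightarrow> Cod C f = X \<longrightarrow> D f y \<longrightarrow> res F f s = y"
proof -
  obtain S where S: "S \<in> J X" "\<forall>f\<in>S. \<exists>y. D f y" using loc by (auto simp: locally_def)
  then obtain x where x: "\<And>f. f \<in> S \<Longrightarrow> D f (x f)" by metis
  have "\<exists>!r. r \<in> sec F X \<and> (\<forall>f\<in>S. res F f r = x f)"
  proof (rule sheaf_ex1[OF F X S(1)])
    fix f assume f: "f \<in> S"
    note a = cover_arr[OF X S(1) f]
    show "x f \<in> sec F (Dom C f)" using D x[OF f] a by blast
    show "x (Cmp C f g) = res F g (x f)" if "g \<in> Arr C" "Cod C g = Dom C f" for g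
      using un[OF _ _ x[OF cover_comp[OF X S(1) f that]] rs[OF _ _ that x[OF f]]] a that
      by (simp add: Cmp_Arr Cod_Cmp)
  qed
  then obtain s where s: "s \<in> sec F X" "\<forall>f\<in>S. res F f s = x f" by blast
  have "res F f s = y" if f: "f \<in> Arr C" "Cod C f = X" "D f y" for f y
  proof (rule sheaf_sep[OF F])
    show "Dom C f \<in> Obj C" using f Dom_Obj by simp
    show "res F f s \<in> sec F (Dom C f)" using res_in[OF F] s f by auto
    show "y \<in> sec F (Dom C f)" using D f by blast
    \<comment> \<open>The arrow f need not lie in S. Pulled back along f, S covers its domain, and
      over that cover both sections restrict to the unique candidate.\<close>
    have "locally X (\<lambda>h. h \<in> S)" using S by (auto simp: locally_def)
    from locally_pull[OF this f(1,2)]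
    show "locally (Dom C f) (\<lambda>g. res F g (res F f s) = res F g y)"
    proof (rule locally_mono)
      fix g assume g: "g \<in> Arr C" "Cod C g = Dom C f" "Cmp C f g \<in> S"
      then have "res F g (res F f s) = x (Cmp C f g)"
        using res_Cmp[OF F, of f g s] s f by auto
      also have "\<dots> = res F g y"
        using un[OF _ _ x[OF g(3)] rs[OF f(1,2) g(1,2) f(3)]] f g by (simp add: Cmp_Arr Cod_Cmp)
      finally show "res F g (res F f s) = res F g y" .
    qed (use f Dom_Obj in simp)
  qed
  then show ?thesis using s by blast
qed

lemma sheaf_glue_locally:
  assumes F: "sheaf F" and X: "X \<in> Obj C"
    and D: "\<And>f y. \<lbrakk>f \<in> Arr C; Cod C f = X; D f y\<rbrakk> \<Longrightarrow> y \<in> sec F (Dom C f)"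
    and un: "\<And>f y y'. \<lbrakk>f \<in> Arr C; Cod C f = X; D f y; D f y'\<rbrakk> \<Longrightarrow> y = y'"
    and rs: "\<And>f g y. \<lbrakk>f \<in> Arr C; Cod C f = X; g \<in> Arr C; Cod C g = Dom C f; D f y\<rbrakk> \<Longrightarrow> D (Cmp C f g) (res F g y)"
    and loc: "locally X (\<lambda>f. \<exists>y. D f y)"
  obtains s where "s \<in> sec F X" "locally X (\<lambda>f. D f (res F f s))"
proof -
  have "\<exists>s\<in>sec F X. \<forall>f y. f \<in> Arr C \<longrightarrow> Cod C f = X \<longrightarrow> D f y \<longrightarrow> res F f s = y"
    by (rule sheaf_glue[OF F X]) (fact D un rs loc)+
  then obtain s where s: "s \<in> sec F X" "\<forall>f y. f \<in> Arr C \<longrightarrow> Cod C f = X \<longrightarrow> D f y \<longrightarrow> res F f s = y"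
    by blast
  show thesis by (rule that[OF s(1) locally_mono[OF loc X]]) (use s(2) in metis)
qed

section \<open>Arrows between sheaves\<close>

lemma Hom_in: "\<lbrakk>\<phi> \<in> Hom F G; X \<in> Obj C; x \<in> sec F X\<rbrakk> \<Longrightarrow> \<phi> X x \<in> sec G X"
  unfolding Hom_def by (auto simp: PiE_iff)

lemma Hom_res:
  "\<lbrakk>\<phi> \<in> Hom F G; f \<in> Arr C; x \<in> sec F (Cod C f)\<rbrakk> \<Longrightarrow>
      \<phi> (Dom C f) (res F f x) = res G f (\<phi> (Cod C f) x)"
  unfolding Hom_def by blast

text \<open>Elements of \<open>Hom\<close> are extensional, so a family given by a formula has to be
  cut down to the sections of its source before it is an arrow.\<close>

definition mk :: "('o, 'a, 'u) presheaf \<Rightarrow> ('o, 'u) family \<Rightarrow> ('o, 'u) family" where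
  "mk F k = (\<lambda>X\<in>Obj C. \<lambda>x\<in>sec F X. k X x)"

lemma mk_apply [simp]: "X \<in> Obj C \<Longrightarrow> x \<in> sec F X \<Longrightarrow> mk F k X x = k X x"
  by (simp add: mk_def)

lemma mk_Hom:
  assumes "\<And>X x. X \<in> Obj C \<Longrightarrow> x \<in> sec F X \<Longrightarrow> k X x \<in> sec G X"
    and "\<And>f x. f \<in> Arr C \<Longrightarrow> x \<in> sec F (Cod C f) \<Longrightarrow> k (Dom C f) (res F f x) = res G f (k (Cod C f) x)"
    and "sheaf F"
  shows "mk F k \<in> Hom F G"
  unfolding Hom_def mk_def using assms by (auto simp: Dom_Obj Cod_Obj res_in)

lemma Hom_eqI:
  assumes "\<phi> \<in> Hom F G" "\<psi> \<in> Hom F G'" "\<And>X x. X \<in> Obj C \<Longrightarrow> x \<in> sec F X \<Longrightarrow> \<phi> X x = \<psi> X x"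
  shows "\<phi> = \<psi>"
proof
  fix X
  show "\<phi> X = \<psi> X"
  proof (cases "X \<in> Obj C")
    case True
    then have a: "\<phi> X \<in> sec F X \<rightarrow>\<^sub>E sec G X" "\<psi> X \<in> sec F X \<rightarrow>\<^sub>E sec G' X"
      using assms(1,2) by (auto simp: Hom_def PiE_iff)
    have "\<phi> X x = \<psi> X x" if "x \<in> sec F X" for x using assms(3) True that by blast
    then show ?thesis using a by (metis PiE_arb ext)
  next
    case False
    then show ?thesis using assms by (auto simp: Hom_def PiE_iff extensional_def)
  qed
qed

lemma cmp_apply [simp]: "X \<in> Obj C \<Longrightarrow> x \<in> sec F X \<Longrightarrow> cmp F \<psi> \<phi> X x = \<psi> X (\<phi> X x)"
  by (simp add: cmp_def compose_def)

lemma idm_apply [simp]: "X \<in> Obj C \<Longrightarrow> x \<in> sec F X \<Longrightarrow> idm F X x = x"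
  by (simp add: idm_def)

lemma idm_Hom: "sheaf F \<Longrightarrow> idm F \<in> Hom F F"
  using mk_Hom[of F "\<lambda>X x. x" F] by (simp add: mk_def idm_def)

lemma cmp_Hom:
  assumes "sheaf F" "\<phi> \<in> Hom F G" "\<psi> \<in> Hom G H"
  shows "cmp F \<psi> \<phi> \<in> Hom F H"
proof -
  have "mk F (\<lambda>X x. \<psi> X (\<phi> X x)) \<in> Hom F H"
    by (rule mk_Hom) (use assms in \<open>auto simp: Hom_res[OF assms(2)] Hom_res[OF assms(3)] Cod_Obj Hom_in\<close>)
  then show ?thesis by (simp add: mk_def cmp_def compose_def)
qed

lemma cmp_idm_left: "\<lbrakk>sheaf F; \<phi> \<in> Hom F G; sheaf G\<rbrakk> \<Longrightarrow> cmp F (idm G) \<phi> = \<phi>"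
  by (rule Hom_eqI[OF cmp_Hom[OF _ _ idm_Hom]]) (auto simp: Hom_in)

lemma cmp_idm_right: "sheaf F \<Longrightarrow> \<phi> \<in> Hom F G \<Longrightarrow> cmp F \<phi> (idm F) = \<phi>"
  by (rule Hom_eqI[OF cmp_Hom[OF _ idm_Hom]]) auto

lemma cmp_assoc:
  assumes "sheaf F" "\<phi> \<in> Hom F G" "sheaf G" "\<psi> \<in> Hom G H" "\<chi> \<in> Hom H K"
  shows "cmp F \<chi> (cmp F \<psi> \<phi>) = cmp F (cmp G \<chi> \<psi>) \<phi>"
  by (rule Hom_eqI[OF cmp_Hom[OF _ cmp_Hom] cmp_Hom[OF _ _ cmp_Hom]])
    (use assms in \<open>auto simp: Hom_in\<close>)

section \<open>Descent along locally surjective maps\<close>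

definition presheaf_on :: "('o \<Rightarrow> 't set) \<Rightarrow> ('a \<Rightarrow> 't \<Rightarrow> 't) \<Rightarrow> bool" where
  "presheaf_on T r \<longleftrightarrow> (\<forall>f\<in>Arr C. \<forall>t\<in>T (Cod C f). r f t \<in> T (Dom C f)) \<and>
     (\<forall>X\<in>Obj C. \<forall>t\<in>T X. r (Idt C X) t = t) \<and>
     (\<forall>f\<in>Arr C. \<forall>g\<in>Arr C. Cod C g = Dom C f \<longrightarrow> (\<forall>t\<in>T (Cod C f). r (Cmp C f g) t = r g (r f t)))"

lemma presheaf_onD:
  assumes "presheaf_on T r"
  shows "f \<in> Arr C \<Longrightarrow> t \<in> T (Cod C f) \<Longrightarrow> r f t \<in> T (Dom C f)"
    and "X \<in> Obj C \<Longrightarrow> t \<in> T X \<Longrightarrow> r (Idt C X) t = t"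
    and "\<lbrakk>f \<in> Arr C; g \<in> Arr C; Cod C g = Dom C f; t \<in> T (Cod C f)\<rbrakk> \<Longrightarrow> r (Cmp C f g) t = r g (r f t)"
  using assms by (simp_all add: presheaf_on_def)

lemma presheaf_on_sheaf: "sheaf F \<Longrightarrow> presheaf_on (sec F) (res F)"
  by (simp add: presheaf_on_def res_in res_Idt res_Cmp)

text \<open>Serves operations of two variables, such as an action or a multiplication: they descend
  in both variables at once, from a presheaf of pairs, whose sections are not of type
  \<open>'u\<close>.\<close>

lemma presheaf_on_Times:
  "presheaf_on T r \<Longrightarrow> presheaf_on T' r' \<Longrightarrow> presheaf_on (\<lambda>X. T X \<times> T' X) (\<lambda>f. map_prod (r f) (r' f))"
  by (auto simp: presheaf_on_def)

text \<open>\<open>R X t s\<close> prescribes the value \<open>s\<close> at \<open>t\<close>; such a value has to exist only locally.\<close>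
lemma descent:
  assumes G: "sheaf G" and T: "presheaf_on T rT"
    and R: "\<And>X t s. \<lbrakk>X \<in> Obj C; t \<in> T X; R X t s\<rbrakk> \<Longrightarrow> s \<in> sec G X"
    and un: "\<And>X t s s'. \<lbrakk>X \<in> Obj C; t \<in> T X; R X t s; R X t s'\<rbrakk> \<Longrightarrow> s = s'"
    and nat: "\<And>f t s. \<lbrakk>f \<in> Arr C; t \<in> T (Cod C f); R (Cod C f) t s\<rbrakk> \<Longrightarrow> R (Dom C f) (rT f t) (res G f s)"
    and loc: "\<And>X t. \<lbrakk>X \<in> Obj C; t \<in> T X\<rbrakk> \<Longrightarrow> locally X (\<lambda>f. \<exists>s. R (Dom C f) (rT f t) s)"
  obtains k where "\<And>X t. \<lbrakk>X \<in> Obj C; t \<in> T X\<rbrakk> \<Longrightarrow> k X t \<in> sec G X"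
    and "\<And>X t s. \<lbrakk>X \<in> Obj C; t \<in> T X; R X t s\<rbrakk> \<Longrightarrow> k X t = s"
    and "\<And>f t. \<lbrakk>f \<in> Arr C; t \<in> T (Cod C f)\<rbrakk> \<Longrightarrow> k (Dom C f) (rT f t) = res G f (k (Cod C f) t)"
proof -
  note T = presheaf_onD[OF T]
  have "\<exists>s\<in>sec G X. \<forall>f y. f \<in> Arr C \<longrightarrow> Cod C f = X \<longrightarrow> R (Dom C f) (rT f t) y \<longrightarrow> res G f s = y"
    if X: "X \<in> Obj C" and t: "t \<in> T X" for X t
  proof (rule sheaf_glue[OF G X])
    show "locally X (\<lambda>f. \<exists>y. R (Dom C f) (rT f t) y)" by (rule loc[OF X t])
  next
    fix f y assume f: "f \<in> Arr C" "Cod C f = X" and y: "R (Dom C f) (rT f t) y"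
    have t': "rT f t \<in> T (Dom C f)" using T(1) f t by blast
    show "y \<in> sec G (Dom C f)" using R[OF Dom_Obj t' y] f by blast
    show "y = y'" if "R (Dom C f) (rT f t) y'" for y' using un[OF Dom_Obj t' y that] f by blast
    fix g assume g: "g \<in> Arr C" "Cod C g = Dom C f"
    show "R (Dom C (Cmp C f g)) (rT (Cmp C f g) t) (res G g y)"
      using nat[OF g(1), of "rT f t" y] t' y f g t T(3) by (simp add: Dom_Cmp)
  qed
  then obtain k where k: "\<And>X t. X \<in> Obj C \<Longrightarrow> t \<in> T X \<Longrightarrow> k X t \<in> sec G X"
    "\<And>f t y. \<lbrakk>f \<in> Arr C; t \<in> T (Cod C f); R (Dom C f) (rT f t) y\<rbrakk> \<Longrightarrow> res G f (k (Cod C f) t) = y"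
    using Cod_Obj by metis
  show ?thesis
  proof (rule that)
    show k1: "k X t \<in> sec G X" if "X \<in> Obj C" "t \<in> T X" for X t using k that by blast
    show "k X t = s" if "X \<in> Obj C" "t \<in> T X" "R X t s" for X t s
      using k(2)[OF Idt_Arr[OF that(1)], of t s] that k1 res_Idt[OF G] by (simp add: Dom_Idt Cod_Idt T(2))
    fix f t assume f: "f \<in> Arr C" and t: "t \<in> T (Cod C f)"
    \<comment> \<open>Neither side need be a prescribed value. On the cover where \<open>R\<close>
      prescribes one, both restrict to it.\<close>
    show "k (Dom C f) (rT f t) = res G f (k (Cod C f) t)"
    proof (rule sheaf_sep[OF G Dom_Obj[OF f]])
      show "k (Dom C f) (rT f t) \<in> sec G (Dom C f)" by (rule k1[OF Dom_Obj[OF f] T(1)[OF f t]])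
      show "res G f (k (Cod C f) t) \<in> sec G (Dom C f)" by (rule res_in[OF G f k1[OF Cod_Obj[OF f] t]])
      show "locally (Dom C f) (\<lambda>g. res G g (k (Dom C f) (rT f t)) = res G g (res G f (k (Cod C f) t)))"
      proof (rule locally_mono[OF loc[OF Dom_Obj[OF f] T(1)[OF f t]] Dom_Obj[OF f]])
        fix g assume g: "g \<in> Arr C" "Cod C g = Dom C f" "\<exists>s. R (Dom C g) (rT g (rT f t)) s"
        then obtain s where s: "R (Dom C g) (rT g (rT f t)) s" by blast
        have "res G g (k (Dom C f) (rT f t)) = s"
          using k(2)[OF g(1), of "rT f t" s] T(1)[OF f t] g s by simp
        moreover have "res G (Cmp C f g) (k (Cod C f) t) = s"
          using k(2)[of "Cmp C f g" t s] f t g s T(3)[OF f g(1,2) t] by (simp add: Cmp_Arr Cod_Cmp Dom_Cmp)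
        ultimately show "res G g (k (Dom C f) (rT f t)) = res G g (res G f (k (Cod C f) t))"
          using res_Cmp[OF G f g(1,2) k1[OF Cod_Obj[OF f] t]] by simp
      qed
    qed
  qed
qed

text \<open>Here \<open>q\<close> exhibits T as a quotient of E in the sense of sheaves, since it is
  surjective only locally. The value prescribed at \<open>q X e\<close> is \<open>h X e\<close>, and
  constancy of h on the fibres of q makes the prescription unique. The family E supplies the
  representatives; it is typically a total space or a set of pairs.\<close>

lemma quotient_descent:
  assumes G: "sheaf G" and T: "presheaf_on T rT"
    and E: "\<And>f e. \<lbrakk>f \<in> Arr C; e \<in> E (Cod C f)\<rbrakk> \<Longrightarrow> rE f e \<in> E (Dom C f) \<and>
      rT f (q (Cod C f) e) = q (Dom C f) (rE f e) \<and> res G f (h (Cod C f) e) = h (Dom C f) (rE f e)"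
    and q: "\<And>X e. \<lbrakk>X \<in> Obj C; e \<in> E X\<rbrakk> \<Longrightarrow> q X e \<in> T X"
    and loc: "\<And>X t. \<lbrakk>X \<in> Obj C; t \<in> T X\<rbrakk> \<Longrightarrow> locally X (\<lambda>f. \<exists>e\<in>E (Dom C f). q (Dom C f) e = rT f t)"
    and h: "\<And>X e. \<lbrakk>X \<in> Obj C; e \<in> E X\<rbrakk> \<Longrightarrow> h X e \<in> sec G X"
    and eq: "\<And>X e e'. \<lbrakk>X \<in> Obj C; e \<in> E X; e' \<in> E X; q X e = q X e'\<rbrakk> \<Longrightarrow> h X e = h X e'"
  obtains k where "\<And>X t. \<lbrakk>X \<in> Obj C; t \<in> T X\<rbrakk> \<Longrightarrow> k X t \<in> sec G X"
    and "\<And>X e. \<lbrakk>X \<in> Obj C; e \<in> E X\<rbrakk> \<Longrightarrow> k X (q X e) = h X e"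
    and "\<And>f t. \<lbrakk>f \<in> Arr C; t \<in> T (Cod C f)\<rbrakk> \<Longrightarrow> k (Dom C f) (rT f t) = res G f (k (Cod C f) t)"
proof -
  show thesis
  proof (rule descent[OF G T, of "\<lambda>X t s. \<exists>e\<in>E X. q X e = t \<and> s = h X e"], goal_cases)
    case (1 X t s)
    then show ?case using h by blast
  next
    case (2 X t s s')
    then obtain e e' where "e \<in> E X" "q X e = t" "s = h X e" "e' \<in> E X" "q X e' = t" "s' = h X e'" by blast
    then show ?case using eq[OF 2(1), of e e'] by simp
  next
    case (3 f t s)
    then obtain e where e: "e \<in> E (Cod C f)" "q (Cod C f) e = t" "s = h (Cod C f) e" by blast
    show ?case by (rule bexI[of _ "rE f e"]) (use E[OF 3(1) e(1)] e in auto)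
  next
    case (4 X t)
    show ?case by (rule locally_mono[OF loc[OF 4]]) (use 4 in blast)+
  next
    case (5 k)
    show ?case by (rule that[of k]) (use 5 q in blast)+
  qed
qed

text \<open>Moves a sheaf whose sections have another type (pairs, families of classes) into the
  type \<open>'u\<close> of the topos. A coding is chosen over each object separately and
  restriction is transported through it; the images are small since \<V> is closed under passing to
  smaller sets.\<close>

lemma represent:
  fixes E :: "'o \<Rightarrow> 't set" and r :: "'a \<Rightarrow> 't \<Rightarrow> 't"
  assumes ps: "presheaf_on E r"
    and sep: "\<And>X t t'. \<lbrakk>X \<in> Obj C; t \<in> E X; t' \<in> E X; locally X (\<lambda>f. r f t = r f t')\<rbrakk> \<Longrightarrow> t = t'"
    and glue: "\<And>X S x. \<lbrakk>X \<in> Obj C; S \<in> J X; (\<And>f. f \<in> S \<Longrightarrow> x f \<in> E (Dom C f)); (\<And>f g. f \<in> S \<Longrightarrow> g \<in> Arr C \<Longrightarrow> Cod C g = Dom C f \<Longrightarrow> x (Cmp C f g) = r g (x f))\<rbrakk> \<Longrightarrow>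
      \<exists>t\<in>E X. \<forall>f\<in>S. r f t = x f"
    and small: "\<And>X. X \<in> Obj C \<Longrightarrow> \<exists>i :: 't \<Rightarrow> 'u. \<exists>B\<in>\<V>. inj_on i (E X) \<and> i ` E X \<subseteq> B"
  obtains F :: "('o, 'a, 'u) presheaf" and c where "sheaf F"
    and "\<And>X. X \<in> Obj C \<Longrightarrow> bij_betw (c X) (E X) (sec F X)"
    and "\<And>f t. f \<in> Arr C \<Longrightarrow> t \<in> E (Cod C f) \<Longrightarrow> res F f (c (Cod C f) t) = c (Dom C f) (r f t)"
proof -
  note r_in = presheaf_onD(1)[OF ps] and r_Idt = presheaf_onD(2)[OF ps] and r_Cmp = presheaf_onD(3)[OF ps]
  obtain c :: "'o \<Rightarrow> 't \<Rightarrow> 'u" and B where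
    c: "\<And>X. X \<in> Obj C \<Longrightarrow> inj_on (c X) (E X)" "\<And>X. X \<in> Obj C \<Longrightarrow> c X ` E X \<subseteq> B X" "\<And>X. X \<in> Obj C \<Longrightarrow> B X \<in> \<V>"
    using small by metis
  define d where "d X = inv_into (E X) (c X)" for X
  define F :: "('o, 'a, 'u) presheaf" where
    "F = \<lparr>sec = (\<lambda>X. c X ` E X), res = (\<lambda>f u. c (Dom C f) (r f (d (Cod C f) u)))\<rparr>"
  have dc: "d X (c X t) = t" if "X \<in> Obj C" "t \<in> E X" for X t
    using c(1) that by (simp add: d_def)
  have sF: "sec F X = c X ` E X" for X by (simp add: F_def)
  have rF: "res F f (c (Cod C f) t) = c (Dom C f) (r f t)" if "f \<in> Arr C" "t \<in> E (Cod C f)" for f t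
    using that by (simp add: F_def dc Cod_Obj)
  have d_in: "d X u \<in> E X \<and> c X (d X u) = u" if "X \<in> Obj C" "u \<in> sec F X" for X u
    using that by (auto simp: sF dc)
  have "sheaf F"
    unfolding sheaf_def
  proof (intro conjI ballI allI impI)
    show "presheaf F"
      unfolding presheaf_def
    proof (intro conjI ballI impI Pi_I)
      show "res F f x \<in> sec F (Dom C f)" if "f \<in> Arr C" "x \<in> sec F (Cod C f)" for f x
        using that by (auto simp: sF rF r_in)
      show "res F (Idt C X) x = x" if X: "X \<in> Obj C" and x: "x \<in> sec F X" for X x
        using x rF[OF Idt_Arr[OF X]] X by (auto simp: sF Cod_Idt Dom_Idt r_Idt)
      show "res F (Cmp C f g) x = res F g (res F f x)"
        if f: "f \<in> Arr C" and g: "g \<in> Arr C" "Cod C g = Dom C f" and x: "x \<in> sec F (Cod C f)" for f g x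
      proof -
        obtain t where t: "t \<in> E (Cod C f)" "x = c (Cod C f) t" using x by (auto simp: sF)
        have "res F (Cmp C f g) x = c (Dom C g) (r g (r f t))"
          using rF[OF Cmp_Arr[OF g(1) f g(2)[symmetric]], of t] t f g by (simp add: Cod_Cmp Dom_Cmp r_Cmp)
        also have "\<dots> = res F g (c (Dom C f) (r f t))"
          using rF[OF g(1), of "r f t"] r_in[OF f t(1)] g(2) by simp
        finally show ?thesis using rF[OF f t(1)] t(2) by simp
      qed
    qed
    show "sec F X \<in> \<V>" if X: "X \<in> Obj C" for X
      using small_le[OF c(3)[OF X], of id] c(2)[OF X] by (simp add: sF)
    fix X S x assume X: "X \<in> Obj C" and S: "S \<in> J X"
      and x: "(\<forall>f\<in>S. x f \<in> sec F (Dom C f)) \<and>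
        (\<forall>f\<in>S. \<forall>g\<in>Arr C. Cod C g = Dom C f \<longrightarrow> x (Cmp C f g) = res F g (x f))"
    define y where "y f = d (Dom C f) (x f)" for f
    have y: "y f \<in> E (Dom C f)" "x f = c (Dom C f) (y f)" if "f \<in> S" for f
      using d_in[of "Dom C f" "x f"] x that cover_arr[OF X S that] Dom_Obj by (auto simp: y_def)
    have "\<exists>t\<in>E X. \<forall>f\<in>S. r f t = y f"
    proof (rule glue[OF X S])
      fix f assume f: "f \<in> S"
      show "y f \<in> E (Dom C f)" using y f by blast
      fix g assume g: "g \<in> Arr C" "Cod C g = Dom C f"
      note fa = cover_arr[OF X S f]
      have "x (Cmp C f g) = c (Dom C g) (r g (y f))"
        using x f g y[OF f] rF[of g "y f"] by simp
      moreover have "r g (y f) \<in> E (Dom C g)" using r_in g y[OF f] by simp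
      ultimately show "y (Cmp C f g) = r g (y f)"
        using fa g by (simp add: y_def Dom_Cmp dc Dom_Obj)
    qed
    then obtain t where t: "t \<in> E X" "\<And>f. f \<in> S \<Longrightarrow> r f t = y f" by blast
    show "\<exists>!s. s \<in> sec F X \<and> (\<forall>f\<in>S. res F f s = x f)"
    proof (rule ex1I[of _ "c X t"])
      have "res F f (c X t) = x f" if f: "f \<in> S" for f
        using rF[of f t] t cover_arr[OF X S f] y[OF f] f by auto
      then show "c X t \<in> sec F X \<and> (\<forall>f\<in>S. res F f (c X t) = x f)"
        using t by (auto simp: sF)
      fix s assume s: "s \<in> sec F X \<and> (\<forall>f\<in>S. res F f s = x f)"
      then obtain t' where t': "s = c X t'" "t' \<in> E X" by (auto simp: sF)
      have "r f t' = r f t" if f: "f \<in> S" for f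
      proof -
        note fa = cover_arr[OF X S f]
        have "c (Dom C f) (r f t') = c (Dom C f) (r f t)"
          using s t t' f fa y rF[of f t'] by auto
        then show ?thesis
          using c(1)[OF Dom_Obj, of f] fa r_in[of f t] r_in[of f t'] t t' by (auto simp: inj_on_def)
      qed
      then have "t' = t" using sep[OF X t'(2) t(1)] S by (auto simp: locally_def)
      then show "s = c X t" using t' by simp
    qed
  qed
  then show ?thesis
    by (rule that) (use c(1) rF in \<open>auto simp: bij_betw_def sF\<close>)
qed

text \<open>More general than its name: the subobject of the product of U and V cut out by R, with
  projections p, q and pairing c. With R true it is the product; with R forcing the second
  coordinate to be a unit it yields the trivial torsor and the sheaf of sections with invertible
  value.\<close>

definition fibre_product ::
  "('o, 'a, 'u) presheaf \<Rightarrow> ('o, 'a, 'u) presheaf \<Rightarrow> ('o \<Rightarrow> 'u \<Rightarrow> 'u \<Rightarrow> bool) \<Rightarrow>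
   ('o, 'a, 'u) presheaf \<times> ('o, 'u) family \<times> ('o, 'u) family \<times> ('o \<Rightarrow> 'u \<Rightarrow> 'u \<Rightarrow> 'u) \<Rightarrow> bool" where
  "fibre_product U V R = (\<lambda>(F, p, q, c). sheaf F \<and> p \<in> Hom F U \<and> q \<in> Hom F V \<and>
     (\<forall>X\<in>Obj C. \<forall>x\<in>sec U X. \<forall>y\<in>sec V X. R X x y \<longrightarrow>
        c X x y \<in> sec F X \<and> p X (c X x y) = x \<and> q X (c X x y) = y) \<and>
     (\<forall>X\<in>Obj C. \<forall>z\<in>sec F X. R X (p X z) (q X z) \<and> c X (p X z) (q X z) = z))"

text \<open>Stability of R under restriction makes the related pairs a presheaf. Sections are glued
  coordinate by coordinate, and locality of R says that the glued pair is related again.\<close>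

lemma fibre_product_exists:
  assumes U: "sheaf U" and V: "sheaf V"
    and R: "\<And>f x y. \<lbrakk>f \<in> Arr C; x \<in> sec U (Cod C f); y \<in> sec V (Cod C f); R (Cod C f) x y\<rbrakk> \<Longrightarrow>
      R (Dom C f) (res U f x) (res V f y)"
    and loc: "\<And>X x y. \<lbrakk>X \<in> Obj C; x \<in> sec U X; y \<in> sec V X; locally X (\<lambda>f. R (Dom C f) (res U f x) (res V f y))\<rbrakk> \<Longrightarrow>
      R X x y"
  shows "\<exists>W. fibre_product U V R W"
proof -
  define E where "E X = {z \<in> sec U X \<times> sec V X. R X (fst z) (snd z)}" for X
  define r where "r f = map_prod (res U f) (res V f)" for f
  obtain F c where F: "sheaf F" and bij: "\<And>X. X \<in> Obj C \<Longrightarrow> bij_betw (c X) (E X) (sec F X)"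
    and rF: "\<And>f t. f \<in> Arr C \<Longrightarrow> t \<in> E (Cod C f) \<Longrightarrow> res F f (c (Cod C f) t) = c (Dom C f) (r f t)"
  proof (rule represent[of E r])
    show "presheaf_on E r"
      unfolding presheaf_on_def E_def r_def using R res_in[OF U] res_in[OF V]
      by (auto simp: res_Idt[OF U] res_Idt[OF V] res_Cmp[OF U] res_Cmp[OF V])
    show "\<exists>i :: 'u \<times> 'u \<Rightarrow> 'u. \<exists>B\<in>\<V>. inj_on i (E X) \<and> i ` E X \<subseteq> B" if X: "X \<in> Obj C" for X
    proof -
      obtain e :: "'u \<times> 'u \<Rightarrow> 'u" where "inj_on e (sec U X \<times> sec V X)" "e ` (sec U X \<times> sec V X) \<in> \<V>"
        using small_Times sheaf_small[OF U X] sheaf_small[OF V X] by blast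
      moreover have "E X \<subseteq> sec U X \<times> sec V X" by (auto simp: E_def)
      ultimately show ?thesis by (meson image_mono inj_on_subset)
    qed
    show "t = t'" if X: "X \<in> Obj C" and t: "t \<in> E X" "t' \<in> E X" and l: "locally X (\<lambda>f. r f t = r f t')" for X t t'
    proof (rule prod_eqI)
      have "locally X (\<lambda>f. res U f (fst t) = res U f (fst t'))"
        by (rule locally_mono[OF l X]) (metis r_def fst_map_prod)
      then show "fst t = fst t'" using sheaf_sep[OF U X] t by (auto simp: E_def)
      have "locally X (\<lambda>f. res V f (snd t) = res V f (snd t'))"
        by (rule locally_mono[OF l X]) (metis r_def snd_map_prod)
      then show "snd t = snd t'" using sheaf_sep[OF V X] t by (auto simp: E_def)
    qed
    show "\<exists>t\<in>E X. \<forall>f\<in>S. r f t = x f" if X: "X \<in> Obj C" and S: "S \<in> J X" and x: "\<And>f. f \<in> S \<Longrightarrow> x f \<in> E (Dom C f)"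
      and xc: "\<And>f g. \<lbrakk>f \<in> S; g \<in> Arr C; Cod C g = Dom C f\<rbrakk> \<Longrightarrow> x (Cmp C f g) = r g (x f)" for X S x
    proof -
      have x': "fst (x f) \<in> sec U (Dom C f)" "snd (x f) \<in> sec V (Dom C f)" "R (Dom C f) (fst (x f)) (snd (x f))" if "f \<in> S" for f
        using x[OF that] by (auto simp: E_def)
      have "\<exists>!s. s \<in> sec U X \<and> (\<forall>f\<in>S. res U f s = fst (x f))"
        by (rule sheaf_ex1[OF U X S]) (use x' xc in \<open>auto simp: r_def\<close>)
      then obtain s where s: "s \<in> sec U X" "\<And>f. f \<in> S \<Longrightarrow> res U f s = fst (x f)" by blast
      have "\<exists>!s. s \<in> sec V X \<and> (\<forall>f\<in>S. res V f s = snd (x f))"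
        by (rule sheaf_ex1[OF V X S]) (use x' xc in \<open>auto simp: r_def\<close>)
      then obtain t where t: "t \<in> sec V X" "\<And>f. f \<in> S \<Longrightarrow> res V f t = snd (x f)" by blast
      have "R X s t"
        by (rule loc[OF X s(1) t(1)]) (use S x' s(2) t(2) in \<open>auto simp: locally_def intro!: bexI[of _ S]\<close>)
      then show ?thesis using s t by (intro bexI[of _ "(s, t)"]) (auto simp: E_def r_def)
    qed
  qed blast
  define d where "d X = inv_into (E X) (c X)" for X
  have cd: "d X z \<in> E X" "c X (d X z) = z" if "X \<in> Obj C" "z \<in> sec F X" for X z
    using bij[OF that(1)] that(2) unfolding d_def bij_betw_def by (auto simp: inv_into_into f_inv_into_f)
  have dc: "d X (c X t) = t" "c X t \<in> sec F X" if "X \<in> Obj C" "t \<in> E X" for X t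
    using bij[OF that(1)] that(2) unfolding d_def bij_betw_def by auto
  have dr: "d (Dom C f) (res F f z) = r f (d (Cod C f) z)" if f: "f \<in> Arr C" and z: "z \<in> sec F (Cod C f)" for f z
  proof -
    note a = cd[OF Cod_Obj[OF f] z]
    have "res F f z = c (Dom C f) (r f (d (Cod C f) z))" using rF[OF f a(1)] a(2) by simp
    moreover have "r f (d (Cod C f) z) \<in> E (Dom C f)"
      using a(1) f R res_in[OF U] res_in[OF V] by (auto simp: E_def r_def)
    ultimately show ?thesis using dc[OF Dom_Obj[OF f]] by simp
  qed
  have "fibre_product U V R (F, mk F (\<lambda>X z. fst (d X z)), mk F (\<lambda>X z. snd (d X z)), \<lambda>X x y. c X (x, y))"
    unfolding fibre_product_def split_conv
  proof (intro conjI ballI impI)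
    show "mk F (\<lambda>X z. fst (d X z)) \<in> Hom F U" "mk F (\<lambda>X z. snd (d X z)) \<in> Hom F V"
      using cd(1) by (auto intro!: mk_Hom F simp: dr r_def E_def mem_Times_iff)
  next
    fix X x y assume X: "X \<in> Obj C" "x \<in> sec U X" "y \<in> sec V X" "R X x y"
    then have "(x, y) \<in> E X" by (simp add: E_def)
    from dc[OF X(1) this] X show "c X (x, y) \<in> sec F X" "mk F (\<lambda>X z. fst (d X z)) X (c X (x, y)) = x"
      "mk F (\<lambda>X z. snd (d X z)) X (c X (x, y)) = y" by auto
  next
    fix X z assume X: "X \<in> Obj C" "z \<in> sec F X"
    from cd[OF X] X show "R X (mk F (\<lambda>X z. fst (d X z)) X z) (mk F (\<lambda>X z. snd (d X z)) X z)"
      "c X (mk F (\<lambda>X z. fst (d X z)) X z, mk F (\<lambda>X z. snd (d X z)) X z) = z"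
      by (auto simp: E_def)
  qed (rule F)
  then show ?thesis by blast
qed

text \<open>
  Locality of the equivalence relation makes the quotient presheaf separated, so that a single plus
  construction suffices: a section over \<open>X\<close> is a family of classes over a covering sieve of \<open>X\<close> that
  is defined on every arrow where it can be. Since it picks at most one class for each arrow, the
  sections form a small set.
\<close>
lemma quotient_sheaf:
  fixes E :: "'o \<Rightarrow> 'e set" and r :: "'a \<Rightarrow> 'e \<Rightarrow> 'e" and eq :: "'o \<Rightarrow> 'e \<Rightarrow> 'e \<Rightarrow> bool"
  assumes ps: "presheaf_on E r"
    and eq_refl: "\<And>X e. X \<in> Obj C \<Longrightarrow> e \<in> E X \<Longrightarrow> eq X e e"
    and eq_sym: "\<And>X e e'. \<lbrakk>X \<in> Obj C; e \<in> E X; e' \<in> E X; eq X e e'\<rbrakk> \<Longrightarrow> eq X e' e"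
    and eq_trans: "\<And>X e e' e''. \<lbrakk>X \<in> Obj C; e \<in> E X; e' \<in> E X; e'' \<in> E X; eq X e e'; eq X e' e''\<rbrakk> \<Longrightarrow> eq X e e''"
    and eq_res: "\<And>f e e'. \<lbrakk>f \<in> Arr C; e \<in> E (Cod C f); e' \<in> E (Cod C f); eq (Cod C f) e e'\<rbrakk> \<Longrightarrow>
      eq (Dom C f) (r f e) (r f e')"
    and eq_loc: "\<And>X e e'. \<lbrakk>X \<in> Obj C; e \<in> E X; e' \<in> E X; locally X (\<lambda>f. eq (Dom C f) (r f e) (r f e'))\<rbrakk> \<Longrightarrow>
      eq X e e'"
    and small: "\<And>X. X \<in> Obj C \<Longrightarrow> \<exists>i :: 'e \<Rightarrow> 'u. \<exists>B\<in>\<V>. inj_on i (E X) \<and> i ` E X \<subseteq> B"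
  obtains F :: "('o, 'a, 'u) presheaf" and q where "sheaf F"
    and "\<And>X e. X \<in> Obj C \<Longrightarrow> e \<in> E X \<Longrightarrow> q X e \<in> sec F X"
    and "\<And>f e. f \<in> Arr C \<Longrightarrow> e \<in> E (Cod C f) \<Longrightarrow> res F f (q (Cod C f) e) = q (Dom C f) (r f e)"
    and "\<And>X e e'. \<lbrakk>X \<in> Obj C; e \<in> E X; e' \<in> E X\<rbrakk> \<Longrightarrow> q X e = q X e' \<longleftrightarrow> eq X e e'"
    and "\<And>X t. X \<in> Obj C \<Longrightarrow> t \<in> sec F X \<Longrightarrow> locally X (\<lambda>f. \<exists>e\<in>E (Dom C f). q (Dom C f) e = res F f t)"
proof -
  note r_in = presheaf_onD(1)[OF ps] and r_Idt = presheaf_onD(2)[OF ps] and r_Cmp = presheaf_onD(3)[OF ps]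
  define into where "into f X \<longleftrightarrow> f \<in> Arr C \<and> Cod C f = X" for f X
  define cl where "cl X e = {e' \<in> E X. eq X e e'}" for X e
  \<comment> \<open>In the order of the conjuncts: T lives on arrows into X; a nonempty
    \<open>T f\<close> is a single class; T is stable under restriction; a class that belongs to T
    locally belongs to T; T is nonempty on a cover. The fourth condition makes the domain of T as
    large as possible, so that a section of the quotient has only one T.\<close>
  define Q where "Q X = {T. (\<forall>f. \<not> into f X \<longrightarrow> T f = {}) \<and>
      (\<forall>f. \<forall>e\<in>T f. e \<in> E (Dom C f) \<and> T f = cl (Dom C f) e) \<and>
      (\<forall>f. \<forall>e\<in>T f. \<forall>g. into g (Dom C f) \<longrightarrow> r g e \<in> T (Cmp C f g)) \<and>
      (\<forall>f. into f X \<longrightarrow> (\<forall>e\<in>E (Dom C f). locally (Dom C f) (\<lambda>g. r g e \<in> T (Cmp C f g)) \<longrightarrow> e \<in> T f)) \<and>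
      locally X (\<lambda>f. T f \<noteq> {})}" for X
  define rQ where "rQ f T = (\<lambda>g. if into g (Dom C f) then T (Cmp C f g) else {})" for f and T :: "'a \<Rightarrow> 'e set"
  define qQ where "qQ X e = (\<lambda>f. if into f X then cl (Dom C f) (r f e) else {})" for X e
  have into_D: "f \<in> Arr C" "Cod C f = X" "Dom C f \<in> Obj C" "X \<in> Obj C" if "into f X" for f X
    using that by (auto simp: into_def Dom_Obj Cod_Obj)
  have into_Cmp: "into (Cmp C f g) X" "Dom C (Cmp C f g) = Dom C g" if "into f X" "into g (Dom C f)" for f g X
    using that by (auto simp: into_def Cmp_Arr Cod_Cmp Dom_Cmp)
  have cl_eq: "cl X e = cl X e' \<longleftrightarrow> eq X e e'" if "X \<in> Obj C" "e \<in> E X" "e' \<in> E X" for X e e'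
    unfolding cl_def using that eq_refl[OF that(1)] eq_sym[OF that(1)] eq_trans[OF that(1)] by blast
  have rEi: "r f e \<in> E (Dom C f)" if "into f X" "e \<in> E X" for f e X
    using r_in that by (auto simp: into_def)
  have rC: "r (Cmp C f g) e = r g (r f e)" if "into f X" "into g (Dom C f)" "e \<in> E X" for f g e X
    using r_Cmp that by (auto simp: into_def)
  have CA: "Cmp C (Cmp C f g) h = Cmp C f (Cmp C g h)" if "into f X" "into g (Dom C f)" "into h (Dom C g)" for f g h X
    using Cmp_assoc that by (auto simp: into_def)
  have intoI: "into (Idt C X) X" if "X \<in> Obj C" for X using that by (simp add: into_def Idt_Arr Cod_Idt)
  have QI: "T \<in> Q X"
    if 1: "\<And>f. \<not> into f X \<Longrightarrow> T f = {}" and 2: "\<And>f e. into f X \<Longrightarrow> e \<in> T f \<Longrightarrow> e \<in> E (Dom C f)"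
      and 3: "\<And>f e e'. \<lbrakk>into f X; e \<in> T f; e' \<in> E (Dom C f)\<rbrakk> \<Longrightarrow>
      e' \<in> T f \<longleftrightarrow> eq (Dom C f) e e'"
      and 4: "\<And>f e g. \<lbrakk>into f X; e \<in> T f; into g (Dom C f)\<rbrakk> \<Longrightarrow> r g e \<in> T (Cmp C f g)"
      and 5: "\<And>f e. \<lbrakk>into f X; e \<in> E (Dom C f); locally (Dom C f) (\<lambda>g. r g e \<in> T (Cmp C f g))\<rbrakk> \<Longrightarrow>
      e \<in> T f"
      and 6: "locally X (\<lambda>f. T f \<noteq> {})" for T X
    unfolding Q_def mem_Collect_eq
  proof (intro conjI allI ballI impI)
    fix f e assume e: "e \<in> T f"
    then have f: "into f X" using 1 by blast
    show "e \<in> E (Dom C f)" using 2[OF f e] .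
    show "T f = cl (Dom C f) e" using 2[OF f] 3[OF f e] unfolding cl_def by blast
    show "r g e \<in> T (Cmp C f g)" if "into g (Dom C f)" for g using 4[OF f e that] .
  qed (use 1 5 6 in simp_all)
  have Q_into: "into f X" if "T \<in> Q X" "e \<in> T f" for T X e f
    using that unfolding Q_def by blast
  have Q_E: "e \<in> E (Dom C f)" "T f = cl (Dom C f) e" if "T \<in> Q X" "e \<in> T f" for T X e f
    using that unfolding Q_def by blast+
  have Q_out: "T f = {}" if "T \<in> Q X" "\<not> into f X" for T X f
    using that unfolding Q_def by blast
  have Q_r: "r g e \<in> T (Cmp C f g)" if "T \<in> Q X" "e \<in> T f" "into g (Dom C f)" for T X e f g
    using that unfolding Q_def by blast
  have Q_loc: "e \<in> T f" if "T \<in> Q X" "into f X" "e \<in> E (Dom C f)" "locally (Dom C f) (\<lambda>g. r g e \<in> T (Cmp C f g))" for T X e f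
    using that unfolding Q_def by blast
  have Q_cov: "locally X (\<lambda>f. T f \<noteq> {})" if "T \<in> Q X" for T X
    using that unfolding Q_def by blast
  have Q_sub: "T f \<subseteq> T' f" if X: "X \<in> Obj C" and T: "T \<in> Q X" "T' \<in> Q X" and l: "locally X (\<lambda>f. rQ f T = rQ f T')" for X T T' f
  proof
    fix e assume e: "e \<in> T f"
    note f = Q_into[OF T(1) e]
    show "e \<in> T' f"
    proof (rule Q_loc[OF T(2) f Q_E(1)[OF T(1) e]], rule locally_mono[OF locally_pull[OF l into_D(1,2)[OF f]] into_D(3)[OF f]])
      fix g assume g: "g \<in> Arr C" "Cod C g = Dom C f" and eq: "rQ (Cmp C f g) T = rQ (Cmp C f g) T'"
      then have g': "into g (Dom C f)" by (simp add: into_def)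
      \<comment> \<open>The value of a restriction at an identity is the value of the family at the
        arrow itself; so equal restrictions mean equal values.\<close>
      have "rQ (Cmp C f g) T'' (Idt C (Dom C g)) = T'' (Cmp C f g)" for T''
        using intoI[OF into_D(3)[OF g']] into_Cmp[OF f g'] Cmp_Idt_right[of "Cmp C f g"] by (simp add: rQ_def into_def)
      then have "T (Cmp C f g) = T' (Cmp C f g)" using eq by metis
      then show "r g e \<in> T' (Cmp C f g)" using Q_r[OF T(1) e g'] by simp
    qed
  qed
  obtain F c where F: "sheaf F" and bij: "\<And>X. X \<in> Obj C \<Longrightarrow> bij_betw (c X) (Q X) (sec F X)"
    and rF: "\<And>f t. f \<in> Arr C \<Longrightarrow> t \<in> Q (Cod C f) \<Longrightarrow> res F f (c (Cod C f) t) = c (Dom C f) (rQ f t)"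
  proof (rule represent[of Q rQ])
    have "rQ f T \<in> Q (Dom C f)" if f: "f \<in> Arr C" and T: "T \<in> Q (Cod C f)" for f T
    proof -
      have fi: "into f (Cod C f)" using f by (simp add: into_def)
      show ?thesis
      proof (rule QI)
        fix g assume g: "into g (Dom C f)"
        note fg = into_Cmp[OF fi g]
        have rg: "rQ f T g = T (Cmp C f g)" using g by (simp add: rQ_def)
        have rh: "rQ f T (Cmp C g h) = T (Cmp C (Cmp C f g) h)" if "into h (Dom C g)" for h
          using into_Cmp[OF g that] CA[OF fi g that] by (simp add: rQ_def)
        { fix e assume e: "e \<in> rQ f T g"
          show "e \<in> E (Dom C g)" using Q_E[OF T] e fg unfolding rg by metis
          show "e' \<in> rQ f T g \<longleftrightarrow> eq (Dom C g) e e'" if "e' \<in> E (Dom C g)" for e'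
            using Q_E(2)[OF T e[unfolded rg]] that unfolding rg fg(2) by (auto simp: cl_def)
          show "r h e \<in> rQ f T (Cmp C g h)" if "into h (Dom C g)" for h
            using Q_r[OF T] e fg that unfolding rg rh[OF that] by metis }
        fix e assume e: "e \<in> E (Dom C g)" and l: "locally (Dom C g) (\<lambda>h. r h e \<in> rQ f T (Cmp C g h))"
        have "locally (Dom C g) (\<lambda>h. r h e \<in> T (Cmp C (Cmp C f g) h))"
          by (rule locally_mono[OF l into_D(3)[OF g]]) (use rh in \<open>auto simp: into_def\<close>)
        then show "e \<in> rQ f T g" using Q_loc[OF T fg(1)] e unfolding rg fg by blast
      next
        show "locally (Dom C f) (\<lambda>g. rQ f T g \<noteq> {})"
          by (rule locally_mono[OF locally_pull[OF Q_cov[OF T] f refl] Dom_Obj[OF f]]) (auto simp: rQ_def into_def)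
      qed (simp add: rQ_def)
    qed
    moreover have "rQ (Idt C X) T = T" if X: "X \<in> Obj C" and T: "T \<in> Q X" for X T
      using Q_out[OF T] X by (auto simp: rQ_def fun_eq_iff Dom_Idt into_def intro: Cmp_Idt_left)
        (metis Cmp_Idt_left)+
    moreover have "rQ (Cmp C f g) T = rQ g (rQ f T)" if f: "f \<in> Arr C" and g: "g \<in> Arr C" "Cod C g = Dom C f" for f g T
      using f g by (auto simp: rQ_def fun_eq_iff into_def Dom_Cmp Cod_Cmp Cmp_Arr Cmp_assoc)
    ultimately show "presheaf_on Q rQ" by (simp add: presheaf_on_def)
    show "T = T'" if "X \<in> Obj C" "T \<in> Q X" "T' \<in> Q X" and l: "locally X (\<lambda>f. rQ f T = rQ f T')" for X T T'
    proof -
      have l': "locally X (\<lambda>f. rQ f T' = rQ f T)" by (rule locally_mono[OF l \<open>X \<in> Obj C\<close>]) simp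
      show ?thesis using Q_sub[OF that] Q_sub[OF that(1,3,2) l'] by (intro ext) blast
    qed
    show "\<exists>T\<in>Q X. \<forall>f\<in>S. rQ f T = x f" if X: "X \<in> Obj C" and S: "S \<in> J X" and x: "\<And>f. f \<in> S \<Longrightarrow> x f \<in> Q (Dom C f)"
      and xc: "\<And>f g. \<lbrakk>f \<in> S; g \<in> Arr C; Cod C g = Dom C f\<rbrakk> \<Longrightarrow> x (Cmp C f g) = rQ g (x f)" for X S x
    proof -
      \<comment> \<open>The class that a glued family must have at f, read off from the given local
        family \<open>x f\<close> at the identity.\<close>
      define I where "I f = x f (Idt C (Dom C f))" for f
      have Si: "into f X" if "f \<in> S" for f using cover_arr[OF X S that] by (simp add: into_def)
      have SC: "Cmp C f g \<in> S" if "f \<in> S" "into g (Dom C f)" for f g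
        using cover_comp[OF X S that(1)] that(2) by (simp add: into_def)
      have I: "x f g = I (Cmp C f g)" if "f \<in> S" "into g (Dom C f)" for f g
      proof -
        have g: "g \<in> Arr C" "Cod C g = Dom C f" "Dom C g \<in> Obj C" using that into_D by blast+
        have "I (Cmp C f g) = rQ g (x f) (Idt C (Dom C g))"
          using xc[OF that(1) g(1,2)] into_Cmp[OF Si[OF that(1)] that(2)] by (simp add: I_def)
        also have "\<dots> = x f g"
          using g Cmp_Idt_right[OF g(1)] intoI by (simp add: rQ_def)
        finally show ?thesis by simp
      qed
      have If: "into f X" "e \<in> E (Dom C f)" "I f = cl (Dom C f) e" "x f \<in> Q (Dom C f)"
        if "f \<in> S" "e \<in> I f" for f e
      proof -
        show "into f X" "x f \<in> Q (Dom C f)" using Si x that by blast+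
        show "e \<in> E (Dom C f)" "I f = cl (Dom C f) e"
          using Q_E[OF x[OF that(1)], of e "Idt C (Dom C f)"] that(2) into_D(3)[OF Si[OF that(1)]]
          unfolding I_def by (simp_all add: Dom_Idt)
      qed
      have Ir: "r g e \<in> I (Cmp C f g)" if "f \<in> S" "e \<in> I f" "into g (Dom C f)" for f e g
      proof -
        note f = If[OF that(1,2)]
        have "Dom C f \<in> Obj C" using f(1) into_D by blast
        then have "r g e \<in> x f (Cmp C (Idt C (Dom C f)) g)"
          using Q_r[OF f(4), of e "Idt C (Dom C f)" g] that by (simp add: I_def Dom_Idt)
        moreover have "Cmp C (Idt C (Dom C f)) g = g" using Cmp_Idt_left[of g] that(3) by (auto simp: into_def)
        ultimately show ?thesis using I[OF that(1,3)] by simp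
      qed
      \<comment> \<open>The glued family cannot be defined on S alone, as it has to contain
        everything that belongs to it locally. Membership of e in \<open>T h\<close> is therefore
        tested on a cover that carries h into S.\<close>
      define T where "T h = (if into h X then {e \<in> E (Dom C h).
         locally (Dom C h) (\<lambda>g. Cmp C h g \<in> S \<and> r g e \<in> I (Cmp C h g))} else {})" for h
      have T_iff: "e \<in> T h \<longleftrightarrow> into h X \<and> e \<in> E (Dom C h) \<and> locally (Dom C h) (\<lambda>g. Cmp C h g \<in> S \<and> r g e \<in> I (Cmp C h g))" for e h
        by (auto simp: T_def)
      have IT: "e \<in> T f" if "f \<in> S" "e \<in> I f" for f e
        unfolding T_iff
      proof (intro conjI)
        note f = If[OF that]
        show "into f X" "e \<in> E (Dom C f)" using f by blast+
        show "locally (Dom C f) (\<lambda>g. Cmp C f g \<in> S \<and> r g e \<in> I (Cmp C f g))"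
          by (rule locally_all[OF into_D(3)[OF f(1)]]) (use SC Ir that in \<open>auto simp: into_def\<close>)
      qed
      have TQ: "T \<in> Q X"
      proof (rule QI)
        show "T f = {}" if "\<not> into f X" for f using that by (simp add: T_def)
        show "e \<in> E (Dom C f)" if "e \<in> T f" for e f using that by (simp add: T_iff)
        show "r g e \<in> T (Cmp C f g)" if f: "into f X" and e: "e \<in> T f" and g: "into g (Dom C f)" for f e g
          unfolding T_iff into_Cmp(2)[OF f g]
        proof (intro conjI)
          show "into (Cmp C f g) X" by (rule into_Cmp[OF f g])
          show "r g e \<in> E (Dom C g)" using e rEi[OF g] by (simp add: T_iff)
          have "locally (Dom C f) (\<lambda>g. Cmp C f g \<in> S \<and> r g e \<in> I (Cmp C f g))" using e by (simp add: T_iff)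
          from locally_pull[OF this into_D(1,2)[OF g]]
          show "locally (Dom C g) (\<lambda>h. Cmp C (Cmp C f g) h \<in> S \<and> r h (r g e) \<in> I (Cmp C (Cmp C f g) h))"
            by (rule locally_mono[OF _ into_D(3)[OF g]])
              (use CA[OF f g] rC[OF g, of _ e] e in \<open>auto simp: into_def T_iff\<close>)
        qed
        show "e \<in> T f" if f: "into f X" and e: "e \<in> E (Dom C f)" and l: "locally (Dom C f) (\<lambda>g. r g e \<in> T (Cmp C f g))" for f e
          unfolding T_iff
        proof (intro conjI f e, rule locally_bind[OF l into_D(3)[OF f]])
          fix g assume "g \<in> Arr C" "Cod C g = Dom C f" and rg: "r g e \<in> T (Cmp C f g)"
          then have g: "into g (Dom C f)" by (simp add: into_def)
          have "locally (Dom C g) (\<lambda>h. Cmp C (Cmp C f g) h \<in> S \<and> r h (r g e) \<in> I (Cmp C (Cmp C f g) h))"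
            using rg by (simp add: T_iff into_Cmp(2)[OF f g])
          then show "locally (Dom C g) (\<lambda>h. Cmp C f (Cmp C g h) \<in> S \<and> r (Cmp C g h) e \<in> I (Cmp C f (Cmp C g h)))"
            by (rule locally_mono[OF _ into_D(3)[OF g]]) (use CA[OF f g] rC[OF g _ e] in \<open>auto simp: into_def\<close>)
        qed
        show "e' \<in> T f \<longleftrightarrow> eq (Dom C f) e e'" if f: "into f X" and e: "e \<in> T f" and e': "e' \<in> E (Dom C f)" for f e e'
        proof -
          have eE: "e \<in> E (Dom C f)" and le: "locally (Dom C f) (\<lambda>g. Cmp C f g \<in> S \<and> r g e \<in> I (Cmp C f g))"
            using e by (auto simp: T_iff)
          note fo = into_D(3)[OF f]
          show ?thesis
          proof
            assume "e' \<in> T f"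
            then have "locally (Dom C f) (\<lambda>g. Cmp C f g \<in> S \<and> r g e' \<in> I (Cmp C f g))" by (simp add: T_iff)
            from locally_conj[OF le this fo]
            have "locally (Dom C f) (\<lambda>g. eq (Dom C g) (r g e) (r g e'))"
            proof (rule locally_mono[OF _ fo])
              fix g assume g: "g \<in> Arr C" "Cod C g = Dom C f" and
                h: "(Cmp C f g \<in> S \<and> r g e \<in> I (Cmp C f g)) \<and> Cmp C f g \<in> S \<and> r g e' \<in> I (Cmp C f g)"
              have g': "into g (Dom C f)" using g by (simp add: into_def)
              show "eq (Dom C g) (r g e) (r g e')"
                using If(3)[of "Cmp C f g" "r g e"] h into_Cmp(2)[OF f g'] by (auto simp: cl_def)
            qed
            then show "eq (Dom C f) e e'" by (rule eq_loc[OF fo eE e'])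
          next
            assume eq: "eq (Dom C f) e e'"
            have "locally (Dom C f) (\<lambda>g. Cmp C f g \<in> S \<and> r g e' \<in> I (Cmp C f g))"
            proof (rule locally_mono[OF le fo])
              fix g assume g: "g \<in> Arr C" "Cod C g = Dom C f" and
                h: "Cmp C f g \<in> S \<and> r g e \<in> I (Cmp C f g)"
              have g': "into g (Dom C f)" using g by (simp add: into_def)
              have "eq (Dom C g) (r g e) (r g e')" using eq_res[of g e e'] g eE e' eq by simp
              moreover have "r g e' \<in> E (Dom C g)" using rEi[OF g'] e' by blast
              ultimately show "Cmp C f g \<in> S \<and> r g e' \<in> I (Cmp C f g)"
                using If(3)[of "Cmp C f g" "r g e"] h into_Cmp(2)[OF f g'] by (auto simp: cl_def)
            qed
            then show "e' \<in> T f" using f e' by (simp add: T_iff)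
          qed
        qed
        have "locally X (\<lambda>f. f \<in> S)" using S by (auto simp: locally_def)
        then show "locally X (\<lambda>f. T f \<noteq> {})"
        proof (rule locally_bind[OF _ X])
          fix f assume f: "f \<in> S"
          note fo = into_D(3)[OF Si[OF f]]
          show "locally (Dom C f) (\<lambda>g. T (Cmp C f g) \<noteq> {})"
          proof (rule locally_mono[OF Q_cov[OF x[OF f]] fo])
            fix g assume "g \<in> Arr C" "Cod C g = Dom C f" "x f g \<noteq> {}"
            then show "T (Cmp C f g) \<noteq> {}"
              using I[OF f, of g] IT[OF SC[OF f, of g]] by (auto simp: into_def)
          qed
        qed
      qed
      have "rQ f T = x f" if f: "f \<in> S" for f
      proof
        fix g
        note fi = Si[OF f]
        show "rQ f T g = x f g"
        proof (cases "into g (Dom C f)")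
          case True
          note fg = into_Cmp[OF fi True]
          have "e \<in> x f g" if e: "e \<in> T (Cmp C f g)" for e
          proof (rule Q_loc[OF x[OF f] True])
            show "e \<in> E (Dom C g)" using e fg by (simp add: T_iff)
            have "locally (Dom C g) (\<lambda>h. Cmp C (Cmp C f g) h \<in> S \<and> r h e \<in> I (Cmp C (Cmp C f g) h))"
              using e fg by (simp add: T_iff)
            then show "locally (Dom C g) (\<lambda>h. r h e \<in> x f (Cmp C g h))"
            proof (rule locally_mono[OF _ into_D(3)[OF True]])
              fix h assume "h \<in> Arr C" "Cod C h = Dom C g"
                and h: "Cmp C (Cmp C f g) h \<in> S \<and> r h e \<in> I (Cmp C (Cmp C f g) h)"
              then have hi: "into h (Dom C g)" by (simp add: into_def)
              show "r h e \<in> x f (Cmp C g h)"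
                using h I[OF f into_Cmp(1)[OF True hi]] CA[OF fi True hi] by simp
            qed
          qed
          moreover have "e \<in> T (Cmp C f g)" if "e \<in> x f g" for e
            using IT[OF SC[OF f True]] that I[OF f True] by simp
          ultimately show ?thesis using True by (auto simp: rQ_def)
        next
          case False
          then show ?thesis using Q_out[OF x[OF f]] by (simp add: rQ_def)
        qed
      qed
      then show ?thesis using TQ by blast
    qed
    show "\<exists>i :: ('a \<Rightarrow> 'e set) \<Rightarrow> 'u. \<exists>B\<in>\<V>. inj_on i (Q X) \<and> i ` Q X \<subseteq> B" if X: "X \<in> Obj C" for X
    proof -
      obtain a b :: 'u where ab: "a \<noteq> b" "{a, b} \<in> \<V>" using small_two by blast
      \<comment> \<open>Nonemptiness of B provides the default that codes an empty
        \<open>T f\<close>.\<close>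
      have "\<exists>i :: 'e \<Rightarrow> 'u. \<exists>B\<in>\<V>. B \<noteq> {} \<and> inj_on i (E Y) \<and> i ` E Y \<subseteq> B" if Y: "Y \<in> Obj C" for Y
      proof (cases "E Y = {}")
        case True then show ?thesis using ab by (metis image_empty inj_on_empty insert_not_empty empty_subsetI)
      next
        case False then show ?thesis using small[OF Y] by fastforce
      qed
      then obtain i :: "'o \<Rightarrow> 'e \<Rightarrow> 'u" and B where i: "\<And>Y. Y \<in> Obj C \<Longrightarrow> B Y \<in> \<V> \<and> B Y \<noteq> {} \<and> inj_on (i Y) (E Y) \<and> i Y ` E Y \<subseteq> B Y"
        by metis
      have "\<exists>e :: 'u \<times> 'u \<Rightarrow> 'u. inj_on e (B Y \<times> {a, b}) \<and> e ` (B Y \<times> {a, b}) \<in> \<V>" if "Y \<in> Obj C" for Y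
        using small_Times[OF _ ab(2)] i[OF that] by blast
      then obtain e where e: "\<And>Y. Y \<in> Obj C \<Longrightarrow> inj_on (e Y) (B Y \<times> {a, b}) \<and> (e Y :: 'u \<times> 'u \<Rightarrow> 'u) ` (B Y \<times> {a, b}) \<in> \<V>"
        by metis
      define B' where "B' f = e (Dom C f) ` (B (Dom C f) \<times> {a, b})" for f
      obtain w :: "('a \<Rightarrow> 'u) \<Rightarrow> 'u" where w: "inj_on w (PiE (Arr C) B')" "w ` PiE (Arr C) B' \<in> \<V>"
        using small_PiE[of B'] e Dom_Obj unfolding B'_def by blast
      \<comment> \<open>A nonempty \<open>T f\<close> is coded by one representative with tag a, an
        empty one by the default with tag b. A representative determines its class, so T can be
        recovered from the codes of its values, and the families of codes are a product indexed by
        arrows, small by \<open>small_PiE\<close>.\<close>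
      define v where "v T f = (if T f = {} then e (Dom C f) (SOME y. y \<in> B (Dom C f), b)
        else e (Dom C f) (i (Dom C f) (SOME y. y \<in> T f), a))" for T f
      define j where "j T = (\<lambda>f\<in>Arr C. v T f)" for T
      have vB: "v T f \<in> B' f" if T: "T \<in> Q X" and f: "f \<in> Arr C" for T f
      proof (cases "T f = {}")
        case True
        have "(SOME y. y \<in> B (Dom C f)) \<in> B (Dom C f)" using i[OF Dom_Obj[OF f]] by (simp add: some_in_eq)
        then show ?thesis using True by (auto simp: v_def B'_def)
      next
        case False
        then have "(SOME y. y \<in> T f) \<in> T f" by (simp add: some_in_eq)
        then have "i (Dom C f) (SOME y. y \<in> T f) \<in> B (Dom C f)" using Q_E(1)[OF T] i[OF Dom_Obj[OF f]] by blast
        then show ?thesis using False by (auto simp: v_def B'_def)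
      qed
      have "inj_on j (Q X)"
      proof (rule inj_onI, rule ext)
        fix T T' f assume T: "T \<in> Q X" "T' \<in> Q X" and jj: "j T = j T'"
        show "T f = T' f"
        proof (cases "into f X")
          case True
          note f = into_D[OF True]
          have v: "v T f = v T' f" using fun_cong[OF jj, of f] f by (simp add: j_def)
          have sb: "(SOME y. y \<in> B (Dom C f)) \<in> B (Dom C f)" using i[OF f(3)] by (simp add: some_in_eq)
          have st: "(SOME y. y \<in> T'' f) \<in> E (Dom C f) \<and> T'' f = cl (Dom C f) (SOME y. y \<in> T'' f) \<and>
             i (Dom C f) (SOME y. y \<in> T'' f) \<in> B (Dom C f)" if "T'' f \<noteq> {}" "T'' \<in> Q X" for T''
          proof -
            have "(SOME y. y \<in> T'' f) \<in> T'' f" using that by (simp add: some_in_eq)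
            then show ?thesis using Q_E[OF that(2)] i[OF f(3)] by blast
          qed
          have ej: "z = z'" if "e (Dom C f) z = e (Dom C f) z'" "z \<in> B (Dom C f) \<times> {a, b}" "z' \<in> B (Dom C f) \<times> {a, b}" for z z'
            using e[OF f(3)] that by (auto dest: inj_onD)
          show ?thesis
          proof (cases "T f = {}"; cases "T' f = {}")
            assume "T f = {}" "T' f = {}" then show ?thesis by simp
          next
            assume h: "T f = {}" "T' f \<noteq> {}"
            then show ?thesis using ej[of "(SOME y. y \<in> B (Dom C f), b)" "(i (Dom C f) (SOME y. y \<in> T' f), a)"]
                v sb st[OF h(2) T(2)] ab(1) by (auto simp: v_def)
          next
            assume h: "T f \<noteq> {}" "T' f = {}"
            then show ?thesis using ej[of "(i (Dom C f) (SOME y. y \<in> T f), a)" "(SOME y. y \<in> B (Dom C f), b)"]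
                v sb st[OF h(1) T(1)] ab(1) by (auto simp: v_def)
          next
            assume h: "T f \<noteq> {}" "T' f \<noteq> {}"
            have "i (Dom C f) (SOME y. y \<in> T f) = i (Dom C f) (SOME y. y \<in> T' f)"
              using ej[of "(i (Dom C f) (SOME y. y \<in> T f), a)" "(i (Dom C f) (SOME y. y \<in> T' f), a)"]
                v st[OF h(1) T(1)] st[OF h(2) T(2)] h by (auto simp: v_def)
            then have "(SOME y. y \<in> T f) = (SOME y. y \<in> T' f)"
              using i[OF f(3)] st[OF h(1) T(1)] st[OF h(2) T(2)] by (auto dest: inj_onD)
            then show ?thesis using st[OF h(1) T(1)] st[OF h(2) T(2)] by metis
          qed
        next
          case False then show ?thesis using Q_out T by metis
        qed
      qed
      moreover have jP: "j T \<in> PiE (Arr C) B'" if "T \<in> Q X" for T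
        using vB[OF that] by (auto simp: j_def)
      ultimately have "inj_on (w \<circ> j) (Q X) \<and> (w \<circ> j) ` Q X \<subseteq> w ` PiE (Arr C) B'"
        using w(1) by (auto intro!: comp_inj_on inj_on_subset[OF w(1)])
      then show ?thesis using w(2) by blast
    qed
  qed blast
  have cl_in: "e' \<in> cl X e \<longleftrightarrow> e' \<in> E X \<and> eq X e e'" for X e e' by (auto simp: cl_def)
  have qQ: "qQ X e \<in> Q X" if X: "X \<in> Obj C" and e: "e \<in> E X" for X e
  proof (rule QI)
    fix f assume f: "into f X"
    note fo = into_D(3)[OF f]
    have qf: "qQ X e f = cl (Dom C f) (r f e)" using f by (simp add: qQ_def)
    have qg: "qQ X e (Cmp C f g) = cl (Dom C g) (r g (r f e))" if "into g (Dom C f)" for g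
      using into_Cmp[OF f that] rC[OF f that e] by (simp add: qQ_def)
    note re = rEi[OF f e]
    fix e'
    { assume e': "e' \<in> qQ X e f"
      show e'E: "e' \<in> E (Dom C f)" using e' by (simp add: qf cl_in)
      show "e'' \<in> qQ X e f \<longleftrightarrow> eq (Dom C f) e' e''" if "e'' \<in> E (Dom C f)" for e''
        using e' that re cl_eq[OF fo re e'E] unfolding qf by (auto simp: cl_in dest: eq_trans[OF fo] eq_sym[OF fo])
      show "r g e' \<in> qQ X e (Cmp C f g)" if g: "into g (Dom C f)" for g
        using e' e'E rEi[OF g] re eq_res[of g "r f e" e'] into_D[OF g] unfolding qg[OF g] qf by (auto simp: cl_in) }
    assume e': "e' \<in> E (Dom C f)" and l: "locally (Dom C f) (\<lambda>g. r g e' \<in> qQ X e (Cmp C f g))"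
    have "locally (Dom C f) (\<lambda>g. eq (Dom C g) (r g (r f e)) (r g e'))"
      by (rule locally_mono[OF l fo]) (use qg in \<open>auto simp: into_def cl_in\<close>)
    then show "e' \<in> qQ X e f" using eq_loc[OF fo re e'] e' by (simp add: qf cl_in)
  next
    show "locally X (\<lambda>f. qQ X e f \<noteq> {})"
    proof (rule locally_all[OF X])
      fix f assume "f \<in> Arr C" "Cod C f = X"
      then have f: "into f X" by (simp add: into_def)
      show "qQ X e f \<noteq> {}" using f rEi[OF f e] eq_refl[OF into_D(3)[OF f]] by (auto simp: qQ_def cl_def)
    qed
  qed (simp add: qQ_def)
  have rqQ: "rQ f (qQ (Cod C f) e) = qQ (Dom C f) (r f e)" if f: "f \<in> Arr C" and e: "e \<in> E (Cod C f)" for f e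
  proof -
    have fi: "into f (Cod C f)" using f by (simp add: into_def)
    show ?thesis using into_Cmp[OF fi] rC[OF fi _ e] by (auto simp: rQ_def qQ_def fun_eq_iff)
  qed
  have q_eq: "qQ X e = qQ X e' \<longleftrightarrow> eq X e e'" if X: "X \<in> Obj C" and e: "e \<in> E X" "e' \<in> E X" for X e e'
  proof
    assume "qQ X e = qQ X e'"
    from fun_cong[OF this, of "Idt C X"] show "eq X e e'"
      using X e cl_eq[OF X e] by (simp add: qQ_def intoI Dom_Idt r_Idt)
  next
    assume eq: "eq X e e'"
    show "qQ X e = qQ X e'"
    proof
      fix f show "qQ X e f = qQ X e' f"
        using eq_res[of f e e'] eq e cl_eq[of "Dom C f" "r f e" "r f e'"] rEi[of f X] into_D[of f X]
        by (auto simp: qQ_def)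
    qed
  qed
  show ?thesis
  proof (rule that[OF F, of "\<lambda>X e. c X (qQ X e)"])
    show "c X (qQ X e) \<in> sec F X" if "X \<in> Obj C" "e \<in> E X" for X e
      using bij[OF that(1)] qQ[OF that] by (auto simp: bij_betw_def)
    show "res F f (c (Cod C f) (qQ (Cod C f) e)) = c (Dom C f) (qQ (Dom C f) (r f e))"
      if "f \<in> Arr C" "e \<in> E (Cod C f)" for f e
      using rF[OF that(1) qQ[OF Cod_Obj[OF that(1)] that(2)]] rqQ[OF that] by simp
    show "c X (qQ X e) = c X (qQ X e') \<longleftrightarrow> eq X e e'" if "X \<in> Obj C" "e \<in> E X" "e' \<in> E X" for X e e'
      using bij[OF that(1)] qQ[OF that(1,2)] qQ[OF that(1,3)] q_eq[OF that] by (auto simp: bij_betw_def dest: inj_onD)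
    show "locally X (\<lambda>f. \<exists>e\<in>E (Dom C f). c (Dom C f) (qQ (Dom C f) e) = res F f t)"
      if X: "X \<in> Obj C" and t: "t \<in> sec F X" for X t
    proof -
      obtain T where T: "T \<in> Q X" "t = c X T" using bij[OF X] t by (auto simp: bij_betw_def)
      show ?thesis
      proof (rule locally_mono[OF Q_cov[OF T(1)] X])
        fix f assume f: "f \<in> Arr C" "Cod C f = X" and "T f \<noteq> {}"
        then obtain e where e: "e \<in> T f" by blast
        have fi: "into f X" using f by (simp add: into_def)
        have "rQ f T = qQ (Dom C f) e"
        proof
          fix g
          show "rQ f T g = qQ (Dom C f) e g"
            using Q_E[OF T(1) Q_r[OF T(1) e, of g]] into_Cmp(2)[OF fi, of g] by (auto simp: rQ_def qQ_def)
        qed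
        then show "\<exists>e\<in>E (Dom C f). c (Dom C f) (qQ (Dom C f) e) = res F f t"
          using Q_E(1)[OF T(1) e] rF[of f T] f T by auto
      qed
    qed
  qed
qed

section \<open>Monoid sheaves and their monoids of arrows\<close>

lemma monoid_sheafD:
  assumes "monoid_sheaf A"
  shows "sheaf (und A)" and "X \<in> Obj C \<Longrightarrow> comm_monoid (mon A X)" (is "PROP ?g1") and "X \<in> Obj C \<Longrightarrow> monoid (mon A X)" (is "PROP ?g2")
    and "f \<in> Arr C \<Longrightarrow> x \<in> carrier (mon A (Cod C f)) \<Longrightarrow> mres A f x \<in> carrier (mon A (Dom C f))" (is "PROP ?g3")
    and "\<lbrakk>f \<in> Arr C; x \<in> carrier (mon A (Cod C f)); y \<in> carrier (mon A (Cod C f))\<rbrakk> \<Longrightarrow>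
      mres A f (x \<otimes>\<^bsub>mon A (Cod C f)\<^esub> y) = mres A f x \<otimes>\<^bsub>mon A (Dom C f)\<^esub> mres A f y" (is "PROP ?g4")
    and "f \<in> Arr C \<Longrightarrow> mres A f \<one>\<^bsub>mon A (Cod C f)\<^esub> = \<one>\<^bsub>mon A (Dom C f)\<^esub>" (is "PROP ?g5")
proof -
  have A: "sheaf (und A)" "\<forall>X\<in>Obj C. comm_monoid (mon A X)"
    "\<forall>f\<in>Arr C. mres A f \<in> hom (mon A (Cod C f)) (mon A (Dom C f)) \<and>
        mres A f \<one>\<^bsub>mon A (Cod C f)\<^esub> = \<one>\<^bsub>mon A (Dom C f)\<^esub>"
    using assms by (simp_all add: monoid_sheaf_def)
  show "sheaf (und A)" by (rule A)
  show "PROP ?g1" "PROP ?g2"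
    using A(2) by (auto intro: comm_monoid.axioms(1))
  show "PROP ?g3" "PROP ?g4" "PROP ?g5"
    using A(3) by (auto simp: hom_def)
qed

lemma monoid_homD:
  assumes "monoid_hom A B \<phi>" "X \<in> Obj C"
  shows "x \<in> carrier (mon A X) \<Longrightarrow> \<phi> X x \<in> carrier (mon B X)"
    and "x \<in> carrier (mon A X) \<Longrightarrow> y \<in> carrier (mon A X) \<Longrightarrow>
      \<phi> X (x \<otimes>\<^bsub>mon A X\<^esub> y) = \<phi> X x \<otimes>\<^bsub>mon B X\<^esub> \<phi> X y"
    and "\<phi> X \<one>\<^bsub>mon A X\<^esub> = \<one>\<^bsub>mon B X\<^esub>"
  using assms by (auto simp: monoid_hom_def hom_def)

lemma monoid_hom_Hom: "monoid_hom A B \<phi> \<Longrightarrow> \<phi> \<in> Hom (und A) (und B)"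
  by (simp add: monoid_hom_def)

lemma arrows_mult_Hom:
  assumes A: "monoid_sheaf A" and U: "sheaf U" and a: "a \<in> Hom U (und A)" and b: "b \<in> Hom U (und A)"
  shows "a \<otimes>\<^bsub>arrows U A\<^esub> b \<in> Hom U (und A)" (is ?g1)
    and "X \<in> Obj C \<Longrightarrow> x \<in> sec U X \<Longrightarrow> (a \<otimes>\<^bsub>arrows U A\<^esub> b) X x = a X x \<otimes>\<^bsub>mon A X\<^esub> b X x" (is "PROP ?g2")
proof -
  have e: "a \<otimes>\<^bsub>arrows U A\<^esub> b = mk U (\<lambda>X x. a X x \<otimes>\<^bsub>mon A X\<^esub> b X x)"
    by (simp add: arrows_def mk_def)
  show ?g1 unfolding e
  proof (rule mk_Hom[OF _ _ U])
    show "a X x \<otimes>\<^bsub>mon A X\<^esub> b X x \<in> sec (und A) X" if "X \<in> Obj C" "x \<in> sec U X" for X x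
      using Hom_in[OF a that] Hom_in[OF b that] monoid_sheafD(3)[OF A that(1)] by (simp add: monoid.m_closed)
    show "a (Dom C f) (res U f x) \<otimes>\<^bsub>mon A (Dom C f)\<^esub> b (Dom C f) (res U f x) =
        res (und A) f (a (Cod C f) x \<otimes>\<^bsub>mon A (Cod C f)\<^esub> b (Cod C f) x)"
      if "f \<in> Arr C" "x \<in> sec U (Cod C f)" for f x
      using Hom_res[OF a that] Hom_res[OF b that] Hom_in[OF a _ that(2)] Hom_in[OF b _ that(2)] that
        monoid_sheafD(5)[OF A] by (simp add: Cod_Obj)
  qed
  show "PROP ?g2"
    by (simp add: e)
qed

lemma arrows_one_Hom:
  assumes A: "monoid_sheaf A" and U: "sheaf U"
  shows "\<one>\<^bsub>arrows U A\<^esub> \<in> Hom U (und A)" (is ?g1)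
    and "X \<in> Obj C \<Longrightarrow> x \<in> sec U X \<Longrightarrow> \<one>\<^bsub>arrows U A\<^esub> X x = \<one>\<^bsub>mon A X\<^esub>" (is "PROP ?g2")
proof -
  have e: "\<one>\<^bsub>arrows U A\<^esub> = mk U (\<lambda>X x. \<one>\<^bsub>mon A X\<^esub>)"
    by (simp add: arrows_def mk_def)
  show ?g1 unfolding e
    by (rule mk_Hom[OF _ _ U]) (use monoid_sheafD[OF A] in \<open>auto simp: monoid.one_closed\<close>)
  show "PROP ?g2"
    by (simp add: e)
qed

lemma arrows_comp:
  assumes A: "monoid_sheaf A" and U: "sheaf U" and V: "sheaf V" and f: "f \<in> Hom V U"
  shows "a \<in> Hom U (und A) \<Longrightarrow> b \<in> Hom U (und A) \<Longrightarrow>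
      cmp V (a \<otimes>\<^bsub>arrows U A\<^esub> b) f = cmp V a f \<otimes>\<^bsub>arrows V A\<^esub> cmp V b f"
    and "cmp V \<one>\<^bsub>arrows U A\<^esub> f = \<one>\<^bsub>arrows V A\<^esub>" (is ?g1)
proof -
  assume ab: "a \<in> Hom U (und A)" "b \<in> Hom U (und A)"
  show "cmp V (a \<otimes>\<^bsub>arrows U A\<^esub> b) f = cmp V a f \<otimes>\<^bsub>arrows V A\<^esub> cmp V b f"
    by (rule Hom_eqI[OF cmp_Hom[OF V f arrows_mult_Hom(1)[OF A U ab]] arrows_mult_Hom(1)[OF A V]])
      (use ab f V in \<open>auto simp: arrows_mult_Hom[OF A] U V cmp_Hom[OF V f] Hom_in\<close>)
next
  show ?g1
    by (rule Hom_eqI[OF cmp_Hom[OF V f arrows_one_Hom(1)[OF A U]] arrows_one_Hom(1)[OF A V]])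
      (use f V in \<open>auto simp: arrows_one_Hom[OF A] U V Hom_in\<close>)
qed

lemma arrows_monoid_laws:
  assumes A: "monoid_sheaf A" and U: "sheaf U" and a: "a \<in> Hom U (und A)" and b: "b \<in> Hom U (und A)"
    and c: "c \<in> Hom U (und A)"
  shows "a \<otimes>\<^bsub>arrows U A\<^esub> b = b \<otimes>\<^bsub>arrows U A\<^esub> a" (is ?g1)
    and "(a \<otimes>\<^bsub>arrows U A\<^esub> b) \<otimes>\<^bsub>arrows U A\<^esub> c = a \<otimes>\<^bsub>arrows U A\<^esub> (b \<otimes>\<^bsub>arrows U A\<^esub> c)" (is ?g2)
    and "\<one>\<^bsub>arrows U A\<^esub> \<otimes>\<^bsub>arrows U A\<^esub> a = a" (is ?g3) and "a \<otimes>\<^bsub>arrows U A\<^esub> \<one>\<^bsub>arrows U A\<^esub> = a" (is ?g4)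
proof -
  note M = arrows_mult_Hom(1)[OF A U] arrows_one_Hom(1)[OF A U] a b c
  note V = arrows_mult_Hom(2)[OF A U] arrows_one_Hom(2)[OF A U]
  have car: "a X x \<in> carrier (mon A X)" "b X x \<in> carrier (mon A X)" "c X x \<in> carrier (mon A X)"
    "comm_monoid (mon A X)" "monoid (mon A X)"
    if "X \<in> Obj C" "x \<in> sec U X" for X x
    using Hom_in[OF a that] Hom_in[OF b that] Hom_in[OF c that] monoid_sheafD[OF A] that by auto
  show ?g1
    by (rule Hom_eqI[of _ U "und A" _ "und A"]) (use M V car in \<open>auto intro: comm_monoid.m_comm\<close>)
  show ?g2
    by (rule Hom_eqI[of _ U "und A" _ "und A"]) (use M V car in \<open>auto intro: monoid.m_assoc\<close>)
  show ?g3 ?g4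
    by (rule Hom_eqI[of _ U "und A" _ "und A"]; use M V car in \<open>auto intro: monoid.l_one monoid.r_one\<close>)+
qed

end

context monoided_topos
begin

section \<open>Invertible sections of the structure monoid\<close>

lemmas sheaf_O = monoid_sheafD(1)[OF monoid_O]
lemmas O_comm_monoid = monoid_sheafD(2)[OF monoid_O]
lemmas O_monoid = monoid_sheafD(3)[OF monoid_O]
lemmas O_res_in = monoid_sheafD(4)[OF monoid_O]
lemmas O_res_mult = monoid_sheafD(5)[OF monoid_O]
lemmas O_res_one = monoid_sheafD(6)[OF monoid_O]

lemma unit_in: "X \<in> Obj C \<Longrightarrow> u \<in> O_units X \<Longrightarrow> u \<in> carrier (mon \<O> X)"
  by (simp add: Units_def)

lemma unit_one: "X \<in> Obj C \<Longrightarrow> \<one>\<^bsub>mon \<O> X\<^esub> \<in> O_units X"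
  by (rule monoid.Units_one_closed[OF O_monoid])

lemma unit_mult: "\<lbrakk>X \<in> Obj C; u \<in> O_units X; v \<in> O_units X\<rbrakk> \<Longrightarrow>
      u \<otimes>\<^bsub>mon \<O> X\<^esub> v \<in> O_units X"
  by (rule monoid.Units_m_closed[OF O_monoid])

lemma unit_inv:
  assumes "X \<in> Obj C" "u \<in> O_units X"
  shows "inv\<^bsub>mon \<O> X\<^esub> u \<in> O_units X" and "inv\<^bsub>mon \<O> X\<^esub> u \<otimes>\<^bsub>mon \<O> X\<^esub> u = \<one>\<^bsub>mon \<O> X\<^esub>"
    and "u \<otimes>\<^bsub>mon \<O> X\<^esub> inv\<^bsub>mon \<O> X\<^esub> u = \<one>\<^bsub>mon \<O> X\<^esub>"
  using O_monoid[OF assms(1)] assms(2)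
  by (auto simp: monoid.Units_inv_Units monoid.Units_l_inv monoid.Units_r_inv)

lemma unit_comm: "\<lbrakk>X \<in> Obj C; u \<in> carrier (mon \<O> X); v \<in> carrier (mon \<O> X)\<rbrakk> \<Longrightarrow>
      u \<otimes>\<^bsub>mon \<O> X\<^esub> v = v \<otimes>\<^bsub>mon \<O> X\<^esub> u"
  by (rule comm_monoid.m_comm[OF O_comm_monoid])

text \<open>The inverse of u is v times the inverse of the product. Commutativity makes it
  two-sided.\<close>

lemma unitI:
  assumes X: "X \<in> Obj C" and u: "u \<in> carrier (mon \<O> X)" and v: "v \<in> carrier (mon \<O> X)"
    and uv: "u \<otimes>\<^bsub>mon \<O> X\<^esub> v \<in> O_units X"
  shows "u \<in> O_units X"
proof -
  interpret comm_monoid "mon \<O> X" by (rule O_comm_monoid[OF X])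
  let ?w = "v \<otimes>\<^bsub>mon \<O> X\<^esub> inv\<^bsub>mon \<O> X\<^esub> (u \<otimes>\<^bsub>mon \<O> X\<^esub> v)"
  have "u \<otimes>\<^bsub>mon \<O> X\<^esub> ?w = \<one>\<^bsub>mon \<O> X\<^esub>" "?w \<in> carrier (mon \<O> X)"
    using u v uv by (simp_all add: m_assoc[symmetric])
  then show ?thesis using u m_comm[of u ?w] by (auto simp: Units_def intro!: bexI[of _ ?w])
qed

lemma unit_res: "f \<in> Arr C \<Longrightarrow> u \<in> O_units (Cod C f) \<Longrightarrow> mres \<O> f u \<in> O_units (Dom C f)"
  by (rule unitI[of _ _ "mres \<O> f (inv\<^bsub>mon \<O> (Cod C f)\<^esub> u)"])
    (use unit_inv[of "Cod C f" u] in \<open>auto simp: O_res_mult[symmetric] O_res_in O_res_one unit_one Cod_Obj Dom_Obj unit_in\<close>)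

lemma unit_cancel:
  assumes X: "X \<in> Obj C" and "u \<in> carrier (mon \<O> X)" "v \<in> carrier (mon \<O> X)" "w \<in> carrier (mon \<O> X)"
    and "w \<otimes>\<^bsub>mon \<O> X\<^esub> u = \<one>\<^bsub>mon \<O> X\<^esub>" "w \<otimes>\<^bsub>mon \<O> X\<^esub> v = \<one>\<^bsub>mon \<O> X\<^esub>"
  shows "u = v"
proof -
  interpret comm_monoid "mon \<O> X" by (rule O_comm_monoid[OF X])
  show ?thesis using assms inv_unique'[of u w] inv_unique'[of v w] by (metis m_comm inv_unique)
qed

text \<open>Inverses are unique, so the inverses on the members of a cover agree and glue; that the
  result is inverse to u is again a local statement.\<close>

lemma unit_local:
  assumes X: "X \<in> Obj C" and u: "u \<in> carrier (mon \<O> X)"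
    and l: "locally X (\<lambda>f. mres \<O> f u \<in> O_units (Dom C f))"
  shows "u \<in> O_units X"
proof -
  define D where "D f y \<longleftrightarrow> y \<in> carrier (mon \<O> (Dom C f)) \<and>
    mres \<O> f u \<otimes>\<^bsub>mon \<O> (Dom C f)\<^esub> y = \<one>\<^bsub>mon \<O> (Dom C f)\<^esub>" for f y
  have ru: "mres \<O> f u \<in> carrier (mon \<O> (Dom C f))" if "f \<in> Arr C" "Cod C f = X" for f
    using O_res_in u that by blast
  have "\<exists>s\<in>sec (und \<O>) X. \<forall>f y. f \<in> Arr C \<longrightarrow> Cod C f = X \<longrightarrow> D f y \<longrightarrow> res (und \<O>) f s = y"
  proof (rule sheaf_glue[OF sheaf_O X])
    show "y = y'" if "f \<in> Arr C" "Cod C f = X" "D f y" "D f y'" for f y y'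
      using unit_cancel[of "Dom C f" y y' "mres \<O> f u"] that ru by (auto simp: D_def Dom_Obj)
    show "D (Cmp C f g) (res (und \<O>) g y)"
      if f: "f \<in> Arr C" "Cod C f = X" and g: "g \<in> Arr C" "Cod C g = Dom C f" and y: "D f y" for f g y
    proof -
      have "mres \<O> (Cmp C f g) u = mres \<O> g (mres \<O> f u)"
        using res_Cmp[OF sheaf_O, of f g u] f g u by auto
      then show ?thesis
        using y f g O_res_mult[OF g(1), of "mres \<O> f u" y] ru[OF f] O_res_in[OF g(1), of y] O_res_one[OF g(1)]
        by (simp add: D_def Dom_Cmp)
    qed
    show "locally X (\<lambda>f. \<exists>y. D f y)"
    proof (rule locally_mono[OF l X])
      fix f assume f: "f \<in> Arr C" and v: "mres \<O> f u \<in> O_units (Dom C f)"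
      show "\<exists>y. D f y"
        using unit_inv[OF Dom_Obj[OF f] v] unit_in[OF Dom_Obj[OF f]] unfolding D_def by blast
    qed
  qed (auto simp: D_def)
  then obtain s where s: "s \<in> carrier (mon \<O> X)" "\<And>f y. \<lbrakk>f \<in> Arr C; Cod C f = X; D f y\<rbrakk> \<Longrightarrow> mres \<O> f s = y"
    by auto
  interpret comm_monoid "mon \<O> X" by (rule O_comm_monoid[OF X])
  have "u \<otimes>\<^bsub>mon \<O> X\<^esub> s = \<one>\<^bsub>mon \<O> X\<^esub>"
  proof (rule sheaf_sep[OF sheaf_O X])
    show "locally X (\<lambda>f. res (und \<O>) f (u \<otimes>\<^bsub>mon \<O> X\<^esub> s) = res (und \<O>) f \<one>\<^bsub>mon \<O> X\<^esub>)"
    proof (rule locally_mono[OF l X])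
      fix f assume f: "f \<in> Arr C" "Cod C f = X" and ul: "mres \<O> f u \<in> O_units (Dom C f)"
      have D: "D f (inv\<^bsub>mon \<O> (Dom C f)\<^esub> (mres \<O> f u))"
        using unit_inv[OF Dom_Obj[OF f(1)] ul] unit_in[OF Dom_Obj[OF f(1)]] by (simp add: D_def)
      show "res (und \<O>) f (u \<otimes>\<^bsub>mon \<O> X\<^esub> s) = res (und \<O>) f \<one>\<^bsub>mon \<O> X\<^esub>"
        using s(2)[OF f D] D O_res_mult[of f u s] O_res_one[of f] f u s(1) by (simp add: D_def)
    qed
  qed (use u s in auto)
  then show ?thesis using unitI[OF X u s(1)] unit_one[OF X] by simp
qed

text \<open>The units are a subsheaf: the candidates glue in \<O>, and the result is a unit by
  \<open>unit_local\<close>. Used wherever two sections are locally related by a unit that freeness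
  makes unique.\<close>

lemma unit_glue:
  assumes X: "X \<in> Obj C"
    and D: "\<And>f u. \<lbrakk>f \<in> Arr C; Cod C f = X; D f u\<rbrakk> \<Longrightarrow> u \<in> O_units (Dom C f)"
    and un: "\<And>f u v. \<lbrakk>f \<in> Arr C; Cod C f = X; D f u; D f v\<rbrakk> \<Longrightarrow> u = v"
    and rs: "\<And>f g u. \<lbrakk>f \<in> Arr C; Cod C f = X; g \<in> Arr C; Cod C g = Dom C f; D f u\<rbrakk> \<Longrightarrow> D (Cmp C f g) (mres \<O> g u)"
    and loc: "locally X (\<lambda>f. \<exists>u. D f u)"
  obtains u where "u \<in> O_units X" "locally X (\<lambda>f. D f (mres \<O> f u))"
proof -
  obtain u where u: "u \<in> sec (und \<O>) X" "locally X (\<lambda>f. D f (res (und \<O>) f u))"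
  proof (rule sheaf_glue_locally[OF sheaf_O X, of D])
    show "y \<in> sec (und \<O>) (Dom C f)" if "f \<in> Arr C" "Cod C f = X" "D f y" for f y
      using D[OF that] unit_in[OF Dom_Obj[OF that(1)]] by simp
    show "u = v" if "f \<in> Arr C" "Cod C f = X" "D f u" "D f v" for f u v by (rule un[OF that])
    show "D (Cmp C f g) (res (und \<O>) g u)"
      if "f \<in> Arr C" "Cod C f = X" "g \<in> Arr C" "Cod C g = Dom C f" "D f u" for f g u using rs[OF that] by simp
  qed (rule loc)
  show thesis
    by (rule that) (use u unit_local[OF X, of u] locally_mono[OF u(2) X] D in auto)
qed

section \<open>Torsors with a map to the monoid\<close>

text \<open>Cited by number throughout, mostly as \<open>divT\<close>: 6 to 10 are the laws of the
  action, 11 is transitivity on the fibres, 12 freeness, 13 the local existence of sections.\<close>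

lemma torsorD:
  assumes "torsor P"
  shows "sheaf (base P)" and "sheaf (tot P)" and "proj P \<in> Hom (tot P) (base P)"
    and "X \<in> Obj C \<Longrightarrow> p \<in> tsec P X \<Longrightarrow> proj P X p \<in> sec (base P) X" (is "PROP ?g1")
    and "f \<in> Arr C \<Longrightarrow> p \<in> tsec P (Cod C f) \<Longrightarrow> proj P (Dom C f) (res (tot P) f p) = res (base P) f (proj P (Cod C f) p)" (is "PROP ?g2")
    and "\<lbrakk>X \<in> Obj C; u \<in> O_units X; p \<in> tsec P X\<rbrakk> \<Longrightarrow> act P X u p \<in> tsec P X" (is "PROP ?g3")
    and "\<lbrakk>X \<in> Obj C; u \<in> O_units X; p \<in> tsec P X\<rbrakk> \<Longrightarrow> proj P X (act P X u p) = proj P X p" (is "PROP ?g4")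
    and "X \<in> Obj C \<Longrightarrow> p \<in> tsec P X \<Longrightarrow> act P X \<one>\<^bsub>mon \<O> X\<^esub> p = p" (is "PROP ?g5")
    and "\<lbrakk>X \<in> Obj C; u \<in> O_units X; v \<in> O_units X; p \<in> tsec P X\<rbrakk> \<Longrightarrow>
      act P X u (act P X v p) = act P X (u \<otimes>\<^bsub>mon \<O> X\<^esub> v) p" (is "PROP ?g6")
    and "\<lbrakk>f \<in> Arr C; u \<in> O_units (Cod C f); p \<in> tsec P (Cod C f)\<rbrakk> \<Longrightarrow>
      res (tot P) f (act P (Cod C f) u p) = act P (Dom C f) (mres \<O> f u) (res (tot P) f p)" (is "PROP ?g7")
    and "\<lbrakk>X \<in> Obj C; p \<in> tsec P X; q \<in> tsec P X; proj P X p = proj P X q\<rbrakk> \<Longrightarrow>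
      \<exists>u\<in>O_units X. act P X u p = q" (is "PROP ?g8")
    and "\<lbrakk>X \<in> Obj C; p \<in> tsec P X; u \<in> O_units X; v \<in> O_units X\<rbrakk> \<Longrightarrow>
      act P X u p = act P X v p \<longleftrightarrow> u = v"
    and "X \<in> Obj C \<Longrightarrow> x \<in> sec (base P) X \<Longrightarrow>
        locally X (\<lambda>f. \<exists>p\<in>tsec P (Dom C f). proj P (Dom C f) p = res (base P) f x)" (is "PROP ?g9")
proof -
  note d = assms[unfolded torsor_def]
  show 1: "sheaf (base P)" "sheaf (tot P)" "proj P \<in> Hom (tot P) (base P)" using d by simp_all
  show "PROP ?g1" using Hom_in[OF 1(3)] .
  show "PROP ?g2"
    using Hom_res[OF 1(3)] .
  show "PROP ?g3" "PROP ?g4" "PROP ?g5" "PROP ?g6" "PROP ?g7"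
    using d by simp_all
  have e: "\<exists>!u. u \<in> O_units X \<and> act P X u p = q"
    if "X \<in> Obj C" "p \<in> tsec P X" "q \<in> tsec P X" "proj P X p = proj P X q" for X p q
    using d that by simp
  show "PROP ?g8" using e by blast
  show "act P X u p = act P X v p \<longleftrightarrow> u = v"
    if a: "X \<in> Obj C" "p \<in> tsec P X" "u \<in> O_units X" "v \<in> O_units X"
  proof -
    have "act P X v p \<in> tsec P X" "proj P X p = proj P X (act P X v p)" using d a by simp_all
    from e[OF a(1,2) this] a show ?thesis by metis
  qed
  show "PROP ?g9"
    using d unfolding locally_def by simp
qed

lemma div_objD:
  assumes "div_obj P"
  shows "torsor P" and "val P \<in> Hom (tot P) (und \<O>)"
    and "X \<in> Obj C \<Longrightarrow> p \<in> tsec P X \<Longrightarrow> val P X p \<in> carrier (mon \<O> X)" (is "PROP ?g1")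
    and "f \<in> Arr C \<Longrightarrow> p \<in> tsec P (Cod C f) \<Longrightarrow> val P (Dom C f) (res (tot P) f p) = mres \<O> f (val P (Cod C f) p)" (is "PROP ?g2")
    and "\<lbrakk>X \<in> Obj C; u \<in> O_units X; p \<in> tsec P X\<rbrakk> \<Longrightarrow>
      val P X (act P X u p) = u \<otimes>\<^bsub>mon \<O> X\<^esub> val P X p" (is "PROP ?g3")
proof -
  show 1: "torsor P" "val P \<in> Hom (tot P) (und \<O>)" using assms by (simp_all add: div_obj_def)
  show "PROP ?g1" using Hom_in[OF 1(2)] by simp
  show "PROP ?g2"
    using Hom_res[OF 1(2)] by simp
  show "PROP ?g3"
    using assms by (simp add: div_obj_def)
qed

lemmas divT = torsorD[OF div_objD(1)]

lemma act_inv: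
  assumes "torsor P" "X \<in> Obj C" "u \<in> O_units X" "p \<in> tsec P X"
  shows "act P X (inv\<^bsub>mon \<O> X\<^esub> u) (act P X u p) = p" and "act P X u (act P X (inv\<^bsub>mon \<O> X\<^esub> u) p) = p"
  using assms by (simp_all add: torsorD unit_inv)

section \<open>Arrows of the fibred category\<close>

lemma div_arrD:
  assumes "g \<in> div_arr P f Q"
  shows "g \<in> Hom (tot P) (tot Q)"
    and "X \<in> Obj C \<Longrightarrow> p \<in> tsec P X \<Longrightarrow> g X p \<in> tsec Q X" (is "PROP ?g1")
    and "h \<in> Arr C \<Longrightarrow> p \<in> tsec P (Cod C h) \<Longrightarrow> g (Dom C h) (res (tot P) h p) = res (tot Q) h (g (Cod C h) p)" (is "PROP ?g2")
    and "X \<in> Obj C \<Longrightarrow> p \<in> tsec P X \<Longrightarrow> proj Q X (g X p) = f X (proj P X p)"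
    and "\<lbrakk>X \<in> Obj C; u \<in> O_units X; p \<in> tsec P X\<rbrakk> \<Longrightarrow> g X (act P X u p) = act Q X u (g X p)"
    and "X \<in> Obj C \<Longrightarrow> p \<in> tsec P X \<Longrightarrow> val Q X (g X p) = val P X p"
proof -
  show 1: "g \<in> Hom (tot P) (tot Q)" using assms by (simp add: div_arr_def)
  show "PROP ?g1" using Hom_in[OF 1] .
  show "PROP ?g2"
    using Hom_res[OF 1] .
qed (use assms in \<open>simp_all add: div_arr_def\<close>)

lemma idm_div_arr: "div_obj P \<Longrightarrow> base P = U \<Longrightarrow> idm (tot P) \<in> div_arr P (idm U) P"
  unfolding div_arr_def by (auto simp: idm_Hom divT)

lemma cmp_div_arr:
  assumes "div_obj P" "base P = U" "g \<in> div_arr P f Q" "h \<in> div_arr Q f' R"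
  shows "cmp (tot P) h g \<in> div_arr P (cmp U f' f) R"
  unfolding div_arr_def
  by (use assms in \<open>auto simp: div_arrD[OF assms(3)] div_arrD[OF assms(4)] divT
      intro!: cmp_Hom[OF divT(2) div_arrD(1) div_arrD(1)]\<close>)

lemma cmp_div_arr_idm:
  assumes "div_obj P" "base P = U" "g \<in> div_arr P (idm U) Q" "h \<in> div_arr Q (idm U) R"
  shows "cmp (tot P) h g \<in> div_arr P (idm U) R"
  using cmp_div_arr[OF assms] cmp_idm_left[of U "idm U" U] idm_Hom[of U] divT(1)[OF assms(1)] assms(2) by simp

text \<open>An arrow over f identifies P with the pullback of Q. Uniqueness: two candidates differ
  by a unit which fixes y, hence is 1. Existence: locally choose any section over x and translate it
  by the unit that moves its image to y; by uniqueness these sections glue.\<close>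

lemma div_arr_cartesian:
  assumes P: "div_obj P" and Q: "div_obj Q" and f: "f \<in> Hom (base P) (base Q)" and g: "g \<in> div_arr P f Q"
    and X: "X \<in> Obj C" and x: "x \<in> sec (base P) X" and y: "y \<in> tsec Q X" and xy: "proj Q X y = f X x"
  shows "\<exists>!p. p \<in> tsec P X \<and> proj P X p = x \<and> g X p = y"
proof -
  have un: "p = p'" if a: "X \<in> Obj C" "p \<in> tsec P X" "p' \<in> tsec P X" "proj P X p = proj P X p'" "g X p = g X p'" for X p p'
  proof -
    obtain u where u: "u \<in> O_units X" "act P X u p = p'" using divT(11)[OF P a(1-4)] by blast
    have "act Q X u (g X p) = act Q X \<one>\<^bsub>mon \<O> X\<^esub> (g X p)"
      using div_arrD(5)[OF g, of X u p] u a divT(8)[OF Q, of X "g X p"] div_arrD(2)[OF g] by simp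
    then have "u = \<one>\<^bsub>mon \<O> X\<^esub>"
      using divT(12)[OF Q a(1) div_arrD(2)[OF g a(1,2)] u(1) unit_one[OF a(1)]] by simp
    then show ?thesis using u(2) divT(8)[OF P] a by simp
  qed
  define D where "D h p \<longleftrightarrow> p \<in> tsec P (Dom C h) \<and> proj P (Dom C h) p = res (base P) h x \<and> g (Dom C h) p = res (tot Q) h y" for h p
  obtain s where s: "s \<in> tsec P X" and l: "locally X (\<lambda>h. D h (res (tot P) h s))"
  proof (rule sheaf_glue_locally[OF divT(2)[OF P] X])
    show "p = p'" if "h \<in> Arr C" "Cod C h = X" "D h p" "D h p'" for h p p'
      using un[OF Dom_Obj[OF that(1)], of p p'] that unfolding D_def by simp
    show "D (Cmp C h k) (res (tot P) k p)" if h: "h \<in> Arr C" "Cod C h = X" and k: "k \<in> Arr C" "Cod C k = Dom C h" and D: "D h p" for h k p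
      using D h k divT(5)[OF P k(1), of p] div_arrD(3)[OF g k(1), of p] res_Cmp[OF divT(1)[OF P] h(1) k, of x]
        res_Cmp[OF divT(2)[OF Q] h(1) k, of y] x y res_in[OF divT(2)[OF P] k(1), of p]
      by (simp add: D_def Dom_Cmp)
    show "locally X (\<lambda>h. \<exists>p. D h p)"
    proof (rule locally_mono[OF divT(13)[OF P X x] X])
      fix h assume h: "h \<in> Arr C" "Cod C h = X"
        and "\<exists>p\<in>tsec P (Dom C h). proj P (Dom C h) p = res (base P) h x"
      then obtain p where p: "p \<in> tsec P (Dom C h)" "proj P (Dom C h) p = res (base P) h x" by blast
      note ho = Dom_Obj[OF h(1)]
      have "proj Q (Dom C h) (g (Dom C h) p) = proj Q (Dom C h) (res (tot Q) h y)"
        using div_arrD(4)[OF g ho p(1)] p(2) divT(5)[OF Q h(1), of y] y h xy Hom_res[OF f h(1), of x] x by simp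
      then obtain u where u: "u \<in> O_units (Dom C h)" "act Q (Dom C h) u (g (Dom C h) p) = res (tot Q) h y"
        using divT(11)[OF Q ho div_arrD(2)[OF g ho p(1)]] res_in[OF divT(2)[OF Q] h(1), of y] y h by blast
      have "D h (act P (Dom C h) u p)"
        using u p ho div_arrD(5)[OF g ho u(1) p(1)] divT(6,7)[OF P ho u(1) p(1)] by (simp add: D_def)
      then show "\<exists>p. D h p" by blast
    qed
  qed (auto simp: D_def)
  have "proj P X s = x"
    by (rule sheaf_sep[OF divT(1)[OF P] X divT(4)[OF P X s] x], rule locally_mono[OF l X])
      (use divT(5)[OF P, of _ s] s in \<open>auto simp: D_def\<close>)
  moreover have "g X s = y"
    by (rule sheaf_sep[OF divT(2)[OF Q] X div_arrD(2)[OF g X s] y], rule locally_mono[OF l X])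
      (use div_arrD(3)[OF g, of _ s] s in \<open>auto simp: D_def\<close>)
  ultimately show ?thesis
    by (intro ex1I[of _ s]) (simp add: s, rule un[OF X], simp_all add: s)
qed

text \<open>The version of \<open>descent\<close> for arrows of Div. It is enough that prescribed
  values exist locally and that the prescription is stable under restriction and under the action:
  compatibility with projection, value and action is an equation between sections, hence can be
  checked on a cover.\<close>

lemma div_arr_descent:
  assumes T: "div_obj T" and G: "div_obj G" and f: "f \<in> Hom (base T) (base G)"
    and R: "\<And>X t s. \<lbrakk>X \<in> Obj C; t \<in> tsec T X; R X t s\<rbrakk> \<Longrightarrow>
      s \<in> tsec G X \<and> proj G X s = f X (proj T X t) \<and> val G X s = val T X t"
    and un: "\<And>X t s s'. \<lbrakk>X \<in> Obj C; t \<in> tsec T X; R X t s; R X t s'\<rbrakk> \<Longrightarrow> s = s'"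
    and nat: "\<And>h t s. \<lbrakk>h \<in> Arr C; t \<in> tsec T (Cod C h); R (Cod C h) t s\<rbrakk> \<Longrightarrow>
      R (Dom C h) (res (tot T) h t) (res (tot G) h s)"
    and act: "\<And>X t s u. \<lbrakk>X \<in> Obj C; t \<in> tsec T X; R X t s; u \<in> O_units X\<rbrakk> \<Longrightarrow>
      R X (act T X u t) (act G X u s)"
    and loc: "\<And>X t. X \<in> Obj C \<Longrightarrow> t \<in> tsec T X \<Longrightarrow> locally X (\<lambda>h. \<exists>s. R (Dom C h) (res (tot T) h t) s)"
  shows "\<exists>k\<in>div_arr T f G. \<forall>X\<in>Obj C. \<forall>t\<in>tsec T X. \<forall>s. R X t s \<longrightarrow> k X t = s"
proof -
  note sT = divT(2)[OF T] and sG = divT(2)[OF G]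
  obtain k where k: "\<And>X t. X \<in> Obj C \<Longrightarrow> t \<in> tsec T X \<Longrightarrow> k X t \<in> tsec G X"
    and kR: "\<And>X t s. \<lbrakk>X \<in> Obj C; t \<in> tsec T X; R X t s\<rbrakk> \<Longrightarrow> k X t = s"
    and kn: "\<And>h t. h \<in> Arr C \<Longrightarrow> t \<in> tsec T (Cod C h) \<Longrightarrow> k (Dom C h) (res (tot T) h t) = res (tot G) h (k (Cod C h) t)"
    by (rule descent[OF sG presheaf_on_sheaf[OF sT], of R]) (use R un nat loc in blast)+
  have kl: "locally X (\<lambda>h. R (Dom C h) (res (tot T) h t) (res (tot G) h (k X t)))"
    if X: "X \<in> Obj C" and t: "t \<in> tsec T X" for X t
  proof (rule locally_mono[OF loc[OF X t] X])
    fix h assume h: "h \<in> Arr C" "Cod C h = X" and "\<exists>s. R (Dom C h) (res (tot T) h t) s"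
    then obtain s where s: "R (Dom C h) (res (tot T) h t) s" by blast
    have "res (tot G) h (k X t) = s"
      using kR[OF Dom_Obj[OF h(1)] _ s] kn[OF h(1), of t] res_in[OF sT h(1), of t] h t by simp
    then show "R (Dom C h) (res (tot T) h t) (res (tot G) h (k X t))" using s by simp
  qed
  have "mk (tot T) k \<in> div_arr T f G"
    unfolding div_arr_def
  proof (intro CollectI conjI ballI)
    show "mk (tot T) k \<in> Hom (tot T) (tot G)" by (rule mk_Hom[OF k kn sT])
    fix X t assume X: "X \<in> Obj C" and t: "t \<in> tsec T X"
    note kt = k[OF X t]
    have "proj G X (k X t) = f X (proj T X t)"
    proof (rule sheaf_sep[OF divT(1)[OF G] X])
      show "proj G X (k X t) \<in> sec (base G) X" by (rule divT(4)[OF G X kt])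
      show "f X (proj T X t) \<in> sec (base G) X" by (rule Hom_in[OF f X divT(4)[OF T X t]])
      show "locally X (\<lambda>h. res (base G) h (proj G X (k X t)) = res (base G) h (f X (proj T X t)))"
      proof (rule locally_mono[OF kl[OF X t] X])
        fix h assume h: "h \<in> Arr C" "Cod C h = X" and r: "R (Dom C h) (res (tot T) h t) (res (tot G) h (k X t))"
        show "res (base G) h (proj G X (k X t)) = res (base G) h (f X (proj T X t))"
          using R[OF Dom_Obj[OF h(1)] _ r] res_in[OF sT h(1), of t] t kt h
            divT(5)[OF G h(1), of "k X t"] divT(5)[OF T h(1), of t] Hom_res[OF f h(1), of "proj T X t"] divT(4)[OF T X t] by simp
      qed
    qed
    then show "proj G X (mk (tot T) k X t) = f X (proj T X t)" using X t by simp
    have "val G X (k X t) = val T X t"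
    proof (rule sheaf_sep[OF sheaf_O X])
      show "val G X (k X t) \<in> sec (und \<O>) X" "val T X t \<in> sec (und \<O>) X"
        using div_objD(3)[OF G X kt] div_objD(3)[OF T X t] by simp_all
      show "locally X (\<lambda>h. res (und \<O>) h (val G X (k X t)) = res (und \<O>) h (val T X t))"
      proof (rule locally_mono[OF kl[OF X t] X])
        fix h assume h: "h \<in> Arr C" "Cod C h = X" and r: "R (Dom C h) (res (tot T) h t) (res (tot G) h (k X t))"
        show "res (und \<O>) h (val G X (k X t)) = res (und \<O>) h (val T X t)"
          using R[OF Dom_Obj[OF h(1)] _ r] res_in[OF sT h(1), of t] t kt h
            div_objD(4)[OF G h(1), of "k X t"] div_objD(4)[OF T h(1), of t] by simp
      qed
    qed
    then show "val G X (mk (tot T) k X t) = val T X t" using X t by simp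
    fix u assume u: "u \<in> O_units X"
    have "k X (act T X u t) = act G X u (k X t)"
    proof (rule sheaf_sep[OF sG X])
      show "k X (act T X u t) \<in> tsec G X" by (rule k[OF X divT(6)[OF T X u t]])
      show "act G X u (k X t) \<in> tsec G X" by (rule divT(6)[OF G X u kt])
      show "locally X (\<lambda>h. res (tot G) h (k X (act T X u t)) = res (tot G) h (act G X u (k X t)))"
      proof (rule locally_mono[OF kl[OF X t] X])
        fix h assume h: "h \<in> Arr C" "Cod C h = X" and r: "R (Dom C h) (res (tot T) h t) (res (tot G) h (k X t))"
        note ho = Dom_Obj[OF h(1)]
        have rt: "res (tot T) h t \<in> tsec T (Dom C h)" using res_in[OF sT h(1), of t] t h by simp
        have ur: "mres \<O> h u \<in> O_units (Dom C h)" using unit_res[OF h(1), of u] u h by simp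
        show "res (tot G) h (k X (act T X u t)) = res (tot G) h (act G X u (k X t))"
          using kR[OF ho divT(6)[OF T ho ur rt] act[OF ho rt r ur]] h u t kt
            kn[OF h(1), of "act T X u t"] divT(6)[OF T X u t] divT(10)[OF T h(1), of u t] divT(10)[OF G h(1), of u "k X t"]
          by simp
      qed
    qed
    then show "mk (tot T) k X (act T X u t) = act G X u (mk (tot T) k X t)"
      using X t divT(6)[OF T X u t] by simp
  qed
  then show ?thesis using kR by (intro bexI[of _ "mk (tot T) k"]) auto
qed

text \<open>Over an identity, \<open>div_arr_cartesian\<close> gives every section of Q exactly one
  preimage with the same base point. The prescription sending q to this preimage is defined
  everywhere, and it inherits all compatibilities from g.\<close>

lemma div_arr_inverse:
  assumes P: "div_obj P" and Q: "div_obj Q" and b: "base P = U" "base Q = U" and g: "g \<in> div_arr P (idm U) Q"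
  obtains g' where "g' \<in> div_arr Q (idm U) P"
    and "\<And>X p. X \<in> Obj C \<Longrightarrow> p \<in> tsec P X \<Longrightarrow> g' X (g X p) = p"
    and "\<And>X q. X \<in> Obj C \<Longrightarrow> q \<in> tsec Q X \<Longrightarrow> g X (g' X q) = q"
proof -
  have U: "sheaf U" using divT(1)[OF P] b by simp
  note iU = idm_Hom[OF U]
  have cart: "\<exists>!p. p \<in> tsec P X \<and> proj P X p = proj Q X q \<and> g X p = q" if "X \<in> Obj C" "q \<in> tsec Q X" for X q
    by (rule div_arr_cartesian[OF P Q _ g that(1) _ that(2)]) (use iU b divT(4)[OF Q that] that in auto)
  have gp: "proj Q X (g X p) = proj P X p" if "X \<in> Obj C" "p \<in> tsec P X" for X p
    using div_arrD(4)[OF g that] divT(4)[OF P that] b that by simp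
  define R where "R X q p \<longleftrightarrow> p \<in> tsec P X \<and> g X p = q" for X q p
  have "\<exists>k\<in>div_arr Q (idm U) P. \<forall>X\<in>Obj C. \<forall>t\<in>tsec Q X. \<forall>s. R X t s \<longrightarrow> k X t = s"
  proof (rule div_arr_descent[OF Q P])
    show "idm U \<in> Hom (base Q) (base P)" using iU b by simp
    show "s \<in> tsec P X \<and> proj P X s = idm U X (proj Q X t) \<and> val P X s = val Q X t"
      if "X \<in> Obj C" "t \<in> tsec Q X" "R X t s" for X t s
      using that gp[OF that(1), of s] div_arrD(6)[OF g that(1), of s] divT(4)[OF Q that(1,2)] b by (auto simp: R_def)
    show "s = s'" if "X \<in> Obj C" "t \<in> tsec Q X" "R X t s" "R X t s'" for X t s s'
      using cart[OF that(1,2)] that gp[OF that(1)] by (metis R_def)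
    show "R (Dom C h) (res (tot Q) h t) (res (tot P) h s)"
      if "h \<in> Arr C" "t \<in> tsec Q (Cod C h)" "R (Cod C h) t s" for h t s
      using that div_arrD(3)[OF g that(1), of s] res_in[OF divT(2)[OF P] that(1)] by (simp add: R_def)
    show "R X (act Q X u t) (act P X u s)"
      if "X \<in> Obj C" "t \<in> tsec Q X" "R X t s" "u \<in> O_units X" for X t s u
      using that div_arrD(5)[OF g that(1,4), of s] divT(6)[OF P] by (simp add: R_def)
    show "locally X (\<lambda>h. \<exists>s. R (Dom C h) (res (tot Q) h t) s)" if "X \<in> Obj C" "t \<in> tsec Q X" for X t
    proof (rule locally_all[OF that(1)])
      fix h assume h: "h \<in> Arr C" "Cod C h = X"
      show "\<exists>s. R (Dom C h) (res (tot Q) h t) s"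
        using cart[OF Dom_Obj[OF h(1)], of "res (tot Q) h t"] res_in[OF divT(2)[OF Q] h(1), of t] that h
        unfolding R_def by blast
    qed
  qed
  then obtain k where k: "k \<in> div_arr Q (idm U) P" "\<And>X t s. \<lbrakk>X \<in> Obj C; t \<in> tsec Q X; R X t s\<rbrakk> \<Longrightarrow> k X t = s"
    by blast
  show ?thesis
  proof (rule that[OF k(1)])
    show kg: "k X (g X p) = p" if "X \<in> Obj C" "p \<in> tsec P X" for X p
      using k(2)[OF that(1) div_arrD(2)[OF g that]] that by (simp add: R_def)
    show "g X (k X q) = q" if "X \<in> Obj C" "q \<in> tsec Q X" for X q
      using cart[OF that] kg[OF that(1)] by metis
  qed
qed

text \<open>The product of U with the units, realised inside the product of U with \<O>. The units
  act on the second coordinate, and that coordinate is also the map to \<O>, so the section (x, 1)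
  has value 1. The relation is local by \<open>unit_local\<close>.\<close>

lemma trivial_torsor_exists:
  assumes U: "sheaf U"
  shows "\<exists>T e. trivial_torsor U T e"
proof -
  obtain W where "fibre_product U (und \<O>) (\<lambda>X x u. u \<in> O_units X) W"
    using fibre_product_exists[OF U sheaf_O, of "\<lambda>X x u. u \<in> O_units X"] unit_res unit_local by auto
  then obtain F p q c where "fibre_product U (und \<O>) (\<lambda>X x u. u \<in> O_units X) (F, p, q, c)" by (cases W) auto
  then have F: "sheaf F" and p: "p \<in> Hom F U" and q: "q \<in> Hom F (und \<O>)"
    and c: "\<And>X x u. \<lbrakk>X \<in> Obj C; x \<in> sec U X; u \<in> O_units X\<rbrakk> \<Longrightarrow>
      c X x u \<in> sec F X \<and> p X (c X x u) = x \<and> q X (c X x u) = u"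
    and z: "\<And>X z. X \<in> Obj C \<Longrightarrow> z \<in> sec F X \<Longrightarrow> q X z \<in> O_units X \<and> c X (p X z) (q X z) = z"
    by (auto simp: fibre_product_def unit_in)
  define T where "T = \<lparr>base = U, tot = F, proj = p, act = (\<lambda>X v z. c X (p X z) (v \<otimes>\<^bsub>mon \<O> X\<^esub> q X z)), val = q\<rparr>"
  note pin = Hom_in[OF p] and pres = Hom_res[OF p] and qres = Hom_res[OF q, simplified]
  have cres: "res F f (c (Cod C f) x u) = c (Dom C f) (res U f x) (mres \<O> f u)"
    if "f \<in> Arr C" "x \<in> sec U (Cod C f)" "u \<in> O_units (Cod C f)" for f x u
    using c[OF Cod_Obj[OF that(1)] that(2,3)] pres[OF that(1)] qres[OF that(1)]
      z[OF Dom_Obj[OF that(1)] res_in[OF F that(1)]] by metis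
  have tT: "torsor T"
    unfolding torsor_def
  proof (intro conjI ballI impI)
    show "sheaf (base T)" "sheaf (tot T)" "proj T \<in> Hom (tot T) (base T)"
      using U F p by (simp_all add: T_def)
  next
    fix X u t assume X: "X \<in> Obj C" and u: "u \<in> O_units X" and t: "t \<in> tsec T X"
    then have t': "t \<in> sec F X" by (simp add: T_def)
    note ct = c[OF X pin[OF X t'] unit_mult[OF X u z[OF X t', THEN conjunct1]]]
    from ct show "act T X u t \<in> tsec T X" "proj T X (act T X u t) = proj T X t" by (simp_all add: T_def)
    fix v assume v: "v \<in> O_units X"
    note cv = c[OF X pin[OF X t'] unit_mult[OF X v z[OF X t', THEN conjunct1]]]
    show "act T X (u \<otimes>\<^bsub>mon \<O> X\<^esub> v) t = act T X u (act T X v t)"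
      using ct cv u v z[OF X t'] X O_monoid[OF X] unit_in[OF X] by (simp add: T_def monoid.m_assoc)
  next
    fix X t assume X: "X \<in> Obj C" and t: "t \<in> tsec T X"
    then have t': "t \<in> sec F X" by (simp add: T_def)
    show "act T X \<one>\<^bsub>mon \<O> X\<^esub> t = t"
      using z[OF X t'] O_monoid[OF X] unit_in[OF X] by (simp add: T_def monoid.l_one)
  next
    fix f u t assume f: "f \<in> Arr C" and u: "u \<in> O_units (Cod C f)" and t: "t \<in> tsec T (Cod C f)"
    note X = Cod_Obj[OF f]
    have t': "t \<in> sec F (Cod C f)" using t by (simp add: T_def)
    show "res (tot T) f (act T (Cod C f) u t) = act T (Dom C f) (mres \<O> f u) (res (tot T) f t)"
      using cres[OF f pin[OF X t'] unit_mult[OF X u z[OF X t', THEN conjunct1]]] pres[OF f t'] qres[OF f t']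
        O_res_mult[OF f] unit_in[OF X] u z[OF X t'] by (simp add: T_def)
  next
    fix X t t' assume X: "X \<in> Obj C" and t: "t \<in> tsec T X" "t' \<in> tsec T X" and pp: "proj T X t = proj T X t'"
    then have t': "t \<in> sec F X" "t' \<in> sec F X" "p X t = p X t'" by (simp_all add: T_def)
    interpret comm_monoid "mon \<O> X" by (rule O_comm_monoid[OF X])
    note qt = z[OF X t'(1)] z[OF X t'(2)]
    show "\<exists>!u. u \<in> O_units X \<and> act T X u t = t'"
    proof (rule ex1I[of _ "q X t' \<otimes>\<^bsub>mon \<O> X\<^esub> inv\<^bsub>mon \<O> X\<^esub> (q X t)"])
      have e: "q X t' \<otimes>\<^bsub>mon \<O> X\<^esub> inv\<^bsub>mon \<O> X\<^esub> (q X t) \<otimes>\<^bsub>mon \<O> X\<^esub> q X t = q X t'"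
        using qt unit_in[OF X] by (simp add: m_assoc)
      show "q X t' \<otimes>\<^bsub>mon \<O> X\<^esub> inv\<^bsub>mon \<O> X\<^esub> (q X t) \<in> O_units X \<and>
          act T X (q X t' \<otimes>\<^bsub>mon \<O> X\<^esub> inv\<^bsub>mon \<O> X\<^esub> (q X t)) t = t'"
        using qt t'(3) by (simp add: T_def e)
      fix u assume u: "u \<in> O_units X \<and> act T X u t = t'"
      have "q X t' = u \<otimes>\<^bsub>mon \<O> X\<^esub> q X t"
        using u qt c[OF X pin[OF X t'(1)] unit_mult[OF X _ qt(1)[THEN conjunct1]]] by (auto simp: T_def)
      then show "u = q X t' \<otimes>\<^bsub>mon \<O> X\<^esub> inv\<^bsub>mon \<O> X\<^esub> (q X t)"
        using u qt unit_in[OF X] by (simp add: m_assoc)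
    qed
  next
    fix X x assume X: "X \<in> Obj C" and x: "x \<in> sec (base T) X"
    have "locally X (\<lambda>f. \<exists>t\<in>tsec T (Dom C f). proj T (Dom C f) t = res (base T) f x)"
    proof (rule locally_all[OF X])
      fix f assume f: "f \<in> Arr C" "Cod C f = X"
      have "res U f x \<in> sec U (Dom C f)" using x f res_in[OF U f(1)] by (simp add: T_def)
      from c[OF Dom_Obj[OF f(1)] this unit_one[OF Dom_Obj[OF f(1)]]]
      show "\<exists>t\<in>tsec T (Dom C f). proj T (Dom C f) t = res (base T) f x" by (auto simp: T_def)
    qed
    then show "\<exists>S\<in>J X. \<forall>f\<in>S. \<exists>t\<in>tsec T (Dom C f). proj T (Dom C f) t = res (base T) f x"
      by (simp add: locally_def)
  qed
  have "div_obj T"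
    unfolding div_obj_def
  proof (intro conjI ballI tT)
    show "val T \<in> Hom (tot T) (und \<O>)" using q by (simp add: T_def)
    fix X u t assume X: "X \<in> Obj C" and u: "u \<in> O_units X" and t: "t \<in> tsec T X"
    then have t': "t \<in> sec F X" by (simp add: T_def)
    show "val T X (act T X u t) = u \<otimes>\<^bsub>mon \<O> X\<^esub> val T X t"
      using c[OF X pin[OF X t'] unit_mult[OF X u z[OF X t', THEN conjunct1]]] by (simp add: T_def)
  qed
  then have "trivial_torsor U T (mk U (\<lambda>X x. c X x \<one>\<^bsub>mon \<O> X\<^esub>))"
    unfolding trivial_torsor_def
    using c[OF _ _ unit_one] cres[OF _ _ unit_one[OF Cod_Obj]]
    by (auto simp: T_def O_res_one intro!: mk_Hom[OF _ _ U])
  then show ?thesis by blast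
qed

text \<open>Clause 8 makes the unit section a basis: t and the unit section over the base point of t
  lie in one fibre, so a unit carries one to the other.\<close>

lemma unit_objD:
  assumes U: "sheaf U"
  shows "div_obj (unit_obj U)" and "base (unit_obj U) = U" and "unit_sec U \<in> Hom U (tot (unit_obj U))"
    and "X \<in> Obj C \<Longrightarrow> x \<in> sec U X \<Longrightarrow> unit_sec U X x \<in> tsec (unit_obj U) X"
    and "X \<in> Obj C \<Longrightarrow> x \<in> sec U X \<Longrightarrow> proj (unit_obj U) X (unit_sec U X x) = x"
    and "X \<in> Obj C \<Longrightarrow> x \<in> sec U X \<Longrightarrow> val (unit_obj U) X (unit_sec U X x) = \<one>\<^bsub>mon \<O> X\<^esub>" (is "PROP ?g1")
    and "f \<in> Arr C \<Longrightarrow> x \<in> sec U (Cod C f) \<Longrightarrow>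
      res (tot (unit_obj U)) f (unit_sec U (Cod C f) x) = unit_sec U (Dom C f) (res U f x)" (is "PROP ?g2")
    and "X \<in> Obj C \<Longrightarrow> t \<in> tsec (unit_obj U) X \<Longrightarrow>
      \<exists>u\<in>O_units X. act (unit_obj U) X u (unit_sec U X (proj (unit_obj U) X t)) = t"
proof -
  have "\<exists>z. case z of (T, e) \<Rightarrow> trivial_torsor U T e" using trivial_torsor_exists[OF U] by auto
  from someI_ex[OF this] have "case unit_choice U of (T, e) \<Rightarrow> trivial_torsor U T e"
    unfolding unit_choice_def .
  then have t: "trivial_torsor U (unit_obj U) (unit_sec U)"
    unfolding unit_obj_def unit_sec_def by (simp add: case_prod_beta)
  show 1: "div_obj (unit_obj U)" "base (unit_obj U) = U" "unit_sec U \<in> Hom U (tot (unit_obj U))"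
    using t by (simp_all add: trivial_torsor_def)
  show 2: "unit_sec U X x \<in> tsec (unit_obj U) X" if "X \<in> Obj C" "x \<in> sec U X" for X x
    using Hom_in[OF 1(3)] that .
  show 3: "proj (unit_obj U) X (unit_sec U X x) = x" if "X \<in> Obj C" "x \<in> sec U X" for X x
    using t that by (simp add: trivial_torsor_def)
  show "PROP ?g1"
    using t by (simp add: trivial_torsor_def)
  show "PROP ?g2"
    using Hom_res[OF 1(3)] by simp
  assume X: "X \<in> Obj C" and t: "t \<in> tsec (unit_obj U) X"
  have "proj (unit_obj U) X t \<in> sec U X" using divT(4)[OF 1(1) X t] 1(2) by simp
  then show "\<exists>u\<in>O_units X. act (unit_obj U) X u (unit_sec U X (proj (unit_obj U) X t)) = t"
    using divT(11)[OF 1(1) X _ t] 2[OF X] 3[OF X] by simp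
qed

lemma unit_obj_eqI:
  assumes U: "sheaf U" and k: "k \<in> div_arr (unit_obj U) f Q" "k' \<in> div_arr (unit_obj U) f' Q"
    and e: "\<And>X x. X \<in> Obj C \<Longrightarrow> x \<in> sec U X \<Longrightarrow> k X (unit_sec U X x) = k' X (unit_sec U X x)"
  shows "k = k'"
proof (rule Hom_eqI[OF div_arrD(1)[OF k(1)] div_arrD(1)[OF k(2)]])
  fix X t assume X: "X \<in> Obj C" and t: "t \<in> tsec (unit_obj U) X"
  have x: "proj (unit_obj U) X t \<in> sec U X" using divT(4)[OF unit_objD(1)[OF U] X t] unit_objD(2)[OF U] by simp
  obtain u where u: "u \<in> O_units X" "act (unit_obj U) X u (unit_sec U X (proj (unit_obj U) X t)) = t"
    using unit_objD(8)[OF U X t] by blast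
  show "k X t = k' X t"
    using div_arrD(5)[OF k(1) X u(1) unit_objD(4)[OF U X x]] div_arrD(5)[OF k(2) X u(1) unit_objD(4)[OF U X x]]
      e[OF X x] u(2) by simp
qed

text \<open>The trivial torsor is free on its unit section. Every section has the form u e for a
  unique unit u, and is sent to u times the prescribed image of e; the image must have value 1
  because e has.\<close>

lemma unit_obj_arr:
  assumes V: "sheaf V" and P: "div_obj P" and f: "f \<in> Hom V (base P)" and e: "e \<in> Hom V (tot P)"
    and pe: "\<And>X x. X \<in> Obj C \<Longrightarrow> x \<in> sec V X \<Longrightarrow> proj P X (e X x) = f X x \<and> val P X (e X x) = \<one>\<^bsub>mon \<O> X\<^esub>"
  shows "\<exists>k\<in>div_arr (unit_obj V) f P. \<forall>X\<in>Obj C. \<forall>x\<in>sec V X. k X (unit_sec V X x) = e X x"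
proof -
  let ?I = "unit_obj V"
  note I = unit_objD[OF V]
  define R where "R X t s \<longleftrightarrow> (\<exists>u\<in>O_units X. \<exists>x\<in>sec V X. t = act ?I X u (unit_sec V X x) \<and> s = act P X u (e X x))" for X t s
  note ein = Hom_in[OF e] and eres = Hom_res[OF e]
  have "\<exists>k\<in>div_arr ?I f P. \<forall>X\<in>Obj C. \<forall>t\<in>tsec ?I X. \<forall>s. R X t s \<longrightarrow> k X t = s"
  proof (rule div_arr_descent[OF I(1) P])
    show "f \<in> Hom (base ?I) (base P)" using f I(2) by simp
    show "s \<in> tsec P X \<and> proj P X s = f X (proj ?I X t) \<and> val P X s = val ?I X t"
      if X: "X \<in> Obj C" and t: "t \<in> tsec ?I X" and R: "R X t s" for X t s
    proof -
      obtain u x where "u \<in> O_units X" "x \<in> sec V X" "t = act ?I X u (unit_sec V X x)" "s = act P X u (e X x)"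
        using R by (auto simp: R_def)
      then show ?thesis using X ein pe I by (simp add: divT[OF P] divT[OF I(1)] div_objD[OF P] div_objD[OF I(1)])
    qed
    show "s = s'" if X: "X \<in> Obj C" and t: "t \<in> tsec ?I X" and R: "R X t s" "R X t s'" for X t s s'
    proof -
      obtain u x where 1: "u \<in> O_units X" "x \<in> sec V X" "t = act ?I X u (unit_sec V X x)" "s = act P X u (e X x)"
        using R by (auto simp: R_def)
      obtain u' x' where 2: "u' \<in> O_units X" "x' \<in> sec V X" "t = act ?I X u' (unit_sec V X x')" "s' = act P X u' (e X x')"
        using R by (auto simp: R_def)
      have "x = proj ?I X t"
        using 1(1-3) X I by (simp add: divT[OF I(1)])
      moreover have "x' = proj ?I X t"
        unfolding 2(3) using 2(1,2) X I by (simp add: divT[OF I(1)])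
      ultimately have "x = x'" by simp
      moreover from this have "u = u'" using 1(1-3) 2 divT(12)[OF I(1) X I(4)[OF X 1(2)] 1(1) 2(1)] by simp
      ultimately show ?thesis using 1 2 by simp
    qed
    show "R (Dom C h) (res (tot ?I) h t) (res (tot P) h s)"
      if h: "h \<in> Arr C" and t: "t \<in> tsec ?I (Cod C h)" and R: "R (Cod C h) t s" for h t s
    proof -
      note X = Cod_Obj[OF h]
      obtain u x where 1: "u \<in> O_units (Cod C h)" "x \<in> sec V (Cod C h)" "t = act ?I (Cod C h) u (unit_sec V (Cod C h) x)"
         "s = act P (Cod C h) u (e (Cod C h) x)"
        using R by (auto simp: R_def)
      show ?thesis unfolding R_def
        by (rule bexI[of _ "mres \<O> h u"], rule bexI[of _ "res V h x"])
          (use 1 h X ein[OF X 1(2)] I eres[OF h 1(2)] in \<open>auto simp: unit_res res_in[OF V] divT(10)[OF P] divT(10)[OF I(1)]\<close>)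
    qed
    show "R X (act ?I X u t) (act P X u s)"
      if X: "X \<in> Obj C" and t: "t \<in> tsec ?I X" and R: "R X t s" and u: "u \<in> O_units X" for X t s u
    proof -
      obtain v x where 1: "v \<in> O_units X" "x \<in> sec V X" "t = act ?I X v (unit_sec V X x)" "s = act P X v (e X x)"
        using R by (auto simp: R_def)
      show ?thesis unfolding R_def
        by (rule bexI[of _ "u \<otimes>\<^bsub>mon \<O> X\<^esub> v"], rule bexI[of _ x])
          (use 1 X u ein I in \<open>auto simp: unit_mult divT(9)[OF P] divT(9)[OF I(1)]\<close>)
    qed
    show "locally X (\<lambda>h. \<exists>s. R (Dom C h) (res (tot ?I) h t) s)" if X: "X \<in> Obj C" and t: "t \<in> tsec ?I X" for X t
    proof (rule locally_all[OF X])
      fix h assume h: "h \<in> Arr C" "Cod C h = X"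
      have t': "res (tot ?I) h t \<in> tsec ?I (Dom C h)" using res_in[OF divT(2)[OF I(1)] h(1), of t] t h by simp
      have "proj ?I (Dom C h) (res (tot ?I) h t) \<in> sec V (Dom C h)"
        using divT(4)[OF I(1) Dom_Obj[OF h(1)] t'] I(2) by simp
      then show "\<exists>s. R (Dom C h) (res (tot ?I) h t) s"
        using I(8)[OF Dom_Obj[OF h(1)] t'] unfolding R_def by metis
    qed
  qed
  then obtain k where k: "k \<in> div_arr ?I f P" "\<And>X t s. \<lbrakk>X \<in> Obj C; t \<in> tsec ?I X; R X t s\<rbrakk> \<Longrightarrow> k X t = s" by blast
  have "k X (unit_sec V X x) = e X x" if X: "X \<in> Obj C" and x: "x \<in> sec V X" for X x
  proof (rule k(2)[OF X I(4)[OF X x]])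
    show "R X (unit_sec V X x) (e X x)" unfolding R_def
      by (rule bexI[of _ "\<one>\<^bsub>mon \<O> X\<^esub>"], rule bexI[of _ x])
        (use X x ein I in \<open>auto simp: unit_one divT(8)[OF P] divT(8)[OF I(1)]\<close>)
  qed
  then show ?thesis using k(1) by blast
qed

lemma unit_mapD:
  assumes V: "sheaf V" and U: "sheaf U" and f: "f \<in> Hom V U"
  shows "unit_map V f U \<in> div_arr (unit_obj V) f (unit_obj U)" (is ?g1)
    and "X \<in> Obj C \<Longrightarrow> x \<in> sec V X \<Longrightarrow> unit_map V f U X (unit_sec V X x) = unit_sec U X (f X x)" (is "PROP ?g2")
proof -
  note I = unit_objD[OF U]
  have "\<exists>k\<in>div_arr (unit_obj V) f (unit_obj U). \<forall>X\<in>Obj C. \<forall>x\<in>sec V X. k X (unit_sec V X x) = cmp V (unit_sec U) f X x"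
    by (rule unit_obj_arr[OF V I(1) _ cmp_Hom[OF V f I(3)]]) (use f I Hom_in[OF f] in auto)
  then have "\<exists>!k. k \<in> div_arr (unit_obj V) f (unit_obj U) \<and>
     (\<forall>X\<in>Obj C. \<forall>x\<in>sec V X. k X (unit_sec V X x) = unit_sec U X (f X x))"
    using unit_obj_eqI[OF V, of _ f "unit_obj U"] by (auto; metis)
  from theI'[OF this] show ?g1 "PROP ?g2"
    unfolding unit_map_def by simp_all
qed

section \<open>The tensor product\<close>

lemma unit_inv_eqI:
  assumes "X \<in> Obj C" "u \<in> O_units X" "v \<in> O_units X" "u \<otimes>\<^bsub>mon \<O> X\<^esub> v = \<one>\<^bsub>mon \<O> X\<^esub>"
  shows "inv\<^bsub>mon \<O> X\<^esub> u = v"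
  by (rule unit_cancel[of X _ _ u]) (use assms unit_inv in \<open>auto simp: unit_in\<close>)

lemma unit_inv_res: "f \<in> Arr C \<Longrightarrow> u \<in> O_units (Cod C f) \<Longrightarrow>
    mres \<O> f (inv\<^bsub>mon \<O> (Cod C f)\<^esub> u) = inv\<^bsub>mon \<O> (Dom C f)\<^esub> (mres \<O> f u)"
  by (rule unit_inv_eqI[symmetric])
    (use unit_inv[of "Cod C f" u] in \<open>auto simp: unit_res O_res_mult[symmetric] O_res_one Cod_Obj Dom_Obj unit_in\<close>)

text \<open>The sheaf quotient of pairs over one base point. \<open>quotient_sheaf\<close> asks for
  a local relation: the unit that relates two pairs is unique since P is a torsor, so local ones
  glue. Projection, value and action descend from pairs; the axioms of a torsor for the quotient are
  then checked where sections are represented by pairs.\<close>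

lemma contracted_product_exists:
  assumes P: "div_obj P" and Q: "div_obj Q" and b: "base Q = base P"
  shows "\<exists>T \<tau>. contracted_product P Q T \<tau>"
proof -
  define E where "E X = {(p, q). p \<in> tsec P X \<and> q \<in> tsec Q X \<and> proj P X p = proj Q X q}" for X
  define r where "r f = map_prod (res (tot P) f) (res (tot Q) f)" for f
  \<comment> \<open>The relation between (p, q) and (u p, v q) with v inverse to u, written with the
    inverse moved to the other side.\<close>
  define eq where "eq X z z' \<longleftrightarrow> (\<exists>u\<in>O_units X. act P X u (fst z) = fst z' \<and> act Q X u (snd z') = snd z)" for X z z'
  note sP = divT(2)[OF P] and sQ = divT(2)[OF Q]
  have E_iff: "(p, q) \<in> E X \<longleftrightarrow> p \<in> tsec P X \<and> q \<in> tsec Q X \<and> proj P X p = proj Q X q" for X p q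
    by (simp add: E_def)
  have ED: "fst z \<in> tsec P X" "snd z \<in> tsec Q X" if "z \<in> E X" for X z
    using that by (auto simp: E_def)
  have r: "presheaf_on E r"
    unfolding presheaf_on_def E_def r_def using res_in[OF sP] res_in[OF sQ] divT(5)[OF P] divT(5)[OF Q] b
    by (auto simp: res_Idt[OF sP] res_Idt[OF sQ] res_Cmp[OF sP] res_Cmp[OF sQ])
  obtain F qm where F: "sheaf F" and qm: "\<And>X e. \<lbrakk>X \<in> Obj C; e \<in> E X\<rbrakk> \<Longrightarrow> qm X e \<in> sec F X"
    and qr: "\<And>f e. \<lbrakk>f \<in> Arr C; e \<in> E (Cod C f)\<rbrakk> \<Longrightarrow> res F f (qm (Cod C f) e) = qm (Dom C f) (r f e)"
    and qe: "\<And>X e e'. \<lbrakk>X \<in> Obj C; e \<in> E X; e' \<in> E X\<rbrakk> \<Longrightarrow> qm X e = qm X e' \<longleftrightarrow> eq X e e'"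
    and ql: "\<And>X t. \<lbrakk>X \<in> Obj C; t \<in> sec F X\<rbrakk> \<Longrightarrow> locally X (\<lambda>f. \<exists>e\<in>E (Dom C f). qm (Dom C f) e = res F f t)"
  proof (rule quotient_sheaf[of E r eq])
    fix X e e' e'' assume X: "X \<in> Obj C" and e: "e \<in> E X"
    show "eq X e e" unfolding eq_def
      by (rule bexI[OF _ unit_one[OF X]]) (simp add: divT(8)[OF P X] divT(8)[OF Q X] ED[OF e])
    assume e': "e' \<in> E X"
    { assume "eq X e e'"
      then obtain u where u: "u \<in> O_units X" "act P X u (fst e) = fst e'" "act Q X u (snd e') = snd e" by (auto simp: eq_def)
      show "eq X e' e" unfolding eq_def
        by (rule bexI[OF _ unit_inv(1)[OF X u(1)]])
          (simp add: act_inv[OF div_objD(1)] P Q X u ED[OF e] ED[OF e'] flip: u(2,3))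
      assume e'': "e'' \<in> E X" and "eq X e' e''"
      then obtain v where v: "v \<in> O_units X" "act P X v (fst e') = fst e''" "act Q X v (snd e'') = snd e'" by (auto simp: eq_def)
      note uv = unit_mult[OF X u(1) v(1)] unit_comm[OF X unit_in[OF X u(1)] unit_in[OF X v(1)]]
      have "act P X (u \<otimes>\<^bsub>mon \<O> X\<^esub> v) (fst e) = fst e''"
        unfolding uv(2) using divT(9)[OF P X v(1) u(1) ED(1)[OF e]] u v by simp
      moreover have "act Q X (u \<otimes>\<^bsub>mon \<O> X\<^esub> v) (snd e'') = snd e"
        using divT(9)[OF Q X u(1) v(1) ED(2)[OF e'']] u v by simp
      ultimately show "eq X e e''" using uv(1) by (auto simp: eq_def) }
    assume l: "locally X (\<lambda>f. eq (Dom C f) (r f e) (r f e'))"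
    define D where "D f u \<longleftrightarrow> u \<in> O_units (Dom C f) \<and> act P (Dom C f) u (res (tot P) f (fst e)) = res (tot P) f (fst e') \<and>
      act Q (Dom C f) u (res (tot Q) f (snd e')) = res (tot Q) f (snd e)" for f u
    have rD: "res (tot P) f (fst e) \<in> tsec P (Dom C f)" "res (tot P) f (fst e') \<in> tsec P (Dom C f)"
      "res (tot Q) f (snd e) \<in> tsec Q (Dom C f)" "res (tot Q) f (snd e') \<in> tsec Q (Dom C f)"
      if "f \<in> Arr C" "Cod C f = X" for f
      using res_in[OF sP that(1)] res_in[OF sQ that(1)] that ED[OF e] ED[OF e'] by simp_all
    obtain u where u: "u \<in> O_units X" and lu: "locally X (\<lambda>f. D f (mres \<O> f u))"
    proof (rule unit_glue[OF X, of D])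
      fix f v assume f: "f \<in> Arr C" "Cod C f = X" and v: "D f v"
      show "v \<in> O_units (Dom C f)" using v by (simp add: D_def)
      show "v = w" if "D f w" for w
        using divT(12)[OF P Dom_Obj[OF f(1)] rD(1)[OF f], of v w] v that by (simp add: D_def)
      fix g assume g: "g \<in> Arr C" "Cod C g = Dom C f"
      show "D (Cmp C f g) (mres \<O> g v)"
        using v f g divT(10)[OF P g(1), of v "res (tot P) f (fst e)"] divT(10)[OF Q g(1), of v "res (tot Q) f (snd e')"]
          res_Cmp[OF sP f(1) g] res_Cmp[OF sQ f(1) g] ED[OF e] ED[OF e'] rD[OF f] unit_res[OF g(1), of v]
        by (simp add: D_def Dom_Cmp)
    next
      show "locally X (\<lambda>f. \<exists>u. D f u)"
        by (rule locally_mono[OF l X]) (auto simp: D_def eq_def r_def)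
    qed
    have "act P X u (fst e) = fst e'"
      by (rule sheaf_sep[OF sP X divT(6)[OF P X u ED(1)[OF e]] ED(1)[OF e'] locally_mono[OF lu X]])
        (use divT(10)[OF P, of _ u "fst e"] u ED[OF e] in \<open>auto simp: D_def\<close>)
    moreover have "act Q X u (snd e') = snd e"
      by (rule sheaf_sep[OF sQ X divT(6)[OF Q X u ED(2)[OF e']] ED(2)[OF e] locally_mono[OF lu X]])
        (use divT(10)[OF Q, of _ u "snd e'"] u ED[OF e'] in \<open>auto simp: D_def\<close>)
    ultimately show "eq X e e'" using u by (auto simp: eq_def)
  next
    fix f e e' assume f: "f \<in> Arr C" and e: "e \<in> E (Cod C f)" "e' \<in> E (Cod C f)" and "eq (Cod C f) e e'"
    then obtain u where u: "u \<in> O_units (Cod C f)" "act P (Cod C f) u (fst e) = fst e'" "act Q (Cod C f) u (snd e') = snd e"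
      by (auto simp: eq_def)
    then show "eq (Dom C f) (r f e) (r f e')"
      using divT(10)[OF P f u(1) ED(1)[OF e(1)]] divT(10)[OF Q f u(1) ED(2)[OF e(2)]] unit_res[OF f u(1)]
      by (auto simp: eq_def r_def)
  next
    fix X assume X: "X \<in> Obj C"
    obtain e :: "'u \<times> 'u \<Rightarrow> 'u" where "inj_on e (tsec P X \<times> tsec Q X)" "e ` (tsec P X \<times> tsec Q X) \<in> \<V>"
      using small_Times sheaf_small[OF sP X] sheaf_small[OF sQ X] by blast
    moreover have "E X \<subseteq> tsec P X \<times> tsec Q X" by (auto simp: E_def)
    ultimately show "\<exists>i :: 'u \<times> 'u \<Rightarrow> 'u. \<exists>B\<in>\<V>. inj_on i (E X) \<and> i ` E X \<subseteq> B" by (meson image_mono inj_on_subset)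
  qed (use r in blast)+
  have qm_cases: "\<exists>p q. z = (p, q) \<and> p \<in> tsec P X \<and> q \<in> tsec Q X \<and> proj P X p = proj Q X q" if "z \<in> E X" for X z
    using that by (auto simp: E_def)
  have qeD: "\<exists>u\<in>O_units X. act P X u p = p' \<and> act Q X u q' = q"
    if "X \<in> Obj C" "(p, q) \<in> E X" "(p', q') \<in> E X" "qm X (p, q) = qm X (p', q')" for X p q p' q'
    using qe[OF that(1-3)] that(4) by (simp add: eq_def)
  have qeI: "qm X (p, q) = qm X (p', q')"
    if "X \<in> Obj C" "(p, q) \<in> E X" "(p', q') \<in> E X" "u \<in> O_units X" "act P X u p = p'" "act Q X u q' = q" for X p q p' q' u
    using qe[OF that(1-3)] that(4-6) by (auto simp: eq_def)
  have actE: "(act P X u p, q) \<in> E X" "(p, act Q X u q) \<in> E X" if "X \<in> Obj C" "(p, q) \<in> E X" "u \<in> O_units X" for X p q u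
    using that divT(6,7)[OF P that(1,3)] divT(6,7)[OF Q that(1,3)] by (auto simp: E_iff)
  have qmQ: "qm X (p, act Q X u q) = qm X (act P X u p, q)" if X: "X \<in> Obj C" and pq: "(p, q) \<in> E X" and u: "u \<in> O_units X" for X p q u
    by (rule qeI[OF X actE(2,1)[OF X pq u] u]) simp_all
  have qr': "res F f (qm X (p, q)) = qm (Dom C f) (res (tot P) f p, res (tot Q) f q)" if "f \<in> Arr C" "Cod C f = X" "(p, q) \<in> E X" for f X p q
    using qr[OF that(1), of "(p, q)"] that by (simp add: r_def)
  have rE': "(res (tot P) f p, res (tot Q) f q) \<in> E (Dom C f)" if "f \<in> Arr C" "Cod C f = X" "(p, q) \<in> E X" for f X p q
    using presheaf_onD(1)[OF r that(1), of "(p, q)"] that by (simp add: r_def)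
  \<comment> \<open>The reduction used for all identities on the quotient: an equation between
    sections that depend on t may be checked where t is the class of a pair.\<close>
  have lE: "s = s'" if G: "sheaf G" and X: "X \<in> Obj C" and t: "t \<in> sec F X" and s: "s \<in> sec G X" "s' \<in> sec G X"
    and e: "\<And>f p q. \<lbrakk>f \<in> Arr C; Cod C f = X; (p, q) \<in> E (Dom C f); res F f t = qm (Dom C f) (p, q)\<rbrakk> \<Longrightarrow>
      res G f s = res G f s'"
    for G X t s s'
  proof (rule sheaf_sep[OF G X s], rule locally_mono[OF ql[OF X t] X])
    fix f assume f: "f \<in> Arr C" "Cod C f = X" and "\<exists>e\<in>E (Dom C f). qm (Dom C f) e = res F f t"
    then obtain p q where "(p, q) \<in> E (Dom C f)" "qm (Dom C f) (p, q) = res F f t" by auto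
    with e[OF f, of p q] show "res G f s = res G f s'" by simp
  qed
  have cval: "val P X p \<otimes>\<^bsub>mon \<O> X\<^esub> val Q X q \<in> carrier (mon \<O> X)" if "X \<in> Obj C" "(p, q) \<in> E X" for X p q
    using that div_objD(3)[OF P] div_objD(3)[OF Q] O_monoid[OF that(1)] by (auto simp: E_iff monoid.m_closed)
  have aval: "val P X (act P X u p) \<otimes>\<^bsub>mon \<O> X\<^esub> val Q X q = u \<otimes>\<^bsub>mon \<O> X\<^esub> (val P X p \<otimes>\<^bsub>mon \<O> X\<^esub> val Q X q)"
    "val P X p \<otimes>\<^bsub>mon \<O> X\<^esub> val Q X (act Q X u q) = u \<otimes>\<^bsub>mon \<O> X\<^esub> (val P X p \<otimes>\<^bsub>mon \<O> X\<^esub> val Q X q)"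
    if X: "X \<in> Obj C" and pq: "(p, q) \<in> E X" and u: "u \<in> O_units X" for X p q u
  proof -
    interpret comm_monoid "mon \<O> X" by (rule O_comm_monoid[OF X])
    note c = pq[unfolded E_iff]
    show "val P X (act P X u p) \<otimes>\<^bsub>mon \<O> X\<^esub> val Q X q = u \<otimes>\<^bsub>mon \<O> X\<^esub> (val P X p \<otimes>\<^bsub>mon \<O> X\<^esub> val Q X q)"
      "val P X p \<otimes>\<^bsub>mon \<O> X\<^esub> val Q X (act Q X u q) = u \<otimes>\<^bsub>mon \<O> X\<^esub> (val P X p \<otimes>\<^bsub>mon \<O> X\<^esub> val Q X q)"
      using c div_objD(3,5)[OF P X] div_objD(3,5)[OF Q X] u unit_in[OF X u] by (simp_all add: m_ac)
  qed
  note PD = divT[OF P] and QD = divT[OF Q]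
  obtain kp where kp: "\<And>X t. \<lbrakk>X \<in> Obj C; t \<in> sec F X\<rbrakk> \<Longrightarrow> kp X t \<in> sec (base P) X"
    and kpq: "\<And>X e. \<lbrakk>X \<in> Obj C; e \<in> E X\<rbrakk> \<Longrightarrow> kp X (qm X e) = proj P X (fst e)"
    and kpr: "\<And>f t. \<lbrakk>f \<in> Arr C; t \<in> sec F (Cod C f)\<rbrakk> \<Longrightarrow> kp (Dom C f) (res F f t) = res (base P) f (kp (Cod C f) t)"
  proof (rule quotient_descent[OF PD(1) presheaf_on_sheaf[OF F], of E r qm "\<lambda>X e. proj P X (fst e)"], goal_cases)
    case (1 f e)
    note 1 = 1(2-)
    then show ?case using presheaf_onD(1)[OF r 1] qr[OF 1] PD(5)[OF 1(1) ED(1)[OF 1(2)]] by (simp add: r_def)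
  next
    case (5 X e e')
    note 5 = 5(2-)
    then show ?case using qeD[of X "fst e" "snd e" "fst e'" "snd e'"] PD(7) ED by (metis prod.collapse)
  qed (use ql qm PD(4) ED in auto)
  obtain kv where kv: "\<And>X t. \<lbrakk>X \<in> Obj C; t \<in> sec F X\<rbrakk> \<Longrightarrow> kv X t \<in> sec (und \<O>) X"
    and kvq: "\<And>X e. \<lbrakk>X \<in> Obj C; e \<in> E X\<rbrakk> \<Longrightarrow> kv X (qm X e) = val P X (fst e) \<otimes>\<^bsub>mon \<O> X\<^esub> val Q X (snd e)"
    and kvr: "\<And>f t. \<lbrakk>f \<in> Arr C; t \<in> sec F (Cod C f)\<rbrakk> \<Longrightarrow> kv (Dom C f) (res F f t) = res (und \<O>) f (kv (Cod C f) t)"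
  proof (rule quotient_descent[OF sheaf_O presheaf_on_sheaf[OF F], of E r qm "\<lambda>X e. val P X (fst e) \<otimes>\<^bsub>mon \<O> X\<^esub> val Q X (snd e)"], goal_cases)
    case (1 f e)
    note 1 = 1(2-)
    note X = Cod_Obj[OF 1(1)] and c = ED[OF 1(2)]
    show ?case using presheaf_onD(1)[OF r 1] qr[OF 1] div_objD(4)[OF P 1(1) c(1)] div_objD(4)[OF Q 1(1) c(2)]
        div_objD(3)[OF P X c(1)] div_objD(3)[OF Q X c(2)] O_res_mult[OF 1(1)] by (simp add: r_def)
  next
    case (5 X e e')
    note 5 = 5(2-)
    obtain p q p' q' where e: "e = (p, q)" "e' = (p', q')" by (cases e, cases e')
    obtain u where u: "u \<in> O_units X" "act P X u p = p'" "act Q X u q' = q" using qeD[of X p q p' q'] 5 e by blast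
    have "(p, q') \<in> E X" using 5(2,3) u PD(7)[OF 5(1) u(1), of p] by (simp add: E_iff e)
    from aval[OF 5(1) this u(1)] show ?case using u by (simp add: e)
  qed (use ql qm cval in \<open>auto simp: E_iff\<close>)
  have OU: "presheaf_on O_units (mres \<O>)"
    unfolding presheaf_on_def using unit_res unit_in res_Idt[OF sheaf_O] res_Cmp[OF sheaf_O] Cod_Obj by simp
  define E' where "E' X = O_units X \<times> E X" for X
  \<comment> \<open>The action has two arguments, so it is descended from units times pairs to units
    times F; on pairs it translates the first component.\<close>
  obtain ka' where ka': "\<And>X t. \<lbrakk>X \<in> Obj C; t \<in> O_units X \<times> sec F X\<rbrakk> \<Longrightarrow> ka' X t \<in> sec F X"
    and kaq': "\<And>X e. \<lbrakk>X \<in> Obj C; e \<in> E' X\<rbrakk> \<Longrightarrow> ka' X (map_prod id (qm X) e) = qm X (act P X (fst e) (fst (snd e)), snd (snd e))"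
    and kar': "\<And>f t. \<lbrakk>f \<in> Arr C; t \<in> O_units (Cod C f) \<times> sec F (Cod C f)\<rbrakk> \<Longrightarrow>
      ka' (Dom C f) (map_prod (mres \<O> f) (res F f) t) = res F f (ka' (Cod C f) t)"
  proof (rule quotient_descent[OF F presheaf_on_Times[OF OU presheaf_on_sheaf[OF F]], of E' "\<lambda>f. map_prod (mres \<O> f) (r f)"
      "\<lambda>X. map_prod id (qm X)" "\<lambda>X e. qm X (act P X (fst e) (fst (snd e)), snd (snd e))"], goal_cases)
    case (1 f e)
    note 1 = 1(2-)
    obtain u p q where e: "e = (u, p, q)" by (cases e)
    have u: "u \<in> O_units (Cod C f)" and pq: "(p, q) \<in> E (Cod C f)" using 1 by (auto simp: E'_def e)
    show ?case using unit_res[OF 1(1) u] qr'[OF 1(1) refl pq] qr'[OF 1(1) refl actE(1)[OF Cod_Obj[OF 1(1)] pq u]]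
        rE'[OF 1(1) refl pq] PD(10)[OF 1(1) u] pq by (simp add: E'_def e r_def E_iff)
  next
    case (2 X e)
    note 2 = 2(2-)
    then show ?case using qm by (auto simp: E'_def)
  next
    case (3 X t)
    note 3 = 3(2-)
    show ?case
    proof (rule locally_mono[OF ql[OF 3(1), of "snd t"] 3(1)])
      fix f assume f: "f \<in> Arr C" "Cod C f = X" and "\<exists>e\<in>E (Dom C f). qm (Dom C f) e = res F f (snd t)"
      then obtain e where e: "e \<in> E (Dom C f)" "qm (Dom C f) e = res F f (snd t)" by blast
      show "\<exists>e\<in>E' (Dom C f). map_prod id (qm (Dom C f)) e = map_prod (mres \<O> f) (res F f) t"
        by (rule bexI[of _ "(mres \<O> f (fst t), e)"]) (use e f 3(2) unit_res[OF f(1)] in \<open>auto simp: E'_def\<close>)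
    qed (use 3 in auto)
  next
    case (4 X e)
    note 4 = 4(2-)
    then show ?case using qm actE(1) by (auto simp: E'_def)
  next
    case (5 X e e')
    note 5 = 5(2-)
    obtain w p q w' p' q' where e: "e = (w, p, q)" "e' = (w', p', q')" by (cases e, cases e')
    have w: "w' = w" "w \<in> O_units X" and pq: "(p, q) \<in> E X" "(p', q') \<in> E X" and eq: "qm X (p, q) = qm X (p', q')"
      using 5 by (auto simp: E'_def e)
    obtain u where u: "u \<in> O_units X" "act P X u p = p'" "act Q X u q' = q" using qeD[OF 5(1) pq eq] by blast
    \<comment> \<open>Units commute, so the unit u that relates (p, q) to (p', q') also relates the
      translates of these pairs by w.\<close>
    have "act P X u (act P X w p) = act P X w p'"
      using PD(9)[OF 5(1) u(1) w(2), of p] PD(9)[OF 5(1) w(2) u(1), of p] unit_comm[OF 5(1), of u w] unit_in[OF 5(1)] u w pq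
      by (simp add: E_iff)
    then show ?case using qeI[OF 5(1) actE(1)[OF 5(1) pq(1) w(2)] actE(1)[OF 5(1) pq(2) w(2)] u(1)] u w by (simp add: e)
  qed blast
  define ka where "ka X u t = ka' X (u, t)" for X u t
  have ka: "ka X u t \<in> sec F X" if "X \<in> Obj C" "u \<in> O_units X" "t \<in> sec F X" for X u t
    using ka'[OF that(1)] that by (simp add: ka_def)
  have kaq: "ka X u (qm X (p, q)) = qm X (act P X u p, q)" if "X \<in> Obj C" "u \<in> O_units X" "(p, q) \<in> E X" for X u p q
    using kaq'[OF that(1), of "(u, p, q)"] that by (simp add: ka_def E'_def)
  have kar: "res F f (ka X u t) = ka (Dom C f) (mres \<O> f u) (res F f t)" if "f \<in> Arr C" "Cod C f = X" "u \<in> O_units X" "t \<in> sec F X" for f X u t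
    using kar'[OF that(1), of "(u, t)"] that by (simp add: ka_def)
  have kpq': "kp X (qm X (p, q)) = proj P X p" if "X \<in> Obj C" "(p, q) \<in> E X" for X p q
    using kpq[OF that] by simp
  have kvq': "kv X (qm X (p, q)) = val P X p \<otimes>\<^bsub>mon \<O> X\<^esub> val Q X q" if "X \<in> Obj C" "(p, q) \<in> E X" for X p q
    using kvq[OF that] by simp
  have kpr': "res (base P) f (kp X t) = kp (Dom C f) (res F f t)" if "f \<in> Arr C" "Cod C f = X" "t \<in> sec F X" for f X t
    using kpr that by auto
  have kvr': "mres \<O> f (kv X t) = kv (Dom C f) (res F f t)" if "f \<in> Arr C" "Cod C f = X" "t \<in> sec F X" for f X t
    using kvr that by auto
  have kvc: "kv X t \<in> carrier (mon \<O> X)" if "X \<in> Obj C" "t \<in> sec F X" for X t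
    using kv[OF that] by simp
  have rF: "res F f t \<in> sec F (Dom C f)" if "f \<in> Arr C" "Cod C f = X" "t \<in> sec F X" for f X t
    using res_in[OF F] that by auto
  have ur: "mres \<O> f u \<in> O_units (Dom C f)" if "f \<in> Arr C" "Cod C f = X" "u \<in> O_units X" for f X u
    using unit_res that by auto
  \<comment> \<open>If u and v translate the class of (p, q) to the same class, the unit w relating
    the translated pairs fixes q. Freeness on Q gives that w is 1, and freeness on P then gives
    equality of u and v, locally and hence globally.\<close>
  have free: "u = v" if X: "X \<in> Obj C" and u: "u \<in> O_units X" and v: "v \<in> O_units X" and t: "t \<in> sec F X" and eq: "ka X u t = ka X v t" for X u v t
  proof (rule lE[OF sheaf_O X t])
    show "u \<in> sec (und \<O>) X" "v \<in> sec (und \<O>) X" using unit_in[OF X] u v by simp_all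
    fix f p q assume f: "f \<in> Arr C" "Cod C f = X" and pq: "(p, q) \<in> E (Dom C f)" and ft: "res F f t = qm (Dom C f) (p, q)"
    note fo = Dom_Obj[OF f(1)] and pq' = pq[unfolded E_iff]
    note uu = ur[OF f u] ur[OF f v]
    have "qm (Dom C f) (act P (Dom C f) (mres \<O> f u) p, q) = qm (Dom C f) (act P (Dom C f) (mres \<O> f v) p, q)"
      using kar[OF f u t] kar[OF f v t] eq kaq[OF fo uu(1) pq] kaq[OF fo uu(2) pq] ft by simp
    then obtain w where w: "w \<in> O_units (Dom C f)" "act P (Dom C f) w (act P (Dom C f) (mres \<O> f u) p) = act P (Dom C f) (mres \<O> f v) p"
       "act Q (Dom C f) w q = q" using qeD[OF fo actE(1)[OF fo pq uu(1)] actE(1)[OF fo pq uu(2)]] by blast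
    have "w = \<one>\<^bsub>mon \<O> (Dom C f)\<^esub>"
      using QD(12)[OF fo _ w(1) unit_one[OF fo], of q] w(3) pq' QD(8)[OF fo] by simp
    then have "act P (Dom C f) (mres \<O> f v) p = act P (Dom C f) (mres \<O> f u) p"
      using w(2) PD(8)[OF fo] PD(6)[OF fo uu(1)] pq' by simp
    then have "mres \<O> f v = mres \<O> f u" using PD(12)[OF fo _ uu(2,1)] pq' by simp
    then show "res (und \<O>) f u = res (und \<O>) f v" by simp
  qed
  define T where "T = \<lparr>base = base P, tot = F, proj = mk F kp, act = ka, val = mk F kv\<rparr>"
  have T_simps: "base T = base P" "tot T = F" "act T = ka" "\<And>X t. X \<in> Obj C \<Longrightarrow> t \<in> sec F X \<Longrightarrow> proj T X t = kp X t"
     "\<And>X t. X \<in> Obj C \<Longrightarrow> t \<in> sec F X \<Longrightarrow> val T X t = kv X t"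
    by (simp_all add: T_def)
  have tT: "torsor T"
    unfolding torsor_def T_simps(1-3)
  proof (intro conjI ballI impI)
    show "sheaf (base P)" "sheaf F" "proj T \<in> Hom F (base P)"
      using divT(1)[OF P] F kp kpr by (auto simp: T_def intro!: mk_Hom)
    fix X u t assume X: "X \<in> Obj C" and u: "u \<in> O_units X" and t: "t \<in> sec F X"
    show kt: "ka X u t \<in> sec F X" by (rule ka[OF X u t])
    have "kp X (ka X u t) = kp X t"
    proof (rule lE[OF divT(1)[OF P] X t kp[OF X kt] kp[OF X t]])
      fix f p q assume f: "f \<in> Arr C" "Cod C f = X" and pq: "(p, q) \<in> E (Dom C f)" and ft: "res F f t = qm (Dom C f) (p, q)"
      note fo = Dom_Obj[OF f(1)]
      show "res (base P) f (kp X (ka X u t)) = res (base P) f (kp X t)"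
        using kpr'[OF f kt] kpr'[OF f t] kar[OF f u t] ft kaq[OF fo ur[OF f u] pq] kpq'[OF fo pq] kpq'[OF fo actE(1)[OF fo pq ur[OF f u]]]
          divT(7)[OF P fo ur[OF f u]] pq by (simp add: E_iff)
    qed
    then show "proj T X (ka X u t) = proj T X t" using T_simps(4)[OF X] kt t by simp
    fix v assume v: "v \<in> O_units X"
    note uv = unit_mult[OF X u v]
    show "ka X (u \<otimes>\<^bsub>mon \<O> X\<^esub> v) t = ka X u (ka X v t)"
    proof (rule lE[OF F X t ka[OF X uv t] ka[OF X u ka[OF X v t]]])
      fix f p q assume f: "f \<in> Arr C" "Cod C f = X" and pq: "(p, q) \<in> E (Dom C f)" and ft: "res F f t = qm (Dom C f) (p, q)"
      note fo = Dom_Obj[OF f(1)]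
      show "res F f (ka X (u \<otimes>\<^bsub>mon \<O> X\<^esub> v) t) = res F f (ka X u (ka X v t))"
        using kar[OF f uv t] kar[OF f u ka[OF X v t]] kar[OF f v t] ft kaq[OF fo ur[OF f uv] pq] kaq[OF fo ur[OF f v] pq]
          kaq[OF fo ur[OF f u] actE(1)[OF fo pq ur[OF f v]]] O_res_mult[OF f(1), of u v] unit_in[OF X] u v f
          divT(9)[OF P fo ur[OF f u] ur[OF f v], of p] pq by (simp add: E_iff)
    qed
  next
    fix X t assume X: "X \<in> Obj C" and t: "t \<in> sec F X"
    note o = unit_one[OF X]
    show "ka X \<one>\<^bsub>mon \<O> X\<^esub> t = t"
    proof (rule lE[OF F X t ka[OF X o t] t])
      fix f p q assume f: "f \<in> Arr C" "Cod C f = X" and pq: "(p, q) \<in> E (Dom C f)" and ft: "res F f t = qm (Dom C f) (p, q)"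
      note fo = Dom_Obj[OF f(1)]
      show "res F f (ka X \<one>\<^bsub>mon \<O> X\<^esub> t) = res F f t"
        using kar[OF f o t] O_res_one[OF f(1)] f ft kaq[OF fo unit_one[OF fo] pq] divT(8)[OF P fo] pq by (simp add: E_iff)
    qed
  next
    fix f u t assume "f \<in> Arr C" "u \<in> O_units (Cod C f)" "t \<in> sec F (Cod C f)"
    then show "res F f (ka (Cod C f) u t) = ka (Dom C f) (mres \<O> f u) (res F f t)" using kar by blast
  next
    fix X t t' assume X: "X \<in> Obj C" and t: "t \<in> sec F X" and t': "t' \<in> sec F X" and "proj T X t = proj T X t'"
    then have pp: "kp X t = kp X t'" using T_simps(4)[OF X] by simp
    \<comment> \<open>Locally the two sections are classes of pairs over the same base point, say p'
      = a p and q' = b q, so the unit b a carries one class to the other. By \<open>free\<close> it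
      is unique, and the local units glue.\<close>
    define D where "D f u \<longleftrightarrow> u \<in> O_units (Dom C f) \<and> ka (Dom C f) u (res F f t) = res F f t'" for f u
    have loc: "locally X (\<lambda>f. \<exists>u. D f u)"
    proof (rule locally_mono[OF locally_conj[OF ql[OF X t] ql[OF X t'] X] X])
      fix f assume f: "f \<in> Arr C" "Cod C f = X" and
        "(\<exists>e\<in>E (Dom C f). qm (Dom C f) e = res F f t) \<and> (\<exists>e\<in>E (Dom C f). qm (Dom C f) e = res F f t')"
      then obtain p q p' q' where 1: "(p, q) \<in> E (Dom C f)" "qm (Dom C f) (p, q) = res F f t"
        "(p', q') \<in> E (Dom C f)" "qm (Dom C f) (p', q') = res F f t'" using qm_cases by auto
      note fo = Dom_Obj[OF f(1)]
      have p: "proj P (Dom C f) p = proj P (Dom C f) p'"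
        using kpq'[OF fo 1(1)] kpq'[OF fo 1(3)] 1 kpr'[OF f t] kpr'[OF f t'] pp by simp
      then have q: "proj Q (Dom C f) q = proj Q (Dom C f) q'" using 1 by (simp add: E_iff)
      obtain a where a: "a \<in> O_units (Dom C f)" "act P (Dom C f) a p = p'" using divT(11)[OF P fo _ _ p] 1 by (auto simp: E_iff)
      obtain b where b: "b \<in> O_units (Dom C f)" "act Q (Dom C f) b q = q'" using divT(11)[OF Q fo _ _ q] 1 by (auto simp: E_iff)
      have "ka (Dom C f) (b \<otimes>\<^bsub>mon \<O> (Dom C f)\<^esub> a) (res F f t) = res F f t'"
        using kaq[OF fo unit_mult[OF fo b(1) a(1)] 1(1)] 1 divT(9)[OF P fo b(1) a(1), of p]
          qmQ[OF fo actE(1)[OF fo 1(1) a(1)] b(1)] a b by (simp add: E_iff)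
      then show "\<exists>u. D f u" using unit_mult[OF fo b(1) a(1)] by (auto simp: D_def)
    qed
    obtain u where uu: "u \<in> O_units X" and lu: "locally X (\<lambda>f. D f (mres \<O> f u))"
    proof (rule unit_glue[OF X _ _ _ loc])
      fix f y assume f: "f \<in> Arr C" "Cod C f = X" and y: "D f y"
      show "y \<in> O_units (Dom C f)" using y by (simp add: D_def)
      show "y = y'" if "D f y'" for y' using free[OF Dom_Obj[OF f(1)] _ _ rF[OF f t], of y y'] y that by (simp add: D_def)
      fix g assume g: "g \<in> Arr C" "Cod C g = Dom C f"
      show "D (Cmp C f g) (mres \<O> g y)"
        using y f g kar[OF g, of y "res F f t"] rF[OF f t] ur[OF g, of y] res_Cmp[OF F f(1) g, of t] res_Cmp[OF F f(1) g, of t'] t t'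
        by (simp add: D_def Dom_Cmp)
    qed
    have "ka X u t = t'"
      by (rule sheaf_sep[OF F X ka[OF X uu t] t'], rule locally_mono[OF lu X]) (use kar[OF _ _ uu t] in \<open>simp add: D_def\<close>)
    then show "\<exists>!u. u \<in> O_units X \<and> ka X u t = t'"
      using free[OF X _ _ t] uu by (intro ex1I[of _ u]) auto
  next
    fix X x assume X: "X \<in> Obj C" and x: "x \<in> sec (base P) X"
    have "locally X (\<lambda>f. \<exists>t\<in>sec F (Dom C f). proj T (Dom C f) t = res (base P) f x)"
    proof (rule locally_mono[OF locally_conj[OF divT(13)[OF P X x] divT(13)[OF Q X] X] X])
      show "x \<in> sec (base Q) X" using x b by simp
      fix f assume f: "f \<in> Arr C" "Cod C f = X" and
        "(\<exists>p\<in>tsec P (Dom C f). proj P (Dom C f) p = res (base P) f x) \<and> (\<exists>p\<in>tsec Q (Dom C f). proj Q (Dom C f) p = res (base Q) f x)"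
      then obtain p q where "p \<in> tsec P (Dom C f)" "proj P (Dom C f) p = res (base P) f x"
        "q \<in> tsec Q (Dom C f)" "proj Q (Dom C f) q = res (base Q) f x" by blast
      then have 1: "(p, q) \<in> E (Dom C f)" "proj P (Dom C f) p = res (base P) f x"
        using b by (simp_all add: E_iff)
      note fo = Dom_Obj[OF f(1)]
      show "\<exists>t\<in>sec F (Dom C f). proj T (Dom C f) t = res (base P) f x"
        using qm[OF fo 1(1)] kpq'[OF fo 1(1)] 1(2) T_simps(4)[OF fo qm[OF fo 1(1)]] by auto
    qed
    then show "\<exists>S\<in>J X. \<forall>f\<in>S. \<exists>t\<in>sec F (Dom C f). proj T (Dom C f) t = res (base P) f x"
      by (simp add: locally_def)
  qed
  have dT: "div_obj T"
    unfolding div_obj_def T_simps(2,3)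
  proof (intro conjI ballI tT)
    show "val T \<in> Hom F (und \<O>)" using F kv kvr by (auto simp: T_def intro!: mk_Hom)
    fix X u t assume X: "X \<in> Obj C" and u: "u \<in> O_units X" and t: "t \<in> sec F X"
    note kt = ka[OF X u t]
    have "kv X (ka X u t) = u \<otimes>\<^bsub>mon \<O> X\<^esub> kv X t"
    proof (rule lE[OF sheaf_O X t])
      show "kv X (ka X u t) \<in> sec (und \<O>) X" "u \<otimes>\<^bsub>mon \<O> X\<^esub> kv X t \<in> sec (und \<O>) X"
        using kvc[OF X kt] kvc[OF X t] unit_in[OF X u] O_monoid[OF X] by (simp_all add: monoid.m_closed)
      fix f p q assume f: "f \<in> Arr C" "Cod C f = X" and pq: "(p, q) \<in> E (Dom C f)" and ft: "res F f t = qm (Dom C f) (p, q)"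
      note fo = Dom_Obj[OF f(1)]
      show "res (und \<O>) f (kv X (ka X u t)) = res (und \<O>) f (u \<otimes>\<^bsub>mon \<O> X\<^esub> kv X t)"
        using kvr'[OF f kt] kvr'[OF f t] kar[OF f u t] ft kaq[OF fo ur[OF f u] pq] kvq'[OF fo pq] kvq'[OF fo actE(1)[OF fo pq ur[OF f u]]]
          O_res_mult[OF f(1), of u "kv X t"] kvc[OF X t] f unit_in[OF X u] aval[OF fo pq ur[OF f u]] by simp
    qed
    then show "val T X (ka X u t) = u \<otimes>\<^bsub>mon \<O> X\<^esub> val T X t" using T_simps(5)[OF X] kt t by simp
  qed
  have "contracted_product P Q T (\<lambda>X p q. qm X (p, q))"
    unfolding contracted_product_def T_simps(1-3)
  proof (intro conjI ballI impI dT)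
    fix X p q assume X: "X \<in> Obj C" and "p \<in> tsec P X" "q \<in> tsec Q X" "proj P X p = proj Q X q"
    then have pq: "(p, q) \<in> E X" by (simp add: E_iff)
    note t = qm[OF X pq]
    show "qm X (p, q) \<in> sec F X" by (rule t)
    show "proj T X (qm X (p, q)) = proj P X p" using T_simps(4)[OF X t] kpq'[OF X pq] by simp
    show "val T X (qm X (p, q)) = val P X p \<otimes>\<^bsub>mon \<O> X\<^esub> val Q X q" using T_simps(5)[OF X t] kvq'[OF X pq] by simp
    show "res F f (qm X (p, q)) = qm (Dom C f) (res (tot P) f p, res (tot Q) f q)" if "f \<in> Arr C" "Cod C f = X" for f
      using qr'[OF that pq] .
    show "qm X (act P X u p, q) = ka X u (qm X (p, q))" "qm X (p, act Q X u q) = ka X u (qm X (p, q))" if "u \<in> O_units X" for u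
      using kaq[OF X that pq] qmQ[OF X pq that] by simp_all
    show "\<exists>u\<in>O_units X. p' = act P X u p \<and> q' = act Q X (inv\<^bsub>mon \<O> X\<^esub> u) q"
      if p': "p' \<in> tsec P X" "q' \<in> tsec Q X" "proj P X p' = proj Q X q'" "qm X (p, q) = qm X (p', q')" for p' q'
    proof -
      obtain u where "u \<in> O_units X" "act P X u p = p'" "act Q X u q' = q" using qeD[OF X pq, of p' q'] p' by (auto simp: E_iff)
      then show ?thesis using act_inv(1)[OF div_objD(1)[OF Q] X, of u q'] p' by auto
    qed
  next
    fix X t assume X: "X \<in> Obj C" and t: "t \<in> sec F X"
    have "locally X (\<lambda>f. \<exists>p\<in>tsec P (Dom C f). \<exists>q\<in>tsec Q (Dom C f). proj P (Dom C f) p = proj Q (Dom C f) q \<and>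
      qm (Dom C f) (p, q) = res F f t)"
      by (rule locally_mono[OF ql[OF X t] X]) (auto simp: E_def)
    then show "\<exists>S\<in>J X. \<forall>f\<in>S. \<exists>p\<in>tsec P (Dom C f). \<exists>q\<in>tsec Q (Dom C f). proj P (Dom C f) p = proj Q (Dom C f) q \<and>
      qm (Dom C f) (p, q) = res F f t" by (simp add: locally_def)
  qed simp
  then show ?thesis by blast
qed

text \<open>Resolves the choice behind \<open>tensor\<close>. The projection is expressed through
  the second factor, so that for iterated tensors it reduces to the last factor.\<close>

lemma tensorD:
  assumes P: "div_obj P" and Q: "div_obj Q" and b: "base Q = base P"
  shows "div_obj (tensor P Q)" and "base (tensor P Q) = base P"
    and "\<lbrakk>X \<in> Obj C; p \<in> tsec P X; q \<in> tsec Q X; proj P X p = proj Q X q\<rbrakk> \<Longrightarrow>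
      tens P Q X p q \<in> tsec (tensor P Q) X"
    and "\<lbrakk>X \<in> Obj C; p \<in> tsec P X; q \<in> tsec Q X; proj P X p = proj Q X q\<rbrakk> \<Longrightarrow>
      proj (tensor P Q) X (tens P Q X p q) = proj Q X q"
    and "\<lbrakk>X \<in> Obj C; p \<in> tsec P X; q \<in> tsec Q X; proj P X p = proj Q X q\<rbrakk> \<Longrightarrow>
      val (tensor P Q) X (tens P Q X p q) = val P X p \<otimes>\<^bsub>mon \<O> X\<^esub> val Q X q"
    and "\<lbrakk>f \<in> Arr C; p \<in> tsec P (Cod C f); q \<in> tsec Q (Cod C f); proj P (Cod C f) p = proj Q (Cod C f) q\<rbrakk> \<Longrightarrow>
      res (tot (tensor P Q)) f (tens P Q (Cod C f) p q) = tens P Q (Dom C f) (res (tot P) f p) (res (tot Q) f q)" (is "PROP ?g1")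
    and "\<lbrakk>X \<in> Obj C; p \<in> tsec P X; q \<in> tsec Q X; proj P X p = proj Q X q; u \<in> O_units X\<rbrakk> \<Longrightarrow>
      tens P Q X (act P X u p) q = act (tensor P Q) X u (tens P Q X p q)"
    and "\<lbrakk>X \<in> Obj C; p \<in> tsec P X; q \<in> tsec Q X; proj P X p = proj Q X q; u \<in> O_units X\<rbrakk> \<Longrightarrow>
      tens P Q X p (act Q X u q) = act (tensor P Q) X u (tens P Q X p q)"
    and "\<lbrakk>X \<in> Obj C; p \<in> tsec P X; q \<in> tsec Q X; proj P X p = proj Q X q;
       p' \<in> tsec P X; q' \<in> tsec Q X; proj P X p' = proj Q X q'; tens P Q X p q = tens P Q X p' q'\<rbrakk> \<Longrightarrow>
       \<exists>u\<in>O_units X. p' = act P X u p \<and> q' = act Q X (inv\<^bsub>mon \<O> X\<^esub> u) q"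
    and "\<lbrakk>X \<in> Obj C; t \<in> tsec (tensor P Q) X\<rbrakk> \<Longrightarrow> locally X (\<lambda>f. \<exists>p q. p \<in> tsec P (Dom C f) \<and>
      q \<in> tsec Q (Dom C f) \<and> proj P (Dom C f) p = proj Q (Dom C f) q \<and>
      tens P Q (Dom C f) p q = res (tot (tensor P Q)) f t)"
proof -
  have "\<exists>z. case z of (T, \<tau>) \<Rightarrow> contracted_product P Q T \<tau>" using contracted_product_exists[OF P Q b] by auto
  from someI_ex[OF this] have "case tensor_choice P Q of (T, \<tau>) \<Rightarrow> contracted_product P Q T \<tau>"
    unfolding tensor_choice_def .
  then have c: "contracted_product P Q (tensor P Q) (tens P Q)"
    by (simp add: tensor_def tens_def case_prod_beta)
  note d = c[unfolded contracted_product_def]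
  show "div_obj (tensor P Q)" "base (tensor P Q) = base P" using d by simp_all
  have d2: "\<forall>X\<in>Obj C. \<forall>p\<in>tsec P X. \<forall>q\<in>tsec Q X. proj P X p = proj Q X q \<longrightarrow>
        tens P Q X p q \<in> tsec (tensor P Q) X \<and> proj (tensor P Q) X (tens P Q X p q) = proj P X p \<and>
        (\<forall>f\<in>Arr C. Cod C f = X \<longrightarrow>
           res (tot (tensor P Q)) f (tens P Q X p q) = tens P Q (Dom C f) (res (tot P) f p) (res (tot Q) f q)) \<and>
        (\<forall>u\<in>O_units X. tens P Q X (act P X u p) q = act (tensor P Q) X u (tens P Q X p q) \<and>
           tens P Q X p (act Q X u q) = act (tensor P Q) X u (tens P Q X p q)) \<and>
        val (tensor P Q) X (tens P Q X p q) = val P X p \<otimes>\<^bsub>mon \<O> X\<^esub> val Q X q \<and>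
        (\<forall>p'\<in>tsec P X. \<forall>q'\<in>tsec Q X. proj P X p' = proj Q X q' \<longrightarrow> tens P Q X p q = tens P Q X p' q' \<longrightarrow>
           (\<exists>u\<in>O_units X. p' = act P X u p \<and> q' = act Q X (inv\<^bsub>mon \<O> X\<^esub> u) q))"
    using d by (elim conjE) assumption
  { fix X p q assume a: "X \<in> Obj C" "p \<in> tsec P X" "q \<in> tsec Q X" "proj P X p = proj Q X q"
    note d3 = d2[rule_format, OF a]
    from d3 show "tens P Q X p q \<in> tsec (tensor P Q) X" "proj (tensor P Q) X (tens P Q X p q) = proj Q X q"
      "val (tensor P Q) X (tens P Q X p q) = val P X p \<otimes>\<^bsub>mon \<O> X\<^esub> val Q X q" using a by simp_all
    from d3 show "u \<in> O_units X \<Longrightarrow> tens P Q X (act P X u p) q = act (tensor P Q) X u (tens P Q X p q)"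
      "u \<in> O_units X \<Longrightarrow> tens P Q X p (act Q X u q) = act (tensor P Q) X u (tens P Q X p q)" for u by simp_all
    from d3 show "\<lbrakk>p' \<in> tsec P X; q' \<in> tsec Q X; proj P X p' = proj Q X q'; tens P Q X p q = tens P Q X p' q'\<rbrakk> \<Longrightarrow>
       \<exists>u\<in>O_units X. p' = act P X u p \<and> q' = act Q X (inv\<^bsub>mon \<O> X\<^esub> u) q" for p' q' by simp }
  show "PROP ?g1"
    using d2[rule_format, of "Cod C f" p q] by (simp add: Cod_Obj)
  have d4: "\<forall>X\<in>Obj C. \<forall>t\<in>tsec (tensor P Q) X. \<exists>S\<in>J X. \<forall>f\<in>S.
        \<exists>p\<in>tsec P (Dom C f). \<exists>q\<in>tsec Q (Dom C f).
          proj P (Dom C f) p = proj Q (Dom C f) q \<and> tens P Q (Dom C f) p q = res (tot (tensor P Q)) f t"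
    using d by (elim conjE) assumption
  show "locally X (\<lambda>f. \<exists>p q. p \<in> tsec P (Dom C f) \<and>
      q \<in> tsec Q (Dom C f) \<and> proj P (Dom C f) p = proj Q (Dom C f) q \<and>
      tens P Q (Dom C f) p q = res (tot (tensor P Q)) f t)" if X: "X \<in> Obj C" and t: "t \<in> tsec (tensor P Q) X"
  proof -
    have "locally X (\<lambda>f. \<exists>p\<in>tsec P (Dom C f). \<exists>q\<in>tsec Q (Dom C f).
          proj P (Dom C f) p = proj Q (Dom C f) q \<and> tens P Q (Dom C f) p q = res (tot (tensor P Q)) f t)"
      using d4 X t unfolding locally_def by simp
    then show ?thesis by (rule locally_mono[OF _ X]) auto
  qed
qed

text \<open>Every section of the tensor product is locally a pure tensor, and sections of a sheaf
  are equal once they are so locally.\<close>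

lemma tensor_eqI:
  assumes P: "div_obj P" and Q: "div_obj Q" and b: "base Q = base P" and G: "sheaf G"
    and k: "k \<in> Hom (tot (tensor P Q)) G" "k' \<in> Hom (tot (tensor P Q)) G"
    and e: "\<And>X p q. \<lbrakk>X \<in> Obj C; p \<in> tsec P X; q \<in> tsec Q X; proj P X p = proj Q X q\<rbrakk> \<Longrightarrow>
      k X (tens P Q X p q) = k' X (tens P Q X p q)"
  shows "k = k'"
proof (rule Hom_eqI[OF k])
  note T = tensorD[OF P Q b]
  fix X t assume X: "X \<in> Obj C" and t: "t \<in> tsec (tensor P Q) X"
  show "k X t = k' X t"
  proof (rule sheaf_sep[OF G X Hom_in[OF k(1) X t] Hom_in[OF k(2) X t]], rule locally_mono[OF T(10)[OF X t] X])
    fix f assume f: "f \<in> Arr C" "Cod C f = X" and "\<exists>p q. p \<in> tsec P (Dom C f) \<and>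
      q \<in> tsec Q (Dom C f) \<and> proj P (Dom C f) p = proj Q (Dom C f) q \<and>
      tens P Q (Dom C f) p q = res (tot (tensor P Q)) f t"
    then obtain p q where 1: "p \<in> tsec P (Dom C f)" "q \<in> tsec Q (Dom C f)"
      "proj P (Dom C f) p = proj Q (Dom C f) q" "tens P Q (Dom C f) p q = res (tot (tensor P Q)) f t" by blast
    show "res G f (k X t) = res G f (k' X t)"
      using Hom_res[OF k(1) f(1), of t] Hom_res[OF k(2) f(1), of t] t f e[OF Dom_Obj[OF f(1)] 1(1-3)] 1(4) by simp
  qed
qed

text \<open>Universal property of the contracted product. Two representations of one pure tensor are
  (p, q) and (u p, v q) with v inverse to u; as h is equivariant in each variable, the units u and v
  come out and cancel in G.\<close>

lemma tensor_arr:
  assumes P: "div_obj P" and Q: "div_obj Q" and b: "base Q = base P" and G: "div_obj G" and f: "f \<in> Hom (base P) (base G)"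
    and h: "\<And>X p q. \<lbrakk>X \<in> Obj C; p \<in> tsec P X; q \<in> tsec Q X; proj P X p = proj Q X q\<rbrakk> \<Longrightarrow>
      h X p q \<in> tsec G X \<and> proj G X (h X p q) = f X (proj Q X q) \<and>
      val G X (h X p q) = val P X p \<otimes>\<^bsub>mon \<O> X\<^esub> val Q X q"
    and hr: "\<And>g p q. \<lbrakk>g \<in> Arr C; p \<in> tsec P (Cod C g); q \<in> tsec Q (Cod C g); proj P (Cod C g) p = proj Q (Cod C g) q\<rbrakk> \<Longrightarrow>
      res (tot G) g (h (Cod C g) p q) = h (Dom C g) (res (tot P) g p) (res (tot Q) g q)"
    and ha: "\<And>X p q u. \<lbrakk>X \<in> Obj C; p \<in> tsec P X; q \<in> tsec Q X; proj P X p = proj Q X q; u \<in> O_units X\<rbrakk> \<Longrightarrow>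
      h X (act P X u p) q = act G X u (h X p q) \<and> h X p (act Q X u q) = act G X u (h X p q)"
  shows "\<exists>k\<in>div_arr (tensor P Q) f G. \<forall>X\<in>Obj C. \<forall>p\<in>tsec P X. \<forall>q\<in>tsec Q X.
    proj P X p = proj Q X q \<longrightarrow> k X (tens P Q X p q) = h X p q"
proof -
  note T = tensorD[OF P Q b]
  define R where "R X t s \<longleftrightarrow> (\<exists>p q. p \<in> tsec P X \<and> q \<in> tsec Q X \<and> proj P X p = proj Q X q \<and>
    t = tens P Q X p q \<and> s = h X p q)" for X t s
  have "\<exists>k\<in>div_arr (tensor P Q) f G. \<forall>X\<in>Obj C. \<forall>t\<in>tsec (tensor P Q) X. \<forall>s. R X t s \<longrightarrow> k X t = s"
  proof (rule div_arr_descent[OF T(1) G])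
    show "f \<in> Hom (base (tensor P Q)) (base G)" using f T(2) by simp
    fix X t s assume X: "X \<in> Obj C" and t: "t \<in> tsec (tensor P Q) X" and "R X t s"
    then obtain p q where 1: "p \<in> tsec P X" "q \<in> tsec Q X" "proj P X p = proj Q X q" "t = tens P Q X p q" "s = h X p q"
      unfolding R_def by blast
    show "s \<in> tsec G X \<and> proj G X s = f X (proj (tensor P Q) X t) \<and> val G X s = val (tensor P Q) X t"
      using h[OF X 1(1-3)] T(4,5)[OF X 1(1-3)] 1 by simp
    show "s = s'" if "R X t s'" for s'
    proof -
      obtain p' q' where 2: "p' \<in> tsec P X" "q' \<in> tsec Q X" "proj P X p' = proj Q X q'" "t = tens P Q X p' q'" "s' = h X p' q'"
        using \<open>R X t s'\<close> unfolding R_def by blast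
      obtain u where u: "u \<in> O_units X" "p' = act P X u p" "q' = act Q X (inv\<^bsub>mon \<O> X\<^esub> u) q"
        using T(9)[OF X 1(1-3) 2(1-3)] 1(4) 2(4) by auto
      note ui = unit_inv[OF X u(1)]
      have hp: "h X p q \<in> tsec G X" using h[OF X 1(1-3)] by simp
      have "s' = act G X u (h X p q')"
        using ha[OF X 1(1) 2(2) _ u(1)] 2 u 1 divT(7)[OF Q X ui(1), of q] by simp
      also have "\<dots> = act G X u (act G X (inv\<^bsub>mon \<O> X\<^esub> u) (h X p q))"
        using ha[OF X 1(1-3) ui(1)] u by simp
      finally show ?thesis using act_inv[OF div_objD(1)[OF G] X u(1) hp] 1 by simp
    qed
    show "R X (act (tensor P Q) X u t) (act G X u s)" if u: "u \<in> O_units X" for u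
      unfolding R_def
      by (rule exI[of _ "act P X u p"], rule exI[of _ q])
        (use 1 X u ha[OF X 1(1-3) u] T(7)[OF X 1(1-3) u] divT(6,7)[OF P X u] in simp)
  next
    fix g t s assume g: "g \<in> Arr C" and t: "t \<in> tsec (tensor P Q) (Cod C g)" and "R (Cod C g) t s"
    then obtain p q where 1: "p \<in> tsec P (Cod C g)" "q \<in> tsec Q (Cod C g)" "proj P (Cod C g) p = proj Q (Cod C g) q"
       "t = tens P Q (Cod C g) p q" "s = h (Cod C g) p q"
      unfolding R_def by blast
    show "R (Dom C g) (res (tot (tensor P Q)) g t) (res (tot G) g s)"
      unfolding R_def
      by (rule exI[of _ "res (tot P) g p"], rule exI[of _ "res (tot Q) g q"])
       (use 1 g T(6)[OF g 1(1-3)] hr[OF g 1(1-3)] res_in[OF divT(2)[OF P] g 1(1)] res_in[OF divT(2)[OF Q] g 1(2)]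
          divT(5)[OF P g 1(1)] divT(5)[OF Q g 1(2)] b in simp)
  next
    show "locally X (\<lambda>g. \<exists>s. R (Dom C g) (res (tot (tensor P Q)) g t) s)"
      if X: "X \<in> Obj C" and t: "t \<in> tsec (tensor P Q) X" for X t
      by (rule locally_mono[OF T(10)[OF X t] X]) (unfold R_def, metis)
  qed
  then obtain k where k: "k \<in> div_arr (tensor P Q) f G" "\<And>X t s. \<lbrakk>X \<in> Obj C; t \<in> tsec (tensor P Q) X; R X t s\<rbrakk> \<Longrightarrow> k X t = s"
    by blast
  have "k X (tens P Q X p q) = h X p q" if "X \<in> Obj C" "p \<in> tsec P X" "q \<in> tsec Q X" "proj P X p = proj Q X q" for X p q
    by (rule k(2)[OF that(1) T(3)[OF that]]) (use that in \<open>auto simp: R_def\<close>)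
  then show ?thesis using k(1) by blast
qed

text \<open>Shows, as does the next lemma for the braiding, that the definite description denotes
  something: existence by \<open>tensor_arr\<close>, uniqueness by
  \<open>tensor_eqI\<close>.\<close>

lemma tensor_mapD:
  assumes P: "div_obj P" and Q: "div_obj Q" and b: "base Q = base P"
    and P': "div_obj P'" and Q': "div_obj Q'" and b': "base Q' = base P'"
    and f: "f \<in> Hom (base P) (base P')" and g: "g \<in> div_arr P f P'" and h: "h \<in> div_arr Q f Q'"
  shows "tensor_map P Q f P' Q' g h \<in> div_arr (tensor P Q) f (tensor P' Q')" (is ?g1)
    and "\<lbrakk>X \<in> Obj C; p \<in> tsec P X; q \<in> tsec Q X; proj P X p = proj Q X q\<rbrakk> \<Longrightarrow>
      tensor_map P Q f P' Q' g h X (tens P Q X p q) = tens P' Q' X (g X p) (h X q)" (is "PROP ?g2")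
proof -
  note T' = tensorD[OF P' Q' b'] and G = div_arrD[OF g] and H = div_arrD[OF h]
  have c: "g X p \<in> tsec P' X \<and> h X q \<in> tsec Q' X \<and> proj P' X (g X p) = proj Q' X (h X q)"
    if "X \<in> Obj C" "p \<in> tsec P X" "q \<in> tsec Q X" "proj P X p = proj Q X q" for X p q
    using that G(2,4)[OF that(1,2)] H(2,4)[OF that(1,3)] by simp
  have "\<exists>k\<in>div_arr (tensor P Q) f (tensor P' Q'). \<forall>X\<in>Obj C. \<forall>p\<in>tsec P X. \<forall>q\<in>tsec Q X.
    proj P X p = proj Q X q \<longrightarrow> k X (tens P Q X p q) = tens P' Q' X (g X p) (h X q)"
  proof (rule tensor_arr[OF P Q b T'(1)])
    show "f \<in> Hom (base P) (base (tensor P' Q'))" using f T'(2) by simp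
    fix X p q assume a: "X \<in> Obj C" "p \<in> tsec P X" "q \<in> tsec Q X" "proj P X p = proj Q X q"
    note cc = c[OF a, THEN conjunct1] c[OF a, THEN conjunct2, THEN conjunct1] c[OF a, THEN conjunct2, THEN conjunct2]
    show "tens P' Q' X (g X p) (h X q) \<in> tsec (tensor P' Q') X \<and>
      proj (tensor P' Q') X (tens P' Q' X (g X p) (h X q)) = f X (proj Q X q) \<and>
      val (tensor P' Q') X (tens P' Q' X (g X p) (h X q)) = val P X p \<otimes>\<^bsub>mon \<O> X\<^esub> val Q X q"
      using T'(3-5)[OF a(1) cc] G(6)[OF a(1,2)] H(4,6)[OF a(1,3)] by simp
    show "tens P' Q' X (g X (act P X u p)) (h X q) = act (tensor P' Q') X u (tens P' Q' X (g X p) (h X q)) \<and>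
      tens P' Q' X (g X p) (h X (act Q X u q)) = act (tensor P' Q') X u (tens P' Q' X (g X p) (h X q))"
      if u: "u \<in> O_units X" for u
      using T'(7,8)[OF a(1) cc u] G(5)[OF a(1) u a(2)] H(5)[OF a(1) u a(3)] by simp
  next
    fix e p q assume a: "e \<in> Arr C" "p \<in> tsec P (Cod C e)" "q \<in> tsec Q (Cod C e)" "proj P (Cod C e) p = proj Q (Cod C e) q"
    show "res (tot (tensor P' Q')) e (tens P' Q' (Cod C e) (g (Cod C e) p) (h (Cod C e) q)) =
      tens P' Q' (Dom C e) (g (Dom C e) (res (tot P) e p)) (h (Dom C e) (res (tot Q) e q))"
      using T'(6)[OF a(1), of "g (Cod C e) p" "h (Cod C e) q"] c[OF Cod_Obj[OF a(1)] a(2-4)] G(3)[OF a(1,2)] H(3)[OF a(1,3)] by simp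
  qed
  then obtain k where k: "k\<in>div_arr (tensor P Q) f (tensor P' Q')" "\<forall>X\<in>Obj C. \<forall>p\<in>tsec P X. \<forall>q\<in>tsec Q X.
    proj P X p = proj Q X q \<longrightarrow> k X (tens P Q X p q) = tens P' Q' X (g X p) (h X q)" by blast
  have "tensor_map P Q f P' Q' g h = k"
    unfolding tensor_map_def
    by (rule the_equality) (use k in simp, rule tensor_eqI[OF P Q b divT(2)[OF T'(1)]], use k in \<open>auto dest: div_arrD(1)\<close>)
  then show ?g1 "PROP ?g2" using k by simp_all
qed

lemma braidingD:
  assumes P: "div_obj P" and Q: "div_obj Q" and b: "base Q = base P"
  shows "braiding P Q \<in> div_arr (tensor P Q) (idm (base P)) (tensor Q P)" (is ?g1)
    and "\<lbrakk>X \<in> Obj C; p \<in> tsec P X; q \<in> tsec Q X; proj P X p = proj Q X q\<rbrakk> \<Longrightarrow>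
      braiding P Q X (tens P Q X p q) = tens Q P X q p" (is "PROP ?g2")
proof -
  note T' = tensorD[OF Q P b[symmetric]]
  have "\<exists>k\<in>div_arr (tensor P Q) (idm (base P)) (tensor Q P). \<forall>X\<in>Obj C. \<forall>p\<in>tsec P X. \<forall>q\<in>tsec Q X.
    proj P X p = proj Q X q \<longrightarrow> k X (tens P Q X p q) = tens Q P X q p"
  proof (rule tensor_arr[OF P Q b T'(1)])
    show "idm (base P) \<in> Hom (base P) (base (tensor Q P))" using T'(2) idm_Hom[OF divT(1)[OF P]] b by simp
    fix X p q assume a: "X \<in> Obj C" "p \<in> tsec P X" "q \<in> tsec Q X" "proj P X p = proj Q X q"
    note a' = a(1,3,2) a(4)[symmetric]
    show "tens Q P X q p \<in> tsec (tensor Q P) X \<and> proj (tensor Q P) X (tens Q P X q p) = idm (base P) X (proj Q X q) \<and>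
      val (tensor Q P) X (tens Q P X q p) = val P X p \<otimes>\<^bsub>mon \<O> X\<^esub> val Q X q"
      using T'(3-5)[OF a'] a divT(4)[OF Q a(1,3)] b unit_comm[OF a(1)] div_objD(3)[OF P a(1,2)] div_objD(3)[OF Q a(1,3)] by simp
    show "tens Q P X q (act P X u p) = act (tensor Q P) X u (tens Q P X q p) \<and>
      tens Q P X (act Q X u q) p = act (tensor Q P) X u (tens Q P X q p)"
      if u: "u \<in> O_units X" for u
      using T'(7,8)[OF a' u] by simp
  next
    fix e p q assume a: "e \<in> Arr C" "p \<in> tsec P (Cod C e)" "q \<in> tsec Q (Cod C e)" "proj P (Cod C e) p = proj Q (Cod C e) q"
    show "res (tot (tensor Q P)) e (tens Q P (Cod C e) q p) = tens Q P (Dom C e) (res (tot Q) e q) (res (tot P) e p)"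
      using T'(6)[OF a(1,3,2) a(4)[symmetric]] .
  qed
  then obtain k where k: "k\<in>div_arr (tensor P Q) (idm (base P)) (tensor Q P)" "\<forall>X\<in>Obj C. \<forall>p\<in>tsec P X. \<forall>q\<in>tsec Q X.
    proj P X p = proj Q X q \<longrightarrow> k X (tens P Q X p q) = tens Q P X q p" by blast
  have "braiding P Q = k"
    unfolding braiding_def
    by (rule the_equality) (use k in simp, rule tensor_eqI[OF P Q b divT(2)[OF T'(1)]], use k in \<open>auto dest: div_arrD(1)\<close>)
  then show ?g1 "PROP ?g2" using k by simp_all
qed

text \<open>After \<open>tensor_eqI\<close> has decomposed the outer tensor, the section of
  \<open>tensor P Q\<close> is still only locally a pure tensor; the cover for this is taken
  here.\<close>

lemma tensor3_eqI:
  assumes P: "div_obj P" and Q: "div_obj Q" and R: "div_obj R" and b: "base Q = base P" "base R = base P" and G: "sheaf G"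
    and k: "k \<in> Hom (tot (tensor (tensor P Q) R)) G" "k' \<in> Hom (tot (tensor (tensor P Q) R)) G"
    and e: "\<And>X p q r. \<lbrakk>X \<in> Obj C; p \<in> tsec P X; q \<in> tsec Q X; r \<in> tsec R X; proj P X p = proj Q X q; proj Q X q = proj R X r\<rbrakk> \<Longrightarrow>
      k X (tens (tensor P Q) R X (tens P Q X p q) r) = k' X (tens (tensor P Q) R X (tens P Q X p q) r)"
  shows "k = k'"
proof -
  note T = tensorD[OF P Q b(1)]
  have bR: "base R = base (tensor P Q)" using T b by simp
  note T3 = tensorD[OF T(1) R bR]
  show ?thesis
  proof (rule tensor_eqI[OF T(1) R bR G k])
    fix X t r assume X: "X \<in> Obj C" and t: "t \<in> tsec (tensor P Q) X" and r: "r \<in> tsec R X"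
      and tr: "proj (tensor P Q) X t = proj R X r"
    note w = T3(3)[OF X t r tr]
    show "k X (tens (tensor P Q) R X t r) = k' X (tens (tensor P Q) R X t r)"
    proof (rule sheaf_sep[OF G X Hom_in[OF k(1) X w] Hom_in[OF k(2) X w]], rule locally_mono[OF T(10)[OF X t] X])
      fix f assume f: "f \<in> Arr C" "Cod C f = X" and "\<exists>p q. p \<in> tsec P (Dom C f) \<and>
        q \<in> tsec Q (Dom C f) \<and> proj P (Dom C f) p = proj Q (Dom C f) q \<and>
        tens P Q (Dom C f) p q = res (tot (tensor P Q)) f t"
      then obtain p q where 1: "p \<in> tsec P (Dom C f)" "q \<in> tsec Q (Dom C f)"
        "proj P (Dom C f) p = proj Q (Dom C f) q" "tens P Q (Dom C f) p q = res (tot (tensor P Q)) f t" by blast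
      note fo = Dom_Obj[OF f(1)]
      have rr: "res (tot R) f r \<in> tsec R (Dom C f)" using res_in[OF divT(2)[OF R] f(1), of r] r f by simp
      have "proj Q (Dom C f) q = proj R (Dom C f) (res (tot R) f r)"
        using T(4)[OF fo 1(1-3)] 1(4) divT(5)[OF T(1) f(1), of t] divT(5)[OF R f(1), of r] t r f tr bR by simp
      from e[OF fo 1(1,2) rr 1(3) this]
      show "res G f (k X (tens (tensor P Q) R X t r)) = res G f (k' X (tens (tensor P Q) R X t r))"
        using Hom_res[OF k(1) f(1), of "tens (tensor P Q) R X t r"] Hom_res[OF k(2) f(1), of "tens (tensor P Q) R X t r"] w f 1(4)
          T3(6)[OF f(1), of t r] t r tr by simp
    qed
  qed
qed

text \<open>The universal property cannot be used directly, since the first argument of the outer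
  tensor is an arbitrary section of \<open>tensor P Q\<close>. Instead the arrow is prescribed on
  triple tensors, which exist only after two local choices, and \<open>div_arr_descent\<close>
  glues.\<close>

lemma associatorD:
  assumes P: "div_obj P" and Q: "div_obj Q" and R: "div_obj R" and b: "base Q = base P" "base R = base P"
  shows "associator P Q R \<in> div_arr (tensor (tensor P Q) R) (idm (base P)) (tensor P (tensor Q R))" (is ?g1)
    and "\<lbrakk>X \<in> Obj C; p \<in> tsec P X; q \<in> tsec Q X; r \<in> tsec R X; proj P X p = proj Q X q; proj Q X q = proj R X r\<rbrakk> \<Longrightarrow>
      associator P Q R X (tens (tensor P Q) R X (tens P Q X p q) r) = tens P (tensor Q R) X p (tens Q R X q r)" (is "PROP ?g2")
proof -
  note T = tensorD[OF P Q b(1)]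
  have bR: "base R = base (tensor P Q)" and bQR: "base R = base Q" using T b by simp_all
  note T3 = tensorD[OF T(1) R bR]
  note S = tensorD[OF Q R bQR]
  have bS: "base (tensor Q R) = base P" using S b by simp
  note S3 = tensorD[OF P S(1) bS]
  let ?T = "tensor (tensor P Q) R" and ?S = "tensor P (tensor Q R)"
  define ok where "ok X p q r \<longleftrightarrow> p \<in> tsec P X \<and> q \<in> tsec Q X \<and> r \<in> tsec R X \<and> proj P X p = proj Q X q \<and> proj Q X q = proj R X r" for X p q r
  define l where "l X p q r = tens (tensor P Q) R X (tens P Q X p q) r" for X p q r
  define m where "m X p q r = tens P (tensor Q R) X p (tens Q R X q r)" for X p q r
  have lD: "l X p q r \<in> tsec ?T X" "proj ?T X (l X p q r) = proj R X r"
      "val ?T X (l X p q r) = (val P X p \<otimes>\<^bsub>mon \<O> X\<^esub> val Q X q) \<otimes>\<^bsub>mon \<O> X\<^esub> val R X r"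
      "m X p q r \<in> tsec ?S X" "proj ?S X (m X p q r) = proj R X r" "val ?S X (m X p q r) = val ?T X (l X p q r)"
    if X: "X \<in> Obj C" and o: "ok X p q r" for X p q r
  proof -
    note a = o[unfolded ok_def]
    have 1: "tens P Q X p q \<in> tsec (tensor P Q) X" "proj (tensor P Q) X (tens P Q X p q) = proj R X r" "r \<in> tsec R X"
      "val (tensor P Q) X (tens P Q X p q) = val P X p \<otimes>\<^bsub>mon \<O> X\<^esub> val Q X q"
      using T(3-5)[OF X, of p q] a by simp_all
    have 2: "tens Q R X q r \<in> tsec (tensor Q R) X" "proj (tensor Q R) X (tens Q R X q r) = proj R X r" "p \<in> tsec P X"
      "val (tensor Q R) X (tens Q R X q r) = val Q X q \<otimes>\<^bsub>mon \<O> X\<^esub> val R X r"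
      using S(3-5)[OF X, of q r] a by simp_all
    have 3: "proj P X p = proj (tensor Q R) X (tens Q R X q r)" using 2 a by simp
    note c = div_objD(3)[OF P X, of p] div_objD(3)[OF Q X, of q] div_objD(3)[OF R X, of r]
    show "l X p q r \<in> tsec ?T X" "proj ?T X (l X p q r) = proj R X r"
      "val ?T X (l X p q r) = (val P X p \<otimes>\<^bsub>mon \<O> X\<^esub> val Q X q) \<otimes>\<^bsub>mon \<O> X\<^esub> val R X r"
      "m X p q r \<in> tsec ?S X" "proj ?S X (m X p q r) = proj R X r" "val ?S X (m X p q r) = val ?T X (l X p q r)"
      using T3(3-5)[OF X 1(1,3,2)] S3(3-5)[OF X 2(3,1) 3] 1 2 a c monoid.m_assoc[OF O_monoid[OF X]] by (simp_all add: l_def m_def)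
  qed
  have lres: "res (tot ?T) f (l (Cod C f) p q r) = l (Dom C f) (res (tot P) f p) (res (tot Q) f q) (res (tot R) f r)"
    "res (tot ?S) f (m (Cod C f) p q r) = m (Dom C f) (res (tot P) f p) (res (tot Q) f q) (res (tot R) f r)"
    "ok (Dom C f) (res (tot P) f p) (res (tot Q) f q) (res (tot R) f r)"
    if f: "f \<in> Arr C" and o: "ok (Cod C f) p q r" for f p q r
  proof -
    note X = Cod_Obj[OF f] and a = o[unfolded ok_def]
    show "res (tot ?T) f (l (Cod C f) p q r) = l (Dom C f) (res (tot P) f p) (res (tot Q) f q) (res (tot R) f r)"
      using T3(6)[OF f, of "tens P Q (Cod C f) p q" r] T(6)[OF f, of p q] T(3,4)[OF X, of p q] a by (simp add: l_def)
    show "res (tot ?S) f (m (Cod C f) p q r) = m (Dom C f) (res (tot P) f p) (res (tot Q) f q) (res (tot R) f r)"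
      using S3(6)[OF f, of p "tens Q R (Cod C f) q r"] S(6)[OF f, of q r] S(3,4)[OF X, of q r] a by (simp add: m_def)
    show "ok (Dom C f) (res (tot P) f p) (res (tot Q) f q) (res (tot R) f r)"
      using a res_in[OF divT(2)[OF P] f] res_in[OF divT(2)[OF Q] f] res_in[OF divT(2)[OF R] f]
        divT(5)[OF P f] divT(5)[OF Q f] divT(5)[OF R f] b by (simp add: ok_def)
  qed
  have oka: "ok X (act P X u p) q r" "ok X p (act Q X u q) r" "ok X p q (act R X u r)"
    if X: "X \<in> Obj C" and o: "ok X p q r" and u: "u \<in> O_units X" for X p q r u
    using o divT(6,7)[OF P X u] divT(6,7)[OF Q X u] divT(6,7)[OF R X u] by (simp_all add: ok_def)
  have acts: "l X (act P X u p) q r = act ?T X u (l X p q r)"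
     "m X (act P X u p) q r = act ?S X u (m X p q r)"
     "m X p (act Q X u q) r = act ?S X u (m X p q r)" "m X p q (act R X u r) = act ?S X u (m X p q r)"
    if X: "X \<in> Obj C" and o: "ok X p q r" and u: "u \<in> O_units X" for X p q r u
  proof -
    note a = o[unfolded ok_def]
    have 1: "tens P Q X p q \<in> tsec (tensor P Q) X" "proj (tensor P Q) X (tens P Q X p q) = proj R X r" "r \<in> tsec R X"
      using T(3-5)[OF X, of p q] a by simp_all
    have 2: "tens Q R X q r \<in> tsec (tensor Q R) X" "p \<in> tsec P X" "proj P X p = proj (tensor Q R) X (tens Q R X q r)"
      using S(3-5)[OF X, of q r] a by simp_all
    show "l X (act P X u p) q r = act ?T X u (l X p q r)"
      using T3(7)[OF X 1(1,3,2) u] T(7)[OF X _ _ _ u, of p q] a by (simp add: l_def)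
    show "m X (act P X u p) q r = act ?S X u (m X p q r)"
     "m X p (act Q X u q) r = act ?S X u (m X p q r)" "m X p q (act R X u r) = act ?S X u (m X p q r)"
      using S3(7,8)[OF X 2(2,1,3) u] S(7,8)[OF X _ _ _ u, of q r] a by (simp_all add: m_def)
  qed
  define Rl where "Rl X t s \<longleftrightarrow> (\<exists>p q r. ok X p q r \<and> t = l X p q r \<and> s = m X p q r)" for X t s
  have "\<exists>k\<in>div_arr ?T (idm (base P)) ?S. \<forall>X\<in>Obj C. \<forall>t\<in>tsec ?T X. \<forall>s. Rl X t s \<longrightarrow> k X t = s"
  proof (rule div_arr_descent[OF T3(1) S3(1)])
    show "idm (base P) \<in> Hom (base ?T) (base ?S)" using idm_Hom[OF divT(1)[OF P]] T3(2) S3(2) T(2) by simp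
    fix X t s assume X: "X \<in> Obj C" and t: "t \<in> tsec ?T X" and "Rl X t s"
    then obtain p q r where 1: "ok X p q r" "t = l X p q r" "s = m X p q r" unfolding Rl_def by blast
    have "proj R X r \<in> sec (base P) X" using divT(4)[OF R X, of r] b 1 by (simp add: ok_def)
    then show "s \<in> tsec ?S X \<and> proj ?S X s = idm (base P) X (proj ?T X t) \<and> val ?S X s = val ?T X t"
      using lD[OF X 1(1)] 1 X by simp
    \<comment> \<open>Equality of the outer tensors yields a unit u, equality of the inner ones a
      further unit v, so that p' = v u p, while q' and r' are q and r translated by the inverses of
      v and u. Changing one component at a time keeps every intermediate triple over one base point,
      and all units cancel.\<close>
    show "s = s'" if "Rl X t s'" for s'
    proof -
      obtain p' q' r' where 2: "ok X p' q' r'" "t = l X p' q' r'" "s' = m X p' q' r'" using \<open>Rl X t s'\<close> unfolding Rl_def by blast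
      note a = 1(1)[unfolded ok_def] and a' = 2(1)[unfolded ok_def]
      have 3: "tens P Q X p q \<in> tsec (tensor P Q) X" "proj (tensor P Q) X (tens P Q X p q) = proj R X r"
        "tens P Q X p' q' \<in> tsec (tensor P Q) X" "proj (tensor P Q) X (tens P Q X p' q') = proj R X r'"
        using T(3-5)[OF X, of p q] T(3-5)[OF X, of p' q'] a a' by simp_all
      obtain u where u: "u \<in> O_units X" "tens P Q X p' q' = act (tensor P Q) X u (tens P Q X p q)" "r' = act R X (inv\<^bsub>mon \<O> X\<^esub> u) r"
        using T3(9)[OF X 3(1) _ 3(2) 3(3) _ 3(4)] 1(2) 2(2) a a' by (auto simp: l_def)
      have "tens P Q X (act P X u p) q = tens P Q X p' q'" using T(7)[OF X _ _ _ u(1), of p q] a u(2) by simp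
      then obtain v where v: "v \<in> O_units X" "p' = act P X v (act P X u p)" "q' = act Q X (inv\<^bsub>mon \<O> X\<^esub> v) q"
        using T(9)[OF X _ _ _ _ _ _, of "act P X u p" q p' q'] a a' divT(6,7)[OF P X u(1), of p] by auto
      note ui = unit_inv(1)[OF X u(1)] and vi = unit_inv(1)[OF X v(1)]
      have o1: "ok X (act P X u p) q r" by (rule oka(1)[OF X 1(1) u(1)])
      have o2: "ok X p' q r" unfolding v(2) by (rule oka(1)[OF X o1 v(1)])
      have o3: "ok X p' q' r" unfolding v(3) by (rule oka(2)[OF X o2 vi])
      note ms = lD(4)[OF X 1(1)]
      have "s' = act ?S X (inv\<^bsub>mon \<O> X\<^esub> u) (m X p' q' r)" using acts(4)[OF X o3 ui] u 2 by simp
      also have "m X p' q' r = act ?S X (inv\<^bsub>mon \<O> X\<^esub> v) (m X p' q r)" using acts(3)[OF X o2 vi] v by simp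
      also have "m X p' q r = act ?S X v (m X (act P X u p) q r)" using acts(2)[OF X o1 v(1)] v by simp
      also have "m X (act P X u p) q r = act ?S X u (m X p q r)" using acts(2)[OF X 1(1) u(1)] .
      finally show ?thesis
        using act_inv[OF div_objD(1)[OF S3(1)] X v(1) divT(6)[OF S3(1) X u(1) ms]] act_inv[OF div_objD(1)[OF S3(1)] X u(1) ms] 1 by simp
    qed
    show "Rl X (act ?T X u t) (act ?S X u s)" if u: "u \<in> O_units X" for u
      using oka(1)[OF X 1(1) u] acts(1,2)[OF X 1(1) u] 1 unfolding Rl_def by metis
  next
    fix f t s assume f: "f \<in> Arr C" and "Rl (Cod C f) t s"
    then show "Rl (Dom C f) (res (tot ?T) f t) (res (tot ?S) f s)"
      unfolding Rl_def using lres[OF f] by metis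
  next
    fix X t assume X: "X \<in> Obj C" and t: "t \<in> tsec ?T X"
    \<comment> \<open>The outer tensor is decomposed over one cover; over each of its members the
      resulting section of \<open>tensor P Q\<close> needs a cover of its own.\<close>
    show "locally X (\<lambda>f. \<exists>s. Rl (Dom C f) (res (tot ?T) f t) s)"
    proof (rule locally_bind[OF T3(10)[OF X t] X])
      fix f assume f: "f \<in> Arr C" "Cod C f = X" and "\<exists>p q. p \<in> tsec (tensor P Q) (Dom C f) \<and>
        q \<in> tsec R (Dom C f) \<and> proj (tensor P Q) (Dom C f) p = proj R (Dom C f) q \<and>
        tens (tensor P Q) R (Dom C f) p q = res (tot ?T) f t"
      then obtain p' r where 1: "p' \<in> tsec (tensor P Q) (Dom C f)" "r \<in> tsec R (Dom C f)"
        "proj (tensor P Q) (Dom C f) p' = proj R (Dom C f) r" "tens (tensor P Q) R (Dom C f) p' r = res (tot ?T) f t" by blast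
      note fo = Dom_Obj[OF f(1)]
      show "locally (Dom C f) (\<lambda>g. \<exists>s. Rl (Dom C (Cmp C f g)) (res (tot ?T) (Cmp C f g) t) s)"
      proof (rule locally_mono[OF T(10)[OF fo 1(1)] fo])
        fix g assume g: "g \<in> Arr C" "Cod C g = Dom C f" and "\<exists>p q. p \<in> tsec P (Dom C g) \<and>
          q \<in> tsec Q (Dom C g) \<and> proj P (Dom C g) p = proj Q (Dom C g) q \<and>
          tens P Q (Dom C g) p q = res (tot (tensor P Q)) g p'"
        then obtain p q where 2: "p \<in> tsec P (Dom C g)" "q \<in> tsec Q (Dom C g)"
          "proj P (Dom C g) p = proj Q (Dom C g) q" "tens P Q (Dom C g) p q = res (tot (tensor P Q)) g p'" by blast
        have "proj Q (Dom C g) q = proj R (Dom C g) (res (tot R) g r)"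
          using T(4)[OF Dom_Obj[OF g(1)] 2(1-3)] 2(4) divT(5)[OF T(1) g(1), of p'] divT(5)[OF R g(1), of r] 1 g bR by simp
        then have o: "ok (Dom C g) p q (res (tot R) g r)" using 2 1 g res_in[OF divT(2)[OF R] g(1), of r] by (simp add: ok_def)
        have "res (tot ?T) (Cmp C f g) t = l (Dom C g) p q (res (tot R) g r)"
          using res_Cmp[OF divT(2)[OF T3(1)] f(1) g, of t] t f T3(6)[OF g(1), of p' r] 1 2 g by (simp add: l_def)
        then show "\<exists>s. Rl (Dom C (Cmp C f g)) (res (tot ?T) (Cmp C f g) t) s"
          using o f g unfolding Rl_def by (auto simp: Dom_Cmp)
      qed
    qed
  qed
  then obtain k where k: "k \<in> div_arr ?T (idm (base P)) ?S" "\<And>X t s. \<lbrakk>X \<in> Obj C; t \<in> tsec ?T X; Rl X t s\<rbrakk> \<Longrightarrow> k X t = s" by blast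
  have kt: "k X (tens (tensor P Q) R X (tens P Q X p q) r) = tens P (tensor Q R) X p (tens Q R X q r)"
    if "X \<in> Obj C" "p \<in> tsec P X" "q \<in> tsec Q X" "r \<in> tsec R X" "proj P X p = proj Q X q" "proj Q X q = proj R X r" for X p q r
  proof -
    have o: "ok X p q r" using that by (simp add: ok_def)
    show ?thesis using k(2)[OF that(1) lD(1)[OF that(1) o], of "m X p q r"] o unfolding Rl_def l_def m_def by blast
  qed
  have "associator P Q R = k"
    unfolding associator_def
  proof (rule the_equality)
    fix k' assume k': "k' \<in> div_arr ?T (idm (base P)) ?S \<and> (\<forall>X\<in>Obj C. \<forall>p\<in>tsec P X. \<forall>q\<in>tsec Q X. \<forall>r\<in>tsec R X.
        proj P X p = proj Q X q \<and> proj Q X q = proj R X r \<longrightarrow>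
        k' X (tens (tensor P Q) R X (tens P Q X p q) r) = tens P (tensor Q R) X p (tens Q R X q r))"
    show "k' = k"
      by (rule tensor3_eqI[OF P Q R b divT(2)[OF S3(1)]]) (use k' kt k(1) in \<open>auto dest: div_arrD(1)\<close>)
  qed (use kt k(1) in auto)
  then show ?g1 "PROP ?g2"
    using k(1) kt by simp_all
qed

text \<open>A section of the unit object is a unit times the unit section, and that unit passes
  through the tensor and through both equivariant arrows. So tensors with the unit section suffice
  as generators.\<close>

lemma tensor_unit_eqI:
  assumes P: "div_obj P" and U: "base P = U" and G: "div_obj G"
  shows "\<lbrakk>k \<in> div_arr (tensor (unit_obj U) P) f G; k' \<in> div_arr (tensor (unit_obj U) P) f' G;
      \<And>X p. \<lbrakk>X \<in> Obj C; p \<in> tsec P X\<rbrakk> \<Longrightarrow> k X (tens (unit_obj U) P X (unit_sec U X (proj P X p)) p) =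
        k' X (tens (unit_obj U) P X (unit_sec U X (proj P X p)) p)\<rbrakk> \<Longrightarrow> k = k'"
    and "\<lbrakk>k \<in> div_arr (tensor P (unit_obj U)) f G; k' \<in> div_arr (tensor P (unit_obj U)) f' G;
      \<And>X p. \<lbrakk>X \<in> Obj C; p \<in> tsec P X\<rbrakk> \<Longrightarrow> k X (tens P (unit_obj U) X p (unit_sec U X (proj P X p))) =
        k' X (tens P (unit_obj U) X p (unit_sec U X (proj P X p)))\<rbrakk> \<Longrightarrow> k = k'"
proof -
  have sU: "sheaf U" using divT(1)[OF P] U by simp
  note I = unit_objD[OF sU]
  have b: "base P = base (unit_obj U)" "base (unit_obj U) = base P" using U I by simp_all
  note L = tensorD[OF I(1) P b(1)] and R = tensorD[OF P I(1) b(2)]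
  { assume k: "k \<in> div_arr (tensor (unit_obj U) P) f G" "k' \<in> div_arr (tensor (unit_obj U) P) f' G"
      and e: "\<And>X p. \<lbrakk>X \<in> Obj C; p \<in> tsec P X\<rbrakk> \<Longrightarrow> k X (tens (unit_obj U) P X (unit_sec U X (proj P X p)) p) =
        k' X (tens (unit_obj U) P X (unit_sec U X (proj P X p)) p)"
    show "k = k'"
    proof (rule tensor_eqI[OF I(1) P b(1) divT(2)[OF G] div_arrD(1)[OF k(1)] div_arrD(1)[OF k(2)]])
      fix X t p assume X: "X \<in> Obj C" and t: "t \<in> tsec (unit_obj U) X" and p: "p \<in> tsec P X" and tp: "proj (unit_obj U) X t = proj P X p"
      obtain u where u: "u \<in> O_units X" "act (unit_obj U) X u (unit_sec U X (proj P X p)) = t" using I(8)[OF X t] tp by auto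
      have x: "proj P X p \<in> sec U X" using divT(4)[OF P X p] U by simp
      show "k X (tens (unit_obj U) P X t p) = k' X (tens (unit_obj U) P X t p)"
        using L(7)[OF X I(4)[OF X x] p I(5)[OF X x] u(1)] u(2) e[OF X p] div_arrD(5)[OF k(1) X u(1)] div_arrD(5)[OF k(2) X u(1)]
          L(3)[OF X I(4)[OF X x] p I(5)[OF X x]] by simp
    qed }
  { assume k: "k \<in> div_arr (tensor P (unit_obj U)) f G" "k' \<in> div_arr (tensor P (unit_obj U)) f' G"
      and e: "\<And>X p. \<lbrakk>X \<in> Obj C; p \<in> tsec P X\<rbrakk> \<Longrightarrow> k X (tens P (unit_obj U) X p (unit_sec U X (proj P X p))) =
        k' X (tens P (unit_obj U) X p (unit_sec U X (proj P X p)))"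
    show "k = k'"
    proof (rule tensor_eqI[OF P I(1) b(2) divT(2)[OF G] div_arrD(1)[OF k(1)] div_arrD(1)[OF k(2)]])
      fix X p t assume X: "X \<in> Obj C" and p: "p \<in> tsec P X" and t: "t \<in> tsec (unit_obj U) X" and tp: "proj P X p = proj (unit_obj U) X t"
      obtain u where u: "u \<in> O_units X" "act (unit_obj U) X u (unit_sec U X (proj P X p)) = t" using I(8)[OF X t] tp by auto
      have x: "proj P X p \<in> sec U X" using divT(4)[OF P X p] U by simp
      show "k X (tens P (unit_obj U) X p t) = k' X (tens P (unit_obj U) X p t)"
        using R(8)[OF X p I(4)[OF X x] I(5)[OF X x, symmetric] u(1)] u(2) e[OF X p] div_arrD(5)[OF k(1) X u(1)] div_arrD(5)[OF k(2) X u(1)]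
          R(3)[OF X p I(4)[OF X x] I(5)[OF X x, symmetric]] by simp
    qed }
qed

text \<open>Constructed backwards: sending p to its tensor with the unit section is defined on all
  sections without any gluing, and an arrow over an identity has an inverse. This inverse is the
  unitor.\<close>

lemma unitorD:
  assumes P: "div_obj P" and U: "base P = U"
  shows "left_unitor P \<in> div_arr (tensor (unit_obj U) P) (idm U) P" (is ?g1)
    and "\<lbrakk>X \<in> Obj C; p \<in> tsec P X\<rbrakk> \<Longrightarrow> left_unitor P X (tens (unit_obj U) P X (unit_sec U X (proj P X p)) p) = p" (is "PROP ?g2")
    and "right_unitor P \<in> div_arr (tensor P (unit_obj U)) (idm U) P" (is ?g3)
    and "\<lbrakk>X \<in> Obj C; p \<in> tsec P X\<rbrakk> \<Longrightarrow> right_unitor P X (tens P (unit_obj U) X p (unit_sec U X (proj P X p))) = p" (is "PROP ?g4")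
proof -
  have sU: "sheaf U" using divT(1)[OF P] U by simp
  note I = unit_objD[OF sU]
  have b: "base P = base (unit_obj U)" "base (unit_obj U) = base P" using U I by simp_all
  note L = tensorD[OF I(1) P b(1)] and R = tensorD[OF P I(1) b(2)]
  have x: "proj P X p \<in> sec U X" if "X \<in> Obj C" "p \<in> tsec P X" for X p using divT(4)[OF P that] U by simp
  have xr: "proj P (Dom C f) (res (tot P) f p) = res U f (proj P (Cod C f) p)" if "f \<in> Arr C" "p \<in> tsec P (Cod C f)" for f p
    using divT(5)[OF P that] U by simp
  have one: "\<one>\<^bsub>mon \<O> X\<^esub> \<otimes>\<^bsub>mon \<O> X\<^esub> val P X p = val P X p" "val P X p \<otimes>\<^bsub>mon \<O> X\<^esub> \<one>\<^bsub>mon \<O> X\<^esub> = val P X p" if "X \<in> Obj C" "p \<in> tsec P X" for X p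
    using O_monoid[OF that(1)] div_objD(3)[OF P that] by (simp_all add: monoid.l_one monoid.r_one)
  define l where "l = mk (tot P) (\<lambda>X p. tens (unit_obj U) P X (unit_sec U X (proj P X p)) p)"
  have l: "l \<in> div_arr P (idm U) (tensor (unit_obj U) P)"
    unfolding div_arr_def
  proof (intro CollectI conjI ballI)
    show "l \<in> Hom (tot P) (tot (tensor (unit_obj U) P))" unfolding l_def
      by (rule mk_Hom[OF _ _ divT(2)[OF P]])
        (use L(3)[OF _ I(4)] I(5,7) x xr L(6)[OF _ I(4)[OF Cod_Obj]] Cod_Obj in simp_all)
    fix X p assume a: "X \<in> Obj C" "p \<in> tsec P X"
    show "proj (tensor (unit_obj U) P) X (l X p) = idm U X (proj P X p)" "val (tensor (unit_obj U) P) X (l X p) = val P X p"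
      using L(4,5)[OF a(1) I(4)[OF a(1) x[OF a]] a(2) I(5)[OF a(1) x[OF a]]] I(6)[OF a(1) x[OF a]] a x one by (simp_all add: l_def)
    show "l X (act P X u p) = act (tensor (unit_obj U) P) X u (l X p)" if u: "u \<in> O_units X" for u
      using L(8)[OF a(1) I(4)[OF a(1) x[OF a]] a(2) I(5)[OF a(1) x[OF a]] u] divT(6,7)[OF P a(1) u a(2)] a by (simp add: l_def)
  qed
  define r where "r = mk (tot P) (\<lambda>X p. tens P (unit_obj U) X p (unit_sec U X (proj P X p)))"
  have r: "r \<in> div_arr P (idm U) (tensor P (unit_obj U))"
    unfolding div_arr_def
  proof (intro CollectI conjI ballI)
    show "r \<in> Hom (tot P) (tot (tensor P (unit_obj U)))" unfolding r_def
      by (rule mk_Hom[OF _ _ divT(2)[OF P]])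
        (use R(3)[OF _ _ I(4)] I(5,7) x xr R(6)[OF _ _ I(4)[OF Cod_Obj]] Cod_Obj in simp_all)
    fix X p assume a: "X \<in> Obj C" "p \<in> tsec P X"
    note c = a(1,2) I(4)[OF a(1) x[OF a]] I(5)[OF a(1) x[OF a], symmetric]
    show "proj (tensor P (unit_obj U)) X (r X p) = idm U X (proj P X p)" "val (tensor P (unit_obj U)) X (r X p) = val P X p"
      using R(4,5)[OF c] I(5,6)[OF a(1) x[OF a]] a x one by (simp_all add: r_def)
    show "r X (act P X u p) = act (tensor P (unit_obj U)) X u (r X p)" if u: "u \<in> O_units X" for u
      using R(7)[OF c u] divT(6,7)[OF P a(1) u a(2)] a by (simp add: r_def)
  qed
  have bL: "base (tensor (unit_obj U) P) = U" "base (tensor P (unit_obj U)) = U" using L(2) R(2) I(2) U by simp_all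
  obtain l' where l': "l' \<in> div_arr (tensor (unit_obj U) P) (idm U) P" "\<And>X p. X \<in> Obj C \<Longrightarrow> p \<in> tsec P X \<Longrightarrow> l' X (l X p) = p"
    by (rule div_arr_inverse[OF P L(1) U bL(1) l]) blast
  obtain r' where r': "r' \<in> div_arr (tensor P (unit_obj U)) (idm U) P" "\<And>X p. X \<in> Obj C \<Longrightarrow> p \<in> tsec P X \<Longrightarrow> r' X (r X p) = p"
    by (rule div_arr_inverse[OF P R(1) U bL(2) r]) blast
  have "left_unitor P = l'" unfolding left_unitor_def U
    by (rule the_equality) (use l' in \<open>simp add: l_def\<close>, rule tensor_unit_eqI(1)[OF P U P], use l' in \<open>auto simp: l_def\<close>)
  then show ?g1 "PROP ?g2"
    using l' by (simp_all add: l_def)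
  have "right_unitor P = r'" unfolding right_unitor_def U
    by (rule the_equality) (use r' in \<open>simp add: r_def\<close>, rule tensor_unit_eqI(2)[OF P U P], use r' in \<open>auto simp: r_def\<close>)
  then show ?g3 "PROP ?g4"
    using r' by (simp_all add: r_def)
qed

section \<open>Monoidal functors in terms of sections\<close>

lemma unit_eq_iff:
  assumes V: "sheaf V" and k: "k \<in> div_arr (unit_obj V) f Q" "k' \<in> div_arr (unit_obj V) f' Q"
  shows "k = k' \<longleftrightarrow> (\<forall>X\<in>Obj C. \<forall>x\<in>sec V X. k X (unit_sec V X x) = k' X (unit_sec V X x))"
  using unit_obj_eqI[OF V k] by blast

lemma tensor_eq_iff:
  assumes P: "div_obj P" and Q: "div_obj Q" and b: "base Q = base P" and G: "div_obj G"
    and k: "k \<in> div_arr (tensor P Q) f G" "k' \<in> div_arr (tensor P Q) f' G"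
  shows "k = k' \<longleftrightarrow> (\<forall>X\<in>Obj C. \<forall>p\<in>tsec P X. \<forall>q\<in>tsec Q X. proj P X p = proj Q X q \<longrightarrow>
      k X (tens P Q X p q) = k' X (tens P Q X p q))"
  using tensor_eqI[OF P Q b divT(2)[OF G] div_arrD(1)[OF k(1)] div_arrD(1)[OF k(2)]] by blast

lemma stack_functorD:
  assumes "stack_functor L"
  shows "sheaf U \<Longrightarrow> a \<in> Lpts L U \<Longrightarrow> div_obj (Lobj L U a)" (is "PROP ?g1")
    and "sheaf U \<Longrightarrow> a \<in> Lpts L U \<Longrightarrow> base (Lobj L U a) = U" (is "PROP ?g2")
    and "\<lbrakk>sheaf V; sheaf U; f \<in> Hom V U; a \<in> Lpts L U\<rbrakk> \<Longrightarrow>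
      Larr L V f U a \<in> div_arr (Lobj L V (cmp V a f)) f (Lobj L U a)" (is "PROP ?g3")
    and "sheaf U \<Longrightarrow> a \<in> Lpts L U \<Longrightarrow> Larr L U (idm U) U a = idm (tot (Lobj L U a))" (is "PROP ?g4")
    and "\<lbrakk>sheaf W; sheaf V; sheaf U; g \<in> Hom W V; f \<in> Hom V U; a \<in> Lpts L U\<rbrakk> \<Longrightarrow>
      Larr L W (cmp W f g) U a =
          cmp (tot (Lobj L W (cmp W a (cmp W f g)))) (Larr L V f U a) (Larr L W g V (cmp V a f))" (is "PROP ?g5")
proof -
  note s = assms[unfolded stack_functor_def]
  show "PROP ?g1" "PROP ?g2"
    using s by simp_all
  show "PROP ?g3" using s by simp
  show "PROP ?g4" using s by simp
  show "PROP ?g5" using s by metis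
qed

text \<open>The pairing of sections of L(a) and L(b) that underlies the arrow \<open>Lmul\<close>.
  With it the axioms of L can be written without tensor products.\<close>

definition lmul where
  "lmul L U a b X p q = Lmul L U a b X (tens (Lobj L U a) (Lobj L U b) X p q)"

definition lone where
  "lone L U X x = Lone L U X (unit_sec U X x)"

text \<open>The diagrams of \<open>symmetric_monoidal\<close>, evaluated on pure tensors and on unit
  sections. Associator, unitors and braiding are determined by their values there, so they drop out
  and leave associativity, unit laws and commutativity of \<open>lmul\<close>.\<close>

definition pointwise_monoidal :: "('o, 'a, 'u) df_data \<Rightarrow> bool" where
  "pointwise_monoidal L \<longleftrightarrow>
     (\<forall>U. sheaf U \<longrightarrow> Lone L U \<in> div_arr (unit_obj U) (idm U) (Lobj L U \<one>\<^bsub>arrows U (Lmon L)\<^esub>)) \<and>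
     (\<forall>U a b. sheaf U \<longrightarrow> a \<in> Lpts L U \<longrightarrow> b \<in> Lpts L U \<longrightarrow>
        Lmul L U a b \<in> div_arr (tensor (Lobj L U a) (Lobj L U b)) (idm U)
                          (Lobj L U (a \<otimes>\<^bsub>arrows U (Lmon L)\<^esub> b))) \<and>
     (\<forall>V U f. sheaf V \<longrightarrow> sheaf U \<longrightarrow> f \<in> Hom V U \<longrightarrow>
        (\<forall>X\<in>Obj C. \<forall>x\<in>sec V X. Larr L V f U \<one>\<^bsub>arrows U (Lmon L)\<^esub> X (lone L V X x) = lone L U X (f X x))) \<and>
     (\<forall>V U f a b. sheaf V \<longrightarrow> sheaf U \<longrightarrow> f \<in> Hom V U \<longrightarrow>
        a \<in> Lpts L U \<longrightarrow> b \<in> Lpts L U \<longrightarrow>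
        (\<forall>X\<in>Obj C. \<forall>p\<in>Lsec L V (cmp V a f) X. \<forall>q\<in>Lsec L V (cmp V b f) X.
          Lproj L V (cmp V a f) X p = Lproj L V (cmp V b f) X q \<longrightarrow>
          Larr L V f U (a \<otimes>\<^bsub>arrows U (Lmon L)\<^esub> b) X (lmul L V (cmp V a f) (cmp V b f) X p q) =
          lmul L U a b X (Larr L V f U a X p) (Larr L V f U b X q))) \<and>
     (\<forall>U a b c. sheaf U \<longrightarrow> a \<in> Lpts L U \<longrightarrow> b \<in> Lpts L U \<longrightarrow>
        c \<in> Lpts L U \<longrightarrow>
        (\<forall>X\<in>Obj C. \<forall>p\<in>Lsec L U a X. \<forall>q\<in>Lsec L U b X. \<forall>r\<in>Lsec L U c X.
          Lproj L U a X p = Lproj L U b X q \<longrightarrow> Lproj L U b X q = Lproj L U c X r \<longrightarrow>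
          lmul L U a (b \<otimes>\<^bsub>arrows U (Lmon L)\<^esub> c) X p (lmul L U b c X q r) =
          lmul L U (a \<otimes>\<^bsub>arrows U (Lmon L)\<^esub> b) c X (lmul L U a b X p q) r)) \<and>
     (\<forall>U a. sheaf U \<longrightarrow> a \<in> Lpts L U \<longrightarrow>
        (\<forall>X\<in>Obj C. \<forall>p\<in>Lsec L U a X.
          lmul L U \<one>\<^bsub>arrows U (Lmon L)\<^esub> a X (lone L U X (Lproj L U a X p)) p = p) \<and>
        (\<forall>X\<in>Obj C. \<forall>p\<in>Lsec L U a X.
          lmul L U a \<one>\<^bsub>arrows U (Lmon L)\<^esub> X p (lone L U X (Lproj L U a X p)) = p)) \<and>
     (\<forall>U a b. sheaf U \<longrightarrow> a \<in> Lpts L U \<longrightarrow> b \<in> Lpts L U \<longrightarrow>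
        (\<forall>X\<in>Obj C. \<forall>p\<in>Lsec L U a X. \<forall>q\<in>Lsec L U b X.
          Lproj L U a X p = Lproj L U b X q \<longrightarrow> lmul L U b a X q p = lmul L U a b X p q))"

lemma lone_lmulD:
  assumes SF: "stack_functor L" and MS: "monoid_sheaf (Lmon L)" and U: "sheaf U"
  shows "\<lbrakk>Lone L U \<in> div_arr (unit_obj U) (idm U) (Lobj L U \<one>\<^bsub>arrows U (Lmon L)\<^esub>); X \<in> Obj C; x \<in> sec U X\<rbrakk> \<Longrightarrow>
      lone L U X x \<in> Lsec L U \<one>\<^bsub>arrows U (Lmon L)\<^esub> X \<and>
      proj (Lobj L U \<one>\<^bsub>arrows U (Lmon L)\<^esub>) X (lone L U X x) = x \<and>
      val (Lobj L U \<one>\<^bsub>arrows U (Lmon L)\<^esub>) X (lone L U X x) = \<one>\<^bsub>mon \<O> X\<^esub>"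
    and "\<lbrakk>Lmul L U a b \<in> div_arr (tensor (Lobj L U a) (Lobj L U b)) (idm U) (Lobj L U (a \<otimes>\<^bsub>arrows U (Lmon L)\<^esub> b)); a \<in> Lpts L U; b \<in> Lpts L U; X \<in> Obj C; p \<in> Lsec L U a X; q \<in> Lsec L U b X; Lproj L U a X p = Lproj L U b X q\<rbrakk> \<Longrightarrow>
      lmul L U a b X p q \<in> Lsec L U (a \<otimes>\<^bsub>arrows U (Lmon L)\<^esub> b) X \<and>
      Lproj L U (a \<otimes>\<^bsub>arrows U (Lmon L)\<^esub> b) X (lmul L U a b X p q) = Lproj L U b X q \<and>
      val (Lobj L U (a \<otimes>\<^bsub>arrows U (Lmon L)\<^esub> b)) X (lmul L U a b X p q) = val (Lobj L U a) X p \<otimes>\<^bsub>mon \<O> X\<^esub> val (Lobj L U b) X q"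
proof -
  note I = unit_objD[OF U]
  assume o: "Lone L U \<in> div_arr (unit_obj U) (idm U) (Lobj L U \<one>\<^bsub>arrows U (Lmon L)\<^esub>)" and X: "X \<in> Obj C" and x: "x \<in> sec U X"
  show "lone L U X x \<in> Lsec L U \<one>\<^bsub>arrows U (Lmon L)\<^esub> X \<and>
      proj (Lobj L U \<one>\<^bsub>arrows U (Lmon L)\<^esub>) X (lone L U X x) = x \<and>
      val (Lobj L U \<one>\<^bsub>arrows U (Lmon L)\<^esub>) X (lone L U X x) = \<one>\<^bsub>mon \<O> X\<^esub>"
    using div_arrD(2,4,6)[OF o X I(4)[OF X x]] I(5,6)[OF X x] X x by (simp add: lone_def)
next
  assume m: "Lmul L U a b \<in> div_arr (tensor (Lobj L U a) (Lobj L U b)) (idm U) (Lobj L U (a \<otimes>\<^bsub>arrows U (Lmon L)\<^esub> b))"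
    and a: "a \<in> Lpts L U" and b: "b \<in> Lpts L U" and X: "X \<in> Obj C"
    and pq: "p \<in> Lsec L U a X" "q \<in> Lsec L U b X" "Lproj L U a X p = Lproj L U b X q"
  note P = stack_functorD(1,2)[OF SF U a] and Q = stack_functorD(1,2)[OF SF U b]
  have bb: "base (Lobj L U b) = base (Lobj L U a)" using P Q by simp
  note T = tensorD[OF P(1) Q(1) bb]
  have x: "Lproj L U b X q \<in> sec U X" using divT(4)[OF Q(1) X pq(2)] Q by simp
  show "lmul L U a b X p q \<in> Lsec L U (a \<otimes>\<^bsub>arrows U (Lmon L)\<^esub> b) X \<and>
      Lproj L U (a \<otimes>\<^bsub>arrows U (Lmon L)\<^esub> b) X (lmul L U a b X p q) = Lproj L U b X q \<and>
      val (Lobj L U (a \<otimes>\<^bsub>arrows U (Lmon L)\<^esub> b)) X (lmul L U a b X p q) = val (Lobj L U a) X p \<otimes>\<^bsub>mon \<O> X\<^esub> val (Lobj L U b) X q"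
    using div_arrD(2,4,6)[OF m X T(3)[OF X pq]] T(4,5)[OF X pq] X x by (simp add: lmul_def)
qed

text \<open>In each diagram both composites are arrows of Div out of a tensor product or a unit
  object, so their equality is equivalent to equality on generators. Both directions serve: one to
  use a given DF log structure, the other to construct one.\<close>

lemma symmetric_monoidal_iff:
  assumes SF: "stack_functor L" and MS: "monoid_sheaf (Lmon L)"
  shows "symmetric_monoidal L \<longleftrightarrow> pointwise_monoidal L"
proof (cases "(\<forall>U. sheaf U \<longrightarrow> Lone L U \<in> div_arr (unit_obj U) (idm U) (Lobj L U \<one>\<^bsub>arrows U (Lmon L)\<^esub>)) \<and>
     (\<forall>U a b. sheaf U \<longrightarrow> a \<in> Lpts L U \<longrightarrow> b \<in> Lpts L U \<longrightarrow>
        Lmul L U a b \<in> div_arr (tensor (Lobj L U a) (Lobj L U b)) (idm U)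
                          (Lobj L U (a \<otimes>\<^bsub>arrows U (Lmon L)\<^esub> b)))")
  \<comment> \<open>The typing conditions are conjuncts of both sides. Once the case where they fail
    is split off, they are available while the remaining conjuncts are compared one by one.\<close>
  case False
  then show ?thesis unfolding symmetric_monoidal_def pointwise_monoidal_def by blast
next
  case True
  then have lo: "\<And>U. sheaf U \<Longrightarrow> Lone L U \<in> div_arr (unit_obj U) (idm U) (Lobj L U \<one>\<^bsub>arrows U (Lmon L)\<^esub>)"
    and lm: "\<And>U a b. \<lbrakk>sheaf U; a \<in> Lpts L U; b \<in> Lpts L U\<rbrakk> \<Longrightarrow>
      Lmul L U a b \<in> div_arr (tensor (Lobj L U a) (Lobj L U b)) (idm U) (Lobj L U (a \<otimes>\<^bsub>arrows U (Lmon L)\<^esub> b))"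
    by blast+
  note D = stack_functorD[OF SF]
  note H = arrows_mult_Hom(1)[OF MS] arrows_one_Hom(1)[OF MS]
  have bb: "base (Lobj L U b) = base (Lobj L U a)" if "sheaf U" "a \<in> Lpts L U" "b \<in> Lpts L U" for U a b
    using D(2) that by simp
  note TD = tensorD[OF D(1) D(1) bb]
  have p6: "cmp (tot (tensor (unit_obj U) (Lobj L U a))) (Lmul L U \<one>\<^bsub>arrows U (Lmon L)\<^esub> a)
           (tensor_map (unit_obj U) (Lobj L U a) (idm U) (Lobj L U \<one>\<^bsub>arrows U (Lmon L)\<^esub>) (Lobj L U a) (Lone L U) (idm (tot (Lobj L U a))))
           = left_unitor (Lobj L U a) \<longleftrightarrow> (\<forall>X\<in>Obj C. \<forall>p\<in>Lsec L U a X.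
          lmul L U \<one>\<^bsub>arrows U (Lmon L)\<^esub> a X (lone L U X (Lproj L U a X p)) p = p)"
      (is "?e1 = ?l1 \<longleftrightarrow> ?r1")
    "cmp (tot (tensor (Lobj L U a) (unit_obj U))) (Lmul L U a \<one>\<^bsub>arrows U (Lmon L)\<^esub>)
           (tensor_map (Lobj L U a) (unit_obj U) (idm U) (Lobj L U a) (Lobj L U \<one>\<^bsub>arrows U (Lmon L)\<^esub>) (idm (tot (Lobj L U a))) (Lone L U))
           = right_unitor (Lobj L U a) \<longleftrightarrow> (\<forall>X\<in>Obj C. \<forall>p\<in>Lsec L U a X.
          lmul L U a \<one>\<^bsub>arrows U (Lmon L)\<^esub> X p (lone L U X (Lproj L U a X p)) = p)"
      (is "?e2 = ?l2 \<longleftrightarrow> ?r2")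
    if U: "sheaf U" and a: "a \<in> Lpts L U" for U a
  proof -
    note I = unit_objD[OF U] and P = D(1,2)[OF U a] and z = H(2)[OF U]
    have b: "base (Lobj L U a) = base (unit_obj U)" "base (unit_obj U) = base (Lobj L U a)" using P I by simp_all
    note LT = tensorD[OF I(1) P(1) b(1)] and RT = tensorD[OF P(1) I(1) b(2)]
    have bT: "base (tensor (unit_obj U) (Lobj L U a)) = U" "base (tensor (Lobj L U a) (unit_obj U)) = U" using LT(2) RT(2) I(2) P(2) by simp_all
    have iU: "idm U \<in> Hom (base (unit_obj U)) (base (Lobj L U \<one>\<^bsub>arrows U (Lmon L)\<^esub>))" "idm U \<in> Hom (base (Lobj L U a)) (base (Lobj L U a))"
      using idm_Hom[OF U] P(2) I(2) D(2)[OF U z] by simp_all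
    note t1 = tensor_mapD[OF I(1) P(1) b(1) D(1)[OF U z] P(1) bb[OF U z a] iU(1) lo[OF U] idm_div_arr[OF P]]
    note t2 = tensor_mapD[OF P(1) I(1) b(2) P(1) D(1)[OF U z] bb[OF U a z] iU(2) idm_div_arr[OF P] lo[OF U]]
    note A = arrows_monoid_laws(3,4)[OF MS U a a a]
    have e1: "?e1 \<in> div_arr (tensor (unit_obj U) (Lobj L U a)) (idm U) (Lobj L U a)"
      using cmp_div_arr_idm[OF LT(1) bT(1) t1(1) lm[OF U z a]] A by simp
    have e2: "?e2 \<in> div_arr (tensor (Lobj L U a) (unit_obj U)) (idm U) (Lobj L U a)"
      using cmp_div_arr_idm[OF RT(1) bT(2) t2(1) lm[OF U a z]] A by simp
    note un = unitorD[OF P]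
    have pt: "?e1 X (tens (unit_obj U) (Lobj L U a) X (unit_sec U X (Lproj L U a X p)) p) = lmul L U \<one>\<^bsub>arrows U (Lmon L)\<^esub> a X (lone L U X (Lproj L U a X p)) p"
        "?e2 X (tens (Lobj L U a) (unit_obj U) X p (unit_sec U X (Lproj L U a X p))) = lmul L U a \<one>\<^bsub>arrows U (Lmon L)\<^esub> X p (lone L U X (Lproj L U a X p))"
      if X: "X \<in> Obj C" and p: "p \<in> Lsec L U a X" for X p
    proof -
      have x: "Lproj L U a X p \<in> sec U X" using divT(4)[OF P(1) X p] P by simp
      note e = I(4,5)[OF X x]
      show "?e1 X (tens (unit_obj U) (Lobj L U a) X (unit_sec U X (Lproj L U a X p)) p) = lmul L U \<one>\<^bsub>arrows U (Lmon L)\<^esub> a X (lone L U X (Lproj L U a X p)) p"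
        using t1(2)[OF X e(1) p e(2)] LT(3)[OF X e(1) p e(2)] X p by (simp add: lmul_def lone_def)
      show "?e2 X (tens (Lobj L U a) (unit_obj U) X p (unit_sec U X (Lproj L U a X p))) = lmul L U a \<one>\<^bsub>arrows U (Lmon L)\<^esub> X p (lone L U X (Lproj L U a X p))"
        using t2(2)[OF X p e(1) e(2)[symmetric]] RT(3)[OF X p e(1) e(2)[symmetric]] X p by (simp add: lmul_def lone_def)
    qed
    show "?e1 = ?l1 \<longleftrightarrow> ?r1" using tensor_unit_eqI(1)[OF P P(1) e1 un(1)] pt(1) un(2) by metis
    show "?e2 = ?l2 \<longleftrightarrow> ?r2" using tensor_unit_eqI(2)[OF P P(1) e2 un(3)] pt(2) un(4) by metis
  qed
  show ?thesis
    unfolding symmetric_monoidal_def pointwise_monoidal_def Let_def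
  proof (intro arg_cong2[where f = "(\<and>)"] iff_allI imp_cong refl p6, goal_cases)
    case (1 V U f)
    then have V: "sheaf V" and U: "sheaf U" and f: "f \<in> Hom V U" by blast+
    note I = unit_objD[OF V]
    have 1: "cmp (tot (unit_obj V)) (Larr L V f U \<one>\<^bsub>arrows U (Lmon L)\<^esub>) (Lone L V) \<in>
        div_arr (unit_obj V) (cmp V f (idm V)) (Lobj L U \<one>\<^bsub>arrows U (Lmon L)\<^esub>)"
      using cmp_div_arr[OF I(1,2) lo[OF V], of _ f] D(3)[OF V U f H(2)[OF U]] arrows_comp(2)[OF MS U V f] by simp
    have 2: "cmp (tot (unit_obj V)) (Lone L U) (unit_map V f U) \<in> div_arr (unit_obj V) (cmp V (idm U) f) (Lobj L U \<one>\<^bsub>arrows U (Lmon L)\<^esub>)"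
      by (rule cmp_div_arr[OF I(1,2) unit_mapD(1)[OF V U f] lo[OF U]])
    show ?case unfolding unit_eq_iff[OF V 1 2]
      using I(4) unit_mapD(2)[OF V U f] by (simp add: lone_def)
  next
    case (2 V U f a b)
    then have V: "sheaf V" and U: "sheaf U" and f: "f \<in> Hom V U" and a: "a \<in> Lpts L U" and b: "b \<in> Lpts L U" by blast+
    note af = cmp_Hom[OF V f a] and bf = cmp_Hom[OF V f b]
    note T = TD[OF V af V bf V af bf]
    let ?T = "tensor (Lobj L V (cmp V a f)) (Lobj L V (cmp V b f))"
    have bT: "base ?T = V" using T(2) D(2)[OF V af] by simp
    have bL: "f \<in> Hom (base (Lobj L V (cmp V a f))) (base (Lobj L U a))" using D(2)[OF V af] D(2)[OF U a] f by simp
    note tm = tensor_mapD[OF D(1)[OF V af] D(1)[OF V bf] bb[OF V af bf] D(1)[OF U a] D(1)[OF U b] bb[OF U a b] bL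
        D(3)[OF V U f a] D(3)[OF V U f b]]
    have 1: "cmp (tot ?T) (Larr L V f U (a \<otimes>\<^bsub>arrows U (Lmon L)\<^esub> b)) (Lmul L V (cmp V a f) (cmp V b f)) \<in>
        div_arr ?T (cmp V f (idm V)) (Lobj L U (a \<otimes>\<^bsub>arrows U (Lmon L)\<^esub> b))"
      using cmp_div_arr[OF T(1) bT lm[OF V af bf], of _ f] D(3)[OF V U f H(1)[OF U a b]] arrows_comp(1)[OF MS U V f a b] by simp
    have 2: "cmp (tot ?T) (Lmul L U a b)
           (tensor_map (Lobj L V (cmp V a f)) (Lobj L V (cmp V b f)) f (Lobj L U a) (Lobj L U b) (Larr L V f U a) (Larr L V f U b)) \<in>
        div_arr ?T (cmp V (idm U) f) (Lobj L U (a \<otimes>\<^bsub>arrows U (Lmon L)\<^esub> b))"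
      by (rule cmp_div_arr[OF T(1) bT tm(1) lm[OF U a b]])
    show ?case
      unfolding tensor_eq_iff[OF D(1)[OF V af] D(1)[OF V bf] bb[OF V af bf] D(1)[OF U H(1)[OF U a b]] 1 2]
      using T(3) tm(2) by (simp add: lmul_def)
  next
    case (3 U a b c)
    then have U: "sheaf U" and a: "a \<in> Lpts L U" and b: "b \<in> Lpts L U" and c: "c \<in> Lpts L U" by blast+
    let "cmp (tot ?T) ?m1 (cmp (tot ?T) ?t1 ?as) = cmp (tot ?T) ?m2 ?t2 \<longleftrightarrow> ?rhs" = ?case
    note ab = H(1)[OF U a b] and bc = H(1)[OF U b c]
    note P = D(1)[OF U a] and Q = D(1)[OF U b] and R = D(1)[OF U c]
    note Tab = tensorD[OF P Q bb[OF U a b]] and Tbc = tensorD[OF Q R bb[OF U b c]]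
    have base_ab: "base (tensor (Lobj L U a) (Lobj L U b)) = U" "base (tensor (Lobj L U b) (Lobj L U c)) = U"
      using Tab(2) Tbc(2) D(2)[OF U a] D(2)[OF U b] by simp_all
    have b1: "base (Lobj L U c) = base (tensor (Lobj L U a) (Lobj L U b))" "base (tensor (Lobj L U b) (Lobj L U c)) = base (Lobj L U a)"
      using base_ab D(2)[OF U a] D(2)[OF U c] by simp_all
    note T = tensorD[OF Tab(1) R b1(1)] and S = tensorD[OF P Tbc(1) b1(2)]
    have bT: "base ?T = U" using T(2) base_ab by simp
    note as = associatorD[OF P Q R bb[OF U a b] bb[OF U a c], unfolded D(2)[OF U a]]
    have iU: "idm U \<in> Hom (base (Lobj L U a)) (base (Lobj L U a))" "idm U \<in> Hom (base (tensor (Lobj L U a) (Lobj L U b))) (base (Lobj L U (a \<otimes>\<^bsub>arrows U (Lmon L)\<^esub> b)))"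
      using idm_Hom[OF U] D(2)[OF U a] D(2)[OF U ab] base_ab by simp_all
    note t1 = tensor_mapD[OF P Tbc(1) b1(2) P D(1)[OF U bc] bb[OF U a bc] iU(1) idm_div_arr[OF P D(2)[OF U a]] lm[OF U b c]]
    note t2 = tensor_mapD[OF Tab(1) R b1(1) D(1)[OF U ab] R bb[OF U ab c] iU(2) lm[OF U a b] idm_div_arr[OF R D(2)[OF U c]]]
    have abc: "(a \<otimes>\<^bsub>arrows U (Lmon L)\<^esub> b) \<otimes>\<^bsub>arrows U (Lmon L)\<^esub> c = a \<otimes>\<^bsub>arrows U (Lmon L)\<^esub> (b \<otimes>\<^bsub>arrows U (Lmon L)\<^esub> c)"
      by (rule arrows_monoid_laws(2)[OF MS U a b c])
    note in1 = cmp_div_arr_idm[OF T(1) bT as(1) t1(1)]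
    note 1 = cmp_div_arr_idm[OF T(1) bT in1 lm[OF U a bc]]
    note 2 = cmp_div_arr_idm[OF T(1) bT t2(1) lm[OF U ab c], unfolded abc]
    have pt: "cmp (tot ?T) ?m1 (cmp (tot ?T) ?t1 ?as) X (tens (tensor (Lobj L U a) (Lobj L U b)) (Lobj L U c) X (tens (Lobj L U a) (Lobj L U b) X p q) r)
        = lmul L U a (b \<otimes>\<^bsub>arrows U (Lmon L)\<^esub> c) X p (lmul L U b c X q r)"
      "cmp (tot ?T) ?m2 ?t2 X (tens (tensor (Lobj L U a) (Lobj L U b)) (Lobj L U c) X (tens (Lobj L U a) (Lobj L U b) X p q) r)
        = lmul L U (a \<otimes>\<^bsub>arrows U (Lmon L)\<^esub> b) c X (lmul L U a b X p q) r"
      if X: "X \<in> Obj C" and p: "p \<in> Lsec L U a X" and q: "q \<in> Lsec L U b X" and r: "r \<in> Lsec L U c X"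
        and e: "Lproj L U a X p = Lproj L U b X q" "Lproj L U b X q = Lproj L U c X r" for X p q r
    proof -
      note pq = Tab(3,4)[OF X p q e(1)] and qr = Tbc(3,4)[OF X q r e(2)]
      have e1: "proj (tensor (Lobj L U a) (Lobj L U b)) X (tens (Lobj L U a) (Lobj L U b) X p q) = Lproj L U c X r" using pq e by simp
      have e2: "Lproj L U a X p = proj (tensor (Lobj L U b) (Lobj L U c)) X (tens (Lobj L U b) (Lobj L U c) X q r)" using qr e by simp
      note w = T(3)[OF X pq(1) r e1]
      show "cmp (tot ?T) ?m1 (cmp (tot ?T) ?t1 ?as) X (tens (tensor (Lobj L U a) (Lobj L U b)) (Lobj L U c) X (tens (Lobj L U a) (Lobj L U b) X p q) r)
        = lmul L U a (b \<otimes>\<^bsub>arrows U (Lmon L)\<^esub> c) X p (lmul L U b c X q r)"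
        using w X as(2)[OF X p q r e] t1(2)[OF X p qr(1) e2] p by (simp add: lmul_def)
      show "cmp (tot ?T) ?m2 ?t2 X (tens (tensor (Lobj L U a) (Lobj L U b)) (Lobj L U c) X (tens (Lobj L U a) (Lobj L U b) X p q) r)
        = lmul L U (a \<otimes>\<^bsub>arrows U (Lmon L)\<^esub> b) c X (lmul L U a b X p q) r"
        using w X t2(2)[OF X pq(1) r e1] r by (simp add: lmul_def)
    qed
    show ?case
    proof
      assume eq: "cmp (tot ?T) ?m1 (cmp (tot ?T) ?t1 ?as) = cmp (tot ?T) ?m2 ?t2"
      show ?rhs using pt[unfolded eq] by simp
    next
      assume r: ?rhs
      show "cmp (tot ?T) ?m1 (cmp (tot ?T) ?t1 ?as) = cmp (tot ?T) ?m2 ?t2"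
        by (rule tensor3_eqI[OF P Q R bb[OF U a b] bb[OF U a c] divT(2)[OF D(1)[OF U H(1)[OF U a bc]]] div_arrD(1)[OF 1] div_arrD(1)[OF 2]])
          (use pt r in simp)
    qed
  next
    \<comment> \<open>Cases 4 to 7 are the premises of the two unitor equivalences \<open>p6\<close>
      and hold by assumption.\<close>
    case (8 U a b)
    then have U: "sheaf U" and a: "a \<in> Lpts L U" and b: "b \<in> Lpts L U" by blast+
    note P = D(1)[OF U a] and Q = D(1)[OF U b]
    note T = tensorD[OF P Q bb[OF U a b]]
    have bT: "base (tensor (Lobj L U a) (Lobj L U b)) = U" using T(2) D(2)[OF U a] by simp
    note br = braidingD[OF P Q bb[OF U a b], unfolded D(2)[OF U a]]
    have 1: "cmp (tot (tensor (Lobj L U a) (Lobj L U b))) (Lmul L U b a) (braiding (Lobj L U a) (Lobj L U b)) \<in>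
       div_arr (tensor (Lobj L U a) (Lobj L U b)) (idm U) (Lobj L U (a \<otimes>\<^bsub>arrows U (Lmon L)\<^esub> b))"
      using cmp_div_arr_idm[OF T(1) bT br(1) lm[OF U b a]] arrows_monoid_laws(1)[OF MS U a b b] by simp
    show ?case
      unfolding tensor_eq_iff[OF P Q bb[OF U a b] D(1)[OF U H(1)[OF U a b]] 1 lm[OF U a b]]
      using T(3) br(2) by (simp add: lmul_def)
  qed
qed

lemma dfD:
  assumes "df L"
  shows "monoid_sheaf (Lmon L)" and "sharp (Lmon L)" and "stack_functor L" and "pointwise_monoidal L" and "trivial_kernel L"
  using assms symmetric_monoidal_iff[of L] by (auto simp: df_def)

section \<open>The Kato log structure of a DF log structure\<close>

text \<open>\<open>tq L\<close> is the universal object \<open>L(id\<^sub>A)\<close>, and \<open>rq L U a\<close> the arrow \<open>L(a) \<rightarrow> L(id\<^sub>A)\<close> over \<open>a\<close>.\<close>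
definition tq :: "('o, 'a, 'u) df_data \<Rightarrow> ('o, 'a, 'u) torsor_map" where
  "tq L = Lobj L (und (Lmon L)) (idm (und (Lmon L)))"

definition rq :: "('o, 'a, 'u) df_data \<Rightarrow> ('o, 'a, 'u) presheaf \<Rightarrow> ('o, 'u) family \<Rightarrow> ('o, 'u) family" where
  "rq L U a = Larr L U a (und (Lmon L)) (idm (und (Lmon L)))"

text \<open>Independent of the choice of the test object \<open>U\<close>, as every choice maps to \<open>A \<times> A\<close>.\<close>
definition mq :: "('o, 'a, 'u) df_data \<Rightarrow> 'o \<Rightarrow> 'u \<Rightarrow> 'u \<Rightarrow> 'u" where
  "mq L X m n = (THE r. \<exists>U a b p q. sheaf U \<and> a \<in> Lpts L U \<and> b \<in> Lpts L U \<and>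
     p \<in> Lsec L U a X \<and> q \<in> Lsec L U b X \<and> Lproj L U a X p = Lproj L U b X q \<and>
     rq L U a X p = m \<and> rq L U b X q = n \<and> r = rq L U (a \<otimes>\<^bsub>arrows U (Lmon L)\<^esub> b) X (lmul L U a b X p q))"

text \<open>Evaluated at the test object A and its section 1; \<open>oq_rq\<close> shows that every
  other test object and every other section give the same.\<close>

definition oq :: "('o, 'a, 'u) df_data \<Rightarrow> 'o \<Rightarrow> 'u" where
  "oq L X = rq L (und (Lmon L)) \<one>\<^bsub>arrows (und (Lmon L)) (Lmon L)\<^esub> X (lone L (und (Lmon L)) X \<one>\<^bsub>mon (Lmon L) X\<^esub>)"

definition kato_of_df :: "('o, 'a, 'u) df_data \<Rightarrow> ('o, 'a, 'u) kato" where
  "kato_of_df L = (\<lparr>mon = (\<lambda>X. \<lparr>carrier = tsec (tq L) X, monoid.mult = mq L X, one = oq L X\<rparr>), mres = res (tot (tq L))\<rparr>, val (tq L))"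

lemma product_exists:
  assumes U: "sheaf U" and V: "sheaf V"
  obtains W p q c where "sheaf W" "p \<in> Hom W U" "q \<in> Hom W V"
    "\<And>X x y. \<lbrakk>X \<in> Obj C; x \<in> sec U X; y \<in> sec V X\<rbrakk> \<Longrightarrow>
      c X x y \<in> sec W X \<and> p X (c X x y) = x \<and> q X (c X x y) = y"
    "\<And>f x y. \<lbrakk>f \<in> Arr C; x \<in> sec U (Cod C f); y \<in> sec V (Cod C f)\<rbrakk> \<Longrightarrow>
      res W f (c (Cod C f) x y) = c (Dom C f) (res U f x) (res V f y)"
proof -
  obtain W where "fibre_product U V (\<lambda>X x y. True) W"
    using fibre_product_exists[OF U V, of "\<lambda>X x y. True"] by auto
  then obtain F p q c where "fibre_product U V (\<lambda>X x y. True) (F, p, q, c)" by (cases W) auto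
  then have F: "sheaf F" and p: "p \<in> Hom F U" and q: "q \<in> Hom F V"
    and c: "\<And>X x u. \<lbrakk>X \<in> Obj C; x \<in> sec U X; u \<in> sec V X\<rbrakk> \<Longrightarrow>
      c X x u \<in> sec F X \<and> p X (c X x u) = x \<and> q X (c X x u) = u"
    and z: "\<And>X z. X \<in> Obj C \<Longrightarrow> z \<in> sec F X \<Longrightarrow> c X (p X z) (q X z) = z"
    by (auto simp: fibre_product_def)
  show ?thesis
  proof (rule that[OF F p q c])
    fix f x y assume f: "f \<in> Arr C" and x: "x \<in> sec U (Cod C f)" and y: "y \<in> sec V (Cod C f)"
    note cc = c[OF Cod_Obj[OF f] x y]
    have "c (Dom C f) (p (Dom C f) (res F f (c (Cod C f) x y))) (q (Dom C f) (res F f (c (Cod C f) x y))) = res F f (c (Cod C f) x y)"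
      using z[OF Dom_Obj[OF f] res_in[OF F f]] cc by simp
    then show "res F f (c (Cod C f) x y) = c (Dom C f) (res U f x) (res V f y)"
      using Hom_res[OF p f] Hom_res[OF q f] cc by simp
  qed
qed

section \<open>Operations on the sections of a DF log structure\<close>

context
  fixes L :: "('o, 'a, 'u) df_data"
  assumes df: "df L"
begin

lemmas sheaf_A = monoid_sheafD(1)[OF dfD(1)[OF df]]
lemmas A_mult_Hom = arrows_mult_Hom(1)[OF dfD(1)[OF df]]
lemmas A_one_Hom = arrows_one_Hom(1)[OF dfD(1)[OF df]]
lemmas L_div = stack_functorD(1)[OF dfD(3)[OF df]]
lemmas L_base = stack_functorD(2)[OF dfD(3)[OF df]]
lemmas L_arr = stack_functorD(3)[OF dfD(3)[OF df]]

lemma L_base_eq: "\<lbrakk>sheaf U; a \<in> Lpts L U; b \<in> Lpts L U\<rbrakk> \<Longrightarrow> base (Lobj L U b) = base (Lobj L U a)"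
  using L_base by simp

lemma L_proj_in: "\<lbrakk>sheaf U; a \<in> Lpts L U; X \<in> Obj C; p \<in> Lsec L U a X\<rbrakk> \<Longrightarrow>
      Lproj L U a X p \<in> sec U X"
  using divT(4)[OF L_div, of U a X p] L_base[of U a] by simp

lemma L_arr_id: "\<lbrakk>sheaf U; a \<in> Lpts L U; X \<in> Obj C; p \<in> Lsec L U a X\<rbrakk> \<Longrightarrow>
      Larr L U (idm U) U a X p = p"
  using stack_functorD(4)[OF dfD(3)[OF df]] by simp

lemma L_arr_comp:
  assumes "sheaf W" "sheaf V" "sheaf U" "g \<in> Hom W V" "f \<in> Hom V U" "a \<in> Lpts L U" "X \<in> Obj C"
    "p \<in> Lsec L W (cmp W (cmp V a f) g) X"
  shows "Larr L W (cmp W f g) U a X p = Larr L V f U a X (Larr L W g V (cmp V a f) X p)"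
  using stack_functorD(5)[OF dfD(3)[OF df] assms(1-6)] assms(7,8) cmp_assoc[OF assms(1,4,2,5,6)] by simp

lemma lone_arr: "sheaf U \<Longrightarrow> Lone L U \<in> div_arr (unit_obj U) (idm U) (Lobj L U \<one>\<^bsub>arrows U (Lmon L)\<^esub>)"
  using dfD(4)[OF df] by (simp add: pointwise_monoidal_def)

lemma lmul_arr: "\<lbrakk>sheaf U; a \<in> Lpts L U; b \<in> Lpts L U\<rbrakk> \<Longrightarrow>
      Lmul L U a b \<in> div_arr (tensor (Lobj L U a) (Lobj L U b)) (idm U) (Lobj L U (a \<otimes>\<^bsub>arrows U (Lmon L)\<^esub> b))"
  using dfD(4)[OF df] by (simp add: pointwise_monoidal_def)

lemma loneD:
  assumes U: "sheaf U" and X: "X \<in> Obj C" and x: "x \<in> sec U X"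
  shows "lone L U X x \<in> Lsec L U \<one>\<^bsub>arrows U (Lmon L)\<^esub> X"
    and "proj (Lobj L U \<one>\<^bsub>arrows U (Lmon L)\<^esub>) X (lone L U X x) = x"
    and "val (Lobj L U \<one>\<^bsub>arrows U (Lmon L)\<^esub>) X (lone L U X x) = \<one>\<^bsub>mon \<O> X\<^esub>"
  using lone_lmulD(1)[OF dfD(3)[OF df] dfD(1)[OF df] U lone_arr[OF U] X x] by simp_all

lemma lone_res: "\<lbrakk>sheaf U; f \<in> Arr C; x \<in> sec U (Cod C f)\<rbrakk> \<Longrightarrow>
      res (tot (Lobj L U \<one>\<^bsub>arrows U (Lmon L)\<^esub>)) f (lone L U (Cod C f) x) = lone L U (Dom C f) (res U f x)"
  using div_arrD(3)[OF lone_arr, of U f "unit_sec U (Cod C f) x"] unit_objD(4)[of U "Cod C f" x] unit_objD(7)[of U f x]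
  by (simp add: lone_def Cod_Obj)

lemma lone_Larr: "\<lbrakk>sheaf V; sheaf U; f \<in> Hom V U; X \<in> Obj C; x \<in> sec V X\<rbrakk> \<Longrightarrow>
      Larr L V f U \<one>\<^bsub>arrows U (Lmon L)\<^esub> X (lone L V X x) = lone L U X (f X x)"
  using dfD(4)[OF df] by (simp add: pointwise_monoidal_def)

lemma lmulD:
  assumes U: "sheaf U" and a: "a \<in> Lpts L U" and b: "b \<in> Lpts L U" and X: "X \<in> Obj C"
    and pq: "p \<in> Lsec L U a X" "q \<in> Lsec L U b X" "Lproj L U a X p = Lproj L U b X q"
  shows "lmul L U a b X p q \<in> Lsec L U (a \<otimes>\<^bsub>arrows U (Lmon L)\<^esub> b) X" (is ?g1)
    and "Lproj L U (a \<otimes>\<^bsub>arrows U (Lmon L)\<^esub> b) X (lmul L U a b X p q) = Lproj L U b X q" (is ?g2)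
    and "val (Lobj L U (a \<otimes>\<^bsub>arrows U (Lmon L)\<^esub> b)) X (lmul L U a b X p q) = val (Lobj L U a) X p \<otimes>\<^bsub>mon \<O> X\<^esub> val (Lobj L U b) X q" (is ?g3)
    and "u \<in> O_units X \<Longrightarrow> lmul L U a b X (act (Lobj L U a) X u p) q = act (Lobj L U (a \<otimes>\<^bsub>arrows U (Lmon L)\<^esub> b)) X u (lmul L U a b X p q)" (is "PROP ?g4")
    and "lmul L U b a X q p = lmul L U a b X p q"
proof -
  show ?g1 ?g2 ?g3
    using lone_lmulD(2)[OF dfD(3)[OF df] dfD(1)[OF df] U lmul_arr[OF U a b] a b X pq] by simp_all
  note T = tensorD[OF L_div[OF U a] L_div[OF U b] L_base_eq[OF U a b]]
  show "PROP ?g4"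
    using T(7)[OF X pq] div_arrD(5)[OF lmul_arr[OF U a b] X _ T(3)[OF X pq]] by (simp add: lmul_def)
  show "lmul L U b a X q p = lmul L U a b X p q"
    using dfD(4)[OF df] U a b X pq by (simp add: pointwise_monoidal_def)
qed

lemma lmul_res:
  assumes U: "sheaf U" and a: "a \<in> Lpts L U" and b: "b \<in> Lpts L U" and f: "f \<in> Arr C"
    and pq: "p \<in> Lsec L U a (Cod C f)" "q \<in> Lsec L U b (Cod C f)"
      "Lproj L U a (Cod C f) p = Lproj L U b (Cod C f) q"
  shows "res (tot (Lobj L U (a \<otimes>\<^bsub>arrows U (Lmon L)\<^esub> b))) f (lmul L U a b (Cod C f) p q) =
      lmul L U a b (Dom C f) (res (tot (Lobj L U a)) f p) (res (tot (Lobj L U b)) f q)"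
proof -
  note T = tensorD[OF L_div[OF U a] L_div[OF U b] L_base_eq[OF U a b]]
  show ?thesis
    using T(6)[OF f pq] div_arrD(3)[OF lmul_arr[OF U a b] f T(3)[OF Cod_Obj[OF f] pq]] by (simp add: lmul_def)
qed

lemma lmul_Larr:
  assumes "sheaf V" "sheaf U" "f \<in> Hom V U" "a \<in> Lpts L U" "b \<in> Lpts L U" "X \<in> Obj C"
    "p \<in> Lsec L V (cmp V a f) X" "q \<in> Lsec L V (cmp V b f) X"
    "Lproj L V (cmp V a f) X p = Lproj L V (cmp V b f) X q"
  shows "Larr L V f U (a \<otimes>\<^bsub>arrows U (Lmon L)\<^esub> b) X (lmul L V (cmp V a f) (cmp V b f) X p q) =
          lmul L U a b X (Larr L V f U a X p) (Larr L V f U b X q)"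
  using dfD(4)[OF df] assms by (simp add: pointwise_monoidal_def)

lemma lmul_assoc:
  assumes "sheaf U" "a \<in> Lpts L U" "b \<in> Lpts L U" "c \<in> Lpts L U" "X \<in> Obj C"
    "p \<in> Lsec L U a X" "q \<in> Lsec L U b X" "r \<in> Lsec L U c X"
    "Lproj L U a X p = Lproj L U b X q" "Lproj L U b X q = Lproj L U c X r"
  shows "lmul L U a (b \<otimes>\<^bsub>arrows U (Lmon L)\<^esub> c) X p (lmul L U b c X q r) =
          lmul L U (a \<otimes>\<^bsub>arrows U (Lmon L)\<^esub> b) c X (lmul L U a b X p q) r"
proof -
  have "\<forall>U a b c. sheaf U \<longrightarrow> a \<in> Lpts L U \<longrightarrow> b \<in> Lpts L U \<longrightarrow>
        c \<in> Lpts L U \<longrightarrow>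
        (\<forall>X\<in>Obj C. \<forall>p\<in>Lsec L U a X. \<forall>q\<in>Lsec L U b X. \<forall>r\<in>Lsec L U c X.
          Lproj L U a X p = Lproj L U b X q \<longrightarrow> Lproj L U b X q = Lproj L U c X r \<longrightarrow>
          lmul L U a (b \<otimes>\<^bsub>arrows U (Lmon L)\<^esub> c) X p (lmul L U b c X q r) =
          lmul L U (a \<otimes>\<^bsub>arrows U (Lmon L)\<^esub> b) c X (lmul L U a b X p q) r)"
    using dfD(4)[OF df] unfolding pointwise_monoidal_def by (elim conjE) assumption
  from this[rule_format, OF assms] show ?thesis .
qed

lemma lmul_lone:
  assumes "sheaf U" "a \<in> Lpts L U" "X \<in> Obj C" "p \<in> Lsec L U a X"
  shows "lmul L U \<one>\<^bsub>arrows U (Lmon L)\<^esub> a X (lone L U X (Lproj L U a X p)) p = p"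
  using dfD(4)[OF df] assms by (simp add: pointwise_monoidal_def)

section \<open>The universal torsor as a monoid\<close>

lemma tq_div: "div_obj (tq L)" and tq_base: "base (tq L) = und (Lmon L)"
  using L_div[OF sheaf_A idm_Hom[OF sheaf_A]] L_base[OF sheaf_A idm_Hom[OF sheaf_A]] by (simp_all add: tq_def)

lemma tq_proj_in: "X \<in> Obj C \<Longrightarrow> m \<in> tsec (tq L) X \<Longrightarrow> proj (tq L) X m \<in> carrier (mon (Lmon L) X)"
  using divT(4)[OF tq_div, of X m] tq_base by simp

lemma rq_arr: "sheaf U \<Longrightarrow> a \<in> Lpts L U \<Longrightarrow> rq L U a \<in> div_arr (Lobj L U a) a (tq L)"
  using L_arr[OF _ sheaf_A _ idm_Hom[OF sheaf_A], of U a] cmp_idm_left[OF _ _ sheaf_A, of U a] by (simp add: rq_def tq_def)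

lemmas rq_in = div_arrD(2)[OF rq_arr]
lemmas rq_res = div_arrD(3)[OF rq_arr]
lemmas rq_proj = div_arrD(4)[OF rq_arr]
lemmas rq_act = div_arrD(5)[OF rq_arr]
lemmas rq_val = div_arrD(6)[OF rq_arr]

lemma rq_id: "X \<in> Obj C \<Longrightarrow> m \<in> tsec (tq L) X \<Longrightarrow> rq L (und (Lmon L)) (idm (und (Lmon L))) X m = m"
  using L_arr_id[OF sheaf_A idm_Hom[OF sheaf_A]] by (simp add: rq_def tq_def)

lemma rq_Larr:
  assumes "sheaf V" "sheaf U" "f \<in> Hom V U" "a \<in> Lpts L U" "X \<in> Obj C" "p \<in> Lsec L V (cmp V a f) X"
  shows "rq L U a X (Larr L V f U a X p) = rq L V (cmp V a f) X p"
  using L_arr_comp[OF assms(1,2) sheaf_A assms(3,4) idm_Hom[OF sheaf_A] assms(5), of p] assms(6)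
    cmp_idm_left[OF assms(2,4) sheaf_A] by (simp add: rq_def)

text \<open>In other words, L(a) is the fibre product of U and the universal torsor over A: its
  sections are the pairs (x, m) with x and m over the same section of A.\<close>

lemma rq_cartesian:
  assumes U: "sheaf U" and a: "a \<in> Lpts L U" and X: "X \<in> Obj C" and x: "x \<in> sec U X"
    and m: "m \<in> tsec (tq L) X" and e: "proj (tq L) X m = a X x"
  shows "\<exists>!p. p \<in> Lsec L U a X \<and> Lproj L U a X p = x \<and> rq L U a X p = m"
  by (rule div_arr_cartesian[OF L_div[OF U a] tq_div _ rq_arr[OF U a] X _ m e])
    (use x a L_base[OF U a] tq_base in simp_all)

text \<open>The arrow s with components a and b from U to the product W of A with itself satisfies
  \<pi> s = a and \<rho> s = b. Naturality of the multiplication along s computes the product in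
  L(\<pi>) and L(\<rho>) over W, where nothing refers to U any more.\<close>

lemma rq_lmul_eq:
  assumes U: "sheaf U" and a: "a \<in> Lpts L U" and b: "b \<in> Lpts L U" and X: "X \<in> Obj C"
    and pq: "p \<in> Lsec L U a X" "q \<in> Lsec L U b X" "Lproj L U a X p = Lproj L U b X q"
    and U': "sheaf U'" and a': "a' \<in> Hom U' (und (Lmon L))" and b': "b' \<in> Hom U' (und (Lmon L))"
    and pq': "p' \<in> Lsec L U' a' X" "q' \<in> Lsec L U' b' X" "Lproj L U' a' X p' = Lproj L U' b' X q'"
    and m: "rq L U a X p = rq L U' a' X p'" and n: "rq L U b X q = rq L U' b' X q'"
  shows "rq L U (a \<otimes>\<^bsub>arrows U (Lmon L)\<^esub> b) X (lmul L U a b X p q) =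
    rq L U' (a' \<otimes>\<^bsub>arrows U' (Lmon L)\<^esub> b') X (lmul L U' a' b' X p' q')"
proof -
  note A = dfD(1)[OF df]
  obtain W \<pi> \<rho> c where W: "sheaf W" and \<pi>: "\<pi> \<in> Lpts L W" and \<rho>: "\<rho> \<in> Lpts L W"
    and c: "\<And>X x y. \<lbrakk>X \<in> Obj C; x \<in> sec (und (Lmon L)) X; y \<in> sec (und (Lmon L)) X\<rbrakk> \<Longrightarrow>
      c X x y \<in> sec W X \<and> \<pi> X (c X x y) = x \<and> \<rho> X (c X x y) = y"
    and cr: "\<And>f x y. \<lbrakk>f \<in> Arr C; x \<in> sec (und (Lmon L)) (Cod C f); y \<in> sec (und (Lmon L)) (Cod C f)\<rbrakk> \<Longrightarrow>
      res W f (c (Cod C f) x y) = c (Dom C f) (res (und (Lmon L)) f x) (res (und (Lmon L)) f y)"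
    using product_exists[OF sheaf_A sheaf_A] by metis
  \<comment> \<open>The base point of P and Q in W is the pair of projections of the two images in
    the universal torsor. It therefore depends on these images alone, and
    \<open>rq_cartesian\<close> determines P and Q from them.\<close>
  have key: "\<exists>P Q. P \<in> Lsec L W \<pi> X \<and> Q \<in> Lsec L W \<rho> X \<and>
      Lproj L W \<pi> X P = c X (proj (tq L) X (rq L U a X p)) (proj (tq L) X (rq L U b X q)) \<and>
      Lproj L W \<rho> X Q = c X (proj (tq L) X (rq L U a X p)) (proj (tq L) X (rq L U b X q)) \<and>
      rq L W \<pi> X P = rq L U a X p \<and> rq L W \<rho> X Q = rq L U b X q \<and>
      rq L U (a \<otimes>\<^bsub>arrows U (Lmon L)\<^esub> b) X (lmul L U a b X p q) = rq L W (\<pi> \<otimes>\<^bsub>arrows W (Lmon L)\<^esub> \<rho>) X (lmul L W \<pi> \<rho> X P Q)"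
    if U: "sheaf U" and a: "a \<in> Lpts L U" and b: "b \<in> Lpts L U"
    and pq: "p \<in> Lsec L U a X" "q \<in> Lsec L U b X" "Lproj L U a X p = Lproj L U b X q"
    for U a b p q
  proof -
    define s where "s = mk U (\<lambda>X x. c X (a X x) (b X x))"
    have s: "s \<in> Hom U W" unfolding s_def
      by (rule mk_Hom[OF _ _ U]) (use c cr Hom_in[OF a] Hom_in[OF b] Hom_res[OF a] Hom_res[OF b] Cod_Obj in simp_all)
    have \<pi>s: "cmp U \<pi> s = a"
      by (rule Hom_eqI[OF cmp_Hom[OF U s \<pi>] a]) (use c Hom_in[OF a] Hom_in[OF b] in \<open>simp add: s_def\<close>)
    have \<rho>s: "cmp U \<rho> s = b"
      by (rule Hom_eqI[OF cmp_Hom[OF U s \<rho>] b]) (use c Hom_in[OF a] Hom_in[OF b] in \<open>simp add: s_def\<close>)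
    let ?P = "Larr L U s W \<pi> X p" and ?Q = "Larr L U s W \<rho> X q"
    note LP = L_arr[OF U W s \<pi>, unfolded \<pi>s] and LQ = L_arr[OF U W s \<rho>, unfolded \<rho>s]
    have x: "Lproj L U a X p \<in> sec U X" by (rule L_proj_in[OF U a X pq(1)])
    have "rq L U (a \<otimes>\<^bsub>arrows U (Lmon L)\<^esub> b) X (lmul L U a b X p q) =
      rq L W (\<pi> \<otimes>\<^bsub>arrows W (Lmon L)\<^esub> \<rho>) X (Larr L U s W (\<pi> \<otimes>\<^bsub>arrows W (Lmon L)\<^esub> \<rho>) X (lmul L U a b X p q))"
      using rq_Larr[OF U W s A_mult_Hom[OF W \<pi> \<rho>] X] lmulD(1)[OF U a b X pq] arrows_comp(1)[OF A W U s \<pi> \<rho>] \<pi>s \<rho>s by simp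
    also have "\<dots> = rq L W (\<pi> \<otimes>\<^bsub>arrows W (Lmon L)\<^esub> \<rho>) X (lmul L W \<pi> \<rho> X ?P ?Q)"
      using lmul_Larr[OF U W s \<pi> \<rho> X] pq \<pi>s \<rho>s by simp
    finally show ?thesis
      using div_arrD(2,4)[OF LP X pq(1)] div_arrD(2,4)[OF LQ X pq(2)] rq_Larr[OF U W s \<pi> X] rq_Larr[OF U W s \<rho> X] \<pi>s \<rho>s pq x X
        rq_proj[OF U a X pq(1)] rq_proj[OF U b X pq(2)]
      by (intro exI[of _ ?P] exI[of _ ?Q]) (simp add: s_def)
  qed
  obtain P Q where 1: "P \<in> Lsec L W \<pi> X" "Q \<in> Lsec L W \<rho> X"
      "Lproj L W \<pi> X P = c X (proj (tq L) X (rq L U a X p)) (proj (tq L) X (rq L U b X q))"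
      "Lproj L W \<rho> X Q = c X (proj (tq L) X (rq L U a X p)) (proj (tq L) X (rq L U b X q))"
      "rq L W \<pi> X P = rq L U a X p" "rq L W \<rho> X Q = rq L U b X q"
      "rq L U (a \<otimes>\<^bsub>arrows U (Lmon L)\<^esub> b) X (lmul L U a b X p q) = rq L W (\<pi> \<otimes>\<^bsub>arrows W (Lmon L)\<^esub> \<rho>) X (lmul L W \<pi> \<rho> X P Q)"
    using key[OF U a b pq] by blast
  obtain P' Q' where 2: "P' \<in> Lsec L W \<pi> X" "Q' \<in> Lsec L W \<rho> X"
      "Lproj L W \<pi> X P' = c X (proj (tq L) X (rq L U' a' X p')) (proj (tq L) X (rq L U' b' X q'))"
      "Lproj L W \<rho> X Q' = c X (proj (tq L) X (rq L U' a' X p')) (proj (tq L) X (rq L U' b' X q'))"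
      "rq L W \<pi> X P' = rq L U' a' X p'" "rq L W \<rho> X Q' = rq L U' b' X q'"
      "rq L U' (a' \<otimes>\<^bsub>arrows U' (Lmon L)\<^esub> b') X (lmul L U' a' b' X p' q') = rq L W (\<pi> \<otimes>\<^bsub>arrows W (Lmon L)\<^esub> \<rho>) X (lmul L W \<pi> \<rho> X P' Q')"
    using key[OF U' a' b' pq'] by blast
  have "P = P'"
    using rq_cartesian[OF W \<pi> X L_proj_in[OF W \<pi> X 1(1)] rq_in[OF W \<pi> X 1(1)] rq_proj[OF W \<pi> X 1(1)]] 1 2 m n by metis
  moreover have "Q = Q'"
    using rq_cartesian[OF W \<rho> X L_proj_in[OF W \<rho> X 1(2)] rq_in[OF W \<rho> X 1(2)] rq_proj[OF W \<rho> X 1(2)]] 1 2 m n by metis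
  ultimately show ?thesis using 1(7) 2(7) by simp
qed

lemma mq_rq:
  assumes U: "sheaf U" and a: "a \<in> Lpts L U" and b: "b \<in> Lpts L U" and X: "X \<in> Obj C"
    and pq: "p \<in> Lsec L U a X" "q \<in> Lsec L U b X" "Lproj L U a X p = Lproj L U b X q"
  shows "mq L X (rq L U a X p) (rq L U b X q) = rq L U (a \<otimes>\<^bsub>arrows U (Lmon L)\<^esub> b) X (lmul L U a b X p q)"
  unfolding mq_def
proof (rule the_equality)
  show "\<exists>U' a' b' p' q'. sheaf U' \<and> a' \<in> Hom U' (und (Lmon L)) \<and> b' \<in> Hom U' (und (Lmon L)) \<and>
     p' \<in> Lsec L U' a' X \<and> q' \<in> Lsec L U' b' X \<and> Lproj L U' a' X p' = Lproj L U' b' X q' \<and>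
     rq L U' a' X p' = rq L U a X p \<and> rq L U' b' X q' = rq L U b X q \<and>
     rq L U (a \<otimes>\<^bsub>arrows U (Lmon L)\<^esub> b) X (lmul L U a b X p q) = rq L U' (a' \<otimes>\<^bsub>arrows U' (Lmon L)\<^esub> b') X (lmul L U' a' b' X p' q')"
    using assms by blast
next
  fix r assume "\<exists>U' a' b' p' q'. sheaf U' \<and> a' \<in> Hom U' (und (Lmon L)) \<and> b' \<in> Hom U' (und (Lmon L)) \<and>
     p' \<in> Lsec L U' a' X \<and> q' \<in> Lsec L U' b' X \<and> Lproj L U' a' X p' = Lproj L U' b' X q' \<and>
     rq L U' a' X p' = rq L U a X p \<and> rq L U' b' X q' = rq L U b X q \<and>
     r = rq L U' (a' \<otimes>\<^bsub>arrows U' (Lmon L)\<^esub> b') X (lmul L U' a' b' X p' q')"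
  then obtain U' a' b' p' q' where 1: "sheaf U'" "a' \<in> Hom U' (und (Lmon L))" "b' \<in> Hom U' (und (Lmon L))"
     "p' \<in> Lsec L U' a' X" "q' \<in> Lsec L U' b' X" "Lproj L U' a' X p' = Lproj L U' b' X q'"
     "rq L U' a' X p' = rq L U a X p" "rq L U' b' X q' = rq L U b X q"
     "r = rq L U' (a' \<otimes>\<^bsub>arrows U' (Lmon L)\<^esub> b') X (lmul L U' a' b' X p' q')" by blast
  then show "r = rq L U (a \<otimes>\<^bsub>arrows U (Lmon L)\<^esub> b) X (lmul L U a b X p q)"
    using rq_lmul_eq[OF 1(1,2,3) X 1(4-6) assms(1-3) pq 1(7,8)] by simp
qed

text \<open>Three sections of the universal torsor have in general three different base points,
  while \<open>lmul\<close> wants a common one. Over W, a threefold product of A, they become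
  sections of the three pullbacks of the torsor along the projections, all over the point x. Two
  sections are handled by repeating one.\<close>

lemma tq_representatives:
  assumes X: "X \<in> Obj C" and m: "m \<in> tsec (tq L) X" and n: "n \<in> tsec (tq L) X" and k: "k \<in> tsec (tq L) X"
  obtains U a b c p q r where "sheaf U" "a \<in> Lpts L U" "b \<in> Lpts L U" "c \<in> Lpts L U"
    "p \<in> Lsec L U a X" "q \<in> Lsec L U b X" "r \<in> Lsec L U c X"
    "Lproj L U a X p = Lproj L U b X q" "Lproj L U b X q = Lproj L U c X r"
    "rq L U a X p = m" "rq L U b X q = n" "rq L U c X r = k"
proof -
  obtain V \<pi> \<rho> c where V: "sheaf V" and \<pi>: "\<pi> \<in> Lpts L V" and \<rho>: "\<rho> \<in> Lpts L V"
    and c: "\<And>X x y. \<lbrakk>X \<in> Obj C; x \<in> sec (und (Lmon L)) X; y \<in> sec (und (Lmon L)) X\<rbrakk> \<Longrightarrow>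
      c X x y \<in> sec V X \<and> \<pi> X (c X x y) = x \<and> \<rho> X (c X x y) = y"
    using product_exists[OF sheaf_A sheaf_A] by metis
  obtain W \<sigma> \<upsilon> d where W: "sheaf W" and \<sigma>: "\<sigma> \<in> Hom W V" and \<upsilon>: "\<upsilon> \<in> Lpts L W"
    and d: "\<And>X x y. \<lbrakk>X \<in> Obj C; x \<in> sec V X; y \<in> sec (und (Lmon L)) X\<rbrakk> \<Longrightarrow>
      d X x y \<in> sec W X \<and> \<sigma> X (d X x y) = x \<and> \<upsilon> X (d X x y) = y"
    using product_exists[OF V sheaf_A] by metis
  define x where "x = d X (c X (proj (tq L) X m) (proj (tq L) X n)) (proj (tq L) X k)"
  note pm = tq_proj_in[OF X m] and pn = tq_proj_in[OF X n] and pk = tq_proj_in[OF X k]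
  have cc: "c X (proj (tq L) X m) (proj (tq L) X n) \<in> sec V X" using c[OF X] pm pn by simp
  have x: "x \<in> sec W X" using d[OF X cc] pk by (simp add: x_def)
  note a = cmp_Hom[OF W \<sigma> \<pi>] and b = cmp_Hom[OF W \<sigma> \<rho>]
  have ax: "proj (tq L) X m = cmp W \<pi> \<sigma> X x" "proj (tq L) X n = cmp W \<rho> \<sigma> X x" "proj (tq L) X k = \<upsilon> X x"
    using x d[OF X cc] c[OF X] pm pn pk X by (simp_all add: x_def)
  show ?thesis
    using rq_cartesian[OF W a X x m ax(1)] rq_cartesian[OF W b X x n ax(2)] rq_cartesian[OF W \<upsilon> X x k ax(3)]
      that[OF W a b \<upsilon>] by metis
qed

text \<open>Over a common test object each law is the corresponding law of \<open>lmul\<close>,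
  carried along the arrows \<open>rq\<close>.\<close>

lemma mqD:
  assumes X: "X \<in> Obj C" and m: "m \<in> tsec (tq L) X" and n: "n \<in> tsec (tq L) X"
  shows "mq L X m n \<in> tsec (tq L) X"
    and "proj (tq L) X (mq L X m n) = proj (tq L) X m \<otimes>\<^bsub>mon (Lmon L) X\<^esub> proj (tq L) X n" (is ?g1)
    and "val (tq L) X (mq L X m n) = val (tq L) X m \<otimes>\<^bsub>mon \<O> X\<^esub> val (tq L) X n" (is ?g2)
    and "u \<in> O_units X \<Longrightarrow> mq L X (act (tq L) X u m) n = act (tq L) X u (mq L X m n)" (is "PROP ?g3")
    and "mq L X m n = mq L X n m"
    and "k \<in> tsec (tq L) X \<Longrightarrow> mq L X (mq L X m n) k = mq L X m (mq L X n k)" (is "PROP ?g4")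
    and "f \<in> Arr C \<Longrightarrow> Cod C f = X \<Longrightarrow> res (tot (tq L)) f (mq L X m n) = mq L (Dom C f) (res (tot (tq L)) f m) (res (tot (tq L)) f n)" (is "PROP ?g5")
proof -
  have main: "mq L X m n \<in> tsec (tq L) X \<and>
    proj (tq L) X (mq L X m n) = proj (tq L) X m \<otimes>\<^bsub>mon (Lmon L) X\<^esub> proj (tq L) X n \<and>
    val (tq L) X (mq L X m n) = val (tq L) X m \<otimes>\<^bsub>mon \<O> X\<^esub> val (tq L) X n \<and>
    (u \<in> O_units X \<longrightarrow> mq L X (act (tq L) X u m) n = act (tq L) X u (mq L X m n)) \<and>
    mq L X m n = mq L X n m \<and> mq L X (mq L X m n) k = mq L X m (mq L X n k) \<and>
    (f \<in> Arr C \<longrightarrow> Cod C f = X \<longrightarrow> res (tot (tq L)) f (mq L X m n) = mq L (Dom C f) (res (tot (tq L)) f m) (res (tot (tq L)) f n))"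
    if k: "k \<in> tsec (tq L) X" for k u f
  proof -
    obtain U a b c p q r where U: "sheaf U" and a: "a \<in> Lpts L U" and b: "b \<in> Lpts L U" and c: "c \<in> Lpts L U"
    and p: "p \<in> Lsec L U a X" and q: "q \<in> Lsec L U b X" and r: "r \<in> Lsec L U c X"
    and pq: "Lproj L U a X p = Lproj L U b X q" and qr: "Lproj L U b X q = Lproj L U c X r"
    and e: "rq L U a X p = m" "rq L U b X q = n" "rq L U c X r = k"
      by (rule tq_representatives[OF X m n k])
    note ab = A_mult_Hom[OF U a b] and bc = A_mult_Hom[OF U b c]
    note l = lmulD[OF U a b X p q pq] and l' = lmulD[OF U b c X q r qr]
    have mn: "mq L X m n = rq L U (a \<otimes>\<^bsub>arrows U (Lmon L)\<^esub> b) X (lmul L U a b X p q)"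
      using mq_rq[OF U a b X p q pq] e by simp
    have nk: "mq L X n k = rq L U (b \<otimes>\<^bsub>arrows U (Lmon L)\<^esub> c) X (lmul L U b c X q r)"
      using mq_rq[OF U b c X q r qr] e by simp
    have x: "Lproj L U a X p \<in> sec U X" by (rule L_proj_in[OF U a X p])
    have 1: "mq L X m n \<in> tsec (tq L) X" unfolding mn by (rule rq_in[OF U ab X l(1)])
    have 2: "proj (tq L) X (mq L X m n) = proj (tq L) X m \<otimes>\<^bsub>mon (Lmon L) X\<^esub> proj (tq L) X n"
      unfolding mn rq_proj[OF U ab X l(1)] l(2) using rq_proj[OF U a X p] rq_proj[OF U b X q] e pq x
        arrows_mult_Hom(2)[OF dfD(1)[OF df] U a b X] by simp
    have 3: "val (tq L) X (mq L X m n) = val (tq L) X m \<otimes>\<^bsub>mon \<O> X\<^esub> val (tq L) X n"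
      unfolding mn rq_val[OF U ab X l(1)] l(3) using rq_val[OF U a X p] rq_val[OF U b X q] e by simp
    have 4: "mq L X (act (tq L) X u m) n = act (tq L) X u (mq L X m n)" if u: "u \<in> O_units X"
    proof -
      note up = divT(6,7)[OF L_div[OF U a] X u p]
      have "mq L X (act (tq L) X u m) n = rq L U (a \<otimes>\<^bsub>arrows U (Lmon L)\<^esub> b) X (lmul L U a b X (act (Lobj L U a) X u p) q)"
        using mq_rq[OF U a b X up(1) q] up(2) pq rq_act[OF U a X u p] e by simp
      then show ?thesis using l(4)[OF u] rq_act[OF U ab X u l(1)] mn by simp
    qed
    have 5: "mq L X m n = mq L X n m"
      using mn mq_rq[OF U b a X q p pq[symmetric]] e l(5) arrows_monoid_laws(1)[OF dfD(1)[OF df] U a b b] by simp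
    have 6: "mq L X (mq L X m n) k = mq L X m (mq L X n k)"
    proof -
      have "mq L X (mq L X m n) k = rq L U ((a \<otimes>\<^bsub>arrows U (Lmon L)\<^esub> b) \<otimes>\<^bsub>arrows U (Lmon L)\<^esub> c) X (lmul L U (a \<otimes>\<^bsub>arrows U (Lmon L)\<^esub> b) c X (lmul L U a b X p q) r)"
        using mq_rq[OF U ab c X l(1) r] l(2) qr e mn by simp
      also have "\<dots> = rq L U (a \<otimes>\<^bsub>arrows U (Lmon L)\<^esub> (b \<otimes>\<^bsub>arrows U (Lmon L)\<^esub> c)) X (lmul L U a (b \<otimes>\<^bsub>arrows U (Lmon L)\<^esub> c) X p (lmul L U b c X q r))"
        using lmul_assoc[OF U a b c X p q r pq qr] arrows_monoid_laws(2)[OF dfD(1)[OF df] U a b c] by simp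
      also have "\<dots> = mq L X m (mq L X n k)"
        using mq_rq[OF U a bc X p l'(1)] l'(2) qr pq e nk by simp
      finally show ?thesis .
    qed
    have 7: "res (tot (tq L)) f (mq L X m n) = mq L (Dom C f) (res (tot (tq L)) f m) (res (tot (tq L)) f n)" if f: "f \<in> Arr C" "Cod C f = X"
    proof -
      have rp: "res (tot (Lobj L U a)) f p \<in> Lsec L U a (Dom C f)" "res (tot (Lobj L U b)) f q \<in> Lsec L U b (Dom C f)"
        using res_in[OF divT(2)[OF L_div[OF U a]] f(1)] res_in[OF divT(2)[OF L_div[OF U b]] f(1)] p q f by simp_all
      have "Lproj L U a (Dom C f) (res (tot (Lobj L U a)) f p) = Lproj L U b (Dom C f) (res (tot (Lobj L U b)) f q)"
        using divT(5)[OF L_div[OF U a] f(1), of p] divT(5)[OF L_div[OF U b] f(1), of q] p q f pq L_base[OF U a] L_base[OF U b] by simp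
      from mq_rq[OF U a b Dom_Obj[OF f(1)] rp this]
      show ?thesis
        using rq_res[OF U a f(1), of p] rq_res[OF U b f(1), of q] rq_res[OF U ab f(1), of "lmul L U a b X p q"] l(1)
          lmul_res[OF U a b f(1), of p q] p q pq f e mn by simp
    qed
    show ?thesis using 1 2 3 4 5 6 7 by blast
  qed
  \<comment> \<open>Clauses without k are taken from \<open>main\<close> with m in its
    place.\<close>
  show "mq L X m n \<in> tsec (tq L) X"
    ?g1 ?g2 "PROP ?g3"
    "mq L X m n = mq L X n m"
    "PROP ?g4" "PROP ?g5"
    using main[OF m] main by blast+
qed

text \<open>On the product of U and A, with projections \<pi> and \<rho>, consider the point (x, 1).
  The unit sections over x and over 1 are both images of the unit section over this point.\<close>

lemma oq_rq:
  assumes U: "sheaf U" and X: "X \<in> Obj C" and x: "x \<in> sec U X"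
  shows "rq L U \<one>\<^bsub>arrows U (Lmon L)\<^esub> X (lone L U X x) = oq L X"
proof -
  note A = dfD(1)[OF df]
  let ?o = "\<one>\<^bsub>mon (Lmon L) X\<^esub>"
  have o: "?o \<in> sec (und (Lmon L)) X" using monoid_sheafD(3)[OF A X] by (simp add: monoid.one_closed)
  obtain W \<pi> \<rho> c where W: "sheaf W" and \<pi>: "\<pi> \<in> Hom W U" and \<rho>: "\<rho> \<in> Lpts L W"
    and c: "\<And>X x y. \<lbrakk>X \<in> Obj C; x \<in> sec U X; y \<in> sec (und (Lmon L)) X\<rbrakk> \<Longrightarrow>
      c X x y \<in> sec W X \<and> \<pi> X (c X x y) = x \<and> \<rho> X (c X x y) = y"
    using product_exists[OF U sheaf_A] by metis
  note cx = c[OF X x o]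
  have "rq L V \<one>\<^bsub>arrows V (Lmon L)\<^esub> X (lone L V X (f X (c X x ?o))) = rq L W \<one>\<^bsub>arrows W (Lmon L)\<^esub> X (lone L W X (c X x ?o))"
    if V: "sheaf V" and f: "f \<in> Hom W V" for V f
    using rq_Larr[OF W V f A_one_Hom[OF V] X, of "lone L W X (c X x ?o)"] arrows_comp(2)[OF A V W f] lone_Larr[OF W V f X, of "c X x ?o"]
      loneD(1)[OF W X, of "c X x ?o"] cx by simp
  from this[OF U \<pi>] this[OF sheaf_A \<rho>] cx show ?thesis by (simp add: oq_def)
qed

lemma oqD:
  assumes X: "X \<in> Obj C"
  shows "oq L X \<in> tsec (tq L) X" and "proj (tq L) X (oq L X) = \<one>\<^bsub>mon (Lmon L) X\<^esub>" (is ?g1)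
    and "val (tq L) X (oq L X) = \<one>\<^bsub>mon \<O> X\<^esub>" (is ?g2)
    and "m \<in> tsec (tq L) X \<Longrightarrow> mq L X (oq L X) m = m"
    and "f \<in> Arr C \<Longrightarrow> Cod C f = X \<Longrightarrow> res (tot (tq L)) f (oq L X) = oq L (Dom C f)"
proof -
  let ?A = "und (Lmon L)" let ?o = "\<one>\<^bsub>mon (Lmon L) X\<^esub>" and ?z = "\<one>\<^bsub>arrows (und (Lmon L)) (Lmon L)\<^esub>"
  have o: "?o \<in> sec ?A X" using monoid_sheafD(3)[OF dfD(1)[OF df] X] by (simp add: monoid.one_closed)
  note z = A_one_Hom[OF sheaf_A] and l = loneD[OF sheaf_A X o]
  show "oq L X \<in> tsec (tq L) X" unfolding oq_def by (rule rq_in[OF sheaf_A z X l(1)])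
  show ?g1
    unfolding oq_def rq_proj[OF sheaf_A z X l(1)] l(2) by (rule arrows_one_Hom(2)[OF dfD(1)[OF df] sheaf_A X o])
  show ?g2
    unfolding oq_def rq_val[OF sheaf_A z X l(1)] by (rule l(3))
  show "mq L X (oq L X) m = m" if m: "m \<in> tsec (tq L) X"
  proof -
    note i = idm_Hom[OF sheaf_A]
    have m': "m \<in> Lsec L ?A (idm ?A) X" using m by (simp add: tq_def)
    have x: "Lproj L ?A (idm ?A) X m \<in> sec ?A X" by (rule L_proj_in[OF sheaf_A i X m'])
    note lx = loneD[OF sheaf_A X x]
    show ?thesis
      using mq_rq[OF sheaf_A z i X lx(1) m' lx(2)] lmul_lone[OF sheaf_A i X m'] oq_rq[OF sheaf_A X x] rq_id[OF X m]
        arrows_monoid_laws(3)[OF dfD(1)[OF df] sheaf_A i i i] by simp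
  qed
  show "res (tot (tq L)) f (oq L X) = oq L (Dom C f)" if f: "f \<in> Arr C" "Cod C f = X"
    using rq_res[OF sheaf_A z f(1), of "lone L ?A X ?o"] l(1) f lone_res[OF sheaf_A f(1), of ?o] o
      monoid_sheafD(6)[OF dfD(1)[OF df] f(1)] by (simp add: oq_def)
qed

text \<open>Trivial kernel concerns arrows from a sheaf to A, whereas m is a section over one X
  only. So it is applied to the generic case: F is the sheaf of all sections of M with invertible
  value, and a is its projection to A. Dividing the generic section by its value gives L(a) a global
  section of value 1, hence an isomorphism with the unit object; so a is trivial, and m is one of
  the points of F.\<close>

lemma unit_section_kernel:
  assumes X: "X \<in> Obj C" and m: "m \<in> tsec (tq L) X" and u: "val (tq L) X m \<in> O_units X"
  shows "proj (tq L) X m = \<one>\<^bsub>mon (Lmon L) X\<^esub>"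
proof -
  let ?A = "und (Lmon L)" and ?t = "tot (tq L)"
  \<comment> \<open>The graph of the value map over the units: \<open>fibre_product\<close> only
    cuts subobjects out of products, so each section is recorded together with its value.\<close>
  define R where "R X m u \<longleftrightarrow> val (tq L) X m = u \<and> u \<in> O_units X" for X m u
  have st: "sheaf ?t" by (rule divT(2)[OF tq_div])
  obtain W where "fibre_product ?t (und \<O>) R W"
  proof -
    have "\<exists>W. fibre_product ?t (und \<O>) R W"
    proof (rule fibre_product_exists[OF st sheaf_O])
      fix f x y assume f: "f \<in> Arr C" "x \<in> sec ?t (Cod C f)" and r: "R (Cod C f) x y"
      then show "R (Dom C f) (res ?t f x) (res (und \<O>) f y)"
        using div_objD(4)[OF tq_div f] unit_res[OF f(1)] by (simp add: R_def)
    next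
      fix X x y assume X: "X \<in> Obj C" and x: "x \<in> sec ?t X" and y: "y \<in> sec (und \<O>) X"
        and l: "locally X (\<lambda>f. R (Dom C f) (res ?t f x) (res (und \<O>) f y))"
      have "val (tq L) X x = y"
        by (rule sheaf_sep[OF sheaf_O X _ y], use div_objD(3)[OF tq_div X x] in simp, rule locally_mono[OF l X])
          (use div_objD(4)[OF tq_div, of _ x] x in \<open>auto simp: R_def\<close>)
      moreover have "y \<in> O_units X"
        by (rule unit_local[OF X], use y in simp, rule locally_mono[OF l X]) (auto simp: R_def)
      ultimately show "R X x y" by (simp add: R_def)
    qed
    then show ?thesis using that by blast
  qed
  then obtain F p q c where "fibre_product ?t (und \<O>) R (F, p, q, c)" by (cases W) auto
  then have F: "sheaf F" and p: "p \<in> Hom F ?t"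
    and c: "\<And>X x u. \<lbrakk>X \<in> Obj C; x \<in> sec ?t X; u \<in> carrier (mon \<O> X); R X x u\<rbrakk> \<Longrightarrow>
      c X x u \<in> sec F X \<and> p X (c X x u) = x"
    and z: "\<And>X z. X \<in> Obj C \<Longrightarrow> z \<in> sec F X \<Longrightarrow> val (tq L) X (p X z) \<in> O_units X"
    by (auto simp: fibre_product_def R_def)
  have pr: "proj (tq L) \<in> Hom ?t ?A" using divT(3)[OF tq_div] tq_base by simp
  define a where "a = cmp F (proj (tq L)) p"
  have a: "a \<in> Hom F ?A" unfolding a_def by (rule cmp_Hom[OF F p pr])
  \<comment> \<open>The generic section divided by its value; it has the same base point and value
    1.\<close>
  define n where "n X z = act (tq L) X (inv\<^bsub>mon \<O> X\<^esub> (val (tq L) X (p X z))) (p X z)" for X z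
  have n: "n X z \<in> sec ?t X" "proj (tq L) X (n X z) = a X z" "val (tq L) X (n X z) = \<one>\<^bsub>mon \<O> X\<^esub>" if X: "X \<in> Obj C" and zF: "z \<in> sec F X" for X z
  proof -
    note pz = Hom_in[OF p X zF] and i = unit_inv[OF X z[OF X zF]]
    show "n X z \<in> sec ?t X" "proj (tq L) X (n X z) = a X z" "val (tq L) X (n X z) = \<one>\<^bsub>mon \<O> X\<^esub>"
      using divT(6,7)[OF tq_div X i(1) pz] div_objD(5)[OF tq_div X i(1) pz] i(2) X zF by (simp_all add: n_def a_def)
  qed
  have nr: "res ?t f (n (Cod C f) z) = n (Dom C f) (res F f z)" if f: "f \<in> Arr C" and zF: "z \<in> sec F (Cod C f)" for f z
  proof -
    note pz = Hom_in[OF p Cod_Obj[OF f] zF] and u = z[OF Cod_Obj[OF f] zF]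
    show ?thesis
      using divT(10)[OF tq_div f unit_inv(1)[OF Cod_Obj[OF f] u] pz] unit_inv_res[OF f u] div_objD(4)[OF tq_div f pz] Hom_res[OF p f zF]
      by (simp add: n_def)
  qed
  define P where "P = Lobj L F a"
  have P: "div_obj P" "base P = F" using L_div[OF F a] L_base[OF F a] by (simp_all add: P_def)
  have ex: "\<exists>!e. e \<in> tsec P X \<and> proj P X e = z \<and> rq L F a X e = n X z" if "X \<in> Obj C" "z \<in> sec F X" for X z
    unfolding P_def by (rule rq_cartesian[OF F a that n(1,2)[OF that]])
  \<comment> \<open>The normalised section lifts uniquely to L(a), the pullback of the universal
    torsor along a.\<close>
  define e where "e X z = (THE e. e \<in> tsec P X \<and> proj P X e = z \<and> rq L F a X e = n X z)" for X z
  have e: "e X z \<in> tsec P X" "proj P X (e X z) = z" "rq L F a X (e X z) = n X z" if "X \<in> Obj C" "z \<in> sec F X" for X z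
    using theI'[OF ex[OF that]] unfolding e_def by blast+
  have eH: "mk F e \<in> Hom F (tot P)"
  proof (rule mk_Hom[OF e(1) _ F])
    fix f z assume f: "f \<in> Arr C" and zF: "z \<in> sec F (Cod C f)"
    note D = Dom_Obj[OF f] and e' = e[OF Cod_Obj[OF f] zF] and zD = res_in[OF F f zF]
    have "res (tot P) f (e (Cod C f) z) \<in> tsec P (Dom C f) \<and> proj P (Dom C f) (res (tot P) f (e (Cod C f) z)) = res F f z \<and>
      rq L F a (Dom C f) (res (tot P) f (e (Cod C f) z)) = n (Dom C f) (res F f z)"
      using res_in[OF divT(2)[OF P(1)] f e'(1)] divT(5)[OF P(1) f e'(1)] rq_res[OF F a f] e' nr[OF f zF] P by (simp add: P_def)
    then show "e (Dom C f) (res F f z) = res (tot P) f (e (Cod C f) z)"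
      using ex[OF D zD] e[OF D zD] by blast
  qed
  have ve: "val P X (e X z) = \<one>\<^bsub>mon \<O> X\<^esub>" if "X \<in> Obj C" "z \<in> sec F X" for X z
    using rq_val[OF F a that(1), of "e X z"] e[OF that] n(3)[OF that] by (simp add: P_def)
  note I = unit_objD[OF F]
  obtain k where k: "k \<in> div_arr (unit_obj F) (idm F) P"
    using unit_obj_arr[OF F P(1) _ eH, of "idm F"] idm_Hom[OF F] P(2) e ve by auto
  obtain k' where k': "k' \<in> div_arr P (idm F) (unit_obj F)"
    by (rule div_arr_inverse[OF I(1) P(1) I(2) P(2) k])
  have b: "base (unit_obj F) = base P" using I(2) P(2) by simp
  note T = tensorD[OF P(1) I(1) b]
  \<comment> \<open>Since P is isomorphic to the unit object, the unit object itself serves as its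
    monoidal inverse.\<close>
  have "cmp (tot (tensor P (unit_obj F))) k' (right_unitor P) \<in> div_arr (tensor P (unit_obj F)) (idm F) (unit_obj F)"
    using T(1,2) P(2) by (intro cmp_div_arr_idm[OF _ _ unitorD(3)[OF P] k']) simp_all
  then have "div_invertible P" unfolding div_invertible_def using I(1) b P(2) by auto
  then have "a = \<one>\<^bsub>arrows F (Lmon L)\<^esub>"
    using dfD(5)[OF df] F a unfolding trivial_kernel_def P_def by blast
  moreover have cm: "c X m (val (tq L) X m) \<in> sec F X \<and> p X (c X m (val (tq L) X m)) = m"
    using c[OF X m, of "val (tq L) X m"] u unit_in[OF X u] by (simp add: R_def)
  ultimately have "a X (c X m (val (tq L) X m)) = \<one>\<^bsub>mon (Lmon L) X\<^esub>"
    using arrows_one_Hom(2)[OF dfD(1)[OF df] F X] by simp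
  then show ?thesis using cm X by (simp add: a_def)
qed

text \<open>By the preceding lemma m lies over 1, that is, in the fibre of the unit section. It is
  thus a translate of the unit section, and taking values identifies the translating unit.\<close>

lemma unit_section:
  assumes X: "X \<in> Obj C" and m: "m \<in> tsec (tq L) X" and u: "val (tq L) X m \<in> O_units X"
  shows "m = act (tq L) X (val (tq L) X m) (oq L X)"
proof -
  note o = oqD[OF X]
  obtain v where v: "v \<in> O_units X" "act (tq L) X v (oq L X) = m"
    using divT(11)[OF tq_div X o(1) m] unit_section_kernel[OF X m u] o(2) by auto
  have "val (tq L) X m = v"
    using div_objD(5)[OF tq_div X v(1) o(1)] v(2) o(3) O_monoid[OF X] unit_in[OF X v(1)] by (simp add: monoid.r_one)
  then show ?thesis using v by simp
qed

lemma und_kato_of_df: "und (fst (kato_of_df L)) = tot (tq L)"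
  by (simp add: kato_of_df_def und_def)

lemma kato_of_df_monoid_sheaf: "monoid_sheaf (fst (kato_of_df L))"
  unfolding monoid_sheaf_def und_kato_of_df
proof (intro conjI ballI)
  show "sheaf (tot (tq L))" by (rule divT(2)[OF tq_div])
  show "comm_monoid (mon (fst (kato_of_df L)) X)" if X: "X \<in> Obj C" for X
    by (rule comm_monoidI) (use mqD[OF X] oqD[OF X] in \<open>auto simp: kato_of_df_def\<close>)
  fix f assume f: "f \<in> Arr C"
  show "mres (fst (kato_of_df L)) f \<in> hom (mon (fst (kato_of_df L)) (Cod C f)) (mon (fst (kato_of_df L)) (Dom C f))"
    using mqD(7)[OF Cod_Obj[OF f]] f res_in[OF divT(2)[OF tq_div] f] by (auto simp: kato_of_df_def hom_def)
  show "mres (fst (kato_of_df L)) f \<one>\<^bsub>mon (fst (kato_of_df L)) (Cod C f)\<^esub> = \<one>\<^bsub>mon (fst (kato_of_df L)) (Dom C f)\<^esub>"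
    using oqD(5)[OF Cod_Obj[OF f] f] by (simp add: kato_of_df_def)
qed

text \<open>By \<open>unit_section\<close> the sections with invertible value are the translates of
  the unit section by their values. This gives the bijection together with its inverse, and is what
  makes \<open>kato_of_df L\<close> a Kato structure.\<close>

lemma kato_of_df_units:
  assumes X: "X \<in> Obj C"
  shows "inv_image_units (kato_of_df L) X = {m \<in> tsec (tq L) X. val (tq L) X m \<in> O_units X}" (is ?g1)
    and "bij_betw (val (tq L) X) (inv_image_units (kato_of_df L) X) (O_units X)" (is ?g2)
    and "u \<in> O_units X \<Longrightarrow> inv_into (inv_image_units (kato_of_df L) X) (val (tq L) X) u = act (tq L) X u (oq L X)" (is "PROP ?g3")
proof -
  show i: ?g1
    by (simp add: inv_image_units_def kato_of_df_def)
  note o = oqD[OF X]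
  have vu: "val (tq L) X (act (tq L) X u (oq L X)) = u" if u: "u \<in> O_units X" for u
    using div_objD(5)[OF tq_div X u o(1)] o(3) O_monoid[OF X] unit_in[OF X u] by (simp add: monoid.r_one)
  have ai: "act (tq L) X u (oq L X) \<in> inv_image_units (kato_of_df L) X" if u: "u \<in> O_units X" for u
    unfolding i using vu[OF u] divT(6)[OF tq_div X u o(1)] u by simp
  show b: ?g2
    unfolding bij_betw_def
  proof
    show "inj_on (val (tq L) X) (inv_image_units (kato_of_df L) X)"
      by (rule inj_onI) (metis (mono_tags, lifting) i mem_Collect_eq unit_section[OF X])
    show "val (tq L) X ` inv_image_units (kato_of_df L) X = O_units X"
    proof
      show "val (tq L) X ` inv_image_units (kato_of_df L) X \<subseteq> O_units X" by (auto simp: i)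
      show "O_units X \<subseteq> val (tq L) X ` inv_image_units (kato_of_df L) X" using vu ai by (metis image_eqI subsetI)
    qed
  qed
  show "PROP ?g3"
    by (rule inv_into_f_eq) (use b ai vu in \<open>auto simp: bij_betw_def\<close>)
qed

text \<open>The action of a Kato structure multiplies by the section of M over u, here u times the
  unit section. So it is the action of the torsor, and freeness of the torsor becomes
  quasi-integrality.\<close>

lemma kato_of_df_act:
  assumes X: "X \<in> Obj C" and u: "u \<in> O_units X" and m: "m \<in> tsec (tq L) X"
  shows "kato_act (kato_of_df L) X u m = act (tq L) X u m"
proof -
  have "kato_act (kato_of_df L) X u m = mq L X (act (tq L) X u (oq L X)) m"
    using kato_of_df_units(3)[OF X u] by (simp add: kato_act_def kato_of_df_def)
  then show ?thesis using mqD(4)[OF X oqD(1)[OF X] m u] oqD(4)[OF X m] by simp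
qed

lemma kato_of_df_kato: "kato (kato_of_df L)"
proof -
  have "monoid_hom (fst (kato_of_df L)) \<O> (val (tq L))"
    unfolding monoid_hom_def und_kato_of_df
    using div_objD(2,3)[OF tq_div] mqD(3) oqD(3) by (auto simp: kato_of_df_def hom_def)
  moreover have "val (tq L) X \<in> Group.iso ((mon (fst (kato_of_df L)) X)\<lparr>carrier := inv_image_units (kato_of_df L) X\<rparr>) (units_of (mon \<O> X))"
    if X: "X \<in> Obj C" for X
    unfolding Group.iso_def hom_def
    using kato_of_df_units(2)[OF X] mqD(3)[OF X] kato_of_df_units(1)[OF X]
    by (auto simp: units_of_def kato_of_df_def)
  ultimately show ?thesis
    using kato_of_df_monoid_sheaf unfolding kato_def by (simp add: case_prod_beta) (simp add: kato_of_df_def)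
qed

lemma kato_of_df_quasi_integral: "quasi_integral (kato_of_df L)"
  unfolding quasi_integral_def
proof (intro ballI impI)
  fix X u m assume X: "X \<in> Obj C" and u: "u \<in> O_units X" and m: "m \<in> carrier (mon (fst (kato_of_df L)) X)"
    and e: "kato_act (kato_of_df L) X u m = m"
  have m': "m \<in> tsec (tq L) X" using m by (simp add: kato_of_df_def)
  show "u = \<one>\<^bsub>mon \<O> X\<^esub>"
    using e kato_of_df_act[OF X u m'] divT(8)[OF tq_div X m'] divT(12)[OF tq_div X m' u unit_one[OF X]] by simp
qed

end

section \<open>The two categories\<close>

lemma div_arr_inj:
  assumes P: "div_obj P" and Q: "div_obj Q" and f: "f \<in> Hom (base P) (base Q)" and g: "g \<in> div_arr P f Q"
    and X: "X \<in> Obj C" and p: "p \<in> tsec P X" "p' \<in> tsec P X" "proj P X p = proj P X p'" "g X p = g X p'"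
  shows "p = p'"
  using div_arr_cartesian[OF P Q f g X divT(4)[OF P X p(1)] div_arrD(2)[OF g X p(1)] div_arrD(4)[OF g X p(1)]] p by metis

text \<open>As h is cartesian, g factors through it over the identity: \<open>k X p\<close> is the
  only section of Q over the base point of p with image \<open>g X p\<close>. This uniqueness also
  yields the naturality and equivariance of k.\<close>

lemma cartesian_lift:
  assumes P: "div_obj P" "base P = U" and Q: "div_obj Q" "base Q = U" and R: "div_obj R" and f: "f \<in> Hom U (base R)"
    and g: "g \<in> div_arr P f R" and h: "h \<in> div_arr Q f R"
  shows "\<exists>k\<in>div_arr P (idm U) Q. \<forall>X\<in>Obj C. \<forall>p\<in>tsec P X. h X (k X p) = g X p"
proof -
  have fQ: "f \<in> Hom (base Q) (base R)" using f Q by simp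
  have pU: "proj P X p \<in> sec U X" if "X \<in> Obj C" "p \<in> tsec P X" for X p using divT(4)[OF P(1) that] P by simp
  have ex: "\<exists>!q. q \<in> tsec Q X \<and> proj Q X q = proj P X p \<and> h X q = g X p" if "X \<in> Obj C" "p \<in> tsec P X" for X p
    by (rule div_arr_cartesian[OF Q(1) R fQ h that(1)])
      (use pU[OF that] Q(2) div_arrD(2,4)[OF g that] in simp_all)
  define k where "k X p = (THE q. q \<in> tsec Q X \<and> proj Q X q = proj P X p \<and> h X q = g X p)" for X p
  have k: "k X p \<in> tsec Q X" "proj Q X (k X p) = proj P X p" "h X (k X p) = g X p" if "X \<in> Obj C" "p \<in> tsec P X" for X p
    using theI'[OF ex[OF that]] unfolding k_def by blast+
  have ku: "q = k X p" if "X \<in> Obj C" "p \<in> tsec P X" "q \<in> tsec Q X" "proj Q X q = proj P X p" "h X q = g X p" for X p q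
    by (rule div_arr_inj[OF Q(1) R fQ h that(1,3)]) (use k[OF that(1,2)] that in simp_all)
  have "mk (tot P) k \<in> div_arr P (idm U) Q"
    unfolding div_arr_def
  proof (intro CollectI conjI ballI)
    show "mk (tot P) k \<in> Hom (tot P) (tot Q)"
    proof (rule mk_Hom[OF k(1) _ divT(2)[OF P(1)]])
      fix e p assume e: "e \<in> Arr C" and p: "p \<in> tsec P (Cod C e)"
      note kp = k[OF Cod_Obj[OF e] p]
      show "k (Dom C e) (res (tot P) e p) = res (tot Q) e (k (Cod C e) p)"
        by (rule ku[symmetric, OF Dom_Obj[OF e] res_in[OF divT(2)[OF P(1)] e p] res_in[OF divT(2)[OF Q(1)] e kp(1)]])
          (use divT(5)[OF P(1) e p] divT(5)[OF Q(1) e kp(1)] div_arrD(3)[OF g e p] div_arrD(3)[OF h e kp(1)] kp P Q in simp_all)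
    qed
    fix X p assume X: "X \<in> Obj C" and p: "p \<in> tsec P X"
    note kp = k[OF X p]
    show "proj Q X (mk (tot P) k X p) = idm U X (proj P X p)" using kp X p pU by simp
    show "val Q X (mk (tot P) k X p) = val P X p" using kp X p div_arrD(6)[OF h X kp(1)] div_arrD(6)[OF g X p] by simp
    fix u assume u: "u \<in> O_units X"
    have "act Q X u (k X p) = k X (act P X u p)"
      by (rule ku[OF X divT(6)[OF P(1) X u p] divT(6)[OF Q(1) X u kp(1)]])
        (use divT(7)[OF P(1) X u p] divT(7)[OF Q(1) X u kp(1)] div_arrD(5)[OF h X u kp(1)] div_arrD(5)[OF g X u p] kp in simp_all)
    then show "mk (tot P) k X (act P X u p) = act Q X u (mk (tot P) k X p)" using X p divT(6)[OF P(1) X u p] by simp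
  qed
  then show ?thesis using k(3) by (intro bexI[of _ "mk (tot P) k"]) simp_all
qed

lemma div_arr_surj:
  assumes P: "div_obj P" "base P = U" and Q: "div_obj Q" "base Q = U" and g: "g \<in> div_arr P (idm U) Q"
    and X: "X \<in> Obj C" and q: "q \<in> tsec Q X"
  obtains p where "p \<in> tsec P X" "g X p = q" "proj P X p = proj Q X q"
proof -
  have U: "sheaf U" using divT(1)[OF P(1)] P by simp
  have x: "proj Q X q \<in> sec U X" using divT(4)[OF Q(1) X q] Q by simp
  have "\<exists>!p. p \<in> tsec P X \<and> proj P X p = proj Q X q \<and> g X p = q"
    by (rule div_arr_cartesian[OF P(1) Q(1) _ g X _ q]) (use idm_Hom[OF U] P Q x X in simp_all)
  then show ?thesis using that by blast
qed

lemma monoid_hom_arrows: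
  assumes A: "monoid_sheaf A" and B: "monoid_sheaf B" and U: "sheaf U" and \<phi>: "monoid_hom A B \<phi>"
  shows "a \<in> Hom U (und A) \<Longrightarrow> b \<in> Hom U (und A) \<Longrightarrow>
      cmp U \<phi> (a \<otimes>\<^bsub>arrows U A\<^esub> b) = cmp U \<phi> a \<otimes>\<^bsub>arrows U B\<^esub> cmp U \<phi> b"
    and "cmp U \<phi> \<one>\<^bsub>arrows U A\<^esub> = \<one>\<^bsub>arrows U B\<^esub>" (is ?g1)
proof -
  note h = monoid_hom_Hom[OF \<phi>] and hD = monoid_homD[OF \<phi>]
  show "cmp U \<phi> (a \<otimes>\<^bsub>arrows U A\<^esub> b) = cmp U \<phi> a \<otimes>\<^bsub>arrows U B\<^esub> cmp U \<phi> b"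
    if a: "a \<in> Hom U (und A)" and b: "b \<in> Hom U (und A)"
    by (rule Hom_eqI[OF cmp_Hom[OF U arrows_mult_Hom(1)[OF A U a b] h] arrows_mult_Hom(1)[OF B U cmp_Hom[OF U a h] cmp_Hom[OF U b h]]])
      (use Hom_in[OF a] Hom_in[OF b] in \<open>simp add: arrows_mult_Hom(2)[OF A U a b] arrows_mult_Hom(2)[OF B U cmp_Hom[OF U a h] cmp_Hom[OF U b h]] hD\<close>)
  show ?g1
    by (rule Hom_eqI[OF cmp_Hom[OF U arrows_one_Hom(1)[OF A U] h] arrows_one_Hom(1)[OF B U]])
      (simp add: arrows_one_Hom(2)[OF A U] arrows_one_Hom(2)[OF B U] hD)
qed

lemma monoid_hom_cmp:
  assumes A: "monoid_sheaf A" and \<phi>: "monoid_hom A B \<phi>" and \<psi>: "monoid_hom B D \<psi>"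
  shows "monoid_hom A D (cmp (und A) \<psi> \<phi>)"
  unfolding monoid_hom_def
  using cmp_Hom[OF monoid_sheafD(1)[OF A] monoid_hom_Hom[OF \<phi>] monoid_hom_Hom[OF \<psi>]] monoid_homD[OF \<phi>] monoid_homD[OF \<psi>]
    monoid_sheafD(3)[OF A]
  by (auto simp: hom_def monoid.m_closed monoid.one_closed)

lemma monoid_hom_idm: "monoid_sheaf A \<Longrightarrow> monoid_hom A A (idm (und A))"
  unfolding monoid_hom_def using idm_Hom[OF monoid_sheafD(1)[of A]] monoid_sheafD(3)[of A]
  by (auto simp: hom_def monoid.m_closed monoid.one_closed)

lemma kato_hom_iff: "kato_hom K K' \<phi> \<longleftrightarrow> monoid_hom (fst K) (fst K') \<phi> \<and> cmp (und (fst K)) (snd K') \<phi> = snd K"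
  by (simp add: kato_hom_def case_prod_beta)

lemma kato_sheaf: "kato K \<Longrightarrow> monoid_sheaf (fst K)" and kato_alpha: "kato K \<Longrightarrow> monoid_hom (fst K) \<O> (snd K)"
  by (auto simp: kato_def case_prod_beta)

lemma kato_hom_cmp:
  assumes K: "kato K" "kato K'" "kato K''" and \<phi>: "kato_hom K K' \<phi>" and \<psi>: "kato_hom K' K'' \<psi>"
  shows "kato_hom K K'' (cmp (und (fst K)) \<psi> \<phi>)"
proof -
  note h = \<phi>[unfolded kato_hom_iff] \<psi>[unfolded kato_hom_iff]
  note s = monoid_sheafD(1)[OF kato_sheaf[OF K(1)]] monoid_sheafD(1)[OF kato_sheaf[OF K(2)]]
  have "cmp (und (fst K)) (snd K'') (cmp (und (fst K)) \<psi> \<phi>) = cmp (und (fst K)) (cmp (und (fst K')) (snd K'') \<psi>) \<phi>"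
    by (rule cmp_assoc[OF s(1) _ s(2)]) (use h monoid_hom_Hom kato_alpha[OF K(3)] in blast)+
  then show ?thesis
    using h monoid_hom_cmp[OF kato_sheaf[OF K(1)] h(1)[THEN conjunct1] h(2)[THEN conjunct1]] by (simp add: kato_hom_iff)
qed

lemma kato_hom_idm:
  assumes "kato K"
  shows "kato_hom K K (idm (und (fst K)))"
  unfolding kato_hom_iff
  using monoid_hom_idm[OF kato_sheaf[OF assms]]
    cmp_idm_right[OF monoid_sheafD(1)[OF kato_sheaf[OF assms]] monoid_hom_Hom[OF kato_alpha[OF assms]]] by simp

lemma category_kato: "category quasi_integral_kato_cat"
proof
  fix f g h
  assume "f \<in> Arr quasi_integral_kato_cat" "g \<in> Arr quasi_integral_kato_cat" "h \<in> Arr quasi_integral_kato_cat"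
    "Dom quasi_integral_kato_cat g = Cod quasi_integral_kato_cat f" "Dom quasi_integral_kato_cat h = Cod quasi_integral_kato_cat g"
  then obtain K \<phi> K' \<psi> K'' \<chi> K''' where f: "f = (K, \<phi>, K')" and g: "g = (K', \<psi>, K'')" and h: "h = (K'', \<chi>, K''')"
    and k: "kato K" "kato K'" "kato_hom K K' \<phi>" "kato_hom K' K'' \<psi>" "kato_hom K'' K''' \<chi>"
    by (auto simp: quasi_integral_kato_cat_def)
  have "cmp (und (fst K)) \<chi> (cmp (und (fst K)) \<psi> \<phi>) = cmp (und (fst K)) (cmp (und (fst K')) \<chi> \<psi>) \<phi>"
    by (rule cmp_assoc[OF monoid_sheafD(1)[OF kato_sheaf[OF k(1)]] _ monoid_sheafD(1)[OF kato_sheaf[OF k(2)]]])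
      (use k(3-5) monoid_hom_Hom in \<open>auto simp: kato_hom_iff\<close>)
  then show "Cmp quasi_integral_kato_cat h (Cmp quasi_integral_kato_cat g f) = Cmp quasi_integral_kato_cat (Cmp quasi_integral_kato_cat h g) f"
    by (simp add: quasi_integral_kato_cat_def f g h)
next
  fix f assume "f \<in> Arr quasi_integral_kato_cat"
  then obtain K \<phi> K' where f: "f = (K, \<phi>, K')" and k: "kato K" "kato K'" "monoid_hom (fst K) (fst K') \<phi>"
    by (auto simp: quasi_integral_kato_cat_def kato_hom_iff)
  note s = monoid_sheafD(1)[OF kato_sheaf[OF k(1)]] monoid_sheafD(1)[OF kato_sheaf[OF k(2)]]
  show "Cmp quasi_integral_kato_cat (Idt quasi_integral_kato_cat (Cod quasi_integral_kato_cat f)) f = f"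
    "Cmp quasi_integral_kato_cat f (Idt quasi_integral_kato_cat (Dom quasi_integral_kato_cat f)) = f"
    using cmp_idm_left[OF s(1) monoid_hom_Hom[OF k(3)] s(2)] cmp_idm_right[OF s(1) monoid_hom_Hom[OF k(3)]]
    by (simp_all add: quasi_integral_kato_cat_def f)
qed (auto simp: quasi_integral_kato_cat_def intro: kato_hom_idm kato_hom_cmp)

section \<open>Morphisms of DF log structures\<close>

definition df_trans where
  "df_trans L K \<phi> = (\<Pi>\<^sub>E U\<in>{U. sheaf U}. \<Pi>\<^sub>E a\<in>Lpts L U. div_arr (Lobj K U (cmp U \<phi> a)) (idm U) (Lobj L U a))"

lemma df_trans_arr: "\<lbrakk>\<Phi> \<in> df_trans L K \<phi>; sheaf U; a \<in> Lpts L U\<rbrakk> \<Longrightarrow>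
      \<Phi> U a \<in> div_arr (Lobj K U (cmp U \<phi> a)) (idm U) (Lobj L U a)"
  unfolding df_trans_def by (auto simp: PiE_iff)

lemma df_trans_eqI:
  assumes "\<Phi> \<in> df_trans L K \<phi>" "\<Psi> \<in> df_trans L K' \<psi>" "\<And>U a. sheaf U \<Longrightarrow> a \<in> Lpts L U \<Longrightarrow> \<Phi> U a = \<Psi> U a"
  shows "\<Phi> = \<Psi>"
proof (rule ext, rule ext)
  show "\<Phi> U a = \<Psi> U a" for U a
    by (cases "sheaf U"; cases "a \<in> Lpts L U")
      (use assms in \<open>auto simp: df_trans_def PiE_iff extensional_def\<close>)
qed

text \<open>The same passage from diagrams to sections as in \<open>symmetric_monoidal_iff\<close>:
  given the typing, both sides of each diagram are compared on sections, on pure tensors, or on unit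
  sections.\<close>

lemma df_hom_iff:
  assumes L: "df L" and K: "df K"
  shows "df_hom L K \<phi> \<Phi> \<longleftrightarrow> monoid_hom (Lmon L) (Lmon K) \<phi> \<and> \<Phi> \<in> df_trans L K \<phi> \<and>
     (\<forall>V U f a. sheaf V \<longrightarrow> sheaf U \<longrightarrow> f \<in> Hom V U \<longrightarrow> a \<in> Lpts L U \<longrightarrow>
        (\<forall>X\<in>Obj C. \<forall>p\<in>Lsec K V (cmp V \<phi> (cmp V a f)) X.
           Larr L V f U a X (\<Phi> V (cmp V a f) X p) = \<Phi> U a X (Larr K V f U (cmp U \<phi> a) X p))) \<and>
     (\<forall>U a b. sheaf U \<longrightarrow> a \<in> Lpts L U \<longrightarrow> b \<in> Lpts L U \<longrightarrow>
        (\<forall>X\<in>Obj C. \<forall>p\<in>Lsec K U (cmp U \<phi> a) X. \<forall>q\<in>Lsec K U (cmp U \<phi> b) X.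
          Lproj K U (cmp U \<phi> a) X p = Lproj K U (cmp U \<phi> b) X q \<longrightarrow>
          \<Phi> U (a \<otimes>\<^bsub>arrows U (Lmon L)\<^esub> b) X (lmul K U (cmp U \<phi> a) (cmp U \<phi> b) X p q) =
          lmul L U a b X (\<Phi> U a X p) (\<Phi> U b X q))) \<and>
     (\<forall>U. sheaf U \<longrightarrow> (\<forall>X\<in>Obj C. \<forall>x\<in>sec U X. \<Phi> U \<one>\<^bsub>arrows U (Lmon L)\<^esub> X (lone K U X x) = lone L U X x))"
proof (cases "monoid_hom (Lmon L) (Lmon K) \<phi> \<and> \<Phi> \<in> df_trans L K \<phi>")
  case False
  then show ?thesis unfolding df_hom_def df_trans_def by blast
next
  case True
  then have \<phi>: "monoid_hom (Lmon L) (Lmon K) \<phi>" and \<Phi>: "\<Phi> \<in> df_trans L K \<phi>" by blast+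
  note \<Phi>a = df_trans_arr[OF \<Phi>]
  note h = monoid_hom_Hom[OF \<phi>]
  note AL = dfD(1)[OF L] and AK = dfD(1)[OF K]
  have \<phi>a: "cmp U \<phi> a \<in> Lpts K U" if "sheaf U" "a \<in> Lpts L U" for U a
    by (rule cmp_Hom[OF that h])
  show ?thesis
    unfolding df_hom_def df_trans_def[symmetric] Let_def
  proof (intro arg_cong2[where f = "(\<and>)"] iff_allI imp_cong refl, goal_cases)
    case (1 V U f a)
    then have V: "sheaf V" and U: "sheaf U" and f: "f \<in> Hom V U" and a: "a \<in> Lpts L U" by blast+
    note af = cmp_Hom[OF V f a]
    have e: "cmp V (cmp U \<phi> a) f = cmp V \<phi> (cmp V a f)" using cmp_assoc[OF V f U a h] by simp
    note T = L_div[OF K V \<phi>a[OF V af]]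
    note 1 = cmp_Hom[OF divT(2)[OF T] div_arrD(1)[OF \<Phi>a[OF V af]] div_arrD(1)[OF L_arr[OF L V U f a]]]
    note 2 = cmp_Hom[OF divT(2)[OF T] div_arrD(1)[OF L_arr[OF K V U f \<phi>a[OF U a], unfolded e]] div_arrD(1)[OF \<Phi>a[OF U a]]]
    let "?l = ?r \<longleftrightarrow> ?rhs" = ?case
    show ?case
    proof
      assume eq: "?l = ?r"
      show ?rhs
      proof (intro ballI)
        fix X p assume "X \<in> Obj C" "p \<in> Lsec K V (cmp V \<phi> (cmp V a f)) X"
        then show "Larr L V f U a X (\<Phi> V (cmp V a f) X p) = \<Phi> U a X (Larr K V f U (cmp U \<phi> a) X p)"
          using fun_cong[OF fun_cong[OF eq, of X], of p] by simp
      qed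
    next
      assume ?rhs
      then show "?l = ?r" by (intro Hom_eqI[OF 1 2]) simp
    qed
  next
    case (2 U a b)
    then have U: "sheaf U" and a: "a \<in> Lpts L U" and b: "b \<in> Lpts L U" by blast+
    let "cmp (tot ?T) _ _ = cmp (tot ?T) _ ?t \<longleftrightarrow> _" = ?case
    note P = L_div[OF K U \<phi>a[OF U a]] and Q = L_div[OF K U \<phi>a[OF U b]]
    note bK = L_base_eq[OF K U \<phi>a[OF U a] \<phi>a[OF U b]]
    note T = tensorD[OF P Q bK]
    have bT: "base ?T = U" using T(2) L_base[OF K U \<phi>a[OF U a]] by simp
    have i: "idm U \<in> Hom (base (Lobj K U (cmp U \<phi> a))) (base (Lobj L U a))"
      using idm_Hom[OF U] L_base[OF K U \<phi>a[OF U a]] L_base[OF L U a] by simp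
    note tm = tensor_mapD[OF P Q bK L_div[OF L U a] L_div[OF L U b] L_base_eq[OF L U a b] i \<Phi>a[OF U a] \<Phi>a[OF U b]]
    note ab = A_mult_Hom[OF L U a b]
    have 1: "cmp (tot ?T) (\<Phi> U (a \<otimes>\<^bsub>arrows U (Lmon L)\<^esub> b)) (Lmul K U (cmp U \<phi> a) (cmp U \<phi> b)) \<in> div_arr ?T (idm U) (Lobj L U (a \<otimes>\<^bsub>arrows U (Lmon L)\<^esub> b))"
      using cmp_div_arr_idm[OF T(1) bT lmul_arr[OF K U \<phi>a[OF U a] \<phi>a[OF U b]], of "\<Phi> U (a \<otimes>\<^bsub>arrows U (Lmon L)\<^esub> b)"]
        \<Phi>a[OF U ab] monoid_hom_arrows(1)[OF AL AK U \<phi> a b] by simp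
    note 2 = cmp_div_arr_idm[OF T(1) bT tm(1) lmul_arr[OF L U a b]]
    show ?case
      unfolding tensor_eq_iff[OF P Q bK L_div[OF L U ab] 1 2]
      using T(3) tm(2) by (simp add: lmul_def)
  next
    case U: (3 U)
    note I = unit_objD[OF U]
    have 1: "cmp (tot (unit_obj U)) (\<Phi> U \<one>\<^bsub>arrows U (Lmon L)\<^esub>) (Lone K U) \<in> div_arr (unit_obj U) (idm U) (Lobj L U \<one>\<^bsub>arrows U (Lmon L)\<^esub>)"
      using cmp_div_arr_idm[OF I(1,2) lone_arr[OF K U], of "\<Phi> U \<one>\<^bsub>arrows U (Lmon L)\<^esub>"]
        \<Phi>a[OF U A_one_Hom[OF L U]] monoid_hom_arrows(2)[OF AL AK U \<phi>] by simp
    show ?case unfolding unit_eq_iff[OF U 1 lone_arr[OF L U]] using I(4) by (simp add: lone_def)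
  qed
qed

lemma df_homD:
  assumes L: "df L" and K: "df K" and h: "df_hom L K \<phi> \<Phi>"
  shows "monoid_hom (Lmon L) (Lmon K) \<phi>" and "\<Phi> \<in> df_trans L K \<phi>"
    and "sheaf U \<Longrightarrow> a \<in> Lpts L U \<Longrightarrow> \<Phi> U a \<in> div_arr (Lobj K U (cmp U \<phi> a)) (idm U) (Lobj L U a)"
    and "sheaf U \<Longrightarrow> a \<in> Lpts L U \<Longrightarrow> cmp U \<phi> a \<in> Lpts K U"
    and "\<lbrakk>sheaf V; sheaf U; f \<in> Hom V U; a \<in> Lpts L U; X \<in> Obj C; p \<in> Lsec K V (cmp V \<phi> (cmp V a f)) X\<rbrakk> \<Longrightarrow>
      Larr L V f U a X (\<Phi> V (cmp V a f) X p) = \<Phi> U a X (Larr K V f U (cmp U \<phi> a) X p)" (is "PROP ?g1")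
    and "\<lbrakk>sheaf U; a \<in> Lpts L U; b \<in> Lpts L U; X \<in> Obj C; p \<in> Lsec K U (cmp U \<phi> a) X; q \<in> Lsec K U (cmp U \<phi> b) X; Lproj K U (cmp U \<phi> a) X p = Lproj K U (cmp U \<phi> b) X q\<rbrakk> \<Longrightarrow>
      \<Phi> U (a \<otimes>\<^bsub>arrows U (Lmon L)\<^esub> b) X (lmul K U (cmp U \<phi> a) (cmp U \<phi> b) X p q) =
          lmul L U a b X (\<Phi> U a X p) (\<Phi> U b X q)" (is "PROP ?g2")
    and "\<lbrakk>sheaf U; X \<in> Obj C; x \<in> sec U X\<rbrakk> \<Longrightarrow>
      \<Phi> U \<one>\<^bsub>arrows U (Lmon L)\<^esub> X (lone K U X x) = lone L U X x" (is "PROP ?g3")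
    and "\<lbrakk>sheaf U; a \<in> Lpts L U; X \<in> Obj C; p \<in> Lsec K U (cmp U \<phi> a) X\<rbrakk> \<Longrightarrow>
      \<Phi> U a X p \<in> Lsec L U a X \<and> Lproj L U a X (\<Phi> U a X p) = Lproj K U (cmp U \<phi> a) X p"
proof -
  note d = h[unfolded df_hom_iff[OF L K]]
  show 1: "monoid_hom (Lmon L) (Lmon K) \<phi>" and 2: "\<Phi> \<in> df_trans L K \<phi>" using d by blast+
  show 3: "\<Phi> U a \<in> div_arr (Lobj K U (cmp U \<phi> a)) (idm U) (Lobj L U a)" if "sheaf U" "a \<in> Lpts L U" for U a
    by (rule df_trans_arr[OF 2 that])
  show 4: "cmp U \<phi> a \<in> Lpts K U" if "sheaf U" "a \<in> Lpts L U" for U a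
    by (rule cmp_Hom[OF that monoid_hom_Hom[OF 1]])
  show "PROP ?g1"
    using d by simp
  show "PROP ?g2"
    using d by simp
  show "PROP ?g3"
    using d by simp
  assume U: "sheaf U" and a: "a \<in> Lpts L U" and X: "X \<in> Obj C" and p: "p \<in> Lsec K U (cmp U \<phi> a) X"
  show "\<Phi> U a X p \<in> Lsec L U a X \<and> Lproj L U a X (\<Phi> U a X p) = Lproj K U (cmp U \<phi> a) X p"
    using div_arrD(2,4)[OF 3[OF U a] X p] L_proj_in[OF K U 4[OF U a] X p] X by simp
qed

definition df_idt where
  "df_idt L = (\<lambda>U\<in>{U. sheaf U}. \<lambda>a\<in>Lpts L U. idm (tot (Lobj L U a)))"

text \<open>The component of a transformation at a leads from the structure of the target, K(\<phi>
  a), back to L(a). Hence \<Psi> is applied before \<Phi>, in contrast to the maps of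
  monoids.\<close>

definition df_cmp where
  "df_cmp L N \<phi> \<Phi> \<psi> \<Psi> = (\<lambda>U\<in>{U. sheaf U}. \<lambda>a\<in>Lpts L U.
     cmp (tot (Lobj N U (cmp U (cmp (und (Lmon L)) \<psi> \<phi>) a))) (\<Phi> U a) (\<Psi> U (cmp U \<phi> a)))"

lemma df_idt_apply: "sheaf U \<Longrightarrow> a \<in> Lpts L U \<Longrightarrow> df_idt L U a = idm (tot (Lobj L U a))"
  by (simp add: df_idt_def)

lemma df_hom_idt:
  assumes L: "df L"
  shows "df_hom L L (idm (und (Lmon L))) (df_idt L)"
proof -
  note A = dfD(1)[OF L] and sA = sheaf_A[OF L]
  have i: "cmp U (idm (und (Lmon L))) a = a" if "sheaf U" "a \<in> Lpts L U" for U a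
    by (rule cmp_idm_left[OF that sA])
  note D = L_div[OF L] and B = L_base[OF L]
  show ?thesis
    unfolding df_hom_iff[OF L L]
  proof (intro conjI allI impI ballI)
    show "monoid_hom (Lmon L) (Lmon L) (idm (und (Lmon L)))" by (rule monoid_hom_idm[OF A])
    show "df_idt L \<in> df_trans L L (idm (und (Lmon L)))"
      unfolding df_trans_def df_idt_def using i D B by (auto intro!: idm_div_arr)
  next
    fix V U f a X p assume V: "sheaf V" and U: "sheaf U" and f: "f \<in> Hom V U" and a: "a \<in> Lpts L U" and X: "X \<in> Obj C"
      and p: "p \<in> Lsec L V (cmp V (idm (und (Lmon L))) (cmp V a f)) X"
    note af = cmp_Hom[OF V f a]
    have p': "p \<in> Lsec L V (cmp V a f) X" using p i[OF V af] by simp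
    show "Larr L V f U a X (df_idt L V (cmp V a f) X p) = df_idt L U a X (Larr L V f U (cmp U (idm (und (Lmon L))) a) X p)"
      using i[OF U a] p' X div_arrD(2)[OF L_arr[OF L V U f a] X p'] by (simp add: df_idt_apply[OF V af] df_idt_apply[OF U a])
  next
    fix U a b X p q assume U: "sheaf U" and a: "a \<in> Lpts L U" and b: "b \<in> Lpts L U" and X: "X \<in> Obj C"
      and pq: "p \<in> Lsec L U (cmp U (idm (und (Lmon L))) a) X" "q \<in> Lsec L U (cmp U (idm (und (Lmon L))) b) X"
      "Lproj L U (cmp U (idm (und (Lmon L))) a) X p = Lproj L U (cmp U (idm (und (Lmon L))) b) X q"
    show "df_idt L U (a \<otimes>\<^bsub>arrows U (Lmon L)\<^esub> b) X (lmul L U (cmp U (idm (und (Lmon L))) a) (cmp U (idm (und (Lmon L))) b) X p q) =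
          lmul L U a b X (df_idt L U a X p) (df_idt L U b X q)"
      using pq X lmulD(1)[OF L U a b X] unfolding i[OF U a] i[OF U b]
      by (simp add: df_idt_apply[OF U a] df_idt_apply[OF U b] df_idt_apply[OF U A_mult_Hom[OF L U a b]])
  next
    fix U X x assume U: "sheaf U" and X: "X \<in> Obj C" and x: "x \<in> sec U X"
    show "df_idt L U \<one>\<^bsub>arrows U (Lmon L)\<^esub> X (lone L U X x) = lone L U X x"
      using loneD(1)[OF L U X x] X by (simp add: df_idt_apply[OF U A_one_Hom[OF L U]])
  qed
qed

lemma df_cmp_apply:
  assumes L: "df L" and K: "df K" and N: "df N" and h: "df_hom L K \<phi> \<Phi>" and g: "df_hom K N \<psi> \<Psi>"
    and U: "sheaf U" and a: "a \<in> Lpts L U"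
  shows "cmp U (cmp (und (Lmon L)) \<psi> \<phi>) a = cmp U \<psi> (cmp U \<phi> a)" (is ?g1)
    and "df_cmp L N \<phi> \<Phi> \<psi> \<Psi> U a = cmp (tot (Lobj N U (cmp U \<psi> (cmp U \<phi> a)))) (\<Phi> U a) (\<Psi> U (cmp U \<phi> a))" (is ?g2)
    and "X \<in> Obj C \<Longrightarrow> p \<in> Lsec N U (cmp U \<psi> (cmp U \<phi> a)) X \<Longrightarrow> df_cmp L N \<phi> \<Phi> \<psi> \<Psi> U a X p = \<Phi> U a X (\<Psi> U (cmp U \<phi> a) X p)" (is "PROP ?g3")
    and "df_cmp L N \<phi> \<Phi> \<psi> \<Psi> U a \<in> div_arr (Lobj N U (cmp U \<psi> (cmp U \<phi> a))) (idm U) (Lobj L U a)" (is ?g4)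
proof -
  note H = df_homD[OF L K h] and G = df_homD[OF K N g]
  show e: ?g1
    using cmp_assoc[OF U a sheaf_A[OF L] monoid_hom_Hom[OF H(1)] monoid_hom_Hom[OF G(1)]] by simp
  show d: ?g2
    using U a e by (simp add: df_cmp_def)
  show "PROP ?g3"
    unfolding d by simp
  note \<phi>a = H(4)[OF U a]
  show ?g4
    unfolding d by (rule cmp_div_arr_idm[OF L_div[OF N U G(4)[OF U \<phi>a]] L_base[OF N U G(4)[OF U \<phi>a]] G(3)[OF U \<phi>a] H(3)[OF U a]])
qed

lemma df_hom_cmp:
  assumes L: "df L" and K: "df K" and N: "df N" and h: "df_hom L K \<phi> \<Phi>" and g: "df_hom K N \<psi> \<Psi>"
  shows "df_hom L N (cmp (und (Lmon L)) \<psi> \<phi>) (df_cmp L N \<phi> \<Phi> \<psi> \<Psi>)"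
proof -
  note H = df_homD[OF L K h] and G = df_homD[OF K N g] and A = df_cmp_apply[OF L K N h g]
  note AL = dfD(1)[OF L] and AK = dfD(1)[OF K] and AN = dfD(1)[OF N]
  show ?thesis
    unfolding df_hom_iff[OF L N]
  proof (intro conjI allI impI ballI)
    show "monoid_hom (Lmon L) (Lmon N) (cmp (und (Lmon L)) \<psi> \<phi>)" by (rule monoid_hom_cmp[OF AL H(1) G(1)])
    have "df_cmp L N \<phi> \<Phi> \<psi> \<Psi> U a \<in> div_arr (Lobj N U (cmp U (cmp (und (Lmon L)) \<psi> \<phi>) a)) (idm U) (Lobj L U a)"
      if "sheaf U" "a \<in> Lpts L U" for U a using A(1,4)[OF that] by simp
    then show "df_cmp L N \<phi> \<Phi> \<psi> \<Psi> \<in> df_trans L N (cmp (und (Lmon L)) \<psi> \<phi>)"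
      unfolding df_trans_def by (auto simp: PiE_iff extensional_def df_cmp_def)
  next
    fix V U f a X p assume V: "sheaf V" and U: "sheaf U" and f: "f \<in> Hom V U" and a: "a \<in> Lpts L U" and X: "X \<in> Obj C"
      and p: "p \<in> Lsec N V (cmp V (cmp (und (Lmon L)) \<psi> \<phi>) (cmp V a f)) X"
    note af = cmp_Hom[OF V f a] and \<phi>a = H(4)[OF U a]
    have e: "cmp V (cmp U \<phi> a) f = cmp V \<phi> (cmp V a f)" using cmp_assoc[OF V f U a monoid_hom_Hom[OF H(1)]] by simp
    have e': "cmp V (cmp U \<psi> (cmp U \<phi> a)) f = cmp V \<psi> (cmp V \<phi> (cmp V a f))" using cmp_assoc[OF V f U \<phi>a monoid_hom_Hom[OF G(1)]] e by simp
    have p': "p \<in> Lsec N V (cmp V \<psi> (cmp V \<phi> (cmp V a f))) X" using p A(1)[OF V af] by simp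
    note \<Psi>p = G(8)[OF V H(4)[OF V af] X p']
    have "Larr L V f U a X (df_cmp L N \<phi> \<Phi> \<psi> \<Psi> V (cmp V a f) X p) = \<Phi> U a X (Larr K V f U (cmp U \<phi> a) X (\<Psi> V (cmp V \<phi> (cmp V a f)) X p))"
      using A(3)[OF V af X p'] H(5)[OF V U f a X, of "\<Psi> V (cmp V \<phi> (cmp V a f)) X p"] \<Psi>p by simp
    also have "\<dots> = \<Phi> U a X (\<Psi> U (cmp U \<phi> a) X (Larr N V f U (cmp U \<psi> (cmp U \<phi> a)) X p))"
      using G(5)[OF V U f \<phi>a X, of p] p' e by simp
    also have "\<dots> = df_cmp L N \<phi> \<Phi> \<psi> \<Psi> U a X (Larr N V f U (cmp U \<psi> (cmp U \<phi> a)) X p)"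
      using A(3)[OF U a X] div_arrD(2)[OF L_arr[OF N V U f G(4)[OF U \<phi>a], unfolded e'] X p'] by simp
    finally show "Larr L V f U a X (df_cmp L N \<phi> \<Phi> \<psi> \<Psi> V (cmp V a f) X p) =
        df_cmp L N \<phi> \<Phi> \<psi> \<Psi> U a X (Larr N V f U (cmp U (cmp (und (Lmon L)) \<psi> \<phi>) a) X p)"
      using A(1)[OF U a] by simp
  next
    fix U a b X p q assume U: "sheaf U" and a: "a \<in> Lpts L U" and b: "b \<in> Lpts L U" and X: "X \<in> Obj C"
      and pq0: "p \<in> Lsec N U (cmp U (cmp (und (Lmon L)) \<psi> \<phi>) a) X" "q \<in> Lsec N U (cmp U (cmp (und (Lmon L)) \<psi> \<phi>) b) X"
      "Lproj N U (cmp U (cmp (und (Lmon L)) \<psi> \<phi>) a) X p = Lproj N U (cmp U (cmp (und (Lmon L)) \<psi> \<phi>) b) X q"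
    note pq = pq0[unfolded A(1)[OF U a] A(1)[OF U b]]
    note ab = A_mult_Hom[OF L U a b] and \<phi>a = H(4)[OF U a] and \<phi>b = H(4)[OF U b]
    note \<Psi>p = G(8)[OF U \<phi>a X pq(1)] and \<Psi>q = G(8)[OF U \<phi>b X pq(2)]
    have e: "cmp U \<phi> (a \<otimes>\<^bsub>arrows U (Lmon L)\<^esub> b) = cmp U \<phi> a \<otimes>\<^bsub>arrows U (Lmon K)\<^esub> cmp U \<phi> b"
      by (rule monoid_hom_arrows(1)[OF AL AK U H(1) a b])
    have e': "cmp U \<psi> (cmp U \<phi> a \<otimes>\<^bsub>arrows U (Lmon K)\<^esub> cmp U \<phi> b) = cmp U \<psi> (cmp U \<phi> a) \<otimes>\<^bsub>arrows U (Lmon N)\<^esub> cmp U \<psi> (cmp U \<phi> b)"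
      by (rule monoid_hom_arrows(1)[OF AK AN U G(1) \<phi>a \<phi>b])
    have "df_cmp L N \<phi> \<Phi> \<psi> \<Psi> U (a \<otimes>\<^bsub>arrows U (Lmon L)\<^esub> b) X (lmul N U (cmp U \<psi> (cmp U \<phi> a)) (cmp U \<psi> (cmp U \<phi> b)) X p q) =
      \<Phi> U (a \<otimes>\<^bsub>arrows U (Lmon L)\<^esub> b) X (\<Psi> U (cmp U \<phi> a \<otimes>\<^bsub>arrows U (Lmon K)\<^esub> cmp U \<phi> b) X (lmul N U (cmp U \<psi> (cmp U \<phi> a)) (cmp U \<psi> (cmp U \<phi> b)) X p q))"
      using A(3)[OF U ab X] lmulD(1)[OF N U G(4)[OF U \<phi>a] G(4)[OF U \<phi>b] X pq] unfolding e e' by simp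
    also have "\<dots> = \<Phi> U (a \<otimes>\<^bsub>arrows U (Lmon L)\<^esub> b) X (lmul K U (cmp U \<phi> a) (cmp U \<phi> b) X (\<Psi> U (cmp U \<phi> a) X p) (\<Psi> U (cmp U \<phi> b) X q))"
      using G(6)[OF U \<phi>a \<phi>b X pq] by simp
    also have "\<dots> = lmul L U a b X (\<Phi> U a X (\<Psi> U (cmp U \<phi> a) X p)) (\<Phi> U b X (\<Psi> U (cmp U \<phi> b) X q))"
      using H(6)[OF U a b X] \<Psi>p \<Psi>q pq(3) by simp
    finally show "df_cmp L N \<phi> \<Phi> \<psi> \<Psi> U (a \<otimes>\<^bsub>arrows U (Lmon L)\<^esub> b) X
        (lmul N U (cmp U (cmp (und (Lmon L)) \<psi> \<phi>) a) (cmp U (cmp (und (Lmon L)) \<psi> \<phi>) b) X p q) =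
      lmul L U a b X (df_cmp L N \<phi> \<Phi> \<psi> \<Psi> U a X p) (df_cmp L N \<phi> \<Phi> \<psi> \<Psi> U b X q)"
      using A(3)[OF U a X pq(1)] A(3)[OF U b X pq(2)] unfolding A(1)[OF U a] A(1)[OF U b] by simp
  next
    fix U X x assume U: "sheaf U" and X: "X \<in> Obj C" and x: "x \<in> sec U X"
    note o = A_one_Hom[OF L U]
    have e: "cmp U \<phi> \<one>\<^bsub>arrows U (Lmon L)\<^esub> = \<one>\<^bsub>arrows U (Lmon K)\<^esub>" "cmp U \<psi> \<one>\<^bsub>arrows U (Lmon K)\<^esub> = \<one>\<^bsub>arrows U (Lmon N)\<^esub>"
      using monoid_hom_arrows(2)[OF AL AK U H(1)] monoid_hom_arrows(2)[OF AK AN U G(1)] .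
    show "df_cmp L N \<phi> \<Phi> \<psi> \<Psi> U \<one>\<^bsub>arrows U (Lmon L)\<^esub> X (lone N U X x) = lone L U X x"
      using A(3)[OF U o X, of "lone N U X x"] loneD(1)[OF N U X x] G(7)[OF U X x] H(7)[OF U X x] unfolding e by simp
  qed
qed

lemma category_df: "category df_cat"
proof
  fix f g h
  assume "f \<in> Arr df_cat" "g \<in> Arr df_cat" "h \<in> Arr df_cat" "Dom df_cat g = Cod df_cat f" "Dom df_cat h = Cod df_cat g"
  then obtain L \<phi> \<Phi> K \<psi> \<Psi> N \<chi> X M where f: "f = (L, (\<phi>, \<Phi>), K)" and g: "g = (K, (\<psi>, \<Psi>), N)" and h: "h = (N, (\<chi>, X), M)"
    and k: "df L" "df K" "df N" "df M" "df_hom L K \<phi> \<Phi>" "df_hom K N \<psi> \<Psi>" "df_hom N M \<chi> X"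
    by (auto simp: df_cat_def)
  note F = df_homD[OF k(1,2,5)] and G = df_homD[OF k(2,3,6)] and H = df_homD[OF k(3,4,7)]
  note gf = df_hom_cmp[OF k(1-3,5,6)] and hg = df_hom_cmp[OF k(2-4,6,7)]
  have c: "cmp (und (Lmon L)) \<chi> (cmp (und (Lmon L)) \<psi> \<phi>) = cmp (und (Lmon L)) (cmp (und (Lmon K)) \<chi> \<psi>) \<phi>"
    by (rule cmp_assoc[OF sheaf_A[OF k(1)] monoid_hom_Hom[OF F(1)] sheaf_A[OF k(2)] monoid_hom_Hom[OF G(1)] monoid_hom_Hom[OF H(1)]])
  have "df_cmp L M (cmp (und (Lmon L)) \<psi> \<phi>) (df_cmp L N \<phi> \<Phi> \<psi> \<Psi>) \<chi> X =
    df_cmp L M \<phi> \<Phi> (cmp (und (Lmon K)) \<chi> \<psi>) (df_cmp K M \<psi> \<Psi> \<chi> X)"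
  proof (rule df_trans_eqI[OF df_homD(2)[OF k(1,4) df_hom_cmp[OF k(1,3,4) gf k(7)]] df_homD(2)[OF k(1,4) df_hom_cmp[OF k(1,2,4,5) hg]]])
    fix U a assume U: "sheaf U" and a: "a \<in> Lpts L U"
    note A = df_cmp_apply[OF k(1,3,4) gf k(7) U a] and B = df_cmp_apply[OF k(1,2,4,5) hg U a]
      and C = df_cmp_apply[OF k(1-3,5,6) U a] and D = df_cmp_apply[OF k(2-4,6,7) U F(4)[OF U a]]
    have e: "cmp U (cmp (und (Lmon K)) \<chi> \<psi>) (cmp U \<phi> a) = cmp U \<chi> (cmp U \<psi> (cmp U \<phi> a))"
      "cmp U (cmp (und (Lmon L)) \<psi> \<phi>) a = cmp U \<psi> (cmp U \<phi> a)" using D(1) C(1) by simp_all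
    show "df_cmp L M (cmp (und (Lmon L)) \<psi> \<phi>) (df_cmp L N \<phi> \<Phi> \<psi> \<Psi>) \<chi> X U a =
      df_cmp L M \<phi> \<Phi> (cmp (und (Lmon K)) \<chi> \<psi>) (df_cmp K M \<psi> \<Psi> \<chi> X) U a"
    proof (rule Hom_eqI[OF div_arrD(1)[OF A(4)[unfolded e]] div_arrD(1)[OF B(4)[unfolded e]]])
      fix Y p assume Y: "Y \<in> Obj C" and p: "p \<in> Lsec M U (cmp U \<chi> (cmp U \<psi> (cmp U \<phi> a))) Y"
      note Xp = H(8)[OF U G(4)[OF U F(4)[OF U a]] Y p]
      show "df_cmp L M (cmp (und (Lmon L)) \<psi> \<phi>) (df_cmp L N \<phi> \<Phi> \<psi> \<Psi>) \<chi> X U a Y p =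
        df_cmp L M \<phi> \<Phi> (cmp (und (Lmon K)) \<chi> \<psi>) (df_cmp K M \<psi> \<Psi> \<chi> X) U a Y p"
        using A(3)[OF Y, unfolded e, OF p] B(3)[OF Y, unfolded e, OF p] C(3)[OF Y Xp[THEN conjunct1]] D(3)[OF Y p] by simp
    qed
  qed
  then show "Cmp df_cat h (Cmp df_cat g f) = Cmp df_cat (Cmp df_cat h g) f"
    using c by (simp add: df_cat_def f g h df_cmp_def)
next
  fix f assume "f \<in> Arr df_cat"
  then obtain L \<phi> \<Phi> K where f: "f = (L, (\<phi>, \<Phi>), K)" and k: "df L" "df K" "df_hom L K \<phi> \<Phi>" by (auto simp: df_cat_def)
  note F = df_homD[OF k] and hi = monoid_hom_Hom[OF df_homD(1)[OF k]]
  have i: "cmp (und (Lmon L)) (idm (und (Lmon K))) \<phi> = \<phi>" "cmp (und (Lmon L)) \<phi> (idm (und (Lmon L))) = \<phi>"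
    by (rule cmp_idm_left[OF sheaf_A[OF k(1)] hi sheaf_A[OF k(2)]], rule cmp_idm_right[OF sheaf_A[OF k(1)] hi])
  have "df_cmp L K \<phi> \<Phi> (idm (und (Lmon K))) (df_idt K) = \<Phi>"
  proof (rule df_trans_eqI[OF df_homD(2)[OF k(1,2) df_hom_cmp[OF k(1,2,2,3) df_hom_idt[OF k(2)]]] F(2)])
    fix U a assume U: "sheaf U" and a: "a \<in> Lpts L U"
    note A = df_cmp_apply[OF k(1,2,2,3) df_hom_idt[OF k(2)] U a]
    have e: "cmp U (idm (und (Lmon K))) (cmp U \<phi> a) = cmp U \<phi> a" by (rule cmp_idm_left[OF U F(4)[OF U a] sheaf_A[OF k(2)]])
    show "df_cmp L K \<phi> \<Phi> (idm (und (Lmon K))) (df_idt K) U a = \<Phi> U a"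
      by (rule Hom_eqI[OF div_arrD(1)[OF A(4)[unfolded e]] div_arrD(1)[OF F(3)[OF U a]]])
        (use A(3)[unfolded e] in \<open>simp add: df_idt_apply[OF U F(4)[OF U a]]\<close>)
  qed
  then show "Cmp df_cat (Idt df_cat (Cod df_cat f)) f = f" using i by (simp add: df_cat_def f df_cmp_def df_idt_def)
  have "df_cmp L K (idm (und (Lmon L))) (df_idt L) \<phi> \<Phi> = \<Phi>"
  proof (rule df_trans_eqI[OF df_homD(2)[OF k(1,2) df_hom_cmp[OF k(1,1,2) df_hom_idt[OF k(1)] k(3)]] F(2)])
    fix U a assume U: "sheaf U" and a: "a \<in> Lpts L U"
    note A = df_cmp_apply[OF k(1,1,2) df_hom_idt[OF k(1)] k(3) U a]
    have e: "cmp U (idm (und (Lmon L))) a = a" by (rule cmp_idm_left[OF U a sheaf_A[OF k(1)]])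
    show "df_cmp L K (idm (und (Lmon L))) (df_idt L) \<phi> \<Phi> U a = \<Phi> U a"
      by (rule Hom_eqI[OF div_arrD(1)[OF A(4)[unfolded e]] div_arrD(1)[OF F(3)[OF U a]]])
        (use A(3)[unfolded e] F(8)[OF U a] in \<open>simp add: df_idt_apply[OF U a]\<close>)
  qed
  then show "Cmp df_cat f (Idt df_cat (Dom df_cat f)) = f" using i by (simp add: df_cat_def f df_cmp_def df_idt_def)
next
  fix f g assume "f \<in> Arr df_cat" "g \<in> Arr df_cat" "Dom df_cat g = Cod df_cat f"
  then obtain L \<phi> \<Phi> K \<psi> \<Psi> N where f: "f = (L, (\<phi>, \<Phi>), K)" and g: "g = (K, (\<psi>, \<Psi>), N)"
    and k: "df L" "df K" "df N" "df_hom L K \<phi> \<Phi>" "df_hom K N \<psi> \<Psi>"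
    by (auto simp: df_cat_def)
  show "Cmp df_cat g f \<in> Arr df_cat" "Dom df_cat (Cmp df_cat g f) = Dom df_cat f" "Cod df_cat (Cmp df_cat g f) = Cod df_cat g"
    using df_hom_cmp[OF k] k by (simp_all add: df_cat_def f g df_cmp_def)
qed (use df_hom_idt in \<open>auto simp: df_cat_def df_idt_def\<close>)

section \<open>Full faithfulness\<close>

text \<open>At the identity of A, \<Phi> is an isomorphism from K(\<phi>) to the universal torsor of
  L. Its inverse, here written as a definite description, is followed by the canonical arrow from
  K(\<phi>) to the universal torsor of K.\<close>

definition kato_mor where
  "kato_mor L K \<phi> \<Phi> = mk (tot (tq L)) (\<lambda>X m. rq K (und (Lmon L)) \<phi> X
     (THE p. p \<in> Lsec K (und (Lmon L)) \<phi> X \<and> \<Phi> (und (Lmon L)) (idm (und (Lmon L))) X p = m))"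

text \<open>The second clause follows from naturality of \<Phi> along a from U to A. It describes
  the arrow through any test object without inverting \<Phi>, and it is the form used from here
  on.\<close>

lemma kato_morD:
  assumes L: "df L" and K: "df K" and h: "df_hom L K \<phi> \<Phi>"
  shows "kato_mor L K \<phi> \<Phi> \<in> div_arr (tq L) \<phi> (tq K)" (is ?g1)
    and "\<lbrakk>sheaf U; a \<in> Lpts L U; X \<in> Obj C; p \<in> Lsec K U (cmp U \<phi> a) X\<rbrakk> \<Longrightarrow>
      kato_mor L K \<phi> \<Phi> X (rq L U a X (\<Phi> U a X p)) = rq K U (cmp U \<phi> a) X p"
proof -
  let ?A = "und (Lmon L)" and ?i = "idm (und (Lmon L))"
  note H = df_homD[OF L K h] and sA = sheaf_A[OF L]
  note i = idm_Hom[OF sA] and \<phi> = monoid_hom_Hom[OF H(1)]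
  have \<phi>i: "cmp ?A \<phi> ?i = \<phi>" by (rule cmp_idm_right[OF sA \<phi>])
  note P = L_div[OF K sA \<phi>] L_base[OF K sA \<phi>]
  have \<Phi>: "\<Phi> ?A ?i \<in> div_arr (Lobj K ?A \<phi>) (idm ?A) (tq L)" using H(3)[OF sA i] \<phi>i by (simp add: tq_def)
  obtain \<Theta> where \<Theta>: "\<Theta> \<in> div_arr (tq L) (idm ?A) (Lobj K ?A \<phi>)"
    and \<Theta>\<Phi>: "\<And>X p. X \<in> Obj C \<Longrightarrow> p \<in> Lsec K ?A \<phi> X \<Longrightarrow> \<Theta> X (\<Phi> ?A ?i X p) = p"
    and \<Phi>\<Theta>: "\<And>X m. X \<in> Obj C \<Longrightarrow> m \<in> tsec (tq L) X \<Longrightarrow> \<Phi> ?A ?i X (\<Theta> X m) = m"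
    by (rule div_arr_inverse[OF P(1) tq_div[OF L] P(2) tq_base[OF L] \<Phi>]) blast
  have the: "(THE p. p \<in> Lsec K ?A \<phi> X \<and> \<Phi> ?A ?i X p = m) = \<Theta> X m" if "X \<in> Obj C" "m \<in> tsec (tq L) X" for X m
    by (rule the_equality) (use \<Phi>\<Theta>[OF that] div_arrD(2)[OF \<Theta> that] \<Theta>\<Phi>[OF that(1)] in auto)
  note c = cmp_div_arr[OF tq_div[OF L] tq_base[OF L] \<Theta> rq_arr[OF K sA \<phi>], unfolded \<phi>i]
  have e: "kato_mor L K \<phi> \<Phi> = cmp (tot (tq L)) (rq K ?A \<phi>) \<Theta>"
  proof (rule Hom_eqI[OF _ div_arrD(1)[OF c]])
    show "kato_mor L K \<phi> \<Phi> \<in> Hom (tot (tq L)) (tot (tq K))"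
      unfolding kato_mor_def
      by (rule mk_Hom[OF _ _ divT(2)[OF tq_div[OF L]]])
        (use the rq_in[OF K sA \<phi>] rq_res[OF K sA \<phi>] div_arrD(2,3)[OF \<Theta>] res_in[OF divT(2)[OF tq_div[OF L]]] Dom_Obj Cod_Obj in simp_all)
  qed (simp add: kato_mor_def the)
  show 1: ?g1 unfolding e by (rule c)
  assume U: "sheaf U" and a: "a \<in> Hom U ?A" and X: "X \<in> Obj C" and p: "p \<in> Lsec K U (cmp U \<phi> a) X"
  have ia: "cmp U ?i a = a" by (rule cmp_idm_left[OF U a sA])
  have Kp: "Larr K U a ?A \<phi> X p \<in> Lsec K ?A \<phi> X" by (rule div_arrD(2)[OF L_arr[OF K U sA a \<phi>] X p])
  have "rq L U a X (\<Phi> U a X p) = \<Phi> ?A ?i X (Larr K U a ?A \<phi> X p)"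
    using H(5)[OF U sA a i X, of p] p ia \<phi>i by (simp add: rq_def)
  then show "kato_mor L K \<phi> \<Phi> X (rq L U a X (\<Phi> U a X p)) = rq K U (cmp U \<phi> a) X p"
    using \<Theta>\<Phi>[OF X Kp] rq_Larr[OF K U sA a \<phi> X p] div_arrD(2)[OF \<Phi> X Kp] X by (simp add: e)
qed

text \<open>The second clause of \<open>kato_morD\<close> determines the arrow: with U = A and a the
  identity, every section of the universal torsor is of the form \<Phi> p, since \<Phi> is
  surjective on sections.\<close>

lemma kato_mor_eqI:
  assumes L: "df L" and K: "df K" and h: "df_hom L K \<phi> \<Phi>" and \<psi>: "\<psi> \<in> Hom (tot (tq L)) G"
    and e: "\<And>U a X p. \<lbrakk>sheaf U; a \<in> Lpts L U; X \<in> Obj C; p \<in> Lsec K U (cmp U \<phi> a) X\<rbrakk> \<Longrightarrow>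
      \<psi> X (rq L U a X (\<Phi> U a X p)) = rq K U (cmp U \<phi> a) X p"
  shows "kato_mor L K \<phi> \<Phi> = \<psi>"
proof (rule Hom_eqI[OF div_arrD(1)[OF kato_morD(1)[OF L K h]] \<psi>])
  let ?A = "und (Lmon L)" and ?i = "idm (und (Lmon L))"
  note H = df_homD[OF L K h] and sA = sheaf_A[OF L]
  note i = idm_Hom[OF sA]
  fix X m assume X: "X \<in> Obj C" and m: "m \<in> tsec (tq L) X"
  have m': "m \<in> Lsec L ?A ?i X" using m by (simp add: tq_def)
  obtain p where p: "p \<in> Lsec K ?A (cmp ?A \<phi> ?i) X" "\<Phi> ?A ?i X p = m"
    by (rule div_arr_surj[OF L_div[OF K sA H(4)[OF sA i]] L_base[OF K sA H(4)[OF sA i]] L_div[OF L sA i] L_base[OF L sA i] H(3)[OF sA i] X m'])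
  show "kato_mor L K \<phi> \<Phi> X m = \<psi> X m"
    using kato_morD(2)[OF L K h sA i X p(1)] e[OF sA i X p(1)] p(2) rq_id[OF L X m] by simp
qed

text \<open>Two sections come from one test object by \<open>tq_representatives\<close>, and they
  lift through \<Phi> by surjectivity. Multiplicativity of the arrow then is monoidality of
  \<Phi>.\<close>

lemma kato_mor_hom:
  assumes L: "df L" and K: "df K" and h: "df_hom L K \<phi> \<Phi>"
  shows "kato_hom (kato_of_df L) (kato_of_df K) (kato_mor L K \<phi> \<Phi>)"
proof -
  note H = df_homD[OF L K h] and M = kato_morD[OF L K h] and sA = sheaf_A[OF L]
  have "kato_mor L K \<phi> \<Phi> X (mq L X m n) = mq K X (kato_mor L K \<phi> \<Phi> X m) (kato_mor L K \<phi> \<Phi> X n)"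
    if X: "X \<in> Obj C" and m: "m \<in> tsec (tq L) X" and n: "n \<in> tsec (tq L) X" for X m n
  proof -
    obtain U a b c p q r where U: "sheaf U" and a: "a \<in> Lpts L U" and b: "b \<in> Lpts L U"
      and p: "p \<in> Lsec L U a X" and q: "q \<in> Lsec L U b X" and pq: "Lproj L U a X p = Lproj L U b X q"
      and e: "rq L U a X p = m" "rq L U b X q = n"
      by (rule tq_representatives[OF L X m n n])
    note \<phi>a = H(4)[OF U a] and \<phi>b = H(4)[OF U b]
    obtain p' where p': "p' \<in> Lsec K U (cmp U \<phi> a) X" "\<Phi> U a X p' = p" "Lproj K U (cmp U \<phi> a) X p' = Lproj L U a X p"
      by (rule div_arr_surj[OF L_div[OF K U \<phi>a] L_base[OF K U \<phi>a] L_div[OF L U a] L_base[OF L U a] H(3)[OF U a] X p])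
    obtain q' where q': "q' \<in> Lsec K U (cmp U \<phi> b) X" "\<Phi> U b X q' = q" "Lproj K U (cmp U \<phi> b) X q' = Lproj L U b X q"
      by (rule div_arr_surj[OF L_div[OF K U \<phi>b] L_base[OF K U \<phi>b] L_div[OF L U b] L_base[OF L U b] H(3)[OF U b] X q])
    have pq': "Lproj K U (cmp U \<phi> a) X p' = Lproj K U (cmp U \<phi> b) X q'" using p' q' pq by simp
    have \<phi>ab: "cmp U \<phi> (a \<otimes>\<^bsub>arrows U (Lmon L)\<^esub> b) = cmp U \<phi> a \<otimes>\<^bsub>arrows U (Lmon K)\<^esub> cmp U \<phi> b"
      by (rule monoid_hom_arrows(1)[OF dfD(1)[OF L] dfD(1)[OF K] U H(1) a b])
    have "mq L X m n = rq L U (a \<otimes>\<^bsub>arrows U (Lmon L)\<^esub> b) X (\<Phi> U (a \<otimes>\<^bsub>arrows U (Lmon L)\<^esub> b) X (lmul K U (cmp U \<phi> a) (cmp U \<phi> b) X p' q'))"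
      using mq_rq[OF L U a b X p q pq] e H(6)[OF U a b X p'(1) q'(1) pq'] p' q' by simp
    then have "kato_mor L K \<phi> \<Phi> X (mq L X m n) = rq K U (cmp U \<phi> a \<otimes>\<^bsub>arrows U (Lmon K)\<^esub> cmp U \<phi> b) X (lmul K U (cmp U \<phi> a) (cmp U \<phi> b) X p' q')"
      using M(2)[OF U A_mult_Hom[OF L U a b] X, unfolded \<phi>ab, OF lmulD(1)[OF K U \<phi>a \<phi>b X p'(1) q'(1) pq']] by simp
    then show ?thesis
      using mq_rq[OF K U \<phi>a \<phi>b X p'(1) q'(1) pq'] M(2)[OF U a X p'(1)] M(2)[OF U b X q'(1)] p' q' e by simp
  qed
  moreover have "kato_mor L K \<phi> \<Phi> X (oq L X) = oq K X" if X: "X \<in> Obj C" for X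
  proof -
    let ?A = "und (Lmon L)"
    have o: "\<one>\<^bsub>mon (Lmon L) X\<^esub> \<in> sec ?A X" using monoid_sheafD(3)[OF dfD(1)[OF L] X] by (simp add: monoid.one_closed)
    have \<phi>o: "cmp ?A \<phi> \<one>\<^bsub>arrows ?A (Lmon L)\<^esub> = \<one>\<^bsub>arrows ?A (Lmon K)\<^esub>"
      by (rule monoid_hom_arrows(2)[OF dfD(1)[OF L] dfD(1)[OF K] sA H(1)])
    show ?thesis
      using M(2)[OF sA A_one_Hom[OF L sA] X, unfolded \<phi>o, OF loneD(1)[OF K sA X o]] H(7)[OF sA X o] oq_rq[OF K sA X o]
      by (simp add: oq_def)
  qed
  ultimately have "monoid_hom (fst (kato_of_df L)) (fst (kato_of_df K)) (kato_mor L K \<phi> \<Phi>)"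
    unfolding monoid_hom_def und_kato_of_df[OF L] und_kato_of_df[OF K]
    using div_arrD(1,2)[OF M(1)] by (auto simp: kato_of_df_def hom_def)
  moreover have "cmp (tot (tq L)) (val (tq K)) (kato_mor L K \<phi> \<Phi>) = val (tq L)"
    by (rule Hom_eqI[OF cmp_Hom[OF divT(2)[OF tq_div[OF L]] div_arrD(1)[OF M(1)] div_objD(2)[OF tq_div[OF K]]] div_objD(2)[OF tq_div[OF L]]])
      (simp add: div_arrD(6)[OF M(1)])
  ultimately show ?thesis
    by (simp add: kato_hom_iff und_kato_of_df[OF L]) (simp add: kato_of_df_def)
qed

lemma kato_mor_idm:
  assumes L: "df L"
  shows "kato_mor L L (idm (und (Lmon L))) (df_idt L) = idm (tot (tq L))"
proof (rule kato_mor_eqI[OF L L df_hom_idt[OF L] idm_Hom[OF divT(2)[OF tq_div[OF L]]]])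
  fix U a X p assume U: "sheaf U" and a: "a \<in> Lpts L U" and X: "X \<in> Obj C"
    and p: "p \<in> Lsec L U (cmp U (idm (und (Lmon L))) a) X"
  have e: "cmp U (idm (und (Lmon L))) a = a" by (rule cmp_idm_left[OF U a sheaf_A[OF L]])
  show "idm (tot (tq L)) X (rq L U a X (df_idt L U a X p)) = rq L U (cmp U (idm (und (Lmon L))) a) X p"
    using p X rq_in[OF L U a X] unfolding e by (simp add: df_idt_apply[OF U a])
qed

text \<open>By the characterisation in \<open>kato_mor_eqI\<close> no inverses have to be composed:
  the two second clauses of \<open>kato_morD\<close> are chained.\<close>

lemma kato_mor_cmp:
  assumes L: "df L" and K: "df K" and N: "df N" and h: "df_hom L K \<phi> \<Phi>" and g: "df_hom K N \<psi> \<Psi>"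
  shows "kato_mor L N (cmp (und (Lmon L)) \<psi> \<phi>) (df_cmp L N \<phi> \<Phi> \<psi> \<Psi>) = cmp (tot (tq L)) (kato_mor K N \<psi> \<Psi>) (kato_mor L K \<phi> \<Phi>)"
proof (rule kato_mor_eqI[OF L N df_hom_cmp[OF L K N h g]])
  note H = df_homD[OF L K h] and G = df_homD[OF K N g]
  note M = kato_morD[OF L K h] and M' = kato_morD[OF K N g]
  show "cmp (tot (tq L)) (kato_mor K N \<psi> \<Psi>) (kato_mor L K \<phi> \<Phi>) \<in> Hom (tot (tq L)) (tot (tq N))"
    by (rule cmp_Hom[OF divT(2)[OF tq_div[OF L]] div_arrD(1)[OF M(1)] div_arrD(1)[OF M'(1)]])
  fix U a X p assume U: "sheaf U" and a: "a \<in> Lpts L U" and X: "X \<in> Obj C"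
    and p0: "p \<in> Lsec N U (cmp U (cmp (und (Lmon L)) \<psi> \<phi>) a) X"
  note A = df_cmp_apply[OF L K N h g U a]
  note p = p0[unfolded A(1)] and \<phi>a = H(4)[OF U a]
  have \<Psi>p: "\<Psi> U (cmp U \<phi> a) X p \<in> Lsec K U (cmp U \<phi> a) X" using G(8)[OF U \<phi>a X p] by simp
  have \<Phi>p: "\<Phi> U a X (\<Psi> U (cmp U \<phi> a) X p) \<in> Lsec L U a X" using H(8)[OF U a X \<Psi>p] by simp
  show "cmp (tot (tq L)) (kato_mor K N \<psi> \<Psi>) (kato_mor L K \<phi> \<Phi>) X (rq L U a X (df_cmp L N \<phi> \<Phi> \<psi> \<Psi> U a X p)) =
    rq N U (cmp U (cmp (und (Lmon L)) \<psi> \<phi>) a) X p"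
    using A(3)[OF X p] M(2)[OF U a X \<Psi>p] M'(2)[OF U \<phi>a X p] rq_in[OF L U a X \<Phi>p] X A(1) by simp
qed

text \<open>The projection of the universal torsor to A is locally surjective, so \<phi> is
  determined by the arrow above it. The composite of \<open>rq L U a\<close> with that arrow is
  injective on fibres, so its known values determine \<open>\<Phi> U a X p\<close>.\<close>

lemma kato_mor_faithful:
  assumes L: "df L" and K: "df K" and h: "df_hom L K \<phi> \<Phi>" and g: "df_hom L K \<psi> \<Psi>"
    and e: "kato_mor L K \<phi> \<Phi> = kato_mor L K \<psi> \<Psi>"
  shows "\<phi> = \<psi>" and "\<Phi> = \<Psi>"
proof -
  note H = df_homD[OF L K h] and G = df_homD[OF L K g]
  note M = kato_morD[OF L K h] and M' = kato_morD[OF L K g, unfolded e[symmetric]]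
  note sA = sheaf_A[OF L] and sB = sheaf_A[OF K]
  note \<phi>H = monoid_hom_Hom[OF H(1)] and \<psi>H = monoid_hom_Hom[OF G(1)]
  show \<phi>: "\<phi> = \<psi>"
  proof (rule Hom_eqI[OF \<phi>H \<psi>H])
    fix X a assume X: "X \<in> Obj C" and a: "a \<in> sec (und (Lmon L)) X"
    have l: "locally X (\<lambda>f. \<exists>m\<in>tsec (tq L) (Dom C f). proj (tq L) (Dom C f) m = res (und (Lmon L)) f a)"
      using divT(13)[OF tq_div[OF L] X, of a] a tq_base[OF L] by simp
    show "\<phi> X a = \<psi> X a"
    proof (rule sheaf_sep[OF sB X Hom_in[OF \<phi>H X a] Hom_in[OF \<psi>H X a]], rule locally_mono[OF l X])
      fix f assume f: "f \<in> Arr C" "Cod C f = X" and "\<exists>m\<in>tsec (tq L) (Dom C f). proj (tq L) (Dom C f) m = res (und (Lmon L)) f a"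
      then obtain m where m: "m \<in> tsec (tq L) (Dom C f)" "proj (tq L) (Dom C f) m = res (und (Lmon L)) f a" by blast
      show "res (und (Lmon K)) f (\<phi> X a) = res (und (Lmon K)) f (\<psi> X a)"
        using Hom_res[OF \<phi>H f(1), of a] Hom_res[OF \<psi>H f(1), of a] a f div_arrD(4)[OF M(1) Dom_Obj[OF f(1)] m(1)]
          div_arrD(4)[OF M'(1) Dom_Obj[OF f(1)] m(1)] m(2) by simp
    qed
  qed
  show "\<Phi> = \<Psi>"
  proof (rule df_trans_eqI[OF H(2) G(2)])
    fix U a assume U: "sheaf U" and a: "a \<in> Lpts L U"
    note \<phi>a = H(4)[OF U a]
    show "\<Phi> U a = \<Psi> U a"
    proof (rule Hom_eqI[OF div_arrD(1)[OF H(3)[OF U a]] div_arrD(1)[OF G(3)[OF U a, folded \<phi>]]])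
      fix X p assume X: "X \<in> Obj C" and p: "p \<in> Lsec K U (cmp U \<phi> a) X"
      note 1 = H(8)[OF U a X p] and 2 = G(8)[OF U a X, folded \<phi>, OF p]
      have c: "cmp (tot (Lobj L U a)) (kato_mor L K \<phi> \<Phi>) (rq L U a) \<in> div_arr (Lobj L U a) (cmp U \<phi> a) (tq K)"
        by (rule cmp_div_arr[OF L_div[OF L U a] L_base[OF L U a] rq_arr[OF L U a] M(1)])
      show "\<Phi> U a X p = \<Psi> U a X p"
        by (rule div_arr_inj[OF L_div[OF L U a] tq_div[OF K] _ c X])
          (use 1 2 \<phi>a L_base[OF L U a] tq_base[OF K] X M(2)[OF U a X p] M'(2)[OF U a X, folded \<phi>, OF p] in simp_all)
    qed
  qed
qed

text \<open>Equivariance of \<psi> is the essential point. It makes \<psi> an arrow of Div over an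
  induced \<phi>; then \<Phi> is obtained by lifting through cartesian arrows, and each condition on
  it is checked after applying the injective composite of \<psi> and \<open>rq\<close>.\<close>

lemma kato_mor_full:
  assumes L: "df L" and K: "df K" and k: "kato_hom (kato_of_df L) (kato_of_df K) \<psi>"
  shows "\<exists>\<phi> \<Phi>. df_hom L K \<phi> \<Phi> \<and> kato_mor L K \<phi> \<Phi> = \<psi>"
proof -
  let ?A = "und (Lmon L)" and ?B = "und (Lmon K)"
  have mh: "monoid_hom (fst (kato_of_df L)) (fst (kato_of_df K)) \<psi>" and cv: "cmp (tot (tq L)) (val (tq K)) \<psi> = val (tq L)"
    using k unfolding kato_hom_iff und_kato_of_df[OF L] by (simp_all add: kato_of_df_def)
  have \<psi>H: "\<psi> \<in> Hom (tot (tq L)) (tot (tq K))"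
    using monoid_hom_Hom[OF mh] unfolding und_kato_of_df[OF L] und_kato_of_df[OF K] .
  note \<psi>in = Hom_in[OF \<psi>H] and \<psi>res = Hom_res[OF \<psi>H]
  have \<psi>m: "\<psi> X (mq L X m n) = mq K X (\<psi> X m) (\<psi> X n)" if "X \<in> Obj C" "m \<in> tsec (tq L) X" "n \<in> tsec (tq L) X" for X m n
    using monoid_homD(2)[OF mh that(1), of m n] that by (simp add: kato_of_df_def)
  have \<psi>o: "\<psi> X (oq L X) = oq K X" if "X \<in> Obj C" for X
    using monoid_homD(3)[OF mh that] by (simp add: kato_of_df_def)
  have \<psi>v: "val (tq K) X (\<psi> X m) = val (tq L) X m" if "X \<in> Obj C" "m \<in> tsec (tq L) X" for X m
    using fun_cong[OF fun_cong[OF cv, of X], of m] that by simp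
  \<comment> \<open>Translation by u is multiplication by the translate of the unit section by u.
    That section has value u, and so has its image, since \<psi> respects values; by
    \<open>unit_section\<close> the image is the translate of the unit section of K by u.\<close>
  have \<psi>a: "\<psi> X (act (tq L) X u m) = act (tq K) X u (\<psi> X m)" if X: "X \<in> Obj C" and m: "m \<in> tsec (tq L) X" and u: "u \<in> O_units X" for X m u
  proof -
    note o = oqD[OF L X] and o' = oqD[OF K X]
    note uo = divT(6)[OF tq_div[OF L] X u o(1)]
    have v: "val (tq L) X (act (tq L) X u (oq L X)) = u"
      using div_objD(5)[OF tq_div[OF L] X u o(1)] o(3) O_monoid[OF X] unit_in[OF X u] by (simp add: monoid.r_one)
    have \<psi>u: "\<psi> X (act (tq L) X u (oq L X)) = act (tq K) X u (oq K X)"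
      using unit_section[OF K X \<psi>in[OF X uo]] \<psi>v[OF X uo] v u by simp
    have "\<psi> X (act (tq L) X u m) = \<psi> X (mq L X (act (tq L) X u (oq L X)) m)"
      using mqD(4)[OF L X o(1) m u] o(4)[OF m] by simp
    also have "\<dots> = mq K X (act (tq K) X u (oq K X)) (\<psi> X m)" using \<psi>m[OF X uo m] \<psi>u by simp
    also have "\<dots> = act (tq K) X u (\<psi> X m)" using mqD(4)[OF K X o'(1) \<psi>in[OF X m] u] o'(4)[OF \<psi>in[OF X m]] by simp
    finally show ?thesis .
  qed
  note sA = sheaf_A[OF L] and sB = sheaf_A[OF K]
  note tL = tq_div[OF L] and tK = tq_div[OF K]
  have loc: "locally X (\<lambda>f. \<exists>m\<in>tsec (tq L) (Dom C f). proj (tq L) (Dom C f) m = res ?A f a)"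
    if "X \<in> Obj C" "a \<in> sec ?A X" for X a
    using divT(13)[OF tL that(1), of a] that tq_base[OF L] by simp
  have prL: "proj (tq L) (Dom C f) (res (tot (tq L)) f m) = res ?A f (proj (tq L) (Cod C f) m)"
    if "f \<in> Arr C" "m \<in> tsec (tq L) (Cod C f)" for f m using divT(5)[OF tL that] tq_base[OF L] by simp
  have prK: "proj (tq K) (Dom C f) (res (tot (tq K)) f m) = res ?B f (proj (tq K) (Cod C f) m)"
    if "f \<in> Arr C" "m \<in> tsec (tq K) (Cod C f)" for f m using divT(5)[OF tK that] tq_base[OF K] by simp
  have pinK: "proj (tq K) X m \<in> sec ?B X" if "X \<in> Obj C" "m \<in> tsec (tq K) X" for X m using tq_proj_in[OF K that] by simp
  \<comment> \<open>Two sections over one section of A differ by a unit, and by equivariance so do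
    their images; hence \<psi> followed by the projection to B descends to A.\<close>
  obtain \<phi>' where \<phi>'1: "\<And>X t. \<lbrakk>X \<in> Obj C; t \<in> sec ?A X\<rbrakk> \<Longrightarrow> \<phi>' X t \<in> sec ?B X"
    and \<phi>'2: "\<And>X m. \<lbrakk>X \<in> Obj C; m \<in> tsec (tq L) X\<rbrakk> \<Longrightarrow> \<phi>' X (proj (tq L) X m) = proj (tq K) X (\<psi> X m)"
    and \<phi>'3: "\<And>f t. \<lbrakk>f \<in> Arr C; t \<in> sec ?A (Cod C f)\<rbrakk> \<Longrightarrow> \<phi>' (Dom C f) (res ?A f t) = res ?B f (\<phi>' (Cod C f) t)"
  proof (rule quotient_descent[OF sB presheaf_on_sheaf[OF sA], of "tsec (tq L)" "res (tot (tq L))" "proj (tq L)" "\<lambda>X m. proj (tq K) X (\<psi> X m)"])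
    show "res (tot (tq L)) f m \<in> tsec (tq L) (Dom C f) \<and> res ?A f (proj (tq L) (Cod C f) m) = proj (tq L) (Dom C f) (res (tot (tq L)) f m) \<and>
        res ?B f (proj (tq K) (Cod C f) (\<psi> (Cod C f) m)) = proj (tq K) (Dom C f) (\<psi> (Dom C f) (res (tot (tq L)) f m))"
      if "f \<in> Arr C" "m \<in> tsec (tq L) (Cod C f)" for f m
      using res_in[OF divT(2)[OF tL] that] prL[OF that] prK[OF that(1) \<psi>in[OF Cod_Obj[OF that(1)] that(2)]] \<psi>res[OF that] by simp
    show "proj (tq K) X (\<psi> X m) = proj (tq K) X (\<psi> X m')"
      if X: "X \<in> Obj C" and m: "m \<in> tsec (tq L) X" "m' \<in> tsec (tq L) X" "proj (tq L) X m = proj (tq L) X m'" for X m m'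
    proof -
      obtain u where u: "u \<in> O_units X" "act (tq L) X u m = m'" using divT(11)[OF tL X m] by auto
      show ?thesis using \<psi>a[OF X m(1) u(1)] divT(7)[OF tK X u(1) \<psi>in[OF X m(1)]] u by simp
    qed
  qed (use loc pinK \<psi>in tq_proj_in[OF L] in auto)
  define \<phi> where "\<phi> = mk ?A \<phi>'"
  have \<phi>H: "\<phi> \<in> Hom ?A ?B" unfolding \<phi>_def by (rule mk_Hom[OF \<phi>'1 \<phi>'3 sA])
  have \<phi>p: "\<phi> X (proj (tq L) X m) = proj (tq K) X (\<psi> X m)" if "X \<in> Obj C" "m \<in> tsec (tq L) X" for X m
    using \<phi>'2[OF that] tq_proj_in[OF L that] that by (simp add: \<phi>_def)
  have \<psi>arr: "\<psi> \<in> div_arr (tq L) \<phi> (tq K)"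
    unfolding div_arr_def using \<psi>H \<phi>p \<psi>a \<psi>v by simp
  have \<phi>hom: "monoid_hom (Lmon L) (Lmon K) \<phi>"
  proof -
    have "\<phi> X (a \<otimes>\<^bsub>mon (Lmon L) X\<^esub> b) = \<phi> X a \<otimes>\<^bsub>mon (Lmon K) X\<^esub> \<phi> X b"
      if X: "X \<in> Obj C" and a: "a \<in> carrier (mon (Lmon L) X)" and b: "b \<in> carrier (mon (Lmon L) X)" for X a b
    proof -
      have a': "a \<in> sec ?A X" and b': "b \<in> sec ?A X" using a b by simp_all
      have ab: "a \<otimes>\<^bsub>mon (Lmon L) X\<^esub> b \<in> sec ?A X" using a b monoid_sheafD(3)[OF dfD(1)[OF L] X] by (simp add: monoid.m_closed)
      note \<phi>ab = Hom_in[OF \<phi>H X a', simplified] Hom_in[OF \<phi>H X b', simplified]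
      show ?thesis
      proof (rule sheaf_sep[OF sB X Hom_in[OF \<phi>H X ab]])
        show "\<phi> X a \<otimes>\<^bsub>mon (Lmon K) X\<^esub> \<phi> X b \<in> sec ?B X" using \<phi>ab monoid_sheafD(3)[OF dfD(1)[OF K] X] by (simp add: monoid.m_closed)
        show "locally X (\<lambda>f. res ?B f (\<phi> X (a \<otimes>\<^bsub>mon (Lmon L) X\<^esub> b)) = res ?B f (\<phi> X a \<otimes>\<^bsub>mon (Lmon K) X\<^esub> \<phi> X b))"
        proof (rule locally_mono[OF locally_conj[OF loc[OF X a'] loc[OF X b'] X] X])
          fix f assume f: "f \<in> Arr C" "Cod C f = X" and "(\<exists>m\<in>tsec (tq L) (Dom C f). proj (tq L) (Dom C f) m = res ?A f a) \<and>
            (\<exists>m\<in>tsec (tq L) (Dom C f). proj (tq L) (Dom C f) m = res ?A f b)"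
          then obtain m n where m: "m\<in>tsec (tq L) (Dom C f)" "proj (tq L) (Dom C f) m = mres (Lmon L) f a"
            and n: "n\<in>tsec (tq L) (Dom C f)" "proj (tq L) (Dom C f) n = mres (Lmon L) f b" by auto
          note fo = Dom_Obj[OF f(1)]
          have "res ?B f (\<phi> X (a \<otimes>\<^bsub>mon (Lmon L) X\<^esub> b)) = \<phi> (Dom C f) (mres (Lmon L) f a \<otimes>\<^bsub>mon (Lmon L) (Dom C f)\<^esub> mres (Lmon L) f b)"
            using Hom_res[OF \<phi>H f(1), of "a \<otimes>\<^bsub>mon (Lmon L) X\<^esub> b"] ab f monoid_sheafD(5)[OF dfD(1)[OF L] f(1), of a b] a b by simp
          also have "\<dots> = proj (tq K) (Dom C f) (\<psi> (Dom C f) (mq L (Dom C f) m n))"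
            using \<phi>p[OF fo mqD(1)[OF L fo m(1) n(1)]] mqD(2)[OF L fo m(1) n(1)] m n by simp
          also have "\<dots> = \<phi> (Dom C f) (mres (Lmon L) f a) \<otimes>\<^bsub>mon (Lmon K) (Dom C f)\<^esub> \<phi> (Dom C f) (mres (Lmon L) f b)"
            using \<psi>m[OF fo m(1) n(1)] mqD(2)[OF K fo \<psi>in[OF fo m(1)] \<psi>in[OF fo n(1)]] \<phi>p[OF fo m(1)] \<phi>p[OF fo n(1)] m n by simp
          also have "\<dots> = res ?B f (\<phi> X a \<otimes>\<^bsub>mon (Lmon K) X\<^esub> \<phi> X b)"
            using Hom_res[OF \<phi>H f(1), of a] Hom_res[OF \<phi>H f(1), of b] a b f monoid_sheafD(5)[OF dfD(1)[OF K] f(1), of "\<phi> X a" "\<phi> X b"] \<phi>ab by simp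
          finally show "res ?B f (\<phi> X (a \<otimes>\<^bsub>mon (Lmon L) X\<^esub> b)) = res ?B f (\<phi> X a \<otimes>\<^bsub>mon (Lmon K) X\<^esub> \<phi> X b)" .
        qed
      qed
    qed
    moreover have "\<phi> X \<one>\<^bsub>mon (Lmon L) X\<^esub> = \<one>\<^bsub>mon (Lmon K) X\<^esub>" if X: "X \<in> Obj C" for X
      using \<phi>p[OF X oqD(1)[OF L X]] oqD(2)[OF L X] \<psi>o[OF X] oqD(2)[OF K X] by simp
    ultimately show ?thesis unfolding monoid_hom_def using \<phi>H Hom_in[OF \<phi>H] by (auto simp: hom_def)
  qed
  have \<phi>a: "cmp U \<phi> a \<in> Hom U ?B" if "sheaf U" "a \<in> Hom U ?A" for U a by (rule cmp_Hom[OF that \<phi>H])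
  have h: "cmp (tot (Lobj L U a)) \<psi> (rq L U a) \<in> div_arr (Lobj L U a) (cmp U \<phi> a) (tq K)" if "sheaf U" "a \<in> Hom U ?A" for U a
    by (rule cmp_div_arr[OF L_div[OF L that] L_base[OF L that] rq_arr[OF L that] \<psi>arr])
  \<comment> \<open>Both K(\<phi> a) and L(a) have arrows to the universal torsor of K over \<phi>
    a, the second by way of \<psi>. Cartesianness of the second supplies the component of \<Phi> at
    a.\<close>
  have "\<exists>k\<in>div_arr (Lobj K U (cmp U \<phi> a)) (idm U) (Lobj L U a). \<forall>X\<in>Obj C. \<forall>p\<in>Lsec K U (cmp U \<phi> a) X.
      \<psi> X (rq L U a X (k X p)) = rq K U (cmp U \<phi> a) X p" if U: "sheaf U" and a: "a \<in> Hom U ?A" for U a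
  proof -
    have "\<exists>k\<in>div_arr (Lobj K U (cmp U \<phi> a)) (idm U) (Lobj L U a). \<forall>X\<in>Obj C. \<forall>p\<in>Lsec K U (cmp U \<phi> a) X.
      cmp (tot (Lobj L U a)) \<psi> (rq L U a) X (k X p) = rq K U (cmp U \<phi> a) X p"
      by (rule cartesian_lift[OF L_div[OF K U \<phi>a[OF U a]] L_base[OF K U \<phi>a[OF U a]] L_div[OF L U a] L_base[OF L U a] tK _ rq_arr[OF K U \<phi>a[OF U a]] h[OF U a]])
        (use \<phi>a[OF U a] tq_base[OF K] in simp)
    then obtain k where k: "k \<in> div_arr (Lobj K U (cmp U \<phi> a)) (idm U) (Lobj L U a)" "\<forall>X\<in>Obj C. \<forall>p\<in>Lsec K U (cmp U \<phi> a) X.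
      cmp (tot (Lobj L U a)) \<psi> (rq L U a) X (k X p) = rq K U (cmp U \<phi> a) X p" by blast
    then show ?thesis using div_arrD(2)[OF k(1)] by (intro bexI[of _ k]) simp_all
  qed
  then obtain \<Phi>' where \<Phi>': "\<And>U a. sheaf U \<Longrightarrow> a \<in> Hom U ?A \<Longrightarrow> \<Phi>' U a \<in> div_arr (Lobj K U (cmp U \<phi> a)) (idm U) (Lobj L U a)"
    "\<And>U a X p. \<lbrakk>sheaf U; a \<in> Hom U ?A; X \<in> Obj C; p \<in> Lsec K U (cmp U \<phi> a) X\<rbrakk> \<Longrightarrow>
      \<psi> X (rq L U a X (\<Phi>' U a X p)) = rq K U (cmp U \<phi> a) X p" by metis
  define \<Phi> where "\<Phi> = (\<lambda>U\<in>{U. sheaf U}. \<lambda>a\<in>Hom U ?A. \<Phi>' U a)"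
  have \<Phi>: "\<Phi> U a \<in> div_arr (Lobj K U (cmp U \<phi> a)) (idm U) (Lobj L U a)" if "sheaf U" "a \<in> Hom U ?A" for U a
    using \<Phi>'(1)[OF that] that by (simp add: \<Phi>_def)
  have \<Phi>\<psi>: "\<psi> X (rq L U a X (\<Phi> U a X p)) = rq K U (cmp U \<phi> a) X p"
    if "sheaf U" "a \<in> Hom U ?A" "X \<in> Obj C" "p \<in> Lsec K U (cmp U \<phi> a) X" for U a X p
    using \<Phi>'(2)[OF that] that by (simp add: \<Phi>_def)
  have \<Phi>in: "\<Phi> U a X p \<in> Lsec L U a X" "Lproj L U a X (\<Phi> U a X p) = Lproj K U (cmp U \<phi> a) X p"
    if U: "sheaf U" and a: "a \<in> Hom U ?A" and X: "X \<in> Obj C" and p: "p \<in> Lsec K U (cmp U \<phi> a) X" for U a X p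
    using div_arrD(2,4)[OF \<Phi>[OF U a] X p] L_proj_in[OF K U \<phi>a[OF U a] X p] X by simp_all
  \<comment> \<open>Sections of L(a) are determined by their base point and their image under
    \<psi>. The naturality and monoidality of \<Phi> below are all equalities of this kind.\<close>
  have inj: "p = p'" if U: "sheaf U" and a: "a \<in> Hom U ?A" and X: "X \<in> Obj C" and p: "p \<in> Lsec L U a X" "p' \<in> Lsec L U a X"
    and pp: "Lproj L U a X p = Lproj L U a X p'" and e: "\<psi> X (rq L U a X p) = \<psi> X (rq L U a X p')" for U a X p p'
    by (rule div_arr_inj[OF L_div[OF L U a] tK _ h[OF U a] X p pp])
      (use \<phi>a[OF U a] L_base[OF L U a] tq_base[OF K] e X p in simp_all)
  have "df_hom L K \<phi> \<Phi>"
    unfolding df_hom_iff[OF L K]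
  proof (intro conjI allI impI ballI)
    show "monoid_hom (Lmon L) (Lmon K) \<phi>" by (rule \<phi>hom)
    show "\<Phi> \<in> df_trans L K \<phi>" using \<Phi>'(1) by (auto simp: df_trans_def \<Phi>_def)
  next
    fix V U f a X p assume V: "sheaf V" and U: "sheaf U" and f: "f \<in> Hom V U" and a: "a \<in> Hom U ?A" and X: "X \<in> Obj C"
      and p: "p \<in> Lsec K V (cmp V \<phi> (cmp V a f)) X"
    note af = cmp_Hom[OF V f a]
    have e: "cmp V (cmp U \<phi> a) f = cmp V \<phi> (cmp V a f)" using cmp_assoc[OF V f U a \<phi>H] by simp
    note \<Phi>p = \<Phi>in[OF V af X p] and Kp = div_arrD(2,4)[OF L_arr[OF K V U f \<phi>a[OF U a], unfolded e] X p]
    note La = div_arrD(2,4)[OF L_arr[OF L V U f a] X \<Phi>p(1)]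
    show "Larr L V f U a X (\<Phi> V (cmp V a f) X p) = \<Phi> U a X (Larr K V f U (cmp U \<phi> a) X p)"
    proof (rule inj[OF U a X La(1) \<Phi>in(1)[OF U a X Kp(1)]])
      show "Lproj L U a X (Larr L V f U a X (\<Phi> V (cmp V a f) X p)) = Lproj L U a X (\<Phi> U a X (Larr K V f U (cmp U \<phi> a) X p))"
        using La(2) \<Phi>p(2) Kp(2) \<Phi>in(2)[OF U a X Kp(1)] by simp
      show "\<psi> X (rq L U a X (Larr L V f U a X (\<Phi> V (cmp V a f) X p))) = \<psi> X (rq L U a X (\<Phi> U a X (Larr K V f U (cmp U \<phi> a) X p)))"
        using rq_Larr[OF L V U f a X \<Phi>p(1)] \<Phi>\<psi>[OF V af X p] \<Phi>\<psi>[OF U a X Kp(1)] rq_Larr[OF K V U f \<phi>a[OF U a] X, of p] p e by simp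
    qed
  next
    fix U a b X p q assume U: "sheaf U" and a: "a \<in> Hom U ?A" and b: "b \<in> Hom U ?A" and X: "X \<in> Obj C"
      and p: "p \<in> Lsec K U (cmp U \<phi> a) X" and q: "q \<in> Lsec K U (cmp U \<phi> b) X"
      and pq: "Lproj K U (cmp U \<phi> a) X p = Lproj K U (cmp U \<phi> b) X q"
    note ab = A_mult_Hom[OF L U a b]
    have e: "cmp U \<phi> (a \<otimes>\<^bsub>arrows U (Lmon L)\<^esub> b) = cmp U \<phi> a \<otimes>\<^bsub>arrows U (Lmon K)\<^esub> cmp U \<phi> b"
      by (rule monoid_hom_arrows(1)[OF dfD(1)[OF L] dfD(1)[OF K] U \<phi>hom a b])
    note lk = lmulD[OF K U \<phi>a[OF U a] \<phi>a[OF U b] X p q pq]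
    note \<Phi>p = \<Phi>in[OF U a X p] and \<Phi>q = \<Phi>in[OF U b X q]
    have \<Phi>pq: "Lproj L U a X (\<Phi> U a X p) = Lproj L U b X (\<Phi> U b X q)" using \<Phi>p \<Phi>q pq by simp
    note ll = lmulD[OF L U a b X \<Phi>p(1) \<Phi>q(1) \<Phi>pq]
    note \<Phi>l = \<Phi>in[OF U ab X, unfolded e, OF lk(1)]
    show "\<Phi> U (a \<otimes>\<^bsub>arrows U (Lmon L)\<^esub> b) X (lmul K U (cmp U \<phi> a) (cmp U \<phi> b) X p q) = lmul L U a b X (\<Phi> U a X p) (\<Phi> U b X q)"
    proof (rule inj[OF U ab X \<Phi>l(1) ll(1)])
      show "Lproj L U (a \<otimes>\<^bsub>arrows U (Lmon L)\<^esub> b) X (\<Phi> U (a \<otimes>\<^bsub>arrows U (Lmon L)\<^esub> b) X (lmul K U (cmp U \<phi> a) (cmp U \<phi> b) X p q)) =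
        Lproj L U (a \<otimes>\<^bsub>arrows U (Lmon L)\<^esub> b) X (lmul L U a b X (\<Phi> U a X p) (\<Phi> U b X q))"
        using \<Phi>l(2) lk(2) ll(2) \<Phi>q(2) by simp
      show "\<psi> X (rq L U (a \<otimes>\<^bsub>arrows U (Lmon L)\<^esub> b) X (\<Phi> U (a \<otimes>\<^bsub>arrows U (Lmon L)\<^esub> b) X (lmul K U (cmp U \<phi> a) (cmp U \<phi> b) X p q))) =
        \<psi> X (rq L U (a \<otimes>\<^bsub>arrows U (Lmon L)\<^esub> b) X (lmul L U a b X (\<Phi> U a X p) (\<Phi> U b X q)))"
        using \<Phi>\<psi>[OF U ab X, unfolded e, OF lk(1)] mq_rq[OF K U \<phi>a[OF U a] \<phi>a[OF U b] X p q pq] mq_rq[OF L U a b X \<Phi>p(1) \<Phi>q(1) \<Phi>pq]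
          \<psi>m[OF X rq_in[OF L U a X \<Phi>p(1)] rq_in[OF L U b X \<Phi>q(1)]] \<Phi>\<psi>[OF U a X p] \<Phi>\<psi>[OF U b X q] by simp
    qed
  next
    fix U X x assume U: "sheaf U" and X: "X \<in> Obj C" and x: "x \<in> sec U X"
    note o = A_one_Hom[OF L U]
    have e: "cmp U \<phi> \<one>\<^bsub>arrows U (Lmon L)\<^esub> = \<one>\<^bsub>arrows U (Lmon K)\<^esub>"
      by (rule monoid_hom_arrows(2)[OF dfD(1)[OF L] dfD(1)[OF K] U \<phi>hom])
    note lk = loneD[OF K U X x] and ll = loneD[OF L U X x]
    note \<Phi>l = \<Phi>in[OF U o X, unfolded e, OF lk(1)]
    show "\<Phi> U \<one>\<^bsub>arrows U (Lmon L)\<^esub> X (lone K U X x) = lone L U X x"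
      by (rule inj[OF U o X \<Phi>l(1) ll(1)])
        (use \<Phi>l(2) lk(2) ll(2) \<Phi>\<psi>[OF U o X, unfolded e, OF lk(1)] oq_rq[OF K U X x] oq_rq[OF L U X x] \<psi>o[OF X] in simp_all)
  qed
  moreover from kato_mor_eqI[OF L K this \<psi>H \<Phi>\<psi>] have "kato_mor L K \<phi> \<Phi> = \<psi>" .
  ultimately show ?thesis by blast
qed

definition kato_arr where
  "kato_arr = (\<lambda>(L, (\<phi>, \<Phi>), K). (kato_of_df L, kato_mor L K \<phi> \<Phi>, kato_of_df K))"

lemma functor_kato_of_df: "is_functor df_cat quasi_integral_kato_cat kato_of_df kato_arr"
  unfolding is_functor_def
proof (intro conjI ballI impI)
  fix L assume "L \<in> Obj df_cat"
  then have L: "df L" by (simp add: df_cat_def)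
  show "kato_of_df L \<in> Obj quasi_integral_kato_cat"
    using kato_of_df_kato[OF L] kato_of_df_quasi_integral[OF L] by (simp add: quasi_integral_kato_cat_def)
  show "kato_arr (Idt df_cat L) = Idt quasi_integral_kato_cat (kato_of_df L)"
    using kato_mor_idm[OF L] by (simp add: kato_arr_def df_cat_def quasi_integral_kato_cat_def und_kato_of_df[OF L] df_idt_def)
next
  fix f assume "f \<in> Arr df_cat"
  then obtain L \<phi> \<Phi> K where f: "f = (L, (\<phi>, \<Phi>), K)" and k: "df L" "df K" "df_hom L K \<phi> \<Phi>" by (auto simp: df_cat_def)
  show "kato_arr f \<in> Arr quasi_integral_kato_cat" "Dom quasi_integral_kato_cat (kato_arr f) = kato_of_df (Dom df_cat f)"
    "Cod quasi_integral_kato_cat (kato_arr f) = kato_of_df (Cod df_cat f)"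
    using kato_mor_hom[OF k] kato_of_df_kato kato_of_df_quasi_integral k(1,2)
    by (simp_all add: f kato_arr_def quasi_integral_kato_cat_def df_cat_def)
next
  fix f g assume "f \<in> Arr df_cat" "g \<in> Arr df_cat" "Dom df_cat g = Cod df_cat f"
  then obtain L \<phi> \<Phi> K \<psi> \<Psi> N where f: "f = (L, (\<phi>, \<Phi>), K)" and g: "g = (K, (\<psi>, \<Psi>), N)"
    and k: "df L" "df K" "df N" "df_hom L K \<phi> \<Phi>" "df_hom K N \<psi> \<Psi>"
    by (auto simp: df_cat_def)
  show "kato_arr (Cmp df_cat g f) = Cmp quasi_integral_kato_cat (kato_arr g) (kato_arr f)"
    using kato_mor_cmp[OF k]
    by (simp add: f g kato_arr_def df_cat_def quasi_integral_kato_cat_def und_kato_of_df[OF k(1)] df_cmp_def)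
qed

lemma fully_faithful_kato_of_df:
  assumes "L \<in> Obj df_cat" "K \<in> Obj df_cat" "f \<in> Arr quasi_integral_kato_cat"
    "Dom quasi_integral_kato_cat f = kato_of_df L" "Cod quasi_integral_kato_cat f = kato_of_df K"
  shows "\<exists>!g. g \<in> Arr df_cat \<and> Dom df_cat g = L \<and> Cod df_cat g = K \<and> kato_arr g = f"
proof -
  have L: "df L" and K: "df K" using assms by (simp_all add: df_cat_def)
  obtain \<psi> where f: "f = (kato_of_df L, \<psi>, kato_of_df K)" and \<psi>: "kato_hom (kato_of_df L) (kato_of_df K) \<psi>"
    using assms(3-5) by (auto simp: quasi_integral_kato_cat_def)
  obtain \<phi> \<Phi> where h: "df_hom L K \<phi> \<Phi>" "kato_mor L K \<phi> \<Phi> = \<psi>" using kato_mor_full[OF L K \<psi>] by blast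
  show ?thesis
  proof (rule ex1I[of _ "(L, (\<phi>, \<Phi>), K)"])
    show "(L, (\<phi>, \<Phi>), K) \<in> Arr df_cat \<and> Dom df_cat (L, (\<phi>, \<Phi>), K) = L \<and> Cod df_cat (L, (\<phi>, \<Phi>), K) = K \<and> kato_arr (L, (\<phi>, \<Phi>), K) = f"
      using L K h by (simp add: df_cat_def kato_arr_def f)
    fix g assume g: "g \<in> Arr df_cat \<and> Dom df_cat g = L \<and> Cod df_cat g = K \<and> kato_arr g = f"
    then obtain \<phi>' \<Phi>' where g': "g = (L, (\<phi>', \<Phi>'), K)" "df_hom L K \<phi>' \<Phi>'" "kato_mor L K \<phi>' \<Phi>' = \<psi>"
      by (auto simp: df_cat_def kato_arr_def f)
    then show "g = (L, (\<phi>, \<Phi>), K)" using kato_mor_faithful[OF L K g'(2) h(1)] h(2) by simp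
  qed
qed

section \<open>The DF log structure of a Kato log structure\<close>

text \<open>The action multiplies by the section \<open>ku X u\<close> of M that corresponds to u.
  As \<alpha> is injective on sections with invertible image, every law for \<open>ku\<close> is
  verified after applying \<alpha>; the laws of the action are then those of the monoid. Clause 8
  says that a section with invertible image is a translate of 1.\<close>

lemma kato_actD:
  assumes K: "kato (M, \<alpha>)" and X: "X \<in> Obj C"
  shows "u \<in> O_units X \<Longrightarrow> m \<in> carrier (mon M X) \<Longrightarrow> kato_act (M, \<alpha>) X u m \<in> carrier (mon M X)" (is "PROP ?g1")
    and "u \<in> O_units X \<Longrightarrow> m \<in> carrier (mon M X) \<Longrightarrow> \<alpha> X (kato_act (M, \<alpha>) X u m) = u \<otimes>\<^bsub>mon \<O> X\<^esub> \<alpha> X m" (is "PROP ?g2")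
    and "m \<in> carrier (mon M X) \<Longrightarrow> kato_act (M, \<alpha>) X \<one>\<^bsub>mon \<O> X\<^esub> m = m" (is "PROP ?g3")
    and "\<lbrakk>u \<in> O_units X; v \<in> O_units X; m \<in> carrier (mon M X)\<rbrakk> \<Longrightarrow>
      kato_act (M, \<alpha>) X (u \<otimes>\<^bsub>mon \<O> X\<^esub> v) m = kato_act (M, \<alpha>) X u (kato_act (M, \<alpha>) X v m)" (is "PROP ?g4")
    and "\<lbrakk>f \<in> Arr C; Cod C f = X; u \<in> O_units X; m \<in> carrier (mon M X)\<rbrakk> \<Longrightarrow>
      mres M f (kato_act (M, \<alpha>) X u m) = kato_act (M, \<alpha>) (Dom C f) (mres \<O> f u) (mres M f m)"
    and "\<lbrakk>u \<in> O_units X; m \<in> carrier (mon M X); n \<in> carrier (mon M X)\<rbrakk> \<Longrightarrow>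
      kato_act (M, \<alpha>) X u m \<otimes>\<^bsub>mon M X\<^esub> n = kato_act (M, \<alpha>) X u (m \<otimes>\<^bsub>mon M X\<^esub> n)" (is "PROP ?g5")
    and "\<lbrakk>u \<in> O_units X; m \<in> carrier (mon M X); n \<in> carrier (mon M X)\<rbrakk> \<Longrightarrow>
      m \<otimes>\<^bsub>mon M X\<^esub> kato_act (M, \<alpha>) X u n = kato_act (M, \<alpha>) X u (m \<otimes>\<^bsub>mon M X\<^esub> n)" (is "PROP ?g6")
    and "m \<in> carrier (mon M X) \<Longrightarrow> \<alpha> X m \<in> O_units X \<Longrightarrow> kato_act (M, \<alpha>) X (\<alpha> X m) \<one>\<^bsub>mon M X\<^esub> = m"
proof -
  have M: "monoid_sheaf M" and al: "monoid_hom M \<O> \<alpha>" using K by (simp_all add: kato_def)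
  define I where "I X = {m \<in> carrier (mon M X). \<alpha> X m \<in> O_units X}" for X
  have I: "inv_image_units (M, \<alpha>) X = I X" for X by (simp add: inv_image_units_def I_def)
  have bij: "bij_betw (\<alpha> X) (I X) (O_units X)" if "X \<in> Obj C" for X
    using K that by (simp add: kato_def I Group.iso_def units_of_def)
  define ku where "ku X u = inv_into (I X) (\<alpha> X) u" for X u
  have ka: "kato_act (M, \<alpha>) X u m = ku X u \<otimes>\<^bsub>mon M X\<^esub> m" for X u m
    by (simp add: kato_act_def I ku_def)
  have ku: "ku X u \<in> carrier (mon M X)" "\<alpha> X (ku X u) = u" if "X \<in> Obj C" "u \<in> O_units X" for X u
  proof -
    have "u \<in> \<alpha> X ` I X" using bij[OF that(1)] that(2) by (simp add: bij_betw_def)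
    then show "ku X u \<in> carrier (mon M X)" "\<alpha> X (ku X u) = u"
      unfolding ku_def using inv_into_into[of u "\<alpha> X" "I X"] f_inv_into_f[of u "\<alpha> X" "I X"] by (auto simp: I_def)
  qed
  have inj: "m = n" if "X \<in> Obj C" "m \<in> carrier (mon M X)" "n \<in> carrier (mon M X)" "\<alpha> X m \<in> O_units X" "\<alpha> X m = \<alpha> X n" for X m n
    using bij[OF that(1)] that(2-5) by (auto simp: bij_betw_def I_def dest: inj_onD)
  interpret comm_monoid "mon M X" by (rule monoid_sheafD(2)[OF M X])
  note h = monoid_homD[OF al X]
  have ku1: "ku X \<one>\<^bsub>mon \<O> X\<^esub> = \<one>\<^bsub>mon M X\<^esub>"
    by (rule inj[OF X]) (use ku[OF X unit_one[OF X]] h(3) unit_one[OF X] in simp_all)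
  have kum: "ku X (u \<otimes>\<^bsub>mon \<O> X\<^esub> v) = ku X u \<otimes>\<^bsub>mon M X\<^esub> ku X v" if "u \<in> O_units X" "v \<in> O_units X" for u v
    by (rule inj[OF X]) (use ku[OF X unit_mult[OF X that]] ku[OF X that(1)] ku[OF X that(2)] h(2) unit_mult[OF X that] in simp_all)
  show "PROP ?g1" "PROP ?g2" "PROP ?g3" "PROP ?g4" "PROP ?g5" "PROP ?g6"
    unfolding ka by (simp_all add: ku[OF X] h ku1 kum m_assoc m_lcomm)
  show "kato_act (M, \<alpha>) X (\<alpha> X m) \<one>\<^bsub>mon M X\<^esub> = m" if "m \<in> carrier (mon M X)" "\<alpha> X m \<in> O_units X"
    unfolding ka using ku[OF X that(2)] inj[OF X ku(1)[OF X that(2)] that(1)] that(2) by simp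
  assume f: "f \<in> Arr C" "Cod C f = X" and u: "u \<in> O_units X" and m: "m \<in> carrier (mon M X)"
  have u': "mres \<O> f u \<in> O_units (Dom C f)" using unit_res[OF f(1)] f u by simp
  have "mres M f (ku X u) = ku (Dom C f) (mres \<O> f u)"
    by (rule inj[OF Dom_Obj[OF f(1)]])
      (use ku[OF X u] ku[OF Dom_Obj[OF f(1)] u'] u' monoid_sheafD(4)[OF M f(1)] Hom_res[OF monoid_hom_Hom[OF al] f(1), of "ku X u"] f in simp_all)
  then show "mres M f (kato_act (M, \<alpha>) X u m) = kato_act (M, \<alpha>) (Dom C f) (mres \<O> f u) (mres M f m)"
    unfolding ka using monoid_sheafD(5)[OF M f(1), of "ku X u" m] ku[OF X u] m f by simp
qed

text \<open>The inverse of v times u stabilises m, so it is 1.\<close>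

lemma quasi_integral_free:
  assumes K: "kato (M, \<alpha>)" and qi: "quasi_integral (M, \<alpha>)" and X: "X \<in> Obj C" and u: "u \<in> O_units X" and v: "v \<in> O_units X"
    and m: "m \<in> carrier (mon M X)"
  shows "kato_act (M, \<alpha>) X u m = kato_act (M, \<alpha>) X v m \<longleftrightarrow> u = v"
proof
  assume e: "kato_act (M, \<alpha>) X u m = kato_act (M, \<alpha>) X v m"
  note D = kato_actD[OF K X] and i = unit_inv[OF X v]
  have "kato_act (M, \<alpha>) X (inv\<^bsub>mon \<O> X\<^esub> v \<otimes>\<^bsub>mon \<O> X\<^esub> u) m = m"
    using D(4)[OF i(1) u m] D(4)[OF i(1) v m] D(3)[OF m] i(2) e by simp
  then have "inv\<^bsub>mon \<O> X\<^esub> v \<otimes>\<^bsub>mon \<O> X\<^esub> u = \<one>\<^bsub>mon \<O> X\<^esub>"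
    using qi X m unit_mult[OF X i(1) u] unfolding quasi_integral_def by (metis fst_conv)
  then show "u = v"
    by (intro unit_cancel[OF X unit_in[OF X u] unit_in[OF X v] unit_in[OF X i(1)]]) (use i in simp_all)
qed simp

text \<open>Quasi-integrality makes the unit relating two sections unique, so sections that are
  locally in one orbit are globally in one orbit. This is the locality that
  \<open>quotient_sheaf\<close> asks for. The multiplication descends from pairs, and the monoid
  laws are checked where sections have representatives.\<close>

lemma kato_quotient_exists:
  assumes K: "kato (M, \<alpha>)" and qi: "quasi_integral (M, \<alpha>)"
  obtains A \<pi> where "monoid_sheaf A" "monoid_hom M A \<pi>"
    "\<And>X m n. \<lbrakk>X \<in> Obj C; m \<in> carrier (mon M X); n \<in> carrier (mon M X)\<rbrakk> \<Longrightarrow>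
      \<pi> X m = \<pi> X n \<longleftrightarrow> (\<exists>u\<in>O_units X. n = kato_act (M, \<alpha>) X u m)"
    "\<And>X a. X \<in> Obj C \<Longrightarrow> a \<in> carrier (mon A X) \<Longrightarrow>
      locally X (\<lambda>f. \<exists>m\<in>carrier (mon M (Dom C f)). \<pi> (Dom C f) m = mres A f a)"
proof -
  have M: "monoid_sheaf M" using K by (simp add: kato_def)
  note sM = monoid_sheafD(1)[OF M] and Mm = monoid_sheafD(3)[OF M] and Mc = monoid_sheafD(2)[OF M]
  note D = kato_actD[OF K]
  define eq where "eq X m n \<longleftrightarrow> (\<exists>u\<in>O_units X. n = kato_act (M, \<alpha>) X u m)" for X m n
  have rM: "mres M f m \<in> carrier (mon M (Dom C f))" if "f \<in> Arr C" "Cod C f = X" "m \<in> carrier (mon M X)" for f X m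
    using monoid_sheafD(4)[OF M] that by blast
  obtain F q where F: "sheaf F" and q: "\<And>X e. X \<in> Obj C \<Longrightarrow> e \<in> carrier (mon M X) \<Longrightarrow> q X e \<in> sec F X"
    and qr: "\<And>f e. f \<in> Arr C \<Longrightarrow> e \<in> carrier (mon M (Cod C f)) \<Longrightarrow> res F f (q (Cod C f) e) = q (Dom C f) (mres M f e)"
    and qe: "\<And>X e e'. \<lbrakk>X \<in> Obj C; e \<in> carrier (mon M X); e' \<in> carrier (mon M X)\<rbrakk> \<Longrightarrow>
      q X e = q X e' \<longleftrightarrow> eq X e e'"
    and ql: "\<And>X t. X \<in> Obj C \<Longrightarrow> t \<in> sec F X \<Longrightarrow> locally X (\<lambda>f. \<exists>e\<in>carrier (mon M (Dom C f)). q (Dom C f) e = res F f t)"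
  proof (rule quotient_sheaf[of "\<lambda>X. carrier (mon M X)" "mres M" eq])
    show "presheaf_on (\<lambda>X. carrier (mon M X)) (mres M)" using presheaf_on_sheaf[OF sM] by (simp add: presheaf_on_def)
    show "eq X m m" if X: "X \<in> Obj C" and m: "m \<in> carrier (mon M X)" for X m
      unfolding eq_def using unit_one[OF X] D(3)[OF X m] by metis
    show "eq X n m" if X: "X \<in> Obj C" and m: "m \<in> carrier (mon M X)" and n: "n \<in> carrier (mon M X)" and e: "eq X m n" for X m n
    proof -
      obtain u where u: "u \<in> O_units X" "n = kato_act (M, \<alpha>) X u m" using e by (auto simp: eq_def)
      note i = unit_inv[OF X u(1)]
      show ?thesis unfolding eq_def using D(4)[OF X i(1) u(1) m] i D(3)[OF X m] u by metis
    qed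
    show "eq X m k" if X: "X \<in> Obj C" and m: "m \<in> carrier (mon M X)" and e: "eq X m n" "eq X n k" for X m n k
    proof -
      obtain u where u: "u \<in> O_units X" "n = kato_act (M, \<alpha>) X u m" using e by (auto simp: eq_def)
      obtain v where v: "v \<in> O_units X" "k = kato_act (M, \<alpha>) X v n" using e by (auto simp: eq_def)
      show ?thesis unfolding eq_def using D(4)[OF X v(1) u(1) m] unit_mult[OF X v(1) u(1)] u v by metis
    qed
    show "eq (Dom C f) (mres M f m) (mres M f n)" if f: "f \<in> Arr C" and m: "m \<in> carrier (mon M (Cod C f))" and e: "eq (Cod C f) m n" for f m n
      using e D(5)[OF Cod_Obj[OF f] f refl _ m] unit_res[OF f] unfolding eq_def by metis
    show "eq X m n" if X: "X \<in> Obj C" and m: "m \<in> carrier (mon M X)" and n: "n \<in> carrier (mon M X)"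
      and l: "locally X (\<lambda>f. eq (Dom C f) (mres M f m) (mres M f n))" for X m n
    proof -
      \<comment> \<open>The unit that carries the restriction of m to that of n. It is unique by
        \<open>quasi_integral_free\<close>, so the local units glue.\<close>
      define E where "E f u \<longleftrightarrow> u \<in> O_units (Dom C f) \<and> mres M f n = kato_act (M, \<alpha>) (Dom C f) u (mres M f m)" for f u
      obtain u where uu: "u \<in> O_units X" and lu: "locally X (\<lambda>f. E f (mres \<O> f u))"
      proof (rule unit_glue[OF X, of E])
        fix f y assume f: "f \<in> Arr C" "Cod C f = X" and y: "E f y"
        note fo = Dom_Obj[OF f(1)]
        show "y \<in> O_units (Dom C f)" using y by (simp add: E_def)
        show "y = y'" if "E f y'" for y'
          using quasi_integral_free[OF K qi fo, of y y' "mres M f m"] y that rM[OF f m] by (simp add: E_def)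
        fix g assume g: "g \<in> Arr C" "Cod C g = Dom C f"
        show "E (Cmp C f g) (mres \<O> g y)"
          using y D(5)[OF fo g, of y "mres M f m"] rM[OF f m] unit_res[OF g(1), of y] g f
            res_Cmp[OF sM f(1) g, of m] res_Cmp[OF sM f(1) g, of n] m n by (simp add: E_def Dom_Cmp)
      next
        show "locally X (\<lambda>f. \<exists>u. E f u)" by (rule locally_mono[OF l X]) (auto simp: eq_def E_def)
      qed
      have "n = kato_act (M, \<alpha>) X u m"
        by (rule sheaf_sep[OF sM X _ _ locally_mono[OF lu X]]) (use m n D(1)[OF X uu m] D(5)[OF X _ _ uu m] in \<open>simp_all add: E_def\<close>)
      then show ?thesis using uu by (auto simp: eq_def)
    qed
    show "\<exists>i :: 'u \<Rightarrow> 'u. \<exists>B\<in>\<V>. inj_on i (carrier (mon M X)) \<and> i ` carrier (mon M X) \<subseteq> B" if X: "X \<in> Obj C" for X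
      using sheaf_small[OF sM X] by (intro exI[of _ id] bexI[of _ "carrier (mon M X)"]) simp_all
  qed blast
  have loc2: "locally X (\<lambda>f. \<exists>m n. m \<in> carrier (mon M (Dom C f)) \<and> n \<in> carrier (mon M (Dom C f)) \<and>
      q (Dom C f) m = res F f a \<and> q (Dom C f) n = res F f b)" if X: "X \<in> Obj C" and "a \<in> sec F X" "b \<in> sec F X" for X a b
    by (rule locally_mono[OF locally_conj[OF ql[OF X that(2)] ql[OF X that(3)] X] X]) blast
  define MM where "MM X = carrier (mon M X) \<times> carrier (mon M X)" for X
  \<comment> \<open>Both factors are quotients, so the product is descended along two copies of q at
    once. If the representatives are changed by u and v, their product changes by the unit that is
    the product of u and v.\<close>
  obtain k where k: "\<And>X ab. \<lbrakk>X \<in> Obj C; ab \<in> sec F X \<times> sec F X\<rbrakk> \<Longrightarrow> k X ab \<in> sec F X"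
    and kq: "\<And>X mn. \<lbrakk>X \<in> Obj C; mn \<in> MM X\<rbrakk> \<Longrightarrow> k X (map_prod (q X) (q X) mn) = q X (fst mn \<otimes>\<^bsub>mon M X\<^esub> snd mn)"
    and kr: "\<And>f ab. \<lbrakk>f \<in> Arr C; ab \<in> sec F (Cod C f) \<times> sec F (Cod C f)\<rbrakk> \<Longrightarrow>
      k (Dom C f) (map_prod (res F f) (res F f) ab) = res F f (k (Cod C f) ab)"
  proof (rule quotient_descent[OF F presheaf_on_Times[OF presheaf_on_sheaf[OF F] presheaf_on_sheaf[OF F]], of MM "\<lambda>f. map_prod (mres M f) (mres M f)"
      "\<lambda>X. map_prod (q X) (q X)" "\<lambda>X mn. q X (fst mn \<otimes>\<^bsub>mon M X\<^esub> snd mn)"], goal_cases)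
    case (1 f mn)
    obtain m n where mn: "mn = (m, n)" "m \<in> carrier (mon M (Cod C f))" "n \<in> carrier (mon M (Cod C f))" using 1 by (auto simp: MM_def)
    show ?case using monoid.m_closed[OF Mm[OF Cod_Obj[OF 1(2)]] mn(2,3)] qr[OF 1(2)] rM[OF 1(2) refl] monoid_sheafD(5)[OF M 1(2) mn(2,3)] mn
      by (simp add: MM_def)
  next
    case (2 X mn)
    then show ?case using q by (auto simp: MM_def)
  next
    case (3 X ab)
    show ?case by (rule locally_mono[OF loc2[OF 3(2), of "fst ab" "snd ab"] 3(2)]) (use 3 in \<open>force simp: MM_def\<close>)+
  next
    case (4 X mn)
    then show ?case using q monoid.m_closed[OF Mm] by (auto simp: MM_def)
  next
    case (5 X mn mn')
    note X = 5(2)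
    obtain m n m' n' where mn: "mn = (m, n)" "mn' = (m', n')" by (cases mn, cases mn')
    have 1: "m \<in> carrier (mon M X)" "n \<in> carrier (mon M X)" "m' \<in> carrier (mon M X)" "n' \<in> carrier (mon M X)"
      "q X m = q X m'" "q X n = q X n'" using 5 by (simp_all add: mn MM_def)
    obtain u where u: "u \<in> O_units X" "m' = kato_act (M, \<alpha>) X u m" using qe[OF X 1(1,3)] 1 by (auto simp: eq_def)
    obtain v where v: "v \<in> O_units X" "n' = kato_act (M, \<alpha>) X v n" using qe[OF X 1(2,4)] 1 by (auto simp: eq_def)
    note cl = monoid.m_closed[OF Mm[OF X]]
    have "m' \<otimes>\<^bsub>mon M X\<^esub> n' = kato_act (M, \<alpha>) X (u \<otimes>\<^bsub>mon \<O> X\<^esub> v) (m \<otimes>\<^bsub>mon M X\<^esub> n)"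
      using D(4)[OF X u(1) v(1) cl[OF 1(1,2)]] D(6)[OF X u(1) 1(1) D(1)[OF X v(1) 1(2)]] D(7)[OF X v(1) 1(1,2)] u v by simp
    then show ?case
      using qe[OF X cl[OF 1(1,2)] cl[OF 1(3,4)]] unit_mult[OF X u(1) v(1)] by (auto simp: eq_def mn)
  qed blast
  define mu where "mu X a b = k X (a, b)" for X a b
  have mu: "mu X a b \<in> sec F X" if "X \<in> Obj C" "a \<in> sec F X" "b \<in> sec F X" for X a b
    using k[OF that(1)] that by (simp add: mu_def)
  have muq: "mu X (q X m) (q X n) = q X (m \<otimes>\<^bsub>mon M X\<^esub> n)" if "X \<in> Obj C" "m \<in> carrier (mon M X)" "n \<in> carrier (mon M X)" for X m n
    using kq[OF that(1), of "(m, n)"] that by (simp add: mu_def MM_def)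
  have mur: "res F f (mu X a b) = mu (Dom C f) (res F f a) (res F f b)" if "f \<in> Arr C" "Cod C f = X" "a \<in> sec F X" "b \<in> sec F X" for f X a b
    using kr[OF that(1), of "(a, b)"] that by (simp add: mu_def)
  have rF: "res F f a \<in> sec F (Dom C f)" if "f \<in> Arr C" "Cod C f = X" "a \<in> sec F X" for f X a using res_in[OF F] that by blast
  define A :: "('o, 'a, 'u) monoid_presheaf" where
    "A = \<lparr>mon = (\<lambda>X. \<lparr>carrier = sec F X, monoid.mult = mu X, one = q X \<one>\<^bsub>mon M X\<^esub>\<rparr>), mres = res F\<rparr>"
  have uA: "und A = F" by (simp add: A_def und_def)
  have A: "monoid_sheaf A"
    unfolding monoid_sheaf_def uA
  proof (intro conjI ballI F)
    fix X assume X: "X \<in> Obj C"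
    interpret comm_monoid "mon M X" by (rule Mc[OF X])
    show "comm_monoid (mon A X)"
    proof (rule comm_monoidI)
      fix a b assume "a \<in> carrier (mon A X)" "b \<in> carrier (mon A X)"
      then have a: "a \<in> sec F X" and b: "b \<in> sec F X" by (simp_all add: A_def)
      show "a \<otimes>\<^bsub>mon A X\<^esub> b \<in> carrier (mon A X)" using mu[OF X a b] by (simp add: A_def)
      have "mu X a b = mu X b a"
      proof (rule sheaf_sep[OF F X mu[OF X a b] mu[OF X b a]], rule locally_mono[OF loc2[OF X a b] X])
        fix f assume f: "f \<in> Arr C" "Cod C f = X" and "\<exists>m n. m \<in> carrier (mon M (Dom C f)) \<and> n \<in> carrier (mon M (Dom C f)) \<and>
          q (Dom C f) m = res F f a \<and> q (Dom C f) n = res F f b"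
        then obtain m n where 1: "m \<in> carrier (mon M (Dom C f))" "n \<in> carrier (mon M (Dom C f))"
          "q (Dom C f) m = res F f a" "q (Dom C f) n = res F f b" by blast
        note fo = Dom_Obj[OF f(1)]
        show "res F f (mu X a b) = res F f (mu X b a)"
          using mur[OF f a b] mur[OF f b a] muq[OF fo 1(1,2)] muq[OF fo 1(2,1)] 1 comm_monoid.m_comm[OF Mc[OF fo] 1(1,2)] by simp
      qed
      then show "a \<otimes>\<^bsub>mon A X\<^esub> b = b \<otimes>\<^bsub>mon A X\<^esub> a" by (simp add: A_def)
      fix c assume "c \<in> carrier (mon A X)"
      then have c: "c \<in> sec F X" by (simp add: A_def)
      have "mu X (mu X a b) c = mu X a (mu X b c)"
      proof (rule sheaf_sep[OF F X mu[OF X mu[OF X a b] c] mu[OF X a mu[OF X b c]]],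
          rule locally_mono[OF locally_conj[OF loc2[OF X a b] ql[OF X c] X] X])
        fix f assume f: "f \<in> Arr C" "Cod C f = X" and "(\<exists>m n. m \<in> carrier (mon M (Dom C f)) \<and> n \<in> carrier (mon M (Dom C f)) \<and>
          q (Dom C f) m = res F f a \<and> q (Dom C f) n = res F f b) \<and> (\<exists>e\<in>carrier (mon M (Dom C f)). q (Dom C f) e = res F f c)"
        then obtain m n e where 1: "m \<in> carrier (mon M (Dom C f))" "n \<in> carrier (mon M (Dom C f))" "e \<in> carrier (mon M (Dom C f))"
          "q (Dom C f) m = res F f a" "q (Dom C f) n = res F f b" "q (Dom C f) e = res F f c" by blast
        note fo = Dom_Obj[OF f(1)] and cl = monoid.m_closed[OF Mm[OF Dom_Obj[OF f(1)]]]
        show "res F f (mu X (mu X a b) c) = res F f (mu X a (mu X b c))"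
          using mur[OF f mu[OF X a b] c] mur[OF f a b] mur[OF f a mu[OF X b c]] mur[OF f b c]
            muq[OF fo 1(1,2)] muq[OF fo 1(2,3)] muq[OF fo cl[OF 1(1,2)] 1(3)] muq[OF fo 1(1) cl[OF 1(2,3)]] 1
            monoid.m_assoc[OF Mm[OF fo] 1(1-3)] by simp
      qed
      then show "a \<otimes>\<^bsub>mon A X\<^esub> b \<otimes>\<^bsub>mon A X\<^esub> c = a \<otimes>\<^bsub>mon A X\<^esub> (b \<otimes>\<^bsub>mon A X\<^esub> c)" by (simp add: A_def)
    next
      show "\<one>\<^bsub>mon A X\<^esub> \<in> carrier (mon A X)" using q[OF X] by (simp add: A_def)
      fix a assume "a \<in> carrier (mon A X)"
      then have a: "a \<in> sec F X" by (simp add: A_def)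
      note o = q[OF X one_closed]
      have "mu X (q X \<one>\<^bsub>mon M X\<^esub>) a = a"
      proof (rule sheaf_sep[OF F X mu[OF X o a] a], rule locally_mono[OF ql[OF X a] X])
        fix f assume f: "f \<in> Arr C" "Cod C f = X" and "\<exists>e\<in>carrier (mon M (Dom C f)). q (Dom C f) e = res F f a"
        then obtain m where 1: "m \<in> carrier (mon M (Dom C f))" "q (Dom C f) m = res F f a" by blast
        note fo = Dom_Obj[OF f(1)]
        show "res F f (mu X (q X \<one>\<^bsub>mon M X\<^esub>) a) = res F f a"
          using mur[OF f o a] qr[OF f(1), of "\<one>\<^bsub>mon M X\<^esub>"] f monoid_sheafD(6)[OF M f(1)] 1 muq[OF fo monoid.one_closed[OF Mm[OF fo]] 1(1)]
            monoid.l_one[OF Mm[OF fo] 1(1)] by simp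
      qed
      then show "\<one>\<^bsub>mon A X\<^esub> \<otimes>\<^bsub>mon A X\<^esub> a = a" by (simp add: A_def)
    qed
  next
    fix f assume f: "f \<in> Arr C"
    show "mres A f \<in> hom (mon A (Cod C f)) (mon A (Dom C f))"
      using rF[OF f refl] mur[OF f refl] by (simp add: A_def hom_def)
    show "mres A f \<one>\<^bsub>mon A (Cod C f)\<^esub> = \<one>\<^bsub>mon A (Dom C f)\<^esub>"
      using qr[OF f monoid.one_closed[OF Mm[OF Cod_Obj[OF f]]]] monoid_sheafD(6)[OF M f] by (simp add: A_def)
  qed
  define \<pi> where "\<pi> = mk (und M) q"
  have \<pi>: "\<pi> X m = q X m" if "X \<in> Obj C" "m \<in> carrier (mon M X)" for X m using that by (simp add: \<pi>_def)
  have "monoid_hom M A \<pi>"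
    unfolding monoid_hom_def uA
  proof (intro conjI ballI)
    show "\<pi> \<in> Hom (und M) F" unfolding \<pi>_def by (rule mk_Hom[OF _ _ sM]) (use q qr in simp_all)
    fix X assume X: "X \<in> Obj C"
    show "\<pi> X \<in> hom (mon M X) (mon A X)"
      using \<pi>[OF X] q[OF X] muq[OF X] monoid.m_closed[OF Mm[OF X]] by (simp add: hom_def A_def)
    show "\<pi> X \<one>\<^bsub>mon M X\<^esub> = \<one>\<^bsub>mon A X\<^esub>" using \<pi>[OF X monoid.one_closed[OF Mm[OF X]]] by (simp add: A_def)
  qed
  with A show ?thesis
  proof (rule that)
    show "\<pi> X m = \<pi> X n \<longleftrightarrow> (\<exists>u\<in>O_units X. n = kato_act (M, \<alpha>) X u m)" if "X \<in> Obj C" "m \<in> carrier (mon M X)" "n \<in> carrier (mon M X)" for X m n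
      using \<pi>[OF that(1,2)] \<pi>[OF that(1,3)] qe[OF that] by (simp add: eq_def)
    show "locally X (\<lambda>f. \<exists>m\<in>carrier (mon M (Dom C f)). \<pi> (Dom C f) m = mres A f a)" if X: "X \<in> Obj C" and "a \<in> carrier (mon A X)" for X a
    proof -
      have "a \<in> sec F X" using that by (simp add: A_def)
      from ql[OF X this] show ?thesis by (rule locally_mono[OF _ X]) (use \<pi> Dom_Obj in \<open>auto simp: A_def\<close>)
    qed
  qed
qed

end

section \<open>The DF log structure over a fixed quotient of M\<close>

locale kato_quotient = monoided_topos C J \<V> \<O>
  for C :: "('o, 'a) cat" and J :: "'o \<Rightarrow> 'a set set" and \<V> :: "'u set set" and \<O> :: "('o, 'a, 'u) monoid_presheaf" +
  fixes M :: "('o, 'a, 'u) monoid_presheaf" and \<alpha> :: "('o, 'u) family"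
    and A :: "('o, 'a, 'u) monoid_presheaf" and \<pi> :: "('o, 'u) family"
  assumes K: "kato (M, \<alpha>)" and qi: "quasi_integral (M, \<alpha>)" and A: "monoid_sheaf A" and \<pi>: "monoid_hom M A \<pi>"
    and fibres: "\<And>X m n. \<lbrakk>X \<in> Obj C; m \<in> carrier (mon M X); n \<in> carrier (mon M X)\<rbrakk> \<Longrightarrow>
      \<pi> X m = \<pi> X n \<longleftrightarrow> (\<exists>u\<in>O_units X. n = kato_act (M, \<alpha>) X u m)"
    and surj: "\<And>X a. X \<in> Obj C \<Longrightarrow> a \<in> carrier (mon A X) \<Longrightarrow>
      locally X (\<lambda>f. \<exists>m\<in>carrier (mon M (Dom C f)). \<pi> (Dom C f) m = mres A f a)"
begin

lemma M: "monoid_sheaf M" and al: "monoid_hom M \<O> \<alpha>"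
  using K by (simp_all add: kato_def)

lemmas sM = monoid_sheafD(1)[OF M]
lemmas sA = monoid_sheafD(1)[OF A]
lemmas ka = kato_actD[OF K]
lemmas free = quasi_integral_free[OF K qi]
lemmas \<pi>_in = monoid_homD(1)[OF \<pi>]
lemmas \<pi>_mult = monoid_homD(2)[OF \<pi>]
lemmas \<pi>_one = monoid_homD(3)[OF \<pi>]

lemma M_closed: "\<lbrakk>X \<in> Obj C; m \<in> carrier (mon M X); n \<in> carrier (mon M X)\<rbrakk> \<Longrightarrow>
      m \<otimes>\<^bsub>mon M X\<^esub> n \<in> carrier (mon M X)"
  using monoid_sheafD(3)[OF M] by (simp add: monoid.m_closed)

lemma M_one: "X \<in> Obj C \<Longrightarrow> \<one>\<^bsub>mon M X\<^esub> \<in> carrier (mon M X)"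
  using monoid_sheafD(3)[OF M] by (simp add: monoid.one_closed)

lemma \<pi>_act: "\<lbrakk>X \<in> Obj C; u \<in> O_units X; m \<in> carrier (mon M X)\<rbrakk> \<Longrightarrow>
      \<pi> X (kato_act (M, \<alpha>) X u m) = \<pi> X m"
  using fibres[of X m "kato_act (M, \<alpha>) X u m"] ka(1)[of X u m] by auto

lemma \<pi>_res: "f \<in> Arr C \<Longrightarrow> m \<in> carrier (mon M (Cod C f)) \<Longrightarrow> \<pi> (Dom C f) (mres M f m) = mres A f (\<pi> (Cod C f) m)"
  using Hom_res[OF monoid_hom_Hom[OF \<pi>], of f m] by simp

text \<open>Such an m is the translate of 1 by the unit \<alpha> m. Sharpness and trivial kernel are
  both reduced to this.\<close>

lemma kernel: "\<lbrakk>X \<in> Obj C; m \<in> carrier (mon M X); \<alpha> X m \<in> O_units X\<rbrakk> \<Longrightarrow>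
      \<pi> X m = \<one>\<^bsub>mon A X\<^esub>"
  using ka(8)[of X m] \<pi>_act[of X "\<alpha> X m" "\<one>\<^bsub>mon M X\<^esub>"] \<pi>_one[of X] M_one[of X] by simp

text \<open>The fibre product of U and M over A. Its components are named below: \<open>pt\<close>
  is the sheaf, \<open>pb\<close> and \<open>pm\<close> are the projections to U and M,
  \<open>pc\<close> is the pairing.\<close>

definition pull where
  "pull U a = (SOME W. fibre_product U (und M) (\<lambda>X x m. a X x = \<pi> X m) W)"

definition pt where "pt U a = fst (pull U a)"
definition pb where "pb U a = fst (snd (pull U a))"
definition pm where "pm U a = fst (snd (snd (pull U a)))"
definition pc where "pc U a = snd (snd (snd (pull U a)))"

text \<open>Clause 6, joint injectivity of the projections, is the way almost every equation between
  sections is proved below: the components in U and in M are compared.\<close>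

lemma pullD:
  assumes U: "sheaf U" and a: "a \<in> Hom U (und A)"
  shows "sheaf (pt U a)" and "pb U a \<in> Hom (pt U a) U" and "pm U a \<in> Hom (pt U a) (und M)"
    and "\<lbrakk>X \<in> Obj C; x \<in> sec U X; m \<in> carrier (mon M X); a X x = \<pi> X m\<rbrakk> \<Longrightarrow>
      pc U a X x m \<in> sec (pt U a) X \<and> pb U a X (pc U a X x m) = x \<and> pm U a X (pc U a X x m) = m" (is "PROP ?g1")
    and "\<lbrakk>X \<in> Obj C; z \<in> sec (pt U a) X\<rbrakk> \<Longrightarrow> a X (pb U a X z) = \<pi> X (pm U a X z)" (is "PROP ?g2")
    and "\<lbrakk>X \<in> Obj C; z \<in> sec (pt U a) X; z' \<in> sec (pt U a) X; pb U a X z = pb U a X z'; pm U a X z = pm U a X z'\<rbrakk> \<Longrightarrow> z = z'" (is "PROP ?g3")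
    and "\<lbrakk>X \<in> Obj C; z \<in> sec (pt U a) X\<rbrakk> \<Longrightarrow> pb U a X z \<in> sec U X" (is "PROP ?g4")
    and "\<lbrakk>X \<in> Obj C; z \<in> sec (pt U a) X\<rbrakk> \<Longrightarrow> pm U a X z \<in> carrier (mon M X)" (is "PROP ?g5")
    and "\<lbrakk>f \<in> Arr C; z \<in> sec (pt U a) (Cod C f)\<rbrakk> \<Longrightarrow> pb U a (Dom C f) (res (pt U a) f z) = res U f (pb U a (Cod C f) z)" (is "PROP ?g6")
    and "\<lbrakk>f \<in> Arr C; z \<in> sec (pt U a) (Cod C f)\<rbrakk> \<Longrightarrow> pm U a (Dom C f) (res (pt U a) f z) = mres M f (pm U a (Cod C f) z)" (is "PROP ?g7")
proof -
  have "\<exists>W. fibre_product U (und M) (\<lambda>X x m. a X x = \<pi> X m) W"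
  proof (rule fibre_product_exists[OF U sM])
    show "a (Dom C f) (res U f x) = \<pi> (Dom C f) (res (und M) f m)"
      if "f \<in> Arr C" "x \<in> sec U (Cod C f)" "m \<in> sec (und M) (Cod C f)" "a (Cod C f) x = \<pi> (Cod C f) m" for f x m
      using Hom_res[OF a that(1,2)] \<pi>_res[OF that(1), of m] that by simp
    show "a X x = \<pi> X m" if X: "X \<in> Obj C" and x: "x \<in> sec U X" and m: "m \<in> sec (und M) X"
      and l: "locally X (\<lambda>f. a (Dom C f) (res U f x) = \<pi> (Dom C f) (res (und M) f m))" for X x m
    proof (rule sheaf_sep[OF sA X Hom_in[OF a X x]])
      show "\<pi> X m \<in> sec (und A) X" using \<pi>_in[OF X] m by simp
      show "locally X (\<lambda>f. res (und A) f (a X x) = res (und A) f (\<pi> X m))"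
        by (rule locally_mono[OF l X]) (use Hom_res[OF a, of _ x] \<pi>_res[of _ m] x m in auto)
    qed
  qed
  from someI_ex[OF this] have "fibre_product U (und M) (\<lambda>X x m. a X x = \<pi> X m) (pt U a, pb U a, pm U a, pc U a)"
    by (simp add: pull_def pt_def pb_def pm_def pc_def)
  then have d: "sheaf (pt U a)" "pb U a \<in> Hom (pt U a) U" "pm U a \<in> Hom (pt U a) (und M)"
    "\<And>X x m. \<lbrakk>X \<in> Obj C; x \<in> sec U X; m \<in> carrier (mon M X); a X x = \<pi> X m\<rbrakk> \<Longrightarrow>
      pc U a X x m \<in> sec (pt U a) X \<and> pb U a X (pc U a X x m) = x \<and> pm U a X (pc U a X x m) = m"
    "\<And>X z. \<lbrakk>X \<in> Obj C; z \<in> sec (pt U a) X\<rbrakk> \<Longrightarrow> a X (pb U a X z) = \<pi> X (pm U a X z) \<and> pc U a X (pb U a X z) (pm U a X z) = z"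
    by (auto simp: fibre_product_def)
  from d show "sheaf (pt U a)" "pb U a \<in> Hom (pt U a) U" "pm U a \<in> Hom (pt U a) (und M)"
    "PROP ?g1" "PROP ?g2" by simp_all
  show "PROP ?g3"
    using d(5) by metis
  show "PROP ?g4" "PROP ?g5" "PROP ?g6" "PROP ?g7"
    using Hom_in[OF d(2)] Hom_in[OF d(3)] Hom_res[OF d(2)] Hom_res[OF d(3)] by simp_all
qed

definition Q where
  "Q U a = \<lparr>base = U, tot = pt U a, proj = pb U a,
     act = (\<lambda>X u z. pc U a X (pb U a X z) (kato_act (M, \<alpha>) X u (pm U a X z))),
     val = cmp (pt U a) \<alpha> (pm U a)\<rparr>"

lemma Q_simps [simp]: "base (Q U a) = U" "tot (Q U a) = pt U a" "proj (Q U a) = pb U a"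
  by (simp_all add: Q_def)

lemma Q_val: "X \<in> Obj C \<Longrightarrow> z \<in> sec (pt U a) X \<Longrightarrow> val (Q U a) X z = \<alpha> X (pm U a X z)"
  by (simp add: Q_def)

lemma Q_act:
  assumes U: "sheaf U" and a: "a \<in> Hom U (und A)" and X: "X \<in> Obj C" and u: "u \<in> O_units X" and z: "z \<in> sec (pt U a) X"
  shows "act (Q U a) X u z \<in> sec (pt U a) X" and "pb U a X (act (Q U a) X u z) = pb U a X z"
    and "pm U a X (act (Q U a) X u z) = kato_act (M, \<alpha>) X u (pm U a X z)" (is ?g1)
proof -
  note D = pullD[OF U a]
  note m = D(8)[OF X z]
  note d = D(4)[OF X D(7)[OF X z] ka(1)[OF X u m]]
  have "a X (pb U a X z) = \<pi> X (kato_act (M, \<alpha>) X u (pm U a X z))" using D(5)[OF X z] \<pi>_act[OF X u m] by simp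
  from d[OF this] show "act (Q U a) X u z \<in> sec (pt U a) X" "pb U a X (act (Q U a) X u z) = pb U a X z"
    ?g1 by (simp_all add: Q_def)
qed

text \<open>Transitivity on fibres is \<open>fibres\<close>, freeness is quasi-integrality in the
  form \<open>free\<close>, and local sections exist by \<open>surj\<close>.\<close>

lemma Q_div:
  assumes U: "sheaf U" and a: "a \<in> Hom U (und A)"
  shows "div_obj (Q U a)"
proof -
  note D = pullD[OF U a] and B = Q_act[OF U a]
  have T: "torsor (Q U a)"
    unfolding torsor_def Q_simps
  proof (intro conjI ballI impI U D(1,2))
    fix X u z assume X: "X \<in> Obj C" and u: "u \<in> O_units X" and z: "z \<in> sec (pt U a) X"
    note b = B[OF X u z]
    show "act (Q U a) X u z \<in> sec (pt U a) X" "pb U a X (act (Q U a) X u z) = pb U a X z" by (rule b)+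
    fix v assume v: "v \<in> O_units X"
    note b' = B[OF X v z]
    note buv = B[OF X unit_mult[OF X u v] z] and bu = B[OF X u b'(1)]
    show "act (Q U a) X (u \<otimes>\<^bsub>mon \<O> X\<^esub> v) z = act (Q U a) X u (act (Q U a) X v z)"
      by (rule D(6)[OF X buv(1) bu(1)]) (use buv bu b' ka(4)[OF X u v D(8)[OF X z]] in simp_all)
  next
    fix X z assume X: "X \<in> Obj C" and z: "z \<in> sec (pt U a) X"
    note b = B[OF X unit_one[OF X] z]
    show "act (Q U a) X \<one>\<^bsub>mon \<O> X\<^esub> z = z"
      by (rule D(6)[OF X b(1) z]) (use b ka(3)[OF X D(8)[OF X z]] in simp_all)
  next
    fix f u z assume f: "f \<in> Arr C" and u: "u \<in> O_units (Cod C f)" and z: "z \<in> sec (pt U a) (Cod C f)"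
    note X = Cod_Obj[OF f] and Y = Dom_Obj[OF f]
    note b = B[OF X u z] and rz = res_in[OF D(1) f z] and ru = unit_res[OF f u]
    note b' = B[OF Y ru rz]
    show "res (pt U a) f (act (Q U a) (Cod C f) u z) = act (Q U a) (Dom C f) (mres \<O> f u) (res (pt U a) f z)"
      by (rule D(6)[OF Y res_in[OF D(1) f b(1)] b'(1)])
        (use D(9,10)[OF f b(1)] D(9,10)[OF f z] b b' ka(5)[OF X f refl u D(8)[OF X z]] in simp_all)
  next
    fix X z z' assume X: "X \<in> Obj C" and z: "z \<in> sec (pt U a) X" and z': "z' \<in> sec (pt U a) X" and e: "pb U a X z = pb U a X z'"
    note m = D(8)[OF X z] and m' = D(8)[OF X z']
    have "\<pi> X (pm U a X z) = \<pi> X (pm U a X z')" using D(5)[OF X z] D(5)[OF X z'] e by simp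
    then obtain u where u: "u \<in> O_units X" "pm U a X z' = kato_act (M, \<alpha>) X u (pm U a X z)" using fibres[OF X m m'] by blast
    show "\<exists>!u. u \<in> O_units X \<and> act (Q U a) X u z = z'"
    proof (rule ex1I[of _ u])
      note b = B[OF X u(1) z]
      have "act (Q U a) X u z = z'" by (rule D(6)[OF X b(1) z']) (simp_all add: b u e)
      then show "u \<in> O_units X \<and> act (Q U a) X u z = z'" using u by simp
      fix v assume v: "v \<in> O_units X \<and> act (Q U a) X v z = z'"
      then show "v = u" using B(3)[OF X _ z, of v] u free[OF X _ u(1) m, of v] by auto
    qed
  next
    fix X x assume X: "X \<in> Obj C" and x: "x \<in> sec U X"
    have ax: "a X x \<in> carrier (mon A X)" using Hom_in[OF a X x] by simp
    have "locally X (\<lambda>f. \<exists>z\<in>sec (pt U a) (Dom C f). pb U a (Dom C f) z = res U f x)"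
    proof (rule locally_mono[OF surj[OF X ax] X])
      fix f assume f: "f \<in> Arr C" "Cod C f = X" and "\<exists>m\<in>carrier (mon M (Dom C f)). \<pi> (Dom C f) m = mres A f (a X x)"
      then obtain m where m: "m\<in>carrier (mon M (Dom C f))" "\<pi> (Dom C f) m = mres A f (a X x)" by blast
      have "res U f x \<in> sec U (Dom C f)" "a (Dom C f) (res U f x) = \<pi> (Dom C f) m"
        using res_in[OF U f(1), of x] x f Hom_res[OF a f(1), of x] m by simp_all
      from D(4)[OF Dom_Obj[OF f(1)] this(1) m(1) this(2)] show "\<exists>z\<in>sec (pt U a) (Dom C f). pb U a (Dom C f) z = res U f x" by blast
    qed
    then show "\<exists>S\<in>J X. \<forall>f\<in>S. \<exists>z\<in>sec (pt U a) (Dom C f). pb U a (Dom C f) z = res U f x" by (simp add: locally_def)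
  qed
  show ?thesis
    unfolding div_obj_def Q_simps
  proof (intro conjI ballI T)
    show "val (Q U a) \<in> Hom (pt U a) (und \<O>)"
      unfolding Q_def using cmp_Hom[OF D(1,3) monoid_hom_Hom[OF al]] by simp
    show "val (Q U a) X (act (Q U a) X u z) = u \<otimes>\<^bsub>mon \<O> X\<^esub> val (Q U a) X z"
      if X: "X \<in> Obj C" and u: "u \<in> O_units X" and z: "z \<in> sec (pt U a) X" for X u z
      using Q_val[OF X B(1)[OF X u z]] Q_val[OF X z] B(3)[OF X u z] ka(2)[OF X u D(8)[OF X z]] by simp
  qed
qed

definition larr where
  "larr V f U a = mk (pt V (cmp V a f)) (\<lambda>X z. pc U a X (f X (pb V (cmp V a f) X z)) (pm V (cmp V a f) X z))"

lemma larrD: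
  assumes V: "sheaf V" and U: "sheaf U" and f: "f \<in> Hom V U" and a: "a \<in> Hom U (und A)"
  shows "larr V f U a \<in> div_arr (Q V (cmp V a f)) f (Q U a)"
    and "\<lbrakk>X \<in> Obj C; z \<in> sec (pt V (cmp V a f)) X\<rbrakk> \<Longrightarrow> larr V f U a X z \<in> sec (pt U a) X"
    and "\<lbrakk>X \<in> Obj C; z \<in> sec (pt V (cmp V a f)) X\<rbrakk> \<Longrightarrow> pb U a X (larr V f U a X z) = f X (pb V (cmp V a f) X z)"
    and "\<lbrakk>X \<in> Obj C; z \<in> sec (pt V (cmp V a f)) X\<rbrakk> \<Longrightarrow> pm U a X (larr V f U a X z) = pm V (cmp V a f) X z"
proof -
  note af = cmp_Hom[OF V f a]
  note D = pullD[OF U a] and E = pullD[OF V af]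
  have l: "larr V f U a X z \<in> sec (pt U a) X \<and> pb U a X (larr V f U a X z) = f X (pb V (cmp V a f) X z) \<and>
    pm U a X (larr V f U a X z) = pm V (cmp V a f) X z" if X: "X \<in> Obj C" and z: "z \<in> sec (pt V (cmp V a f)) X" for X z
    using D(4)[OF X Hom_in[OF f X E(7)[OF X z]] E(8)[OF X z]] E(5)[OF X z] E(7)[OF X z] X z by (simp add: larr_def)
  then show 1: "\<lbrakk>X \<in> Obj C; z \<in> sec (pt V (cmp V a f)) X\<rbrakk> \<Longrightarrow> larr V f U a X z \<in> sec (pt U a) X"
    "\<lbrakk>X \<in> Obj C; z \<in> sec (pt V (cmp V a f)) X\<rbrakk> \<Longrightarrow> pb U a X (larr V f U a X z) = f X (pb V (cmp V a f) X z)"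
    "\<lbrakk>X \<in> Obj C; z \<in> sec (pt V (cmp V a f)) X\<rbrakk> \<Longrightarrow> pm U a X (larr V f U a X z) = pm V (cmp V a f) X z" for X z by simp_all
  show "larr V f U a \<in> div_arr (Q V (cmp V a f)) f (Q U a)"
    unfolding div_arr_def Q_simps
  proof (intro CollectI conjI ballI)
    have "mk (pt V (cmp V a f)) (larr V f U a) \<in> Hom (pt V (cmp V a f)) (pt U a)"
    proof (rule mk_Hom[OF 1(1) _ E(1)])
      fix h z assume h: "h \<in> Arr C" and z: "z \<in> sec (pt V (cmp V a f)) (Cod C h)"
      note X = Cod_Obj[OF h] and Y = Dom_Obj[OF h] and rz = res_in[OF E(1) h z]
      note lz = 1[OF X z] and lr = 1[OF Y rz]
      show "larr V f U a (Dom C h) (res (pt V (cmp V a f)) h z) = res (pt U a) h (larr V f U a (Cod C h) z)"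
        by (rule D(6)[OF Y lr(1) res_in[OF D(1) h lz(1)]])
          (use lr lz E(9,10)[OF h z] D(9,10)[OF h lz(1)] Hom_res[OF f h E(7)[OF X z]] in simp_all)
    qed
    moreover have "mk (pt V (cmp V a f)) (larr V f U a) = larr V f U a" unfolding larr_def mk_def by (auto simp: fun_eq_iff)
    ultimately show "larr V f U a \<in> Hom (pt V (cmp V a f)) (pt U a)" by simp
    fix X z assume X: "X \<in> Obj C" and z: "z \<in> sec (pt V (cmp V a f)) X"
    note lz = 1[OF X z]
    show "pb U a X (larr V f U a X z) = f X (pb V (cmp V a f) X z)" by (rule lz)
    show "val (Q U a) X (larr V f U a X z) = val (Q V (cmp V a f)) X z" using Q_val[OF X z] Q_val[OF X lz(1)] lz by simp
    fix u assume u: "u \<in> O_units X"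
    note uz = Q_act[OF V af X u z] and ul = Q_act[OF U a X u lz(1)]
    show "larr V f U a X (act (Q V (cmp V a f)) X u z) = act (Q U a) X u (larr V f U a X z)"
      by (rule D(6)[OF X 1(1)[OF X uz(1)] ul(1)]) (use 1(2,3)[OF X uz(1)] uz ul lz in simp_all)
  qed
qed

text \<open>Specified by its values on pure tensors, the only place where a formula is available:
  the M-components are multiplied and the common base point is kept.\<close>

definition lm where
  "lm U a b = (SOME k. k \<in> div_arr (tensor (Q U a) (Q U b)) (idm U) (Q U (a \<otimes>\<^bsub>arrows U A\<^esub> b)) \<and>
     (\<forall>X\<in>Obj C. \<forall>p\<in>sec (pt U a) X. \<forall>q\<in>sec (pt U b) X. pb U a X p = pb U b X q \<longrightarrow>
       k X (tens (Q U a) (Q U b) X p q) = pc U (a \<otimes>\<^bsub>arrows U A\<^esub> b) X (pb U b X q) (pm U a X p \<otimes>\<^bsub>mon M X\<^esub> pm U b X q)))"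

lemma lmD:
  assumes U: "sheaf U" and a: "a \<in> Hom U (und A)" and b: "b \<in> Hom U (und A)"
  shows "lm U a b \<in> div_arr (tensor (Q U a) (Q U b)) (idm U) (Q U (a \<otimes>\<^bsub>arrows U A\<^esub> b))"
    and "\<lbrakk>X \<in> Obj C; p \<in> sec (pt U a) X; q \<in> sec (pt U b) X; pb U a X p = pb U b X q\<rbrakk> \<Longrightarrow>
      lm U a b X (tens (Q U a) (Q U b) X p q) \<in> sec (pt U (a \<otimes>\<^bsub>arrows U A\<^esub> b)) X \<and>
      pb U (a \<otimes>\<^bsub>arrows U A\<^esub> b) X (lm U a b X (tens (Q U a) (Q U b) X p q)) = pb U b X q \<and>
      pm U (a \<otimes>\<^bsub>arrows U A\<^esub> b) X (lm U a b X (tens (Q U a) (Q U b) X p q)) = pm U a X p \<otimes>\<^bsub>mon M X\<^esub> pm U b X q"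
proof -
  let ?ab = "a \<otimes>\<^bsub>arrows U A\<^esub> b"
  note ab = arrows_mult_Hom(1)[OF A U a b]
  note D = pullD[OF U a] and E = pullD[OF U b] and F = pullD[OF U ab]
  define h where "h X p q = pc U ?ab X (pb U b X q) (pm U a X p \<otimes>\<^bsub>mon M X\<^esub> pm U b X q)" for X p q
  have h: "h X p q \<in> sec (pt U ?ab) X" "pb U ?ab X (h X p q) = pb U b X q" "pm U ?ab X (h X p q) = pm U a X p \<otimes>\<^bsub>mon M X\<^esub> pm U b X q"
    if X: "X \<in> Obj C" and p: "p \<in> sec (pt U a) X" and q: "q \<in> sec (pt U b) X" and pq: "pb U a X p = pb U b X q" for X p q
  proof -
    note x = E(7)[OF X q]
    have "?ab X (pb U b X q) = \<pi> X (pm U a X p \<otimes>\<^bsub>mon M X\<^esub> pm U b X q)"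
      using arrows_mult_Hom(2)[OF A U a b X x] D(5)[OF X p] E(5)[OF X q] pq \<pi>_mult[OF X D(8)[OF X p] E(8)[OF X q]] by simp
    from F(4)[OF X x M_closed[OF X D(8)[OF X p] E(8)[OF X q]] this]
    show "h X p q \<in> sec (pt U ?ab) X" "pb U ?ab X (h X p q) = pb U b X q" "pm U ?ab X (h X p q) = pm U a X p \<otimes>\<^bsub>mon M X\<^esub> pm U b X q"
      by (simp_all add: h_def)
  qed
  have "\<exists>k\<in>div_arr (tensor (Q U a) (Q U b)) (idm U) (Q U ?ab). \<forall>X\<in>Obj C. \<forall>p\<in>tsec (Q U a) X. \<forall>q\<in>tsec (Q U b) X.
    proj (Q U a) X p = proj (Q U b) X q \<longrightarrow> k X (tens (Q U a) (Q U b) X p q) = h X p q"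
  proof (rule tensor_arr[OF Q_div[OF U a] Q_div[OF U b] _ Q_div[OF U ab]], unfold Q_simps)
    show "idm U \<in> Hom U U" by (rule idm_Hom[OF U])
    fix X p q assume c: "X \<in> Obj C" "p \<in> sec (pt U a) X" "q \<in> sec (pt U b) X" "pb U a X p = pb U b X q"
    note hh = h[OF c] and X = c(1)
    show "h X p q \<in> sec (pt U ?ab) X \<and> pb U ?ab X (h X p q) = idm U X (pb U b X q) \<and>
      val (Q U ?ab) X (h X p q) = val (Q U a) X p \<otimes>\<^bsub>mon \<O> X\<^esub> val (Q U b) X q"
      using hh Q_val[OF X hh(1)] Q_val[OF X c(2)] Q_val[OF X c(3)] monoid_homD(2)[OF al X D(8)[OF X c(2)] E(8)[OF X c(3)]] E(7)[OF X c(3)] X by simp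
    fix u assume u: "u \<in> O_units X"
    note up = Q_act[OF U a X u c(2)] and uq = Q_act[OF U b X u c(3)] and uh = Q_act[OF U ab X u hh(1)]
    have e: "pb U a X (act (Q U a) X u p) = pb U b X q" "pb U a X p = pb U b X (act (Q U b) X u q)" using up uq c by simp_all
    note h1 = h[OF X up(1) c(3) e(1)] and h2 = h[OF X c(2) uq(1) e(2)]
    have "h X (act (Q U a) X u p) q = act (Q U ?ab) X u (h X p q)"
      by (rule F(6)[OF X h1(1) uh(1)]) (use h1 hh uh up ka(6)[OF X u D(8)[OF X c(2)] E(8)[OF X c(3)]] in simp_all)
    moreover have "h X p (act (Q U b) X u q) = act (Q U ?ab) X u (h X p q)"
      by (rule F(6)[OF X h2(1) uh(1)]) (use h2 hh uh uq ka(7)[OF X u D(8)[OF X c(2)] E(8)[OF X c(3)]] in simp_all)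
    ultimately show "h X (act (Q U a) X u p) q = act (Q U ?ab) X u (h X p q) \<and> h X p (act (Q U b) X u q) = act (Q U ?ab) X u (h X p q)" ..
  next
    fix g p q assume c: "g \<in> Arr C" "p \<in> sec (pt U a) (Cod C g)" "q \<in> sec (pt U b) (Cod C g)" "pb U a (Cod C g) p = pb U b (Cod C g) q"
    note g = c(1) and X = Cod_Obj[OF c(1)] and Y = Dom_Obj[OF c(1)]
    note hh = h[OF X c(2-4)] and rp = res_in[OF D(1) g c(2)] and rq = res_in[OF E(1) g c(3)]
    have e: "pb U a (Dom C g) (res (pt U a) g p) = pb U b (Dom C g) (res (pt U b) g q)"
      using D(9)[OF g c(2)] E(9)[OF g c(3)] c(4) by simp
    note hr = h[OF Y rp rq e]
    show "res (pt U ?ab) g (h (Cod C g) p q) = h (Dom C g) (res (pt U a) g p) (res (pt U b) g q)"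
      by (rule F(6)[OF Y res_in[OF F(1) g hh(1)] hr(1)])
        (use F(9,10)[OF g hh(1)] hh hr E(9,10)[OF g c(3)] D(10)[OF g c(2)] monoid_sheafD(5)[OF M g D(8)[OF X c(2)] E(8)[OF X c(3)]] in simp_all)
  qed simp
  then have "\<exists>k. k \<in> div_arr (tensor (Q U a) (Q U b)) (idm U) (Q U ?ab) \<and>
     (\<forall>X\<in>Obj C. \<forall>p\<in>sec (pt U a) X. \<forall>q\<in>sec (pt U b) X. pb U a X p = pb U b X q \<longrightarrow>
       k X (tens (Q U a) (Q U b) X p q) = pc U ?ab X (pb U b X q) (pm U a X p \<otimes>\<^bsub>mon M X\<^esub> pm U b X q))"
    unfolding h_def Q_simps by blast
  from someI_ex[OF this] have l: "lm U a b \<in> div_arr (tensor (Q U a) (Q U b)) (idm U) (Q U ?ab)"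
    "\<forall>X\<in>Obj C. \<forall>p\<in>sec (pt U a) X. \<forall>q\<in>sec (pt U b) X. pb U a X p = pb U b X q \<longrightarrow> lm U a b X (tens (Q U a) (Q U b) X p q) = h X p q"
    unfolding lm_def h_def by blast+
  show "lm U a b \<in> div_arr (tensor (Q U a) (Q U b)) (idm U) (Q U ?ab)" by (rule l(1))
  show "\<lbrakk>X \<in> Obj C; p \<in> sec (pt U a) X; q \<in> sec (pt U b) X; pb U a X p = pb U b X q\<rbrakk> \<Longrightarrow>
      lm U a b X (tens (Q U a) (Q U b) X p q) \<in> sec (pt U ?ab) X \<and>
      pb U ?ab X (lm U a b X (tens (Q U a) (Q U b) X p q)) = pb U b X q \<and>
      pm U ?ab X (lm U a b X (tens (Q U a) (Q U b) X p q)) = pm U a X p \<otimes>\<^bsub>mon M X\<^esub> pm U b X q"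
    using l(2) h by simp
qed

definition lo where
  "lo U = (SOME k. k \<in> div_arr (unit_obj U) (idm U) (Q U \<one>\<^bsub>arrows U A\<^esub>) \<and>
     (\<forall>X\<in>Obj C. \<forall>x\<in>sec U X. k X (unit_sec U X x) = pc U \<one>\<^bsub>arrows U A\<^esub> X x \<one>\<^bsub>mon M X\<^esub>))"

lemma loD:
  assumes U: "sheaf U"
  shows "lo U \<in> div_arr (unit_obj U) (idm U) (Q U \<one>\<^bsub>arrows U A\<^esub>)"
    and "\<lbrakk>X \<in> Obj C; x \<in> sec U X\<rbrakk> \<Longrightarrow> lo U X (unit_sec U X x) \<in> sec (pt U \<one>\<^bsub>arrows U A\<^esub>) X \<and>
      pb U \<one>\<^bsub>arrows U A\<^esub> X (lo U X (unit_sec U X x)) = x \<and> pm U \<one>\<^bsub>arrows U A\<^esub> X (lo U X (unit_sec U X x)) = \<one>\<^bsub>mon M X\<^esub>"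
proof -
  let ?o = "\<one>\<^bsub>arrows U A\<^esub>"
  note o = arrows_one_Hom(1)[OF A U]
  note D = pullD[OF U o]
  have c: "pc U ?o X x \<one>\<^bsub>mon M X\<^esub> \<in> sec (pt U ?o) X \<and> pb U ?o X (pc U ?o X x \<one>\<^bsub>mon M X\<^esub>) = x \<and> pm U ?o X (pc U ?o X x \<one>\<^bsub>mon M X\<^esub>) = \<one>\<^bsub>mon M X\<^esub>"
    if X: "X \<in> Obj C" and x: "x \<in> sec U X" for X x
    using D(4)[OF X x M_one[OF X]] arrows_one_Hom(2)[OF A U X x] \<pi>_one[OF X] by simp
  have eH: "mk U (\<lambda>X x. pc U ?o X x \<one>\<^bsub>mon M X\<^esub>) \<in> Hom U (pt U ?o)"
  proof (rule mk_Hom[OF _ _ U])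
    fix f x assume f: "f \<in> Arr C" and x: "x \<in> sec U (Cod C f)"
    note X = Cod_Obj[OF f] and Y = Dom_Obj[OF f]
    note cx = c[OF X x] and cr = c[OF Y res_in[OF U f x]]
    show "pc U ?o (Dom C f) (res U f x) \<one>\<^bsub>mon M (Dom C f)\<^esub> = res (pt U ?o) f (pc U ?o (Cod C f) x \<one>\<^bsub>mon M (Cod C f)\<^esub>)"
      by (rule D(6)[OF Y]) (use cx cr res_in[OF D(1) f] D(9,10)[OF f] monoid_sheafD(6)[OF M f] in simp_all)
  qed (use c in blast)
  have v: "val (Q U ?o) X (pc U ?o X x \<one>\<^bsub>mon M X\<^esub>) = \<one>\<^bsub>mon \<O> X\<^esub>" if "X \<in> Obj C" "x \<in> sec U X" for X x
    using Q_val[OF that(1), of "pc U ?o X x \<one>\<^bsub>mon M X\<^esub>" U ?o] c[OF that] monoid_homD(3)[OF al that(1)] by simp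
  have "\<exists>k\<in>div_arr (unit_obj U) (idm U) (Q U ?o). \<forall>X\<in>Obj C. \<forall>x\<in>sec U X. k X (unit_sec U X x) = mk U (\<lambda>X x. pc U ?o X x \<one>\<^bsub>mon M X\<^esub>) X x"
    by (rule unit_obj_arr[OF U Q_div[OF U o]]) (use idm_Hom[OF U] eH c v in simp_all)
  then have "\<exists>k. k \<in> div_arr (unit_obj U) (idm U) (Q U ?o) \<and>
     (\<forall>X\<in>Obj C. \<forall>x\<in>sec U X. k X (unit_sec U X x) = pc U ?o X x \<one>\<^bsub>mon M X\<^esub>)" by auto
  from someI_ex[OF this] have l: "lo U \<in> div_arr (unit_obj U) (idm U) (Q U ?o)"
     "\<forall>X\<in>Obj C. \<forall>x\<in>sec U X. lo U X (unit_sec U X x) = pc U ?o X x \<one>\<^bsub>mon M X\<^esub>" unfolding lo_def by blast+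
  show "lo U \<in> div_arr (unit_obj U) (idm U) (Q U ?o)" by (rule l(1))
  show "\<lbrakk>X \<in> Obj C; x \<in> sec U X\<rbrakk> \<Longrightarrow> lo U X (unit_sec U X x) \<in> sec (pt U ?o) X \<and>
      pb U ?o X (lo U X (unit_sec U X x)) = x \<and> pm U ?o X (lo U X (unit_sec U X x)) = \<one>\<^bsub>mon M X\<^esub>"
    using l(2) c by simp
qed

definition dfk :: "('o, 'a, 'u) df_data" where
  "dfk = \<lparr>Lmon = A, Lobj = Q, Larr = larr, Lmul = lm, Lone = lo\<rparr>"

lemma dfk_simps [simp]: "Lmon dfk = A" "Lobj dfk = Q" "Larr dfk = larr" "Lmul dfk = lm" "Lone dfk = lo"
  by (simp_all add: dfk_def)

lemma stack_functor_dfk: "stack_functor dfk"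
  unfolding stack_functor_def dfk_simps Q_simps
proof (intro conjI allI impI)
  show "div_obj (Q U a)" if "sheaf U" "a \<in> Hom U (und A)" for U a by (rule Q_div[OF that])
  show "larr V f U a \<in> div_arr (Q V (cmp V a f)) f (Q U a)" if "sheaf V" "sheaf U" "f \<in> Hom V U" "a \<in> Hom U (und A)" for V U f a
    by (rule larrD(1)[OF that])
  show "larr U (idm U) U a = idm (pt U a)" if U: "sheaf U" and a: "a \<in> Hom U (und A)" for U a
  proof -
    have e: "cmp U a (idm U) = a" by (rule cmp_idm_right[OF U a])
    note l = larrD[OF U U idm_Hom[OF U] a, unfolded e] and D = pullD[OF U a]
    show ?thesis
      by (rule Hom_eqI[OF div_arrD(1)[OF l(1), unfolded Q_simps] idm_Hom[OF D(1)]], rule D(6)) (use l D(7) in simp_all)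
  qed
  show "larr W (cmp W f g) U a = cmp (pt W (cmp W a (cmp W f g))) (larr V f U a) (larr W g V (cmp V a f))"
    if W: "sheaf W" and V: "sheaf V" and U: "sheaf U" and g: "g \<in> Hom W V" and f: "f \<in> Hom V U" and a: "a \<in> Hom U (und A)" for W V U g f a
  proof -
    note af = cmp_Hom[OF V f a] and fg = cmp_Hom[OF W g f]
    have e: "cmp W (cmp V a f) g = cmp W a (cmp W f g)" using cmp_assoc[OF W g V f a] by simp
    note l1 = larrD[OF W U fg a] and l2 = larrD[OF V U f a] and l3 = larrD[OF W V g af, unfolded e]
    note D = pullD[OF U a] and Dw = pullD[OF W cmp_Hom[OF W fg a]]
    note c = cmp_Hom[OF Dw(1) div_arrD(1)[OF l3(1), unfolded Q_simps] div_arrD(1)[OF l2(1), unfolded Q_simps]]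
    show ?thesis
    proof (rule Hom_eqI[OF div_arrD(1)[OF l1(1), unfolded Q_simps] c])
      fix X z assume X: "X \<in> Obj C" and z: "z \<in> sec (pt W (cmp W a (cmp W f g))) X"
      note 3 = l3(2-4)[OF X z] and 1 = l1(2-4)[OF X z]
      note 2 = l2(2-4)[OF X 3(1)]
      show "larr W (cmp W f g) U a X z = cmp (pt W (cmp W a (cmp W f g))) (larr V f U a) (larr W g V (cmp V a f)) X z"
        by (rule D(6)[OF X]) (use 1 2 3 X z Dw(7)[OF X z] in simp_all)
    qed
  qed
qed simp

lemma lmul_dfk:
  assumes "sheaf U" "a \<in> Hom U (und A)" "b \<in> Hom U (und A)" "X \<in> Obj C" "p \<in> sec (pt U a) X" "q \<in> sec (pt U b) X" "pb U a X p = pb U b X q"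
  shows "lmul dfk U a b X p q \<in> sec (pt U (a \<otimes>\<^bsub>arrows U A\<^esub> b)) X"
    and "pb U (a \<otimes>\<^bsub>arrows U A\<^esub> b) X (lmul dfk U a b X p q) = pb U b X q"
    and "pm U (a \<otimes>\<^bsub>arrows U A\<^esub> b) X (lmul dfk U a b X p q) = pm U a X p \<otimes>\<^bsub>mon M X\<^esub> pm U b X q"
  using lmD(2)[OF assms] by (simp_all add: lmul_def)

lemma lone_dfk:
  assumes "sheaf U" "X \<in> Obj C" "x \<in> sec U X"
  shows "lone dfk U X x \<in> sec (pt U \<one>\<^bsub>arrows U A\<^esub>) X" and "pb U \<one>\<^bsub>arrows U A\<^esub> X (lone dfk U X x) = x"
    and "pm U \<one>\<^bsub>arrows U A\<^esub> X (lone dfk U X x) = \<one>\<^bsub>mon M X\<^esub>"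
  using loD(2)[OF assms] by (simp_all add: lone_def)

text \<open>In each law both sides have the same base point, and their M-components differ by a law
  of the monoid M; \<open>pullD\<close> then gives equality.\<close>

lemma pointwise_monoidal_dfk: "pointwise_monoidal dfk"
  unfolding pointwise_monoidal_def dfk_simps Q_simps
proof (intro conjI allI impI ballI)
  show "lo U \<in> div_arr (unit_obj U) (idm U) (Q U \<one>\<^bsub>arrows U A\<^esub>)" if "sheaf U" for U by (rule loD(1)[OF that])
  show "lm U a b \<in> div_arr (tensor (Q U a) (Q U b)) (idm U) (Q U (a \<otimes>\<^bsub>arrows U A\<^esub> b))"
    if "sheaf U" "a \<in> Hom U (und A)" "b \<in> Hom U (und A)" for U a b by (rule lmD(1)[OF that])
next
  fix V U f X x assume V: "sheaf V" and U: "sheaf U" and f: "f \<in> Hom V U" and X: "X \<in> Obj C" and x: "x \<in> sec V X"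
  note o = arrows_one_Hom(1)[OF A U]
  have e: "cmp V \<one>\<^bsub>arrows U A\<^esub> f = \<one>\<^bsub>arrows V A\<^esub>" by (rule arrows_comp(2)[OF A U V f])
  note lx = lone_dfk[OF V X x] and lf = lone_dfk[OF U X Hom_in[OF f X x]]
  note l = larrD[OF V U f o, unfolded e]
  show "larr V f U \<one>\<^bsub>arrows U A\<^esub> X (lone dfk V X x) = lone dfk U X (f X x)"
    by (rule pullD(6)[OF U o X l(2)[OF X lx(1)] lf(1)]) (use l(3,4)[OF X lx(1)] lx lf in simp_all)
next
  fix V U f a b X p q assume V: "sheaf V" and U: "sheaf U" and f: "f \<in> Hom V U" and a: "a \<in> Hom U (und A)" and b: "b \<in> Hom U (und A)"
    and X: "X \<in> Obj C" and p: "p \<in> sec (pt V (cmp V a f)) X" and q: "q \<in> sec (pt V (cmp V b f)) X"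
    and pq: "pb V (cmp V a f) X p = pb V (cmp V b f) X q"
  note af = cmp_Hom[OF V f a] and bf = cmp_Hom[OF V f b] and ab = arrows_mult_Hom(1)[OF A U a b]
  have e: "cmp V (a \<otimes>\<^bsub>arrows U A\<^esub> b) f = cmp V a f \<otimes>\<^bsub>arrows V A\<^esub> cmp V b f" by (rule arrows_comp(1)[OF A U V f a b])
  note l1 = lmul_dfk[OF V af bf X p q pq]
  note l2 = larrD(2-4)[OF V U f ab, unfolded e, OF X l1(1)]
  note lp = larrD(2-4)[OF V U f a X p] and lq = larrD(2-4)[OF V U f b X q]
  have e': "pb U a X (larr V f U a X p) = pb U b X (larr V f U b X q)" using lp lq pq by simp
  note l3 = lmul_dfk[OF U a b X lp(1) lq(1) e']
  show "larr V f U (a \<otimes>\<^bsub>arrows U A\<^esub> b) X (lmul dfk V (cmp V a f) (cmp V b f) X p q) = lmul dfk U a b X (larr V f U a X p) (larr V f U b X q)"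
    by (rule pullD(6)[OF U ab X l2(1) l3(1)]) (use l1 l2 l3 lp lq in simp_all)
next
  fix U a b c X p q r assume U: "sheaf U" and a: "a \<in> Hom U (und A)" and b: "b \<in> Hom U (und A)" and c: "c \<in> Hom U (und A)"
    and X: "X \<in> Obj C" and p: "p \<in> sec (pt U a) X" and q: "q \<in> sec (pt U b) X" and r: "r \<in> sec (pt U c) X"
    and pq: "pb U a X p = pb U b X q" and qr: "pb U b X q = pb U c X r"
  note ab = arrows_mult_Hom(1)[OF A U a b] and bc = arrows_mult_Hom(1)[OF A U b c]
  have e: "(a \<otimes>\<^bsub>arrows U A\<^esub> b) \<otimes>\<^bsub>arrows U A\<^esub> c = a \<otimes>\<^bsub>arrows U A\<^esub> (b \<otimes>\<^bsub>arrows U A\<^esub> c)" by (rule arrows_monoid_laws(2)[OF A U a b c])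
  note l1 = lmul_dfk[OF U a b X p q pq] and l2 = lmul_dfk[OF U b c X q r qr]
  have e1: "pb U (a \<otimes>\<^bsub>arrows U A\<^esub> b) X (lmul dfk U a b X p q) = pb U c X r" using l1 qr by simp
  have e2: "pb U a X p = pb U (b \<otimes>\<^bsub>arrows U A\<^esub> c) X (lmul dfk U b c X q r)" using l2 pq qr by simp
  note l3 = lmul_dfk[OF U ab c X l1(1) r e1, unfolded e] and l4 = lmul_dfk[OF U a bc X p l2(1) e2]
  show "lmul dfk U a (b \<otimes>\<^bsub>arrows U A\<^esub> c) X p (lmul dfk U b c X q r) = lmul dfk U (a \<otimes>\<^bsub>arrows U A\<^esub> b) c X (lmul dfk U a b X p q) r"
    by (rule pullD(6)[OF U arrows_mult_Hom(1)[OF A U a bc] X l4(1) l3(1)])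
      (use l1 l2 l3 l4 monoid.m_assoc[OF monoid_sheafD(3)[OF M X]] pullD(8)[OF U a X p] pullD(8)[OF U b X q] pullD(8)[OF U c X r] in simp_all)
next
  fix U a X p assume U: "sheaf U" and a: "a \<in> Hom U (und A)" and X: "X \<in> Obj C" and p: "p \<in> sec (pt U a) X"
  note o = arrows_one_Hom(1)[OF A U] and D = pullD[OF U a]
  note lo = lone_dfk[OF U X D(7)[OF X p]]
  note l1 = lmul_dfk[OF U o a X lo(1) p lo(2), unfolded arrows_monoid_laws(3)[OF A U a a a]]
    and l2 = lmul_dfk[OF U a o X p lo(1) lo(2)[symmetric], unfolded arrows_monoid_laws(4)[OF A U a a a]]
  show "lmul dfk U \<one>\<^bsub>arrows U A\<^esub> a X (lone dfk U X (pb U a X p)) p = p"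
    by (rule D(6)[OF X l1(1) p]) (use l1 lo monoid.l_one[OF monoid_sheafD(3)[OF M X]] D(8)[OF X p] in simp_all)
  show "lmul dfk U a \<one>\<^bsub>arrows U A\<^esub> X p (lone dfk U X (pb U a X p)) = p"
    by (rule D(6)[OF X l2(1) p]) (use l2 lo monoid.r_one[OF monoid_sheafD(3)[OF M X]] D(8)[OF X p] in simp_all)
next
  fix U a b X p q assume U: "sheaf U" and a: "a \<in> Hom U (und A)" and b: "b \<in> Hom U (und A)"
    and X: "X \<in> Obj C" and p: "p \<in> sec (pt U a) X" and q: "q \<in> sec (pt U b) X" and pq: "pb U a X p = pb U b X q"
  note l1 = lmul_dfk[OF U a b X p q pq] and l2 = lmul_dfk[OF U b a X q p pq[symmetric], unfolded arrows_monoid_laws(1)[OF A U b a a]]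
  show "lmul dfk U b a X q p = lmul dfk U a b X p q"
    by (rule pullD(6)[OF U arrows_mult_Hom(1)[OF A U a b] X l2(1) l1(1)])
      (use l1 l2 pq comm_monoid.m_comm[OF monoid_sheafD(2)[OF M X]] pullD(8)[OF U a X p] pullD(8)[OF U b X q] in simp_all)
qed

text \<open>If a b = 1, then locally a and b are images of sections m and n of M whose product is in
  the orbit of 1. So \<alpha> m divides a unit and is itself a unit, and m lies in the kernel of
  \<pi>.\<close>

lemma sharp_A: "sharp A"
  unfolding sharp_def
proof (intro allI impI equalityI subsetI)
  fix U a assume U: "sheaf U" and "a \<in> Units (arrows U A)"
  then obtain b where a: "a \<in> Hom U (und A)" and b: "b \<in> Hom U (und A)" and ab: "a \<otimes>\<^bsub>arrows U A\<^esub> b = \<one>\<^bsub>arrows U A\<^esub>"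
    by (auto simp: Units_def arrows_def)
  have "a = \<one>\<^bsub>arrows U A\<^esub>"
  proof (rule Hom_eqI[OF a arrows_one_Hom(1)[OF A U]])
    fix X x assume X: "X \<in> Obj C" and x: "x \<in> sec U X"
    have c: "a X x \<in> carrier (mon A X)" "b X x \<in> carrier (mon A X)" using Hom_in[OF a X x] Hom_in[OF b X x] by simp_all
    have 1: "a X x \<otimes>\<^bsub>mon A X\<^esub> b X x = \<one>\<^bsub>mon A X\<^esub>"
      using arrows_mult_Hom(2)[OF A U a b X x] arrows_one_Hom(2)[OF A U X x] ab by simp
    have "a X x = \<one>\<^bsub>mon A X\<^esub>"
    proof (rule sheaf_sep[OF sA X])
      show "a X x \<in> sec (und A) X" "\<one>\<^bsub>mon A X\<^esub> \<in> sec (und A) X" using c monoid_sheafD(3)[OF A X] by (simp_all add: monoid.one_closed)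
      show "locally X (\<lambda>f. res (und A) f (a X x) = res (und A) f \<one>\<^bsub>mon A X\<^esub>)"
      proof (rule locally_mono[OF locally_conj[OF surj[OF X c(1)] surj[OF X c(2)] X] X])
        fix f assume f: "f \<in> Arr C" "Cod C f = X" and "(\<exists>m\<in>carrier (mon M (Dom C f)). \<pi> (Dom C f) m = mres A f (a X x)) \<and>
          (\<exists>m\<in>carrier (mon M (Dom C f)). \<pi> (Dom C f) m = mres A f (b X x))"
        then obtain m n where m: "m\<in>carrier (mon M (Dom C f))" "\<pi> (Dom C f) m = mres A f (a X x)"
          and n: "n\<in>carrier (mon M (Dom C f))" "\<pi> (Dom C f) n = mres A f (b X x)" by blast
        note Y = Dom_Obj[OF f(1)]
        note mn = M_closed[OF Y m(1) n(1)]
        have "\<pi> (Dom C f) (m \<otimes>\<^bsub>mon M (Dom C f)\<^esub> n) = \<pi> (Dom C f) \<one>\<^bsub>mon M (Dom C f)\<^esub>"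
          using \<pi>_mult[OF Y m(1) n(1)] \<pi>_one[OF Y] m n monoid_sheafD(5)[OF A f(1), of "a X x" "b X x"] monoid_sheafD(6)[OF A f(1)] c f 1 by simp
        then obtain u where u: "u \<in> O_units (Dom C f)" "\<one>\<^bsub>mon M (Dom C f)\<^esub> = kato_act (M, \<alpha>) (Dom C f) u (m \<otimes>\<^bsub>mon M (Dom C f)\<^esub> n)"
          using fibres[OF Y mn M_one[OF Y]] by blast
        note h = monoid_homD[OF al Y]
        have "u \<otimes>\<^bsub>mon \<O> (Dom C f)\<^esub> (\<alpha> (Dom C f) m \<otimes>\<^bsub>mon \<O> (Dom C f)\<^esub> \<alpha> (Dom C f) n) = \<one>\<^bsub>mon \<O> (Dom C f)\<^esub>"
          using ka(2)[OF Y u(1) mn] u(2) h(2)[OF m(1) n(1)] h(3) by simp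
        \<comment> \<open>Rearranged so that \<alpha> m is one factor of an invertible product, as
          \<open>unitI\<close> requires.\<close>
        then have "\<alpha> (Dom C f) m \<otimes>\<^bsub>mon \<O> (Dom C f)\<^esub> (\<alpha> (Dom C f) n \<otimes>\<^bsub>mon \<O> (Dom C f)\<^esub> u) = \<one>\<^bsub>mon \<O> (Dom C f)\<^esub>"
          using h(1)[OF m(1)] h(1)[OF n(1)] unit_in[OF Y u(1)] O_monoid[OF Y]
            unit_comm[OF Y, of u "\<alpha> (Dom C f) m \<otimes>\<^bsub>mon \<O> (Dom C f)\<^esub> \<alpha> (Dom C f) n"] by (simp add: monoid.m_closed monoid.m_assoc)
        then have "\<alpha> (Dom C f) m \<in> O_units (Dom C f)"
          using unitI[OF Y h(1)[OF m(1)], of "\<alpha> (Dom C f) n \<otimes>\<^bsub>mon \<O> (Dom C f)\<^esub> u"] h(1)[OF n(1)] unit_in[OF Y u(1)] O_monoid[OF Y] unit_one[OF Y]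
          by (simp add: monoid.m_closed)
        then show "res (und A) f (a X x) = res (und A) f \<one>\<^bsub>mon A X\<^esub>"
          using kernel[OF Y m(1)] m(2) monoid_sheafD(6)[OF A f(1)] f by simp
      qed
    qed
    then show "a X x = \<one>\<^bsub>arrows U A\<^esub> X x" using arrows_one_Hom(2)[OF A U X x] by simp
  qed
  then show "a \<in> {\<one>\<^bsub>arrows U A\<^esub>}" by simp
next
  fix U a assume U: "sheaf U" and "a \<in> {\<one>\<^bsub>arrows U A\<^esub>}"
  moreover note o = arrows_one_Hom(1)[OF A U]
  moreover have "\<one>\<^bsub>arrows U A\<^esub> \<otimes>\<^bsub>arrows U A\<^esub> \<one>\<^bsub>arrows U A\<^esub> = \<one>\<^bsub>arrows U A\<^esub>" by (rule arrows_monoid_laws(3)[OF A U o o o])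
  moreover have "carrier (arrows U A) = Hom U (und A)" by (simp add: arrows_def)
  ultimately show "a \<in> Units (arrows U A)" by (auto simp: Units_def)
qed

text \<open>An isomorphism of the tensor product with the unit object preserves values. Locally the
  value of a section of \<open>Q U a\<close> thus divides a value taken in the unit object, which is
  invertible; so the M-component lies over 1 by \<open>kernel\<close>, and a is locally
  trivial.\<close>

lemma trivial_kernel_dfk: "trivial_kernel dfk"
  unfolding trivial_kernel_def dfk_simps
proof (intro allI impI)
  fix U a assume U: "sheaf U" and a: "a \<in> Hom U (und A)" and "div_invertible (Q U a)"
  then obtain P k where P: "div_obj P" "base P = U" and k: "k \<in> div_arr (tensor (Q U a) P) (idm U) (unit_obj U)"
    by (auto simp: div_invertible_def)
  note D = pullD[OF U a] and I = unit_objD[OF U] and Qd = Q_div[OF U a]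
  have b: "base P = base (Q U a)" using P by simp
  note T = tensorD[OF Qd P(1) b]
  show "a = \<one>\<^bsub>arrows U A\<^esub>"
  proof (rule Hom_eqI[OF a arrows_one_Hom(1)[OF A U]])
    fix X x assume X: "X \<in> Obj C" and x: "x \<in> sec U X"
    have "a X x = \<one>\<^bsub>mon A X\<^esub>"
    proof (rule sheaf_sep[OF sA X Hom_in[OF a X x]])
      show "\<one>\<^bsub>mon A X\<^esub> \<in> sec (und A) X" using monoid_sheafD(3)[OF A X] by (simp add: monoid.one_closed)
      show "locally X (\<lambda>f. res (und A) f (a X x) = res (und A) f \<one>\<^bsub>mon A X\<^esub>)"
      proof (rule locally_mono[OF locally_conj[OF divT(13)[OF Qd X] divT(13)[OF P(1) X] X] X])
        show "x \<in> sec (base (Q U a)) X" "x \<in> sec (base P) X" using x P by simp_all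
        fix f assume f: "f \<in> Arr C" "Cod C f = X" and "(\<exists>p\<in>tsec (Q U a) (Dom C f). proj (Q U a) (Dom C f) p = res (base (Q U a)) f x) \<and>
          (\<exists>p\<in>tsec P (Dom C f). proj P (Dom C f) p = res (base P) f x)"
        then obtain p q where p: "p\<in>sec (pt U a) (Dom C f)" "pb U a (Dom C f) p = res U f x"
          and q: "q \<in>tsec P (Dom C f)" "proj P (Dom C f) q = res U f x" unfolding Q_simps P(2) by blast
        note Y = Dom_Obj[OF f(1)]
        have pq: "p \<in> tsec (Q U a) (Dom C f)" "proj (Q U a) (Dom C f) p = proj P (Dom C f) q" using p q by simp_all
        note t = T(3)[OF Y pq(1) q(1) pq(2)] and tv = T(5)[OF Y pq(1) q(1) pq(2)]
        let ?e = "k (Dom C f) (tens (Q U a) P (Dom C f) p q)"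
        have e: "?e \<in> tsec (unit_obj U) (Dom C f)" by (rule div_arrD(2)[OF k Y t])
        have ex: "proj (unit_obj U) (Dom C f) ?e \<in> sec U (Dom C f)" using divT(4)[OF I(1) Y e] I(2) by simp
        obtain u where u: "u \<in> O_units (Dom C f)" "act (unit_obj U) (Dom C f) u (unit_sec U (Dom C f) (proj (unit_obj U) (Dom C f) ?e)) = ?e"
          using I(8)[OF Y e] by blast
        \<comment> \<open>A section of the unit object is a unit times the unit section, whose value
          is 1; so its value is that unit.\<close>
        have "val (unit_obj U) (Dom C f) ?e = u"
          using div_objD(5)[OF I(1) Y u(1) I(4)[OF Y ex]] I(6)[OF Y ex] u O_monoid[OF Y] unit_in[OF Y u(1)] by (simp add: monoid.r_one)
        then have "val (Q U a) (Dom C f) p \<otimes>\<^bsub>mon \<O> (Dom C f)\<^esub> val P (Dom C f) q \<in> O_units (Dom C f)"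
          using div_arrD(6)[OF k Y t] tv u by simp
        then have "val (Q U a) (Dom C f) p \<in> O_units (Dom C f)"
          by (rule unitI[OF Y div_objD(3)[OF Qd Y pq(1)] div_objD(3)[OF P(1) Y q(1)]])
        then have "\<pi> (Dom C f) (pm U a (Dom C f) p) = \<one>\<^bsub>mon A (Dom C f)\<^esub>"
          using kernel[OF Y D(8)[OF Y p(1)]] Q_val[OF Y p(1)] by simp
        then show "res (und A) f (a X x) = res (und A) f \<one>\<^bsub>mon A X\<^esub>"
          using D(5)[OF Y p(1)] p(2) Hom_res[OF a f(1), of x] x f monoid_sheafD(6)[OF A f(1)] by simp
      qed
    qed
    then show "a X x = \<one>\<^bsub>arrows U A\<^esub> X x" using arrows_one_Hom(2)[OF A U X x] by simp
  qed
qed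

lemma df_dfk: "df dfk"
  unfolding df_def using symmetric_monoidal_iff[OF stack_functor_dfk] A sharp_A stack_functor_dfk pointwise_monoidal_dfk trivial_kernel_dfk
  by simp

text \<open>The total space of the universal torsor is the fibre product of A and M over A. Its
  projection to M is the isomorphism that gives M back, with inverse sending m to (\<pi> m,
  m).\<close>

definition \<theta> where "\<theta> = pm (und A) (idm (und A))"
definition \<theta>' where "\<theta>' = mk (und M) (\<lambda>X m. pc (und A) (idm (und A)) X (\<pi> X m) m)"

lemma tot_tq_dfk: "tot (tq dfk) = pt (und A) (idm (und A))"
  by (simp add: tq_def)

lemma \<theta>D:
  shows "\<theta> \<in> Hom (tot (tq dfk)) (und M)" and "\<theta>' \<in> Hom (und M) (tot (tq dfk))"
    and "X \<in> Obj C \<Longrightarrow> m \<in> carrier (mon M X) \<Longrightarrow> \<theta> X (\<theta>' X m) = m" (is "PROP ?g1")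
    and "X \<in> Obj C \<Longrightarrow> z \<in> tsec (tq dfk) X \<Longrightarrow> \<theta>' X (\<theta> X z) = z"
    and "X \<in> Obj C \<Longrightarrow> z \<in> tsec (tq dfk) X \<Longrightarrow> val (tq dfk) X z = \<alpha> X (\<theta> X z)" (is "PROP ?g2")
    and "\<lbrakk>sheaf U; a \<in> Hom U (und A); X \<in> Obj C; p \<in> sec (pt U a) X\<rbrakk> \<Longrightarrow> \<theta> X (rq dfk U a X p) = pm U a X p"
proof -
  let ?i = "idm (und A)"
  note D = pullD[OF sA idm_Hom[OF sA]]
  show "\<theta> \<in> Hom (tot (tq dfk)) (und M)" unfolding \<theta>_def tot_tq_dfk by (rule D(3))
  have c: "pc (und A) ?i X (\<pi> X m) m \<in> sec (pt (und A) ?i) X \<and> pb (und A) ?i X (pc (und A) ?i X (\<pi> X m) m) = \<pi> X m \<and>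
    pm (und A) ?i X (pc (und A) ?i X (\<pi> X m) m) = m" if X: "X \<in> Obj C" and m: "m \<in> carrier (mon M X)" for X m
    by (rule D(4)[OF X _ m]) (use \<pi>_in[OF X m] X in simp_all)
  show "\<theta>' \<in> Hom (und M) (tot (tq dfk))"
    unfolding \<theta>'_def tot_tq_dfk
  proof (rule mk_Hom[OF _ _ sM])
    fix f m assume f: "f \<in> Arr C" and "m \<in> sec (und M) (Cod C f)"
    then have m: "m \<in> carrier (mon M (Cod C f))" by simp
    note X = Cod_Obj[OF f] and Y = Dom_Obj[OF f]
    note cm = c[OF X m] and cr = c[OF Y monoid_sheafD(4)[OF M f m]]
    have "pc (und A) ?i (Dom C f) (\<pi> (Dom C f) (mres M f m)) (mres M f m) = res (pt (und A) ?i) f (pc (und A) ?i (Cod C f) (\<pi> (Cod C f) m) m)"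
      by (rule D(6)[OF Y]) (use cm cr res_in[OF D(1) f] D(9,10)[OF f] \<pi>_res[OF f m] in simp_all)
    then show "pc (und A) ?i (Dom C f) (\<pi> (Dom C f) (res (und M) f m)) (res (und M) f m) = res (pt (und A) ?i) f (pc (und A) ?i (Cod C f) (\<pi> (Cod C f) m) m)"
      by simp
  qed (use c in simp)
  show "PROP ?g1" using c by (simp add: \<theta>_def \<theta>'_def)
  show "\<theta>' X (\<theta> X z) = z" if X: "X \<in> Obj C" and "z \<in> tsec (tq dfk) X" for X z
  proof -
    have z: "z \<in> sec (pt (und A) ?i) X" using that by (simp add: tot_tq_dfk)
    note m = D(8)[OF X z]
    show ?thesis unfolding \<theta>_def \<theta>'_def
      by (rule D(6)[OF X _ z]) (use D(5,7)[OF X z] X m c[OF X m] in simp_all)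
  qed
  show "PROP ?g2"
    using Q_val[of X z "und A" ?i] by (simp add: \<theta>_def tq_def)
  assume U: "sheaf U" and a: "a \<in> Hom U (und A)" and X: "X \<in> Obj C" and p: "p \<in> sec (pt U a) X"
  have e: "cmp U ?i a = a" by (rule cmp_idm_left[OF U a sA])
  show "\<theta> X (rq dfk U a X p) = pm U a X p"
    using larrD(4)[OF U sA a idm_Hom[OF sA], unfolded e, OF X p] by (simp add: rq_def \<theta>_def)
qed

text \<open>The multiplication \<open>mq\<close> is known only through test objects. There \<theta>
  reads off the M-component, on which \<open>lmul\<close> is the multiplication of M.\<close>

lemma \<theta>_mult:
  assumes X: "X \<in> Obj C" and z: "z \<in> tsec (tq dfk) X" and w: "w \<in> tsec (tq dfk) X"
  shows "\<theta> X (mq dfk X z w) = \<theta> X z \<otimes>\<^bsub>mon M X\<^esub> \<theta> X w"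
proof -
  obtain U a b c p q r where U: "sheaf U" and a: "a \<in> Hom U (und A)" and b: "b \<in> Hom U (und A)"
    and p: "p \<in> sec (pt U a) X" and q: "q \<in> sec (pt U b) X" and pq: "pb U a X p = pb U b X q"
    and e: "rq dfk U a X p = z" "rq dfk U b X q = w"
    by (rule tq_representatives[OF df_dfk X z w w]) simp
  note l = lmul_dfk[OF U a b X p q pq]
  have "mq dfk X z w = rq dfk U (a \<otimes>\<^bsub>arrows U A\<^esub> b) X (lmul dfk U a b X p q)"
    using mq_rq[OF df_dfk U _ _ X, of a b p q] a b p q pq e by simp
  then show ?thesis
    using \<theta>D(6)[OF U arrows_mult_Hom(1)[OF A U a b] X l(1)] l(3) \<theta>D(6)[OF U a X p] \<theta>D(6)[OF U b X q] e by simp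
qed

lemma \<theta>_one:
  assumes X: "X \<in> Obj C"
  shows "\<theta> X (oq dfk X) = \<one>\<^bsub>mon M X\<^esub>"
proof -
  have o: "\<one>\<^bsub>mon A X\<^esub> \<in> sec (und A) X" using monoid_sheafD(3)[OF A X] by (simp add: monoid.one_closed)
  note l = lone_dfk[OF sA X o]
  show ?thesis using \<theta>D(6)[OF sA arrows_one_Hom(1)[OF A sA] X l(1)] l(3) by (simp add: oq_def)
qed

lemma kato_iso: "\<exists>f. is_iso quasi_integral_kato_cat f \<and> Dom quasi_integral_kato_cat f = (M, \<alpha>) \<and>
    Cod quasi_integral_kato_cat f = kato_of_df dfk"
proof -
  let ?G = "kato_of_df dfk"
  note D = \<theta>D and tq = tq_div[OF df_dfk]
  \<comment> \<open>Multiplicativity passes from \<theta> to its inverse.\<close>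
  have \<theta>'m: "\<theta>' X (m \<otimes>\<^bsub>mon M X\<^esub> n) = mq dfk X (\<theta>' X m) (\<theta>' X n)" if X: "X \<in> Obj C" and m: "m \<in> carrier (mon M X)" and n: "n \<in> carrier (mon M X)" for X m n
  proof -
    have 1: "\<theta>' X m \<in> tsec (tq dfk) X" "\<theta>' X n \<in> tsec (tq dfk) X" using Hom_in[OF D(2) X] m n by simp_all
    have "\<theta> X (mq dfk X (\<theta>' X m) (\<theta>' X n)) = m \<otimes>\<^bsub>mon M X\<^esub> n" using \<theta>_mult[OF X 1] D(3)[OF X m] D(3)[OF X n] by simp
    then show ?thesis using D(4)[OF X mqD(1)[OF df_dfk X 1]] by simp
  qed
  have \<theta>'o: "\<theta>' X \<one>\<^bsub>mon M X\<^esub> = oq dfk X" if X: "X \<in> Obj C" for X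
    using \<theta>_one[OF X] D(4)[OF X oqD(1)[OF df_dfk X]] by simp
  have h: "monoid_hom (fst ?G) M \<theta>"
    unfolding monoid_hom_def und_kato_of_df[OF df_dfk] using D(1) Hom_in[OF D(1)] \<theta>_mult \<theta>_one
    by (auto simp: kato_of_df_def hom_def)
  have h': "monoid_hom M (fst ?G) \<theta>'"
    unfolding monoid_hom_def und_kato_of_df[OF df_dfk] using D(2) Hom_in[OF D(2)] \<theta>'m \<theta>'o
    by (auto simp: kato_of_df_def hom_def)
  have v: "cmp (tot (tq dfk)) \<alpha> \<theta> = val (tq dfk)"
    by (rule Hom_eqI[OF cmp_Hom[OF divT(2)[OF tq] D(1) monoid_hom_Hom[OF al]] div_objD(2)[OF tq]]) (simp add: D(5))
  have v': "cmp (und M) (val (tq dfk)) \<theta>' = \<alpha>"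
    by (rule Hom_eqI[OF cmp_Hom[OF sM D(2) div_objD(2)[OF tq]] monoid_hom_Hom[OF al]])
      (use Hom_in[OF D(2)] in \<open>simp add: D(5) D(3)\<close>)
  have \<theta>: "kato_hom ?G (M, \<alpha>) \<theta>"
    using h v by (simp add: kato_hom_iff und_kato_of_df[OF df_dfk]) (simp add: kato_of_df_def)
  have \<theta>': "kato_hom (M, \<alpha>) ?G \<theta>'"
    using h' v' by (simp add: kato_hom_iff) (simp add: kato_of_df_def)
  have i1: "cmp (und M) \<theta> \<theta>' = idm (und M)"
    by (rule Hom_eqI[OF cmp_Hom[OF sM D(2,1)] idm_Hom[OF sM]]) (simp add: D(3))
  have i2: "cmp (tot (tq dfk)) \<theta>' \<theta> = idm (tot (tq dfk))"
    by (rule Hom_eqI[OF cmp_Hom[OF divT(2)[OF tq] D(1,2)] idm_Hom[OF divT(2)[OF tq]]]) (simp add: D(4))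
  let ?f = "((M, \<alpha>), \<theta>', ?G)" and ?g = "(?G, \<theta>, (M, \<alpha>))"
  have "is_iso quasi_integral_kato_cat ?f"
    unfolding is_iso_def
    by (intro conjI bexI[of _ ?g])
      (use \<theta> \<theta>' K qi kato_of_df_kato[OF df_dfk] kato_of_df_quasi_integral[OF df_dfk] i1 i2 in
        \<open>simp_all add: quasi_integral_kato_cat_def und_kato_of_df[OF df_dfk]\<close>)
  then show ?thesis by (intro exI[of _ ?f]) (simp add: quasi_integral_kato_cat_def)
qed

end

theorem proposition2p6:
  fixes C :: "('o, 'a) cat" and J :: "'o \<Rightarrow> 'a set set" and \<V> :: "'u set set"
    and \<O> :: "('o, 'a, 'u) monoid_presheaf"
  assumes "monoided_topos C J \<V> \<O>"
  shows "equivalent_categories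
    (monoided_topos.quasi_integral_kato_cat C J \<V> \<O>) (monoided_topos.df_cat C J \<V> \<O>)"
proof -
  interpret monoided_topos C J \<V> \<O> by fact
  show ?thesis
  proof (rule equivalent_categoriesI[OF category_kato category_df functor_kato_of_df])
    fix X assume "X \<in> Obj quasi_integral_kato_cat"
    then obtain M \<alpha> where X: "X = (M, \<alpha>)" and K: "kato (M, \<alpha>)" and qi: "quasi_integral (M, \<alpha>)"
      by (cases X) (auto simp: quasi_integral_kato_cat_def)
    obtain A \<pi> where "monoid_sheaf A" "monoid_hom M A \<pi>"
      "\<And>X m n. \<lbrakk>X \<in> Obj C; m \<in> carrier (mon M X); n \<in> carrier (mon M X)\<rbrakk> \<Longrightarrow>
      \<pi> X m = \<pi> X n \<longleftrightarrow> (\<exists>u\<in>O_units X. n = kato_act (M, \<alpha>) X u m)"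
      "\<And>X a. X \<in> Obj C \<Longrightarrow> a \<in> carrier (mon A X) \<Longrightarrow>
        locally X (\<lambda>f. \<exists>m\<in>carrier (mon M (Dom C f)). \<pi> (Dom C f) m = mres A f a)"
      by (rule kato_quotient_exists[OF K qi]) blast
    \<comment> \<open>The quotient is merely known to exist. Essential surjectivity asks for no
      coherence between the quotients chosen for different Kato structures, so the locale is entered
      for one object at a time.\<close>
    then interpret kato_quotient C J \<V> \<O> M \<alpha> A \<pi>
      by unfold_locales (use K qi in auto)
    show "\<exists>L\<in>Obj df_cat. \<exists>f. is_iso quasi_integral_kato_cat f \<and> Dom quasi_integral_kato_cat f = X \<and>
        Cod quasi_integral_kato_cat f = kato_of_df L"
      using kato_iso df_dfk unfolding X by (intro bexI[of _ dfk]) (simp_all add: df_cat_def)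
  qed (rule fully_faithful_kato_of_df)
qed

end
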